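(* Let $(G,P)$ and $(K,Q)$ be quasi-lattice ordered groups. Suppose that $\mu:G\to K$ is a controlled map. If $K$ is an amenable group and $\big(\mu^{-1}(e),\mu^{-1}(e)\cap P\big)$ is an amenable quasi-lattice ordered group, then $(G,P)$ is amenable (as a quasi-lattice ordered group).
   Context: Groups are discrete and $e$ denotes the identity of any group. **Quasi-lattice ordered groups.** Let $P$ be a subsemigroup of a group $G$ with $P\cap P^{-1}=\{e\}$. Define a left-invariant partial order on $G$ by $x\le y \iff x^{-1}y\in P$. The pair $(G,P)$ is quasi-lattice ordered if every finite subset of $G$ with a common upper bound in $P$ has a least common upper bound in $P$. For $x,y\in G$, if $x,y$ have a common upper bound in $P$ we write $x\vee y<\infty$ and let $x\vee y\in P$ denote their least common upper bound in $P$; otherwise $x\vee y=\infty$. **$C^*$-algebras and amenability.** An isometric representation of $P$ in a unital $C^*$-algebra is a map $W$ on $P$ with $W_e=1$, each $W_p$ an isometry, and $W_pW_q=W_{pq}$. It is covariant if $W_pW_p^*W_qW_q^*=W_{p\vee q}W_{p\vee q}^*$ when $p\vee q<\infty$ and $W_pW_p^*W_qW_q^*=0$ otherwise. $C^*(G,P)$ is the $C^*$-algebra generated by a universal covariant representation $w:P\to C^*(G,P)$: for every covariant representation $W:P\to A$ there is a unital homomorphism $\pi_W:C^*(G,P)\to A$ with $\pi_W(w_p)=W_p$. The Toeplitz representation $T:P\to B(\ell^2(P))$, $T_p\epsilon_x=\epsilon_{px}$ (with $\{\epsilon_x:x\in P\}$ the standard basis), is covariant; $C^*_r(G,P)$ is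 the $C^*$-algebra generated by $\{T_p:p\in P\}$. The quasi-lattice ordered group $(G,P)$ is amenable if $\pi_T:C^*(G,P)\to C^*_r(G,P)$ is faithful; equivalently, if the conditional expectation $E:C^*(G,P)\to\overline{\operatorname{span}}\{w_pw_p^*:p\in P\}$ (with $E(w_pw_q^* )=w_pw_p^*$ if $p=q$ and $0$ otherwise) is faithful. **Controlled maps.** Let $(G,P)$ and $(K,Q)$ be quasi-lattice ordered groups and $\mu:G\to K$ an order-preserving group homomorphism ($x\le y\Rightarrow\mu(x)\le\mu(y)$). For $k\in Q$ let $\Sigma_k$ be the set of $\sigma\in\mu^{-1}(k)\cap P$ which are minimal: $x\in\mu^{-1}(k)\cap P$ and $x\le\sigma$ imply $\sigma=x$. Then $\mu$ is a controlled map if: (1) for all $x,y\in G$ with $x\vee y<\infty$ we have $\mu(x)\vee\mu(y)=\mu(x\vee y)$; (2) for all $k\in Q$ and every $x\in\mu^{-1}(k)\cap P$ there exists $\sigma\in\Sigma_k$ with $\sigma\le x$; (3) for all $k\in Q$ and $\sigma,\tau\in\Sigma_k$, $\sigma\vee\tau<\infty$ implies $\sigma=\tau$. When $\mu$ is a controlled map, $\big(\mu^{-1}(e),\mu^{-1}(e)\cap P\big)$ is a quasi-lattice ordered group. *)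

theory Defs
  imports "HOL-Analysis.Analysis" "HOL-Algebra.Module" "HOL-Algebra.Coset"
begin

section \<open>Quasi-lattice ordered groups and controlled maps\<close>

definition le_of :: "('g, 'm) monoid_scheme \<Rightarrow> 'g set \<Rightarrow> 'g \<Rightarrow> 'g \<Rightarrow> bool" where
  "le_of G P x y \<longleftrightarrow> inv\<^bsub>G\<^esub> x \<otimes>\<^bsub>G\<^esub> y \<in> P"

definition upper_bounds :: "('g, 'm) monoid_scheme \<Rightarrow> 'g set \<Rightarrow> 'g set \<Rightarrow> 'g set" where
  "upper_bounds G P F = {z \<in> P. \<forall>x\<in>F. le_of G P x z}"

definition is_lub :: "('g, 'm) monoid_scheme \<Rightarrow> 'g set \<Rightarrow> 'g set \<Rightarrow> 'g \<Rightarrow> bool" where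
  "is_lub G P F z \<longleftrightarrow> z \<in> upper_bounds G P F \<and> (\<forall>y\<in>upper_bounds G P F. le_of G P z y)"

definition quasi_lattice_ordered :: "('g, 'm) monoid_scheme \<Rightarrow> 'g set \<Rightarrow> bool" where
  "quasi_lattice_ordered G P \<longleftrightarrow>
     group G \<and> P \<subseteq> carrier G \<and>
     (\<forall>p\<in>P. \<forall>q\<in>P. p \<otimes>\<^bsub>G\<^esub> q \<in> P) \<and>
     P \<inter> (\<lambda>p. inv\<^bsub>G\<^esub> p) ` P = {\<one>\<^bsub>G\<^esub>} \<and>
     (\<forall>F. finite F \<and> F \<subseteq> carrier G \<and> upper_bounds G P F \<noteq> {} \<longrightarrow> (\<exists>z. is_lub G P F z))"

text \<open>\<^const>\<open>None\<close> stands for the value \<open>\<infinity>\<close> of \<open>x \<or> y\<close>.\<close>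

definition join :: "('g, 'm) monoid_scheme \<Rightarrow> 'g set \<Rightarrow> 'g \<Rightarrow> 'g \<Rightarrow> 'g option" where
  "join G P x y =
     (if upper_bounds G P {x, y} = {} then None else Some (THE z. is_lub G P {x, y} z))"

definition minimal_elements ::
  "('g, 'm) monoid_scheme \<Rightarrow> 'g set \<Rightarrow> ('g \<Rightarrow> 'k) \<Rightarrow> 'k \<Rightarrow> 'g set" where
  "minimal_elements G P \<mu> k =
     {\<sigma> \<in> P. \<mu> \<sigma> = k \<and> (\<forall>x\<in>P. \<mu> x = k \<and> le_of G P x \<sigma> \<longrightarrow> \<sigma> = x)}"

definition controlled_map ::
  "('g, 'm) monoid_scheme \<Rightarrow> 'g set \<Rightarrow> ('k, 'n) monoid_scheme \<Rightarrow> 'k set \<Rightarrow> ('g \<Rightarrow> 'k) \<Rightarrow> bool" where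
  "controlled_map G P K Q \<mu> \<longleftrightarrow>
     \<mu> \<in> hom G K \<and>
     (\<forall>x\<in>carrier G. \<forall>y\<in>carrier G. le_of G P x y \<longrightarrow> le_of K Q (\<mu> x) (\<mu> y)) \<and>
     (\<forall>x\<in>carrier G. \<forall>y\<in>carrier G. \<forall>z. join G P x y = Some z \<longrightarrow>
        join K Q (\<mu> x) (\<mu> y) = Some (\<mu> z)) \<and>
     (\<forall>k\<in>Q. \<forall>x\<in>P. \<mu> x = k \<longrightarrow> (\<exists>\<sigma>\<in>minimal_elements G P \<mu> k. le_of G P \<sigma> x)) \<and>
     (\<forall>k\<in>Q. \<forall>\<sigma>\<in>minimal_elements G P \<mu> k. \<forall>\<tau>\<in>minimal_elements G P \<mu> k.
        join G P \<sigma> \<tau> \<noteq> None \<longrightarrow> \<sigma> = \<tau>)"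

section \<open>Amenable discrete groups\<close>

text \<open>A left-invariant mean on the bounded real functions on the group. Functions are total on
  the type; linearity and positivity force the mean to depend only on the values on the carrier.\<close>

definition invariant_mean :: "('k, 'n) monoid_scheme \<Rightarrow> (('k \<Rightarrow> real) \<Rightarrow> real) \<Rightarrow> bool" where
  "invariant_mean K m \<longleftrightarrow>
     (\<forall>f g. bounded (f ` carrier K) \<and> bounded (g ` carrier K) \<longrightarrow>
        m (\<lambda>x. f x + g x) = m f + m g) \<and>
     (\<forall>c f. bounded (f ` carrier K) \<longrightarrow> m (\<lambda>x. c * f x) = c * m f) \<and>
     (\<forall>f. bounded (f ` carrier K) \<and> (\<forall>x\<in>carrier K. 0 \<le> f x) \<longrightarrow> 0 \<le> m f) \<and>
     m (\<lambda>_. 1) = 1 \<and>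
     (\<forall>f. \<forall>k\<in>carrier K. bounded (f ` carrier K) \<longrightarrow> m (\<lambda>x. f (inv\<^bsub>K\<^esub> k \<otimes>\<^bsub>K\<^esub> x)) = m f)"

definition amenable_group :: "('k, 'n) monoid_scheme \<Rightarrow> bool" where
  "amenable_group K \<longleftrightarrow> group K \<and> (\<exists>m. invariant_mean K m)"

section \<open>Unital $C^*$-algebras\<close>

definition complex_ring :: "complex ring" where
  "complex_ring = \<lparr>carrier = UNIV, mult = (*), one = 1, zero = 0, add = (+)\<rparr>"

record 'a cstar = "(complex, 'a) module" +
  adj :: "'a \<Rightarrow> 'a"
  cnorm :: "'a \<Rightarrow> real"

locale unital_cstar_algebra = module complex_ring A + A?: ring A for A :: "'a cstar" (structure) +
  assumes smult_mult_left:
      "\<lbrakk>x \<in> carrier A; y \<in> carrier A\<rbrakk> \<Longrightarrow> (c \<odot> x) \<otimes> y = c \<odot> (x \<otimes> y)"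
    and smult_mult_right:
      "\<lbrakk>x \<in> carrier A; y \<in> carrier A\<rbrakk> \<Longrightarrow> x \<otimes> (c \<odot> y) = c \<odot> (x \<otimes> y)"
    and adj_closed: "x \<in> carrier A \<Longrightarrow> adj A x \<in> carrier A"
    and adj_add:
      "\<lbrakk>x \<in> carrier A; y \<in> carrier A\<rbrakk> \<Longrightarrow> adj A (x \<oplus> y) = adj A x \<oplus> adj A y"
    and adj_smult: "x \<in> carrier A \<Longrightarrow> adj A (c \<odot> x) = cnj c \<odot> adj A x"
    and adj_mult:
      "\<lbrakk>x \<in> carrier A; y \<in> carrier A\<rbrakk> \<Longrightarrow> adj A (x \<otimes> y) = adj A y \<otimes> adj A x"
    and adj_adj: "x \<in> carrier A \<Longrightarrow> adj A (adj A x) = x"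
    and cnorm_eq_0: "x \<in> carrier A \<Longrightarrow> cnorm A x = 0 \<longleftrightarrow> x = \<zero>"
    and cnorm_triangle:
      "\<lbrakk>x \<in> carrier A; y \<in> carrier A\<rbrakk> \<Longrightarrow> cnorm A (x \<oplus> y) \<le> cnorm A x + cnorm A y"
    and cnorm_smult: "x \<in> carrier A \<Longrightarrow> cnorm A (c \<odot> x) = cmod c * cnorm A x"
    and cnorm_mult:
      "\<lbrakk>x \<in> carrier A; y \<in> carrier A\<rbrakk> \<Longrightarrow> cnorm A (x \<otimes> y) \<le> cnorm A x * cnorm A y"
    and cstar_identity: "x \<in> carrier A \<Longrightarrow> cnorm A (adj A x \<otimes> x) = (cnorm A x)\<^sup>2"
    and complete:
      "\<lbrakk>\<And>n. s n \<in> carrier A;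
        \<And>e. e > 0 \<Longrightarrow> \<exists>N. \<forall>m\<ge>N. \<forall>n\<ge>N. cnorm A (s m \<ominus> s n) < e\<rbrakk>
       \<Longrightarrow> \<exists>x\<in>carrier A. (\<lambda>n::nat. cnorm A (s n \<ominus> x)) \<longlonglongrightarrow> 0"

definition star_hom :: "'a cstar \<Rightarrow> 'b cstar \<Rightarrow> ('a \<Rightarrow> 'b) set" where
  "star_hom A B =
     {\<pi> \<in> ring_hom A B.
        (\<forall>c. \<forall>x\<in>carrier A. \<pi> (c \<odot>\<^bsub>A\<^esub> x) = c \<odot>\<^bsub>B\<^esub> \<pi> x) \<and>
        (\<forall>x\<in>carrier A. \<pi> (adj A x) = adj B (\<pi> x))}"

inductive_set cstar_span :: "'a cstar \<Rightarrow> 'a set \<Rightarrow> 'a set" for A (structure) and S where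
  base: "x \<in> S \<Longrightarrow> x \<in> cstar_span A S"
| one: "\<one> \<in> cstar_span A S"
| add: "x \<in> cstar_span A S \<Longrightarrow> y \<in> cstar_span A S \<Longrightarrow> x \<oplus> y \<in> cstar_span A S"
| smult: "x \<in> cstar_span A S \<Longrightarrow> c \<odot> x \<in> cstar_span A S"
| mult: "x \<in> cstar_span A S \<Longrightarrow> y \<in> cstar_span A S \<Longrightarrow> x \<otimes> y \<in> cstar_span A S"
| adj: "x \<in> cstar_span A S \<Longrightarrow> adj A x \<in> cstar_span A S"
| limit: "(\<And>n::nat. s n \<in> cstar_span A S) \<Longrightarrow> x \<in> carrier A
    \<Longrightarrow> (\<lambda>n. cnorm A (s n \<ominus> x)) \<longlonglongrightarrow> 0 \<Longrightarrow> x \<in> cstar_span A S"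

definition cstar_generated :: "'a cstar \<Rightarrow> 'a set \<Rightarrow> 'a cstar" where
  "cstar_generated A S = A\<lparr>carrier := cstar_span A S\<rparr>"

text \<open>The $\ell^\infty$-product of a family of $C^*$-algebras; the infimum is the least bound of the
  norms of the entries.\<close>

definition cstar_prod :: "'i set \<Rightarrow> ('i \<Rightarrow> 'a cstar) \<Rightarrow> ('i \<Rightarrow> 'a) cstar" where
  "cstar_prod I A =
     \<lparr>carrier = {f \<in> (\<Pi>\<^sub>E i\<in>I. carrier (A i)). \<exists>M. \<forall>i\<in>I. cnorm (A i) (f i) \<le> M},
      mult = (\<lambda>f g. \<lambda>i\<in>I. f i \<otimes>\<^bsub>A i\<^esub> g i),
      one = (\<lambda>i\<in>I. \<one>\<^bsub>A i\<^esub>),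
      zero = (\<lambda>i\<in>I. \<zero>\<^bsub>A i\<^esub>),
      add = (\<lambda>f g. \<lambda>i\<in>I. f i \<oplus>\<^bsub>A i\<^esub> g i),
      smult = (\<lambda>c f. \<lambda>i\<in>I. c \<odot>\<^bsub>A i\<^esub> f i),
      adj = (\<lambda>f. \<lambda>i\<in>I. adj (A i) (f i)),
      cnorm = (\<lambda>f. Inf {M. 0 \<le> M \<and> (\<forall>i\<in>I. cnorm (A i) (f i) \<le> M)})\<rparr>"

section \<open>The $C^*$-algebra of bounded operators on $\ell^2(X)$\<close>

text \<open>Vectors vanish off \<open>X\<close>; operators are extensional functions on \<open>ell2 X\<close>.\<close>

definition ell2 :: "'i set \<Rightarrow> ('i \<Rightarrow> complex) set" where
  "ell2 X = {f. (\<forall>x. x \<notin> X \<longrightarrow> f x = 0) \<and> (\<lambda>x. (cmod (f x))\<^sup>2) summable_on X}"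

definition ell2_norm :: "'i set \<Rightarrow> ('i \<Rightarrow> complex) \<Rightarrow> real" where
  "ell2_norm X f = sqrt (\<Sum>\<^sub>\<infinity>x\<in>X. (cmod (f x))\<^sup>2)"

definition ell2_inner :: "'i set \<Rightarrow> ('i \<Rightarrow> complex) \<Rightarrow> ('i \<Rightarrow> complex) \<Rightarrow> complex" where
  "ell2_inner X f g = (\<Sum>\<^sub>\<infinity>x\<in>X. f x * cnj (g x))"

definition bounded_ops :: "'i set \<Rightarrow> (('i \<Rightarrow> complex) \<Rightarrow> ('i \<Rightarrow> complex)) set" where
  "bounded_ops X =
     {T \<in> ell2 X \<rightarrow>\<^sub>E ell2 X.
        (\<forall>f\<in>ell2 X. \<forall>g\<in>ell2 X. T (\<lambda>x. f x + g x) = (\<lambda>x. T f x + T g x)) \<and>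
        (\<forall>c. \<forall>f\<in>ell2 X. T (\<lambda>x. c * f x) = (\<lambda>x. c * T f x)) \<and>
        (\<exists>M. \<forall>f\<in>ell2 X. ell2_norm X (T f) \<le> M * ell2_norm X f)}"

definition ell2_operators :: "'i set \<Rightarrow> (('i \<Rightarrow> complex) \<Rightarrow> ('i \<Rightarrow> complex)) cstar" where
  "ell2_operators X =
     \<lparr>carrier = bounded_ops X,
      mult = (\<lambda>S T. \<lambda>f\<in>ell2 X. S (T f)),
      one = (\<lambda>f\<in>ell2 X. f),
      zero = (\<lambda>f\<in>ell2 X. (\<lambda>_. 0)),
      add = (\<lambda>S T. \<lambda>f\<in>ell2 X. (\<lambda>x. S f x + T f x)),
      smult = (\<lambda>c T. \<lambda>f\<in>ell2 X. (\<lambda>x. c * T f x)),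
      adj = (\<lambda>T. THE S. S \<in> bounded_ops X \<and>
        (\<forall>f\<in>ell2 X. \<forall>g\<in>ell2 X. ell2_inner X (T f) g = ell2_inner X f (S g))),
      cnorm = (\<lambda>T. Inf {M. 0 \<le> M \<and> (\<forall>f\<in>ell2 X. ell2_norm X (T f) \<le> M * ell2_norm X f)})\<rparr>"

section \<open>Covariant representations\<close>

definition isometric_rep :: "('g, 'm) monoid_scheme \<Rightarrow> 'g set \<Rightarrow> 'a cstar \<Rightarrow> ('g \<Rightarrow> 'a) \<Rightarrow> bool" where
  "isometric_rep G P A W \<longleftrightarrow>
     (\<forall>p\<in>P. W p \<in> carrier A) \<and>
     W \<one>\<^bsub>G\<^esub> = \<one>\<^bsub>A\<^esub> \<and>
     (\<forall>p\<in>P. adj A (W p) \<otimes>\<^bsub>A\<^esub> W p = \<one>\<^bsub>A\<^esub>) \<and>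
     (\<forall>p\<in>P. \<forall>q\<in>P. W p \<otimes>\<^bsub>A\<^esub> W q = W (p \<otimes>\<^bsub>G\<^esub> q))"

definition range_proj :: "'a cstar \<Rightarrow> 'a \<Rightarrow> 'a" where
  "range_proj A v = v \<otimes>\<^bsub>A\<^esub> adj A v"

definition covariant_rep :: "('g, 'm) monoid_scheme \<Rightarrow> 'g set \<Rightarrow> 'a cstar \<Rightarrow> ('g \<Rightarrow> 'a) \<Rightarrow> bool" where
  "covariant_rep G P A W \<longleftrightarrow>
     isometric_rep G P A W \<and>
     (\<forall>p\<in>P. \<forall>q\<in>P. range_proj A (W p) \<otimes>\<^bsub>A\<^esub> range_proj A (W q) =
        (case join G P p q of Some r \<Rightarrow> range_proj A (W r) | None \<Rightarrow> \<zero>\<^bsub>A\<^esub>))"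

text \<open>$T_p\epsilon_x = \epsilon_{px}$; see \<open>toeplitz_basis\<close> below.\<close>

definition toeplitz :: "('g, 'm) monoid_scheme \<Rightarrow> 'g set \<Rightarrow> 'g \<Rightarrow> ('g \<Rightarrow> complex) \<Rightarrow> ('g \<Rightarrow> complex)" where
  "toeplitz G P p =
     (\<lambda>f\<in>ell2 P. (\<lambda>y. if y \<in> P \<and> le_of G P p y then f (inv\<^bsub>G\<^esub> p \<otimes>\<^bsub>G\<^esub> y) else 0))"

definition reduced_cstar ::
  "('g, 'm) monoid_scheme \<Rightarrow> 'g set \<Rightarrow> (('g \<Rightarrow> complex) \<Rightarrow> ('g \<Rightarrow> complex)) cstar" where
  "reduced_cstar G P = cstar_generated (ell2_operators P) (toeplitz G P ` P)"

text \<open>A universal covariant representation is obtained as the product of all covariant representations,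
  which needs a type from which the target algebras are drawn. Every element of a $C^*$-algebra
  generated by a representation \<open>W\<close> of \<open>P\<close> is the limit of a sequence of noncommutative
  $*$-polynomials in the \<open>W p\<close> (below, a word is a list of pairs \<open>(p, b)\<close>, with \<open>b\<close> saying whether the
  letter is adjoined), so such an algebra has an isomorphic copy carried by a set of sequences of
  formal $*$-polynomials. Restricting to this type therefore loses nothing: the theorem
  \<open>universal_rep_universal\<close> below proves the universal property for $C^*$-algebras over an
  arbitrary type.\<close>

type_synonym 'g star_poly = "(complex \<times> ('g \<times> bool) list) list"
type_synonym 'g cstar_univ = "nat \<Rightarrow> 'g star_poly"

definition covariant_reps ::
  "('g, 'm) monoid_scheme \<Rightarrow> 'g set \<Rightarrow> ('g cstar_univ cstar \<times> ('g \<Rightarrow> 'g cstar_univ)) set" where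
  "covariant_reps G P = {(A, W). unital_cstar_algebra A \<and> covariant_rep G P A W}"

definition universal_rep ::
  "('g, 'm) monoid_scheme \<Rightarrow> 'g set \<Rightarrow> 'g
     \<Rightarrow> 'g cstar_univ cstar \<times> ('g \<Rightarrow> 'g cstar_univ) \<Rightarrow> 'g cstar_univ" where
  "universal_rep G P p = (\<lambda>(A, W)\<in>covariant_reps G P. W p)"

definition universal_cstar ::
  "('g, 'm) monoid_scheme \<Rightarrow> 'g set
     \<Rightarrow> ('g cstar_univ cstar \<times> ('g \<Rightarrow> 'g cstar_univ) \<Rightarrow> 'g cstar_univ) cstar" where
  "universal_cstar G P =
     cstar_generated (cstar_prod (covariant_reps G P) fst) (universal_rep G P ` P)"

text \<open>The homomorphism is determined by its values on the generators, so \<open>\<pi>\<close> is the homomorphism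
  $\pi_T$ induced by the Toeplitz representation.\<close>

definition amenable_qlo :: "('g, 'm) monoid_scheme \<Rightarrow> 'g set \<Rightarrow> bool" where
  "amenable_qlo G P \<longleftrightarrow>
     quasi_lattice_ordered G P \<and>
     (\<exists>\<pi>\<in>star_hom (universal_cstar G P) (reduced_cstar G P).
        (\<forall>p\<in>P. \<pi> (universal_rep G P p) = toeplitz G P p) \<and>
        inj_on \<pi> (carrier (universal_cstar G P)))"

section \<open>Basic facts about $C^*$-algebras\<close>

lemma complex_ring_simps [simp]:
  "carrier complex_ring = UNIV" "mult complex_ring = (*)" "one complex_ring = 1"
  "zero complex_ring = 0" "add complex_ring = (+)"
  by (simp_all add: complex_ring_def)

lemma cring_complex_ring: "cring complex_ring"
proof (rule cringI)
  show "abelian_group complex_ring"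
    by (rule abelian_groupI) (auto intro: exI[of _ "- x" for x] simp: add_eq_0_iff)
  show "comm_monoid complex_ring" by (rule comm_monoidI) auto
qed (auto simp: algebra_simps)

context unital_cstar_algebra
begin

lemma smult_in [simp, intro]: "x \<in> carrier A \<Longrightarrow> c \<odot> x \<in> carrier A"
  by (rule smult_closed) auto

lemma smult_add_left: "x \<in> carrier A \<Longrightarrow> (a + b) \<odot> x = a \<odot> x \<oplus> b \<odot> x"
  using smult_l_distr[of a b x] by simp

lemma smult_smult: "x \<in> carrier A \<Longrightarrow> a \<odot> (b \<odot> x) = (a * b) \<odot> x"
  using smult_assoc1[of a b x] by simp

lemma smult_1 [simp]: "x \<in> carrier A \<Longrightarrow> 1 \<odot> x = x"
  using smult_one[of x] by simp

lemma smult_0 [simp]: "x \<in> carrier A \<Longrightarrow> 0 \<odot> x = \<zero>"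
  using smult_l_null[of x] by simp

lemmas laws = M.r_zero M.a_assoc M.a_comm M.a_lcomm M.l_zero M.a_closed M.zero_closed A.m_assoc A.l_one A.r_one
  A.m_closed A.one_closed A.l_distr A.r_distr smult_in smult_add_left smult_r_distr smult_smult
  smult_1 smult_0 smult_mult_left smult_mult_right adj_closed adj_add adj_smult adj_mult adj_adj

lemma a_inv_eq_smult: "x \<in> carrier A \<Longrightarrow> \<ominus> x = (- 1) \<odot> x"
proof -
  assume x: "x \<in> carrier A"
  have "(- 1) \<odot> x \<oplus> x = (- 1 + 1) \<odot> x" using smult_add_left[OF x, of "- 1" 1] x by simp
  also have "\<dots> = \<zero>" using x by simp
  finally show ?thesis using x by (intro M.minus_equality) auto
qed

lemma minus_eq_smult: "y \<in> carrier A \<Longrightarrow> x \<ominus> y = x \<oplus> (- 1) \<odot> y"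
  by (simp add: a_minus_def a_inv_eq_smult)

lemma cnorm_zero [simp]: "cnorm A \<zero> = 0"
  using cnorm_eq_0[of \<zero>] by simp

lemma minus_self [simp]: "x \<in> carrier A \<Longrightarrow> x \<ominus> x = \<zero>"
  by (simp add: a_minus_def M.r_neg)

lemma eq_if_minus_zero: "\<lbrakk>x \<ominus> y = \<zero>; x \<in> carrier A; y \<in> carrier A\<rbrakk> \<Longrightarrow> x = y"
  by (metis M.a_inv_closed M.minus_equality M.minus_minus a_minus_def)

lemma cnorm_nonneg [simp]: "x \<in> carrier A \<Longrightarrow> 0 \<le> cnorm A x"
  using cnorm_triangle[of x "(- 1) \<odot> x"] cnorm_smult[of x "- 1"]
  by (simp add: minus_eq_smult[symmetric])

lemma cnorm_adj_le: assumes "x \<in> carrier A" shows "cnorm A x \<le> cnorm A (adj A x)"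
proof (cases "cnorm A x = 0")
  case False
  have "(cnorm A x)\<^sup>2 \<le> cnorm A (adj A x) * cnorm A x"
    using cstar_identity[OF assms] cnorm_mult[of "adj A x" x] assms adj_closed by simp
  with False cnorm_nonneg[OF assms] show ?thesis by (simp add: power2_eq_square)
qed (use assms adj_closed in auto)

lemma cnorm_adj: "x \<in> carrier A \<Longrightarrow> cnorm A (adj A x) = cnorm A x"
  using cnorm_adj_le[of x] cnorm_adj_le[of "adj A x"] adj_closed adj_adj by (simp add: order_antisym)

lemma adj_one: "adj A \<one> = \<one>"
  using adj_mult[of "adj A \<one>" \<one>] adj_adj[of \<one>] adj_closed[of \<one>] by simp

lemma cnorm_diff_commute: "\<lbrakk>x \<in> carrier A; y \<in> carrier A\<rbrakk> \<Longrightarrow> cnorm A (x \<ominus> y) = cnorm A (y \<ominus> x)"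
proof -
  assume a: "x \<in> carrier A" "y \<in> carrier A"
  have "x \<ominus> y = (-1) \<odot> (y \<ominus> x)" using a
    by (simp add: a_inv_eq_smult[symmetric]) (simp add: a_minus_def M.minus_add M.minus_minus M.a_comm)
  then show ?thesis using a by (simp add: cnorm_smult)
qed

lemma cnorm_diff_triangle:
  "\<lbrakk>x \<in> carrier A; y \<in> carrier A; z \<in> carrier A\<rbrakk> \<Longrightarrow> cnorm A (x \<ominus> z) \<le> cnorm A (x \<ominus> y) + cnorm A (y \<ominus> z)"
proof -
  assume a: "x \<in> carrier A" "y \<in> carrier A" "z \<in> carrier A"
  have "x \<ominus> z = (x \<ominus> y) \<oplus> (y \<ominus> z)" using a
    by (simp add: a_minus_def M.a_assoc M.r_neg2 M.r_neg1)
  then show ?thesis using a cnorm_triangle[of "x \<ominus> y" "y \<ominus> z"] by simp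
qed

lemma limit_unique:
  assumes "\<And>n. s n \<in> carrier A" "x \<in> carrier A" "y \<in> carrier A"
    and "(\<lambda>n::nat. cnorm A (s n \<ominus> x)) \<longlonglongrightarrow> 0" "(\<lambda>n::nat. cnorm A (s n \<ominus> y)) \<longlonglongrightarrow> 0"
  shows "x = y"
proof -
  have "(\<lambda>n. cnorm A (s n \<ominus> x) + cnorm A (s n \<ominus> y)) \<longlonglongrightarrow> 0 + 0"
    by (intro tendsto_add assms)
  moreover have "cnorm A (x \<ominus> y) \<le> cnorm A (s n \<ominus> x) + cnorm A (s n \<ominus> y)" for n
    using cnorm_diff_triangle[of x "s n" y] cnorm_diff_commute[of x "s n"] assms(1-3) by simp
  ultimately have "cnorm A (x \<ominus> y) \<le> 0" by (intro LIMSEQ_le_const) auto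
  moreover have "x \<ominus> y \<in> carrier A" using assms(2,3) by simp
  ultimately have "cnorm A (x \<ominus> y) = 0" using cnorm_nonneg[of "x \<ominus> y"] by linarith
  then show ?thesis using cnorm_eq_0[of "x \<ominus> y"] assms(2,3) eq_if_minus_zero by simp
qed

lemma cstar_span_in_carrier:
  assumes "x \<in> cstar_span A S" "S \<subseteq> carrier A"
  shows "x \<in> carrier A"
  using assms by (induction rule: cstar_span.induct) (auto simp: adj_closed)

end

lemma unital_cstar_algebraI:
  fixes A :: "'a cstar" (structure)
  assumes closed: "\<zero> \<in> carrier A" "\<one> \<in> carrier A"
      "\<And>x y. \<lbrakk>x \<in> carrier A; y \<in> carrier A\<rbrakk> \<Longrightarrow> x \<oplus> y \<in> carrier A"
      "\<And>x y. \<lbrakk>x \<in> carrier A; y \<in> carrier A\<rbrakk> \<Longrightarrow> x \<otimes> y \<in> carrier A"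
      "\<And>c x. x \<in> carrier A \<Longrightarrow> c \<odot> x \<in> carrier A"
      "\<And>x. x \<in> carrier A \<Longrightarrow> adj A x \<in> carrier A"
    and ab: "\<And>x y z. \<lbrakk>x \<in> carrier A; y \<in> carrier A; z \<in> carrier A\<rbrakk> \<Longrightarrow> (x \<oplus> y) \<oplus> z = x \<oplus> (y \<oplus> z)"
      "\<And>x y. \<lbrakk>x \<in> carrier A; y \<in> carrier A\<rbrakk> \<Longrightarrow> x \<oplus> y = y \<oplus> x"
      "\<And>x. x \<in> carrier A \<Longrightarrow> \<zero> \<oplus> x = x"
    and mon: "\<And>x y z. \<lbrakk>x \<in> carrier A; y \<in> carrier A; z \<in> carrier A\<rbrakk> \<Longrightarrow> (x \<otimes> y) \<otimes> z = x \<otimes> (y \<otimes> z)"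
      "\<And>x. x \<in> carrier A \<Longrightarrow> \<one> \<otimes> x = x" "\<And>x. x \<in> carrier A \<Longrightarrow> x \<otimes> \<one> = x"
    and dist: "\<And>x y z. \<lbrakk>x \<in> carrier A; y \<in> carrier A; z \<in> carrier A\<rbrakk> \<Longrightarrow> (x \<oplus> y) \<otimes> z = x \<otimes> z \<oplus> y \<otimes> z"
      "\<And>x y z. \<lbrakk>x \<in> carrier A; y \<in> carrier A; z \<in> carrier A\<rbrakk> \<Longrightarrow> z \<otimes> (x \<oplus> y) = z \<otimes> x \<oplus> z \<otimes> y"
    and sm: "\<And>a b x. x \<in> carrier A \<Longrightarrow> (a + b) \<odot> x = a \<odot> x \<oplus> b \<odot> x"
      "\<And>a x y. \<lbrakk>x \<in> carrier A; y \<in> carrier A\<rbrakk> \<Longrightarrow> a \<odot> (x \<oplus> y) = a \<odot> x \<oplus> a \<odot> y"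
      "\<And>a b x. x \<in> carrier A \<Longrightarrow> (a * b) \<odot> x = a \<odot> (b \<odot> x)"
      "\<And>x. x \<in> carrier A \<Longrightarrow> 1 \<odot> x = x" "\<And>x. x \<in> carrier A \<Longrightarrow> 0 \<odot> x = \<zero>"
      "\<And>c x y. \<lbrakk>x \<in> carrier A; y \<in> carrier A\<rbrakk> \<Longrightarrow> (c \<odot> x) \<otimes> y = c \<odot> (x \<otimes> y)"
      "\<And>c x y. \<lbrakk>x \<in> carrier A; y \<in> carrier A\<rbrakk> \<Longrightarrow> x \<otimes> (c \<odot> y) = c \<odot> (x \<otimes> y)"
    and ad: "\<And>x y. \<lbrakk>x \<in> carrier A; y \<in> carrier A\<rbrakk> \<Longrightarrow> adj A (x \<oplus> y) = adj A x \<oplus> adj A y"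
      "\<And>c x. x \<in> carrier A \<Longrightarrow> adj A (c \<odot> x) = cnj c \<odot> adj A x"
      "\<And>x y. \<lbrakk>x \<in> carrier A; y \<in> carrier A\<rbrakk> \<Longrightarrow> adj A (x \<otimes> y) = adj A y \<otimes> adj A x"
      "\<And>x. x \<in> carrier A \<Longrightarrow> adj A (adj A x) = x"
    and nm: "\<And>x. x \<in> carrier A \<Longrightarrow> cnorm A x = 0 \<longleftrightarrow> x = \<zero>"
      "\<And>x y. \<lbrakk>x \<in> carrier A; y \<in> carrier A\<rbrakk> \<Longrightarrow> cnorm A (x \<oplus> y) \<le> cnorm A x + cnorm A y"
      "\<And>c x. x \<in> carrier A \<Longrightarrow> cnorm A (c \<odot> x) = cmod c * cnorm A x"
      "\<And>x y. \<lbrakk>x \<in> carrier A; y \<in> carrier A\<rbrakk> \<Longrightarrow> cnorm A (x \<otimes> y) \<le> cnorm A x * cnorm A y"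
      "\<And>x. x \<in> carrier A \<Longrightarrow> cnorm A (adj A x \<otimes> x) = (cnorm A x)\<^sup>2"
    and cpl: "\<And>s. \<lbrakk>\<And>n. s n \<in> carrier A;
        \<And>e. e > 0 \<Longrightarrow> \<exists>N. \<forall>m\<ge>N. \<forall>n\<ge>N. cnorm A (s m \<oplus> (- 1) \<odot> s n) < e\<rbrakk>
       \<Longrightarrow> \<exists>x\<in>carrier A. (\<lambda>n::nat. cnorm A (s n \<oplus> (- 1) \<odot> x)) \<longlonglongrightarrow> 0"
  shows "unital_cstar_algebra A"
proof -
  have neg: "(- 1) \<odot> x \<oplus> x = \<zero>" if "x \<in> carrier A" for x
    using sm(1)[OF that, of "- 1" 1] sm(4)[OF that] sm(5)[OF that] by simp
  have agrp: "abelian_group A"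
  proof (rule abelian_groupI)
    show "\<exists>y\<in>carrier A. y \<oplus> x = \<zero>" if "x \<in> carrier A" for x
      using neg[OF that] closed(5)[OF that] by blast
  qed (use closed ab in auto)
  have "monoid A" using closed mon by (intro monoidI) auto
  then have "ring A" using agrp dist by (intro ringI) auto
  then interpret ring A .
  have inv: "\<ominus> x = (- 1) \<odot> x" if "x \<in> carrier A" for x
    using neg[OF that] that closed by (intro minus_equality) auto
  have "module complex_ring A"
    using closed sm agrp cring_complex_ring by (intro moduleI) auto
  then interpret module complex_ring A .
  show ?thesis
  proof unfold_locales
    fix s :: "nat \<Rightarrow> 'a"
    assume s: "\<And>n. s n \<in> carrier A" and c: "\<And>e. e > 0 \<Longrightarrow> \<exists>N. \<forall>m\<ge>N. \<forall>n\<ge>N. cnorm A (s m \<ominus> s n) < e"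
    have "\<exists>x\<in>carrier A. (\<lambda>n::nat. cnorm A (s n \<oplus> (- 1) \<odot> x)) \<longlonglongrightarrow> 0"
      using s c by (intro cpl) (simp_all add: a_minus_def inv)
    then show "\<exists>x\<in>carrier A. (\<lambda>n. cnorm A (s n \<ominus> x)) \<longlonglongrightarrow> 0"
      by (metis (no_types, lifting) ext a_minus_def inv)
  qed (use sm ad nm closed in auto)
qed

lemma cstar_generated_simps [simp]:
  "carrier (cstar_generated A S) = cstar_span A S"
  "mult (cstar_generated A S) = mult A" "one (cstar_generated A S) = one A"
  "zero (cstar_generated A S) = zero A" "add (cstar_generated A S) = add A"
  "smult (cstar_generated A S) = smult A" "adj (cstar_generated A S) = adj A"
  "cnorm (cstar_generated A S) = cnorm A"
  by (simp_all add: cstar_generated_def)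

lemma (in unital_cstar_algebra) cstar_generated:
  assumes "S \<subseteq> carrier A"
  shows "unital_cstar_algebra (cstar_generated A S)"
proof -
  have c: "x \<in> carrier A" if "x \<in> cstar_span A S" for x
    using that assms by (rule cstar_span_in_carrier)
  show ?thesis
  proof (rule unital_cstar_algebraI, simp_all only: cstar_generated_simps)
    show "\<zero> \<in> cstar_span A S"
      using cstar_span.smult[OF cstar_span.one, of A 0 S] by simp
    fix s :: "nat \<Rightarrow> 'a"
    assume s: "\<And>n. s n \<in> cstar_span A S"
      and "\<And>e. 0 < e \<Longrightarrow> \<exists>N. \<forall>m\<ge>N. \<forall>n\<ge>N. cnorm A (s m \<oplus> (- 1) \<odot> s n) < e"
    then have "\<And>e. 0 < e \<Longrightarrow> \<exists>N. \<forall>m\<ge>N. \<forall>n\<ge>N. cnorm A (s m \<ominus> s n) < e"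
      using c by (simp add: minus_eq_smult)
    then obtain x where x: "x \<in> carrier A" "(\<lambda>n. cnorm A (s n \<ominus> x)) \<longlonglongrightarrow> 0"
      using complete[of s] c s by blast
    moreover have "x \<in> cstar_span A S" using cstar_span.limit[of s A S x] s x by blast
    ultimately show "\<exists>x\<in>cstar_span A S. (\<lambda>n. cnorm A (s n \<oplus> (- 1) \<odot> x)) \<longlonglongrightarrow> 0"
      by (auto simp: minus_eq_smult)
  qed (auto intro: cstar_span.intros simp: c laws cnorm_eq_0 cnorm_triangle cnorm_smult cnorm_mult
      cstar_identity)
qed

subsection \<open>Products\<close>

lemma cstar_prod_simps:
  "carrier (cstar_prod I A) = {f \<in> (\<Pi>\<^sub>E i\<in>I. carrier (A i)). \<exists>M. \<forall>i\<in>I. cnorm (A i) (f i) \<le> M}"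
  "mult (cstar_prod I A) f g = (\<lambda>i\<in>I. f i \<otimes>\<^bsub>A i\<^esub> g i)"
  "one (cstar_prod I A) = (\<lambda>i\<in>I. \<one>\<^bsub>A i\<^esub>)"
  "zero (cstar_prod I A) = (\<lambda>i\<in>I. \<zero>\<^bsub>A i\<^esub>)"
  "add (cstar_prod I A) f g = (\<lambda>i\<in>I. f i \<oplus>\<^bsub>A i\<^esub> g i)"
  "smult (cstar_prod I A) c f = (\<lambda>i\<in>I. c \<odot>\<^bsub>A i\<^esub> f i)"
  "adj (cstar_prod I A) f = (\<lambda>i\<in>I. adj (A i) (f i))"
  "cnorm (cstar_prod I A) f = Inf {M. 0 \<le> M \<and> (\<forall>i\<in>I. cnorm (A i) (f i) \<le> M)}"
  by (simp_all add: cstar_prod_def)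

lemma cstar_prod_norm:
  assumes f: "f \<in> carrier (cstar_prod I A)"
  shows "0 \<le> cnorm (cstar_prod I A) f"
    and "i \<in> I \<Longrightarrow> cnorm (A i) (f i) \<le> cnorm (cstar_prod I A) f"
    and "\<lbrakk>0 \<le> M; \<And>i. i \<in> I \<Longrightarrow> cnorm (A i) (f i) \<le> M\<rbrakk> \<Longrightarrow> cnorm (cstar_prod I A) f \<le> M"
proof -
  let ?S = "{M. 0 \<le> M \<and> (\<forall>i\<in>I. cnorm (A i) (f i) \<le> M)}"
  from f obtain M0 where "\<forall>i\<in>I. cnorm (A i) (f i) \<le> M0" by (auto simp: cstar_prod_simps)
  then have ne: "\<bar>M0\<bar> \<in> ?S" by force
  have bd: "bdd_below ?S" by (rule bdd_belowI[of _ 0]) auto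
  show "0 \<le> cnorm (cstar_prod I A) f"
    unfolding cstar_prod_simps using ne by (intro cInf_greatest) (blast | simp)+
  show "cnorm (A i) (f i) \<le> cnorm (cstar_prod I A) f" if "i \<in> I"
    unfolding cstar_prod_simps using ne that by (intro cInf_greatest) (blast | simp)+
  show "cnorm (cstar_prod I A) f \<le> M" if "0 \<le> M" "\<And>i. i \<in> I \<Longrightarrow> cnorm (A i) (f i) \<le> M"
    unfolding cstar_prod_simps using that bd by (intro cInf_lower) auto
qed

lemma unital_cstar_algebra_prod:
  assumes A: "\<And>i. i \<in> I \<Longrightarrow> unital_cstar_algebra (A i)"
  shows "unital_cstar_algebra (cstar_prod I A)" (is "unital_cstar_algebra ?P")
proof -
  note u = unital_cstar_algebra.axioms
  have C: "f i \<in> carrier (A i)" if "f \<in> carrier ?P" "i \<in> I" for f i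
    using that by (auto simp: cstar_prod_simps)
  have E: "f = g" if "f \<in> carrier ?P" "g \<in> carrier ?P" "\<And>i. i \<in> I \<Longrightarrow> f i = g i" for f g
    using that by (auto simp: cstar_prod_simps intro: PiE_ext)
  have mem: "f \<in> carrier ?P" if "f \<in> extensional I" "\<And>i. i \<in> I \<Longrightarrow> f i \<in> carrier (A i)"
    "\<And>i. i \<in> I \<Longrightarrow> cnorm (A i) (f i) \<le> M" for f M
    using that by (auto simp: cstar_prod_simps PiE_def)
  note N = cstar_prod_norm[of _ I A]
  have ring: "ring (A i)" and mod: "module complex_ring (A i)" if "i \<in> I" for i
    using A[OF that] by (auto dest: unital_cstar_algebra.axioms)
  note agr = ring.is_abelian_group[OF ring]
  note mon = ring.is_monoid[OF ring]
  have mz: "\<zero>\<^bsub>?P\<^esub> \<in> carrier ?P"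
    by (rule mem[of _ 0]) (auto simp: cstar_prod_simps unital_cstar_algebra.cnorm_zero[OF A]
        abelian_groupE(2)[OF agr])
  have n1: "cnorm (A i) \<one>\<^bsub>A i\<^esub> \<le> 1" if "i \<in> I" for i
  proof -
    interpret unital_cstar_algebra "A i" by (rule A[OF that])
    show ?thesis using cstar_identity[of "\<one>\<^bsub>A i\<^esub>"] adj_one cnorm_nonneg[of "\<one>\<^bsub>A i\<^esub>"]
      by (cases "cnorm (A i) \<one>\<^bsub>A i\<^esub> = 0") (auto simp: power2_eq_square)
  qed
  have mo: "\<one>\<^bsub>?P\<^esub> \<in> carrier ?P"
    by (rule mem[of _ 1]) (auto simp: cstar_prod_simps n1 monoid.one_closed[OF mon])
  have ma: "f \<oplus>\<^bsub>?P\<^esub> g \<in> carrier ?P" if "f \<in> carrier ?P" "g \<in> carrier ?P" for f g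
  proof (rule mem[of _ "cnorm ?P f + cnorm ?P g"])
    fix i assume i: "i \<in> I"
    show "cnorm (A i) ((f \<oplus>\<^bsub>?P\<^esub> g) i) \<le> cnorm ?P f + cnorm ?P g"
      using N(2)[OF that(1) i] N(2)[OF that(2) i] i
        unital_cstar_algebra.cnorm_triangle[OF A[OF i] C[OF that(1) i] C[OF that(2) i]]
      by (simp add: cstar_prod_simps(5))
    show "(f \<oplus>\<^bsub>?P\<^esub> g) i \<in> carrier (A i)"
      using i C that abelian_groupE(1)[OF agr] by (simp add: cstar_prod_simps(5))
  qed (simp add: cstar_prod_simps(2-7) del: restrict_apply)
  have mm_le: "cnorm (A i) ((f \<otimes>\<^bsub>?P\<^esub> g) i) \<le> cnorm ?P f * cnorm ?P g"
    if "f \<in> carrier ?P" "g \<in> carrier ?P" "i \<in> I" for f g i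
  proof -
    have "cnorm (A i) ((f \<otimes>\<^bsub>?P\<^esub> g) i) \<le> cnorm (A i) (f i) * cnorm (A i) (g i)"
      using unital_cstar_algebra.cnorm_mult[OF A C C] that by (simp add: cstar_prod_simps(2))
    also have "\<dots> \<le> cnorm ?P f * cnorm ?P g"
      using N that C unital_cstar_algebra.cnorm_nonneg[OF A] by (intro mult_mono) blast+
    finally show ?thesis .
  qed
  have mm: "f \<otimes>\<^bsub>?P\<^esub> g \<in> carrier ?P" if "f \<in> carrier ?P" "g \<in> carrier ?P" for f g
  proof (rule mem[OF _ _ mm_le[OF that]])
    fix i assume i: "i \<in> I"
    show "(f \<otimes>\<^bsub>?P\<^esub> g) i \<in> carrier (A i)"
      using i C that monoid.m_closed[OF mon] by (simp add: cstar_prod_simps(2))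
  qed (simp add: cstar_prod_simps(2) del: restrict_apply)
  have ms: "c \<odot>\<^bsub>?P\<^esub> f \<in> carrier ?P" if "f \<in> carrier ?P" for c f
  proof (rule mem[of _ "cmod c * cnorm ?P f"])
    fix i assume i: "i \<in> I"
    show "cnorm (A i) ((c \<odot>\<^bsub>?P\<^esub> f) i) \<le> cmod c * cnorm ?P f"
      using N(2)[OF that i] i unital_cstar_algebra.cnorm_smult[OF A[OF i] C[OF that i]]
      by (simp add: cstar_prod_simps(6) mult_left_mono)
    show "(c \<odot>\<^bsub>?P\<^esub> f) i \<in> carrier (A i)"
      using i C that unital_cstar_algebra.smult_in[OF A] by (simp add: cstar_prod_simps(6))
  qed (simp add: cstar_prod_simps(2-7) del: restrict_apply)
  have mj: "adj ?P f \<in> carrier ?P" if "f \<in> carrier ?P" for f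
  proof (rule mem[of _ "cnorm ?P f"])
    fix i assume i: "i \<in> I"
    show "cnorm (A i) (adj ?P f i) \<le> cnorm ?P f"
      using N(2)[OF that i] i unital_cstar_algebra.cnorm_adj[OF A[OF i] C[OF that i]]
      by (simp add: cstar_prod_simps(7))
    show "adj ?P f i \<in> carrier (A i)"
      using i C that unital_cstar_algebra.adj_closed[OF A] by (simp add: cstar_prod_simps(7))
  qed (simp add: cstar_prod_simps(2-7) del: restrict_apply)
  note ops = cstar_prod_simps(2-7)
  note cl = mz mo ma mm ms mj
  show ?thesis
  proof (rule unital_cstar_algebraI)
    fix f assume f: "f \<in> carrier ?P"
    show "cnorm ?P f = 0 \<longleftrightarrow> f = \<zero>\<^bsub>?P\<^esub>"
    proof
      assume "cnorm ?P f = 0"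
      then have "f i = \<zero>\<^bsub>A i\<^esub>" if "i \<in> I" for i
        using N(2)[OF f that] unital_cstar_algebra.cnorm_nonneg[OF A C, OF that f that]
          unital_cstar_algebra.cnorm_eq_0[OF A C, OF that f that] by simp
      then show "f = \<zero>\<^bsub>?P\<^esub>" by (intro E f mz) (simp add: ops)
    next
      assume "f = \<zero>\<^bsub>?P\<^esub>"
      then have "cnorm ?P f \<le> 0"
        by (intro N(3) f) (auto simp: ops unital_cstar_algebra.cnorm_zero[OF A])
      then show "cnorm ?P f = 0" using N(1)[OF f] by simp
    qed
    show "cnorm ?P (c \<odot>\<^bsub>?P\<^esub> f) = cmod c * cnorm ?P f" for c
    proof (rule antisym)
      show "cnorm ?P (c \<odot>\<^bsub>?P\<^esub> f) \<le> cmod c * cnorm ?P f"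
        using N(1)[OF f] N(2)[OF f] unital_cstar_algebra.cnorm_smult[OF A C[OF f]]
        by (intro N(3) ms f) (auto simp: ops mult_left_mono)
      have "cnorm ?P f \<le> cnorm ?P (c \<odot>\<^bsub>?P\<^esub> f) / cmod c" if "c \<noteq> 0"
        using N(1)[OF ms[OF f]] N(2)[OF ms[OF f, of c]] that
          unital_cstar_algebra.cnorm_smult[OF A C[OF f]]
        by (intro N(3) f) (auto simp: ops field_simps)
      then show "cmod c * cnorm ?P f \<le> cnorm ?P (c \<odot>\<^bsub>?P\<^esub> f)"
        using N(1)[OF ms[OF f, of c]] by (cases "c = 0") (auto simp: field_simps)
    qed
    show "cnorm ?P (adj ?P f \<otimes>\<^bsub>?P\<^esub> f) = (cnorm ?P f)\<^sup>2"
    proof (rule antisym)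
      have eq: "cnorm (A i) ((adj ?P f \<otimes>\<^bsub>?P\<^esub> f) i) = (cnorm (A i) (f i))\<^sup>2" if "i \<in> I" for i
        using unital_cstar_algebra.cstar_identity[OF A C[OF f]] that by (simp add: ops)
      show "cnorm ?P (adj ?P f \<otimes>\<^bsub>?P\<^esub> f) \<le> (cnorm ?P f)\<^sup>2"
      proof (rule N(3)[OF mm[OF mj[OF f] f]])
        show "cnorm (A i) ((adj ?P f \<otimes>\<^bsub>?P\<^esub> f) i) \<le> (cnorm ?P f)\<^sup>2" if "i \<in> I" for i
          unfolding eq[OF that] using N(2)[OF f that]
            unital_cstar_algebra.cnorm_nonneg[OF A C, OF that f that] by (rule power_mono)
      qed simp
      have "cnorm ?P f \<le> sqrt (cnorm ?P (adj ?P f \<otimes>\<^bsub>?P\<^esub> f))"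
      proof (rule N(3)[OF f])
        show "0 \<le> sqrt (cnorm ?P (adj ?P f \<otimes>\<^bsub>?P\<^esub> f))" using N(1)[OF mm[OF mj[OF f] f]] by simp
        show "cnorm (A i) (f i) \<le> sqrt (cnorm ?P (adj ?P f \<otimes>\<^bsub>?P\<^esub> f))" if "i \<in> I" for i
          using N(2)[OF mm[OF mj[OF f] f] that] unfolding eq[OF that] by (rule real_le_rsqrt)
      qed
      then show "(cnorm ?P f)\<^sup>2 \<le> cnorm ?P (adj ?P f \<otimes>\<^bsub>?P\<^esub> f)"
        using N(1)[OF f] N(1)[OF mm[OF mj[OF f] f]]
        by (metis power_mono real_sqrt_pow2)
    qed
  next
    fix f g assume fg: "f \<in> carrier ?P" "g \<in> carrier ?P"
    show "cnorm ?P (f \<oplus>\<^bsub>?P\<^esub> g) \<le> cnorm ?P f + cnorm ?P g"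
    proof (rule N(3)[OF ma[OF fg]])
      fix i assume i: "i \<in> I"
      show "cnorm (A i) ((f \<oplus>\<^bsub>?P\<^esub> g) i) \<le> cnorm ?P f + cnorm ?P g"
        using N(2)[OF fg(1) i] N(2)[OF fg(2) i] i
          unital_cstar_algebra.cnorm_triangle[OF A[OF i] C[OF fg(1) i] C[OF fg(2) i]]
        by (simp add: ops)
    qed (use N(1) fg in force)
    show "cnorm ?P (f \<otimes>\<^bsub>?P\<^esub> g) \<le> cnorm ?P f * cnorm ?P g"
      by (rule N(3)[OF mm[OF fg] _ mm_le[OF fg]]) (use N(1) fg in force)
  next
    fix s :: "nat \<Rightarrow> _"
    assume s: "\<And>n. s n \<in> carrier ?P"
      and cau: "\<And>e. 0 < e \<Longrightarrow>
        \<exists>N. \<forall>m\<ge>N. \<forall>n\<ge>N. cnorm ?P (s m \<oplus>\<^bsub>?P\<^esub> (- 1) \<odot>\<^bsub>?P\<^esub> s n) < e"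
    have d: "(s m \<oplus>\<^bsub>?P\<^esub> (- 1) \<odot>\<^bsub>?P\<^esub> s n) \<in> carrier ?P" for m n using s ma ms by blast
    have di: "cnorm (A i) (s m i \<ominus>\<^bsub>A i\<^esub> s n i) \<le> cnorm ?P (s m \<oplus>\<^bsub>?P\<^esub> (- 1) \<odot>\<^bsub>?P\<^esub> s n)"
      if "i \<in> I" for m n i
      using N(2)[OF d that, of m n] that unital_cstar_algebra.minus_eq_smult[OF A C[OF s]]
      by (simp add: ops)
    have "\<exists>x. x \<in> carrier (A i) \<and> (\<lambda>n. cnorm (A i) (s n i \<ominus>\<^bsub>A i\<^esub> x)) \<longlonglongrightarrow> 0" if i: "i \<in> I" for i
    proof -
      have "\<exists>x\<in>carrier (A i). (\<lambda>n. cnorm (A i) (s n i \<ominus>\<^bsub>A i\<^esub> x)) \<longlonglongrightarrow> 0"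
      proof (rule unital_cstar_algebra.complete[OF A[OF i], of "\<lambda>n. s n i"])
        show "\<exists>N. \<forall>m\<ge>N. \<forall>n\<ge>N. cnorm (A i) (s m i \<ominus>\<^bsub>A i\<^esub> s n i) < e" if "e > 0" for e
          using cau[OF that] di[OF i] by (meson order_le_less_trans)
      qed (use C s i in auto)
      then show ?thesis by blast
    qed
    then obtain x0 where x0: "\<And>i. i \<in> I \<Longrightarrow> x0 i \<in> carrier (A i)"
      "\<And>i. i \<in> I \<Longrightarrow> (\<lambda>n. cnorm (A i) (s n i \<ominus>\<^bsub>A i\<^esub> x0 i)) \<longlonglongrightarrow> 0" by metis
    define x where "x = restrict x0 I"
    have tail: "cnorm (A i) (s m i \<ominus>\<^bsub>A i\<^esub> x i) \<le> e"
      if i: "i \<in> I" and N: "\<forall>m\<ge>N. \<forall>n\<ge>N. cnorm ?P (s m \<oplus>\<^bsub>?P\<^esub> (- 1) \<odot>\<^bsub>?P\<^esub> s n) < e" and m: "m \<ge> N"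
      for i N e m
    proof -
      interpret unital_cstar_algebra "A i" by (rule A[OF i])
      have "(\<lambda>n. e + cnorm (A i) (s n i \<ominus>\<^bsub>A i\<^esub> x0 i)) \<longlonglongrightarrow> e + 0"
        by (intro tendsto_intros x0 i)
      moreover have "cnorm (A i) (s m i \<ominus>\<^bsub>A i\<^esub> x0 i) \<le> e + cnorm (A i) (s n i \<ominus>\<^bsub>A i\<^esub> x0 i)" if "n \<ge> N" for n
        using cnorm_diff_triangle[of "s m i" "s n i" "x0 i"] C[OF s i] x0(1)[OF i] di[OF i, of m n] N m that
        by (smt (verit))
      ultimately have "cnorm (A i) (s m i \<ominus>\<^bsub>A i\<^esub> x0 i) \<le> e + 0"
        by (intro LIMSEQ_le_const) auto
      then show ?thesis using i by (simp add: x_def)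
    qed
    have x: "x \<in> carrier ?P"
    proof -
      obtain N where N: "\<forall>m\<ge>N. \<forall>n\<ge>N. cnorm ?P (s m \<oplus>\<^bsub>?P\<^esub> (- 1) \<odot>\<^bsub>?P\<^esub> s n) < 1"
        using cau[of 1] by auto
      show ?thesis
      proof (rule mem[of _ "1 + cnorm ?P (s N)"])
        fix i assume i: "i \<in> I"
        interpret unital_cstar_algebra "A i" by (rule A[OF i])
        show xi: "x i \<in> carrier (A i)" using x0 i by (simp add: x_def)
        have a: "x i \<ominus>\<^bsub>A i\<^esub> \<zero>\<^bsub>A i\<^esub> = x i" "s N i \<ominus>\<^bsub>A i\<^esub> \<zero>\<^bsub>A i\<^esub> = s N i"
          using xi C[OF s i, of N] by (simp_all add: a_minus_def)
        show "cnorm (A i) (x i) \<le> 1 + cnorm ?P (s N)"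
          using cnorm_diff_triangle[of "x i" "s N i" "\<zero>\<^bsub>A i\<^esub>"] tail[OF i N order_refl]
            N(1) xi C[OF s i, of N] cnorm_diff_commute[of "x i" "s N i"] N(1)
            cstar_prod_norm(2)[OF s i, of N] a
          by simp
      qed (simp add: x_def)
    qed
    have dx: "(s n \<oplus>\<^bsub>?P\<^esub> (- 1) \<odot>\<^bsub>?P\<^esub> x) \<in> carrier ?P" for n using s x ma ms by blast
    have "(\<lambda>n. cnorm ?P (s n \<oplus>\<^bsub>?P\<^esub> (- 1) \<odot>\<^bsub>?P\<^esub> x)) \<longlonglongrightarrow> 0"
    proof (rule LIMSEQ_I)
      fix e :: real assume "e > 0"
      then obtain N where N: "\<forall>m\<ge>N. \<forall>n\<ge>N. cnorm ?P (s m \<oplus>\<^bsub>?P\<^esub> (- 1) \<odot>\<^bsub>?P\<^esub> s n) < e/2"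
        using cau[of "e/2"] by auto
      have "cnorm ?P (s n \<oplus>\<^bsub>?P\<^esub> (- 1) \<odot>\<^bsub>?P\<^esub> x) \<le> e/2" if "n \<ge> N" for n
      proof (rule cstar_prod_norm(3)[OF dx])
        fix i assume i: "i \<in> I"
        show "cnorm (A i) ((s n \<oplus>\<^bsub>?P\<^esub> (- 1) \<odot>\<^bsub>?P\<^esub> x) i) \<le> e/2"
          using tail[OF i N that] i unital_cstar_algebra.minus_eq_smult[OF A[OF i] C[OF x i]]
          by (simp add: ops)
      qed (use \<open>e > 0\<close> in simp)
      then show "\<exists>no. \<forall>n\<ge>no. norm (cnorm ?P (s n \<oplus>\<^bsub>?P\<^esub> (- 1) \<odot>\<^bsub>?P\<^esub> x) - 0) < e"
        using cstar_prod_norm(1)[OF dx] \<open>e > 0\<close> by (intro exI[of _ N]) (fastforce)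
    qed
    then show "\<exists>x\<in>carrier ?P. (\<lambda>n. cnorm ?P (s n \<oplus>\<^bsub>?P\<^esub> (- 1) \<odot>\<^bsub>?P\<^esub> x)) \<longlonglongrightarrow> 0"
      using x by blast
  qed ((rule E; (assumption | (intro cl; assumption) | (simp add: ops C unital_cstar_algebra.laws[OF A]; fail)))
      | (intro cl; assumption))+
qed

subsection \<open>Transport along an injection\<close>

definition cstar_transport :: "('a \<Rightarrow> 'b) \<Rightarrow> 'a cstar \<Rightarrow> 'b cstar" where
  "cstar_transport \<phi> A = (let \<psi> = the_inv_into (carrier A) \<phi> in
     \<lparr>carrier = \<phi> ` carrier A,
      mult = (\<lambda>x y. \<phi> (\<psi> x \<otimes>\<^bsub>A\<^esub> \<psi> y)), one = \<phi> \<one>\<^bsub>A\<^esub>, zero = \<phi> \<zero>\<^bsub>A\<^esub>,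
      add = (\<lambda>x y. \<phi> (\<psi> x \<oplus>\<^bsub>A\<^esub> \<psi> y)), smult = (\<lambda>c x. \<phi> (c \<odot>\<^bsub>A\<^esub> \<psi> x)),
      adj = (\<lambda>x. \<phi> (adj A (\<psi> x))), cnorm = (\<lambda>x. cnorm A (\<psi> x))\<rparr>)"

lemma (in unital_cstar_algebra) transport:
  assumes inj: "inj_on \<phi> (carrier A)"
  defines "\<psi> \<equiv> the_inv_into (carrier A) \<phi>"
  shows "unital_cstar_algebra (cstar_transport \<phi> A)"
    and "\<phi> \<in> star_hom A (cstar_transport \<phi> A)"
    and "\<psi> \<in> star_hom (cstar_transport \<phi> A) A"
proof -
  have \<psi>: "\<psi> (\<phi> x) = x" if "x \<in> carrier A" for x
    using that inj by (simp add: \<psi>_def the_inv_into_f_f)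
  have eqs: "carrier (cstar_transport \<phi> A) = \<phi> ` carrier A"
    "mult (cstar_transport \<phi> A) = (\<lambda>x y. \<phi> (\<psi> x \<otimes> \<psi> y))"
    "one (cstar_transport \<phi> A) = \<phi> \<one>" "zero (cstar_transport \<phi> A) = \<phi> \<zero>"
    "add (cstar_transport \<phi> A) = (\<lambda>x y. \<phi> (\<psi> x \<oplus> \<psi> y))"
    "smult (cstar_transport \<phi> A) = (\<lambda>c x. \<phi> (c \<odot> \<psi> x))"
    "adj (cstar_transport \<phi> A) = (\<lambda>x. \<phi> (adj A (\<psi> x)))"
    "cnorm (cstar_transport \<phi> A) = (\<lambda>x. cnorm A (\<psi> x))"
    by (simp_all add: cstar_transport_def Let_def \<psi>_def)
  show "\<phi> \<in> star_hom A (cstar_transport \<phi> A)" "\<psi> \<in> star_hom (cstar_transport \<phi> A) A"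
    by (auto simp: star_hom_def ring_hom_def eqs \<psi> laws)
  show "unital_cstar_algebra (cstar_transport \<phi> A)"
  proof (rule unital_cstar_algebraI, simp_all only: eqs)
    fix s :: "nat \<Rightarrow> 'b"
    assume s: "\<And>n. s n \<in> \<phi> ` carrier A"
      and c: "\<And>e. 0 < e \<Longrightarrow> \<exists>N. \<forall>m\<ge>N. \<forall>n\<ge>N. cnorm A (\<psi> (\<phi> (\<psi> (s m) \<oplus> \<psi> (\<phi> ((- 1) \<odot> \<psi> (s n)))))) < e"
    have sc: "\<psi> (s n) \<in> carrier A" for n using s[of n] \<psi> by auto
    have "\<exists>x\<in>carrier A. (\<lambda>n. cnorm A (\<psi> (s n) \<ominus> x)) \<longlonglongrightarrow> 0"
      using c by (intro complete sc) (simp_all add: \<psi> sc laws minus_eq_smult)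
    then show "\<exists>x\<in>\<phi> ` carrier A. (\<lambda>n. cnorm A (\<psi> (\<phi> (\<psi> (s n) \<oplus> \<psi> (\<phi> ((- 1) \<odot> \<psi> x)))))) \<longlonglongrightarrow> 0"
      by (auto simp: \<psi> sc laws minus_eq_smult)
  next
    fix x assume "x \<in> \<phi> ` carrier A"
    then show "(cnorm A (\<psi> x) = 0) = (x = \<phi> \<zero>)"
      using inj by (auto simp: \<psi> cnorm_eq_0 inj_on_eq_iff)
  qed (auto simp: \<psi> laws cnorm_triangle cnorm_smult cnorm_mult cstar_identity)
qed

subsection \<open>Every $C^*$-algebra generated by a representation embeds into the fixed type\<close>

context unital_cstar_algebra
begin

fun eval_word :: "('g \<Rightarrow> 'a) \<Rightarrow> ('g \<times> bool) list \<Rightarrow> 'a" where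
  "eval_word W [] = \<one>"
| "eval_word W ((g, b) # w) = (if b then adj A (W g) else W g) \<otimes> eval_word W w"

fun eval_poly :: "('g \<Rightarrow> 'a) \<Rightarrow> 'g star_poly \<Rightarrow> 'a" where
  "eval_poly W [] = \<zero>"
| "eval_poly W ((c, w) # l) = c \<odot> eval_word W w \<oplus> eval_poly W l"

context fixes W :: "'g \<Rightarrow> 'a" assumes W: "\<And>g. W g \<in> carrier A"
begin

lemma eval_word_in [simp]: "eval_word W w \<in> carrier A"
  by (induction w) (auto simp: W laws)

lemma eval_poly_in [simp]: "eval_poly W l \<in> carrier A"
  by (induction l) (auto simp: laws)

lemma eval_word_append: "eval_word W (u @ v) = eval_word W u \<otimes> eval_word W v"
  by (induction u) (auto simp: W laws)

lemma eval_poly_append: "eval_poly W (u @ v) = eval_poly W u \<oplus> eval_poly W v"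
  by (induction u) (auto simp: W laws)

lemma eval_poly_smult: "eval_poly W (map (\<lambda>(d, w). (c * d, w)) l) = c \<odot> eval_poly W l"
  by (induction l) (auto simp: W laws)

lemma eval_poly_word_mult:
  "eval_poly W (map (\<lambda>(d, w). (c * d, u @ w)) l) = (c \<odot> eval_word W u) \<otimes> eval_poly W l"
  by (induction l) (auto simp: W laws eval_word_append mult.commute)

lemma eval_poly_mult:
  "eval_poly W (concat (map (\<lambda>(c, u). map (\<lambda>(d, w). (c * d, u @ w)) l) k)) =
     eval_poly W k \<otimes> eval_poly W l"
  by (induction k) (auto simp: W laws eval_poly_append eval_poly_word_mult)

lemma eval_word_adj: "eval_word W (rev (map (\<lambda>(g, b). (g, \<not> b)) w)) = adj A (eval_word W w)"
  by (induction w) (auto simp: W laws eval_word_append adj_one)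

lemma adj_zero: "adj A \<zero> = \<zero>"
  using adj_smult[of \<zero> 0] by (simp add: adj_closed)

lemma eval_poly_adj:
  "eval_poly W (map (\<lambda>(c, w). (cnj c, rev (map (\<lambda>(g, b). (g, \<not> b)) w))) l) = adj A (eval_poly W l)"
  by (induction l) (auto simp: W laws eval_word_adj adj_zero)

definition approx :: "'a \<Rightarrow> (nat \<Rightarrow> 'g star_poly) \<Rightarrow> bool" where
  "approx x t \<longleftrightarrow> (\<lambda>n. cnorm A (eval_poly W (t n) \<ominus> x)) \<longlonglongrightarrow> 0"

lemma approxI: 
  assumes "\<And>n::nat. cnorm A (eval_poly W (t n) \<ominus> x) \<le> f n" "x \<in> carrier A" "f \<longlonglongrightarrow> 0"
  shows "approx x t"
  unfolding approx_def
  by (rule tendsto_sandwich[OF _ _ tendsto_const assms(3)]) (use assms in auto)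

lemma diff_add: "\<lbrakk>a \<in> carrier A; b \<in> carrier A; x \<in> carrier A; y \<in> carrier A\<rbrakk> \<Longrightarrow>
  (a \<oplus> b) \<ominus> (x \<oplus> y) = (a \<ominus> x) \<oplus> (b \<ominus> y)"
  by (simp add: minus_eq_smult laws)

lemma cstar_span_approx:
  assumes "x \<in> cstar_span A (W ` S)"
  shows "\<exists>t. approx x t"
  using assms
proof (induction rule: cstar_span.induct)
  case (base x)
  then obtain g where "x = W g" by auto
  then have "approx x (\<lambda>_. [(1, [(g, False)])])" using W by (simp add: approx_def laws)
  then show ?case by blast
next
  case one
  have "approx \<one> (\<lambda>_. [(1, [])])" by (simp add: approx_def laws)
  then show ?case by blast
next
  note inC = cstar_span_in_carrier[of _ "W ` S"]
  case (add x y)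
  then obtain t u where t: "approx x t" "approx y u" by auto
  have xy: "x \<in> carrier A" "y \<in> carrier A" using add.hyps W by (auto intro: inC)
  have "approx (x \<oplus> y) (\<lambda>n. t n @ u n)"
  proof (rule approxI)
    show "(\<lambda>n. cnorm A (eval_poly W (t n) \<ominus> x) + cnorm A (eval_poly W (u n) \<ominus> y)) \<longlonglongrightarrow> 0"
      using tendsto_add[OF t[unfolded approx_def]] by simp
  qed (use xy in \<open>simp_all add: eval_poly_append diff_add cnorm_triangle\<close>)
  then show ?case by blast
next
  note inC = cstar_span_in_carrier[of _ "W ` S"]
  case (smult x c)
  then obtain t where t: "approx x t" by auto
  have x: "x \<in> carrier A" using smult.hyps W by (auto intro: inC)
  have "c \<odot> eval_poly W (t n) \<ominus> c \<odot> x = c \<odot> (eval_poly W (t n) \<ominus> x)" for n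
    using x by (simp add: minus_eq_smult laws mult.commute)
  then have "approx (c \<odot> x) (\<lambda>n. map (\<lambda>(d, w). (c * d, w)) (t n))"
    using t x tendsto_mult_left[of _ 0 _ "cmod c"] by (simp add: approx_def eval_poly_smult cnorm_smult) fastforce
  then show ?case by blast
next
  note inC = cstar_span_in_carrier[of _ "W ` S"]
  case (mult x y)
  then obtain t u where t: "approx x t" "approx y u" by auto
  have xy: "x \<in> carrier A" "y \<in> carrier A" using mult.hyps W by (auto intro: inC)
  let ?dx = "\<lambda>n. cnorm A (eval_poly W (t n) \<ominus> x)" and ?dy = "\<lambda>n. cnorm A (eval_poly W (u n) \<ominus> y)"
  have dx: "?dx \<longlonglongrightarrow> 0" and dy: "?dy \<longlonglongrightarrow> 0" using t by (auto simp: approx_def)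
  have "approx (x \<otimes> y) (\<lambda>n. concat (map (\<lambda>(c, v). map (\<lambda>(d, w). (c * d, v @ w)) (u n)) (t n)))"
  proof (rule approxI)
    show "(\<lambda>n. ?dx n * ?dy n + (?dx n * cnorm A y + cnorm A x * ?dy n)) \<longlonglongrightarrow> 0"
      using tendsto_add[OF tendsto_mult[OF dx dy] tendsto_add[OF tendsto_mult_right[OF dx, of "cnorm A y"]
        tendsto_mult_left[OF dy, of "cnorm A x"]]] by simp
    fix n
    define a where "a = eval_poly W (t n) \<ominus> x"
    define b where "b = eval_poly W (u n) \<ominus> y"
    have ab: "a \<in> carrier A" "b \<in> carrier A" using xy by (simp_all add: a_def b_def)
    have "eval_poly W (t n) = a \<oplus> x" "eval_poly W (u n) = b \<oplus> y"
      using xy by (simp_all add: a_def b_def a_minus_def M.a_assoc M.l_neg)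
    then have "eval_poly W (t n) \<otimes> eval_poly W (u n) = (a \<otimes> b \<oplus> (a \<otimes> y \<oplus> x \<otimes> b)) \<oplus> x \<otimes> y"
      using ab xy by (simp add: laws)
    then have "eval_poly W (t n) \<otimes> eval_poly W (u n) \<ominus> x \<otimes> y = a \<otimes> b \<oplus> (a \<otimes> y \<oplus> x \<otimes> b)"
      using ab xy by (simp add: a_minus_def M.a_assoc M.r_neg)
    also have "cnorm A \<dots> \<le> cnorm A a * cnorm A b + (cnorm A a * cnorm A y + cnorm A x * cnorm A b)"
      using ab xy cnorm_triangle[of "a \<otimes> b" "a \<otimes> y \<oplus> x \<otimes> b"] cnorm_triangle[of "a \<otimes> y" "x \<otimes> b"]
        cnorm_mult[of a b] cnorm_mult[of a y] cnorm_mult[of x b] by simp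
    finally show "cnorm A (eval_poly W (concat (map (\<lambda>(c, v). map (\<lambda>(d, w). (c * d, v @ w)) (u n)) (t n)))
        \<ominus> x \<otimes> y) \<le> ?dx n * ?dy n + (?dx n * cnorm A y + cnorm A x * ?dy n)"
      by (simp add: eval_poly_mult a_def b_def)
  qed (use xy in simp)
  then show ?case by blast
next
  note inC = cstar_span_in_carrier[of _ "W ` S"]
  case (adj x)
  then obtain t where t: "approx x t" by auto
  have x: "x \<in> carrier A" using adj.hyps W by (auto intro: inC)
  have "adj A (eval_poly W (t n)) \<ominus> adj A x = adj A (eval_poly W (t n) \<ominus> x)" for n
    using x by (simp add: minus_eq_smult laws)
  then have "approx (adj A x) (\<lambda>n. map (\<lambda>(c, w). (cnj c, rev (map (\<lambda>(g, b). (g, \<not> b)) w))) (t n))"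
    using t x by (simp add: approx_def eval_poly_adj cnorm_adj)
  then show ?case by blast
next
  note inC = cstar_span_in_carrier[of _ "W ` S"]
  case (limit s x)
  then obtain t where t: "\<And>n. approx (s n) (t n)" by metis
  have s: "s n \<in> carrier A" for n using limit.hyps W by (auto intro: inC)
  have "\<exists>k. cnorm A (eval_poly W (t n k) \<ominus> s n) < 1 / Suc n" for n
    using LIMSEQ_D[OF t[of n, unfolded approx_def], of "1 / Suc n"] s by fastforce
  then obtain k where k: "\<And>n. cnorm A (eval_poly W (t n (k n)) \<ominus> s n) < 1 / Suc n" by metis
  have "approx x (\<lambda>n. t n (k n))"
  proof (rule approxI)
    show "(\<lambda>n. 1 / Suc n + cnorm A (s n \<ominus> x)) \<longlonglongrightarrow> 0"
      using tendsto_add[OF LIMSEQ_Suc[OF lim_1_over_n] limit.hyps(3)] by simp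
    show "cnorm A (eval_poly W (t n (k n)) \<ominus> x) \<le> 1 / Suc n + cnorm A (s n \<ominus> x)" for n
      using cnorm_diff_triangle[of "eval_poly W (t n (k n))" "s n" x] k[of n] s limit.hyps(2)
      by fastforce
  qed (use limit in simp)
  then show ?case by blast
qed

lemma cstar_span_embeds:
  "\<exists>\<phi> :: 'a \<Rightarrow> 'g cstar_univ. inj_on \<phi> (cstar_span A (W ` S))"
proof -
  obtain \<phi> where \<phi>: "\<And>x. x \<in> cstar_span A (W ` S) \<Longrightarrow> approx x (\<phi> x)"
    using cstar_span_approx by metis
  have "inj_on \<phi> (cstar_span A (W ` S))"
  proof (rule inj_onI)
    fix x y assume a: "x \<in> cstar_span A (W ` S)" "y \<in> cstar_span A (W ` S)" "\<phi> x = \<phi> y"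
    then have "x \<in> carrier A" "y \<in> carrier A" using W by (auto intro: cstar_span_in_carrier[of _ "W ` S"])
    then show "x = y"
      using \<phi>[OF a(1)] \<phi>[OF a(2)] a(3) by (intro limit_unique[of "\<lambda>n. eval_poly W (\<phi> x n)"]) (simp_all add: approx_def)
  qed
  then show ?thesis by blast
qed

end

end

section \<open>Universality of the canonical representation\<close>

lemma join_SomeD:
  fixes G (structure)
  assumes q: "quasi_lattice_ordered G P" and P: "x \<in> carrier G" "y \<in> carrier G"
    and j: "join G P x y = Some z"
  shows "is_lub G P {x, y} z" and "z \<in> P"
proof -
  interpret group G using q by (simp add: quasi_lattice_ordered_def)
  have PG: "P \<subseteq> carrier G" and anti: "P \<inter> (\<lambda>p. inv p) ` P = {\<one>}"
    using q by (auto simp: quasi_lattice_ordered_def)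
  have ne: "upper_bounds G P {x, y} \<noteq> {}" and z: "z = (THE z. is_lub G P {x, y} z)"
    using j by (auto simp: join_def split: if_splits)
  have "\<exists>z. is_lub G P {x, y} z" using q ne P by (simp add: quasi_lattice_ordered_def)
  moreover have "u = v" if "is_lub G P {x, y} u" "is_lub G P {x, y} v" for u v
  proof -
    have uv: "u \<in> carrier G" "v \<in> carrier G" "inv u \<otimes> v \<in> P" "inv v \<otimes> u \<in> P"
      using that PG by (auto simp: is_lub_def upper_bounds_def le_of_def)
    moreover have "inv u \<otimes> v = inv (inv v \<otimes> u)" using uv by (simp add: inv_mult_group)
    ultimately have "inv u \<otimes> v \<in> {\<one>}" using anti by blast
    then have "inv u \<otimes> v = \<one>" by simp
    moreover have "u \<otimes> (inv u \<otimes> v) = v" using uv by (simp add: m_assoc[symmetric])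
    ultimately show ?thesis using uv by simp
  qed
  ultimately have "\<exists>!z. is_lub G P {x, y} z" by blast
  then show l: "is_lub G P {x, y} z" unfolding z by (rule theI')
  then show "z \<in> P" by (simp add: is_lub_def upper_bounds_def)
qed

lemma qlo_carrier: "quasi_lattice_ordered G P \<Longrightarrow> p \<in> P \<Longrightarrow> p \<in> carrier G"
  by (auto simp: quasi_lattice_ordered_def)

lemma qlo_one: "quasi_lattice_ordered G P \<Longrightarrow> \<one>\<^bsub>G\<^esub> \<in> P"
  by (auto simp: quasi_lattice_ordered_def)

lemma qlo_mult: "quasi_lattice_ordered G P \<Longrightarrow> p \<in> P \<Longrightarrow> q \<in> P \<Longrightarrow> p \<otimes>\<^bsub>G\<^esub> q \<in> P"
  by (auto simp: quasi_lattice_ordered_def)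

lemma covariant_rep_cong:
  assumes q: "quasi_lattice_ordered G P" and c: "covariant_rep G P A W" and e: "\<And>p. p \<in> P \<Longrightarrow> V p = W p"
  shows "covariant_rep G P A V"
proof -
  have j: "(case join G P p r of Some s \<Rightarrow> range_proj A (V s) | None \<Rightarrow> \<zero>\<^bsub>A\<^esub>) =
      (case join G P p r of Some s \<Rightarrow> range_proj A (W s) | None \<Rightarrow> \<zero>\<^bsub>A\<^esub>)" if "p \<in> P" "r \<in> P" for p r
    using join_SomeD(2)[OF q qlo_carrier[OF q that(1)] qlo_carrier[OF q that(2)]] e
    by (cases "join G P p r") auto
  show ?thesis using c
    by (simp add: covariant_rep_def isometric_rep_def e j qlo_one[OF q] qlo_mult[OF q])
qed

lemma star_hom_zero:
  assumes "unital_cstar_algebra A" "unital_cstar_algebra B" "\<pi> \<in> star_hom A B"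
  shows "\<pi> \<zero>\<^bsub>A\<^esub> = \<zero>\<^bsub>B\<^esub>"
proof -
  interpret A: unital_cstar_algebra A by fact
  interpret B: unital_cstar_algebra B by fact
  have "\<pi> (0 \<odot>\<^bsub>A\<^esub> \<zero>\<^bsub>A\<^esub>) = 0 \<odot>\<^bsub>B\<^esub> \<pi> \<zero>\<^bsub>A\<^esub>"
    using assms(3) A.M.zero_closed unfolding star_hom_def by blast
  moreover have "\<pi> \<zero>\<^bsub>A\<^esub> \<in> carrier B"
    using assms(3) A.M.zero_closed unfolding star_hom_def ring_hom_def by blast
  ultimately show ?thesis by simp
qed

lemma covariant_rep_star_hom:
  assumes q: "quasi_lattice_ordered G P"
    and A: "unital_cstar_algebra A" and B: "unital_cstar_algebra B"
    and \<pi>: "\<pi> \<in> star_hom A B" and c: "covariant_rep G P A W"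
  shows "covariant_rep G P B (\<lambda>p. \<pi> (W p))"
proof -
  interpret A: unital_cstar_algebra A by fact
  have W: "W p \<in> carrier A" if "p \<in> P" for p
    using c that by (auto simp: covariant_rep_def isometric_rep_def)
  have h: "\<pi> (x \<otimes>\<^bsub>A\<^esub> y) = \<pi> x \<otimes>\<^bsub>B\<^esub> \<pi> y" "\<pi> (adj A x) = adj B (\<pi> x)" "\<pi> \<one>\<^bsub>A\<^esub> = \<one>\<^bsub>B\<^esub>"
    "\<pi> x \<in> carrier B" if "x \<in> carrier A" "y \<in> carrier A" for x y
    using \<pi> that by (auto simp: star_hom_def ring_hom_def)
  have r: "range_proj B (\<pi> x) = \<pi> (range_proj A x)" "range_proj A x \<in> carrier A" if "x \<in> carrier A" for x
    using that h by (auto simp: range_proj_def A.laws)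
  have iso: "isometric_rep G P B (\<lambda>p. \<pi> (W p))"
    unfolding isometric_rep_def
  proof (intro conjI ballI)
    have c': "isometric_rep G P A W" using c by (simp add: covariant_rep_def)
    note c' = c'[unfolded isometric_rep_def]
    show "\<pi> (W p) \<in> carrier B" if "p \<in> P" for p using h(4)[OF W[OF that] W[OF that]] .
    show "\<pi> (W \<one>\<^bsub>G\<^esub>) = \<one>\<^bsub>B\<^esub>" using c' \<pi> by (simp add: star_hom_def ring_hom_def)
    show "adj B (\<pi> (W p)) \<otimes>\<^bsub>B\<^esub> \<pi> (W p) = \<one>\<^bsub>B\<^esub>" if "p \<in> P" for p
      using h(1)[OF A.adj_closed[OF W[OF that]] W[OF that]] h(2)[OF W[OF that] W[OF that]]
        h(3)[OF W[OF that] W[OF that]] c' that by simp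
    show "\<pi> (W p) \<otimes>\<^bsub>B\<^esub> \<pi> (W p') = \<pi> (W (p \<otimes>\<^bsub>G\<^esub> p'))" if "p \<in> P" "p' \<in> P" for p p'
      using h(1)[OF W[OF that(1)] W[OF that(2)]] c' that by simp
  qed
  show ?thesis unfolding covariant_rep_def
  proof (intro conjI ballI iso)
    fix p p' assume p: "p \<in> P" "p' \<in> P"
    have "range_proj B (\<pi> (W p)) \<otimes>\<^bsub>B\<^esub> range_proj B (\<pi> (W p')) =
      \<pi> (range_proj A (W p) \<otimes>\<^bsub>A\<^esub> range_proj A (W p'))"
      using h(1) r p W by simp
    also have "\<dots> = \<pi> (case join G P p p' of Some s \<Rightarrow> range_proj A (W s) | None \<Rightarrow> \<zero>\<^bsub>A\<^esub>)"
      using c p by (simp add: covariant_rep_def)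
    also have "\<dots> = (case join G P p p' of Some s \<Rightarrow> range_proj B (\<pi> (W s)) | None \<Rightarrow> \<zero>\<^bsub>B\<^esub>)"
      using join_SomeD(2)[OF q qlo_carrier[OF q p(1)] qlo_carrier[OF q p(2)]] W r star_hom_zero[OF A B \<pi>]
      by (auto split: option.splits)
    finally show "range_proj B (\<pi> (W p)) \<otimes>\<^bsub>B\<^esub> range_proj B (\<pi> (W p')) =
      (case join G P p p' of Some s \<Rightarrow> range_proj B (\<pi> (W s)) | None \<Rightarrow> \<zero>\<^bsub>B\<^esub>)" .
  qed
qed

lemma unital_cstar_algebra_covariant_reps:
  "unital_cstar_algebra (cstar_prod (covariant_reps G P) fst)"
  by (rule unital_cstar_algebra_prod) (auto simp: covariant_reps_def)

lemma (in unital_cstar_algebra) cnorm_isometry_le: 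
  assumes "x \<in> carrier A" "adj A x \<otimes> x = \<one>" shows "cnorm A x \<le> 1"
proof -
  have one: "cnorm A \<one> = (cnorm A \<one>)\<^sup>2" using cstar_identity[of \<one>] adj_one by simp
  then have "cnorm A \<one> \<le> 1" by (cases "cnorm A \<one> = 0") (auto simp: power2_eq_square)
  then have "(cnorm A x)\<^sup>2 \<le> 1\<^sup>2" using cstar_identity[OF assms(1)] assms(2) by simp
  then show ?thesis by (rule power2_le_imp_le) simp
qed

lemma universal_rep_in:
  assumes "p \<in> P"
  shows "universal_rep G P p \<in> carrier (cstar_prod (covariant_reps G P) fst)"
proof -
  have "cnorm A (W p) \<le> 1" if "(A, W) \<in> covariant_reps G P" for A W
    using that assms by (intro unital_cstar_algebra.cnorm_isometry_le)
      (auto simp: covariant_reps_def covariant_rep_def isometric_rep_def)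
  moreover have "W p \<in> carrier A" if "(A, W) \<in> covariant_reps G P" for A W
    using that assms by (simp add: covariant_reps_def covariant_rep_def isometric_rep_def)
  ultimately show ?thesis
    by (auto simp: cstar_prod_simps universal_rep_def intro!: exI[of _ 1])
qed

theorem universal_cstar_algebra: "unital_cstar_algebra (universal_cstar G P)"
  unfolding universal_cstar_def
  by (rule unital_cstar_algebra.cstar_generated[OF unital_cstar_algebra_covariant_reps])
    (auto intro: universal_rep_in)

theorem universal_rep_covariant:
  assumes q: "quasi_lattice_ordered G P"
  shows "covariant_rep G P (universal_cstar G P) (universal_rep G P)"
proof -
  let ?I = "covariant_reps G P" and ?U = "universal_cstar G P"
  have w: "universal_rep G P p = (\<lambda>i\<in>?I. snd i p)" for p
    by (auto simp: universal_rep_def restrict_def fun_eq_iff)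
  have U: "f \<otimes>\<^bsub>?U\<^esub> g = (\<lambda>i\<in>?I. f i \<otimes>\<^bsub>fst i\<^esub> g i)" "\<one>\<^bsub>?U\<^esub> = (\<lambda>i\<in>?I. \<one>\<^bsub>fst i\<^esub>)"
    "\<zero>\<^bsub>?U\<^esub> = (\<lambda>i\<in>?I. \<zero>\<^bsub>fst i\<^esub>)" "adj ?U f = (\<lambda>i\<in>?I. adj (fst i) (f i))" for f g
    by (simp_all only: universal_cstar_def cstar_generated_simps cstar_prod_simps)
  have c: "covariant_rep G P (fst i) (snd i)" if "i \<in> ?I" for i
    using that by (auto simp: covariant_reps_def)
  then have r: "isometric_rep G P (fst i) (snd i)" if "i \<in> ?I" for i
    using that by (simp add: covariant_rep_def)
  have rp: "range_proj ?U (universal_rep G P p) = (\<lambda>i\<in>?I. range_proj (fst i) (snd i p))" for p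
    unfolding range_proj_def w U by (intro restrict_ext) simp
  have 1: "isometric_rep G P ?U (universal_rep G P)"
    unfolding isometric_rep_def
  proof (intro conjI ballI)
    show "universal_rep G P p \<in> carrier ?U" if "p \<in> P" for p
      using that by (auto simp: universal_cstar_def intro: cstar_span.base)
    show "universal_rep G P \<one>\<^bsub>G\<^esub> = \<one>\<^bsub>?U\<^esub>"
      unfolding w U by (rule restrict_ext) (use r in \<open>simp add: isometric_rep_def\<close>)
    show "adj ?U (universal_rep G P p) \<otimes>\<^bsub>?U\<^esub> universal_rep G P p = \<one>\<^bsub>?U\<^esub>" if "p \<in> P" for p
      unfolding w U by (rule restrict_ext) (use r that in \<open>simp add: isometric_rep_def\<close>)
    show "universal_rep G P p \<otimes>\<^bsub>?U\<^esub> universal_rep G P p' = universal_rep G P (p \<otimes>\<^bsub>G\<^esub> p')"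
      if "p \<in> P" "p' \<in> P" for p p'
      unfolding w U by (rule restrict_ext) (use r that in \<open>simp add: isometric_rep_def\<close>)
  qed
  show ?thesis unfolding covariant_rep_def
  proof (intro conjI ballI 1)
    fix p p' assume p: "p \<in> P" "p' \<in> P"
    have "range_proj (fst i) (snd i p) \<otimes>\<^bsub>fst i\<^esub> range_proj (fst i) (snd i p') =
        (case join G P p p' of Some s \<Rightarrow> range_proj (fst i) (snd i s) | None \<Rightarrow> \<zero>\<^bsub>fst i\<^esub>)" if "i \<in> ?I" for i
      using c[OF that] p by (simp add: covariant_rep_def)
    then show "range_proj ?U (universal_rep G P p) \<otimes>\<^bsub>?U\<^esub> range_proj ?U (universal_rep G P p') =
        (case join G P p p' of Some s \<Rightarrow> range_proj ?U (universal_rep G P s) | None \<Rightarrow> \<zero>\<^bsub>?U\<^esub>)"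
      by (cases "join G P p p'") (auto simp: rp U intro!: restrict_ext)
  qed
qed

theorem universal_rep_universal:
  assumes q: "quasi_lattice_ordered G P"
    and B: "unital_cstar_algebra (B :: 'b cstar)" and c: "covariant_rep G P B W"
  shows "\<exists>\<pi>\<in>star_hom (universal_cstar G P) B. \<forall>p\<in>P. \<pi> (universal_rep G P p) = W p"
proof -
  interpret B: unital_cstar_algebra B by fact
  define V where "V p = (if p \<in> P then W p else \<one>\<^bsub>B\<^esub>)" for p
  have V: "V p \<in> carrier B" for p
    using c by (auto simp: V_def covariant_rep_def isometric_rep_def)
  have cV: "covariant_rep G P B V" by (rule covariant_rep_cong[OF q c]) (simp add: V_def)
  let ?B = "cstar_generated B (V ` P)"
  have "unital_cstar_algebra ?B" using V by (intro B.cstar_generated) auto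
  then interpret B': unital_cstar_algebra ?B .
  have cV': "covariant_rep G P ?B V"
  proof -
    have "V p \<in> cstar_span B (V ` P)" if "p \<in> P" for p using that by (auto intro: cstar_span.base)
    then show ?thesis using cV unfolding covariant_rep_def isometric_rep_def range_proj_def cstar_generated_simps
      by blast
  qed
  obtain \<phi> :: "'b \<Rightarrow> 'a cstar_univ" where \<phi>: "inj_on \<phi> (carrier ?B)"
    using B.cstar_span_embeds[of V P] V by auto
  define A where "A = cstar_transport \<phi> ?B"
  define \<psi> where "\<psi> = the_inv_into (carrier ?B) \<phi>"
  note t = B'.transport[OF \<phi>, folded A_def \<psi>_def]
  define V' where "V' p = \<phi> (V p)" for p
  have "covariant_rep G P A V'"
    unfolding V'_def by (rule covariant_rep_star_hom[OF q _ t(1) t(2) cV']) (rule B'.unital_cstar_algebra_axioms)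
  then have i: "(A, V') \<in> covariant_reps G P" using t(1) by (simp add: covariant_reps_def)
  let ?U = "universal_cstar G P" and ?Pr = "cstar_prod (covariant_reps G P) fst"
  have u: "x \<in> carrier ?Pr" if "x \<in> carrier ?U" for x
  proof (rule unital_cstar_algebra.cstar_span_in_carrier[OF unital_cstar_algebra_covariant_reps])
    show "x \<in> cstar_span ?Pr (universal_rep G P ` P)" using that by (simp add: universal_cstar_def)
    show "universal_rep G P ` P \<subseteq> carrier ?Pr" by (rule image_subsetI) (rule universal_rep_in)
  qed
  have evA: "x (A, V') \<in> carrier A" if "x \<in> carrier ?U" for x
  proof -
    have "x \<in> (\<Pi>\<^sub>E i\<in>covariant_reps G P. carrier (fst i))"
      using u[OF that] by (simp add: cstar_prod_simps(1))
    from PiE_mem[OF this i] show ?thesis by simp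
  qed
  have ev: "(f \<otimes>\<^bsub>?U\<^esub> g) (A, V') = f (A, V') \<otimes>\<^bsub>A\<^esub> g (A, V')"
    "(f \<oplus>\<^bsub>?U\<^esub> g) (A, V') = f (A, V') \<oplus>\<^bsub>A\<^esub> g (A, V')"
    "\<one>\<^bsub>?U\<^esub> (A, V') = \<one>\<^bsub>A\<^esub>" "(c \<odot>\<^bsub>?U\<^esub> f) (A, V') = c \<odot>\<^bsub>A\<^esub> f (A, V')"
    "adj ?U f (A, V') = adj A (f (A, V'))" for f g c
    using i by (simp_all add: universal_cstar_def cstar_prod_simps(2-7))
  have spB: "x \<in> carrier B" if "x \<in> cstar_span B (V ` P)" for x
    by (rule B.cstar_span_in_carrier[OF that]) (use V in blast)
  note t3 = t(3)[unfolded star_hom_def ring_hom_def mem_Collect_eq cstar_generated_simps]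
  have \<psi>: "\<psi> \<one>\<^bsub>A\<^esub> = \<one>\<^bsub>B\<^esub>"
    "x \<in> carrier A \<Longrightarrow> \<psi> x \<in> carrier B"
    "x \<in> carrier A \<Longrightarrow> y \<in> carrier A \<Longrightarrow> \<psi> (x \<otimes>\<^bsub>A\<^esub> y) = \<psi> x \<otimes>\<^bsub>B\<^esub> \<psi> y"
    "x \<in> carrier A \<Longrightarrow> y \<in> carrier A \<Longrightarrow> \<psi> (x \<oplus>\<^bsub>A\<^esub> y) = \<psi> x \<oplus>\<^bsub>B\<^esub> \<psi> y"
    "x \<in> carrier A \<Longrightarrow> \<psi> (c \<odot>\<^bsub>A\<^esub> x) = c \<odot>\<^bsub>B\<^esub> \<psi> x"
    "x \<in> carrier A \<Longrightarrow> \<psi> (adj A x) = adj B (\<psi> x)" for x y c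
    using t3 spB by blast+
  have "(\<lambda>f. \<psi> (f (A, V'))) \<in> star_hom (universal_cstar G P) B"
    unfolding star_hom_def ring_hom_def mem_Collect_eq
    by (intro conjI allI impI ballI Pi_I) (simp_all only: ev \<psi> evA)
  moreover have "\<psi> (universal_rep G P p (A, V')) = W p" if "p \<in> P" for p
  proof -
    have "V p \<in> cstar_span B (V ` P)" using that by (auto intro: cstar_span.base)
    then have "\<psi> (\<phi> (V p)) = V p" using \<phi> unfolding \<psi>_def by (intro the_inv_into_f_f) simp_all
    moreover have "universal_rep G P p (A, V') = V' p" using i by (simp add: universal_rep_def)
    ultimately show ?thesis using that by (simp only: V'_def) (simp add: V_def)
  qed
  ultimately show ?thesis by (intro bexI[of _ "\<lambda>f. \<psi> (f (A, V'))"]) auto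
qed

lemma toeplitz_basis:
  fixes G (structure)
  assumes q: "quasi_lattice_ordered G P" and p: "p \<in> P" "x \<in> P"
  shows "toeplitz G P p (\<lambda>y. if y = x then 1 else 0) = (\<lambda>y. if y = p \<otimes>\<^bsub>G\<^esub> x then 1 else 0)"
proof -
  interpret group G using q by (simp add: quasi_lattice_ordered_def)
  have [simp]: "p \<in> carrier G" "x \<in> carrier G" "p \<otimes> x \<in> P"
    using p qlo_carrier[OF q] qlo_mult[OF q] by auto
  have "(\<lambda>y. if y = x then 1 else 0) \<in> ell2 P"
  proof -
    have "(\<lambda>y. (cmod (if y = x then 1 else 0))\<^sup>2) summable_on P"
      by (rule finite_nonzero_values_imp_summable_on, rule finite_subset[of _ "{x}"]) (auto split: if_splits)
    then show ?thesis using p by (auto simp: ell2_def)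
  qed
  moreover have "inv p \<otimes> (p \<otimes> x) = x" by (simp add: m_assoc[symmetric])
  moreover have "y = p \<otimes> x" if "y \<in> P" "inv p \<otimes> y = x" for y
    using that qlo_carrier[OF q] by (metis \<open>p \<in> carrier G\<close> inv_closed inv_inv l_inv m_assoc l_one inv_solve_left)
  ultimately show ?thesis using p by (auto simp: toeplitz_def le_of_def)
qed

end

theory Submission
  imports Defs
begin

text \<open>Write $w_p$ for the generators of $C^*(G,P)$ and $\pi_T$ for the Toeplitz homomorphism. It is enough to
  prove $\|a\| \le \|\pi_T(a)\|$ for finite sums $a$ of monomials $w_p w_q^*$; such an $a$ is a sum of
  components $a_k$, where $w_p w_q^*$ has degree $k = \mu(p)\mu(q)^{-1} \in K$.

  At a single level $\mu(p) = \mu(q) = l$ the isometries $w_\sigma$, $\sigma \in \Sigma_l$, have orthogonal ranges,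
  so that the monomials span matrices over the image of $C^*(\mu^{-1}(e), \mu^{-1}(e) \cap P)$, and amenability of
  the kernel bounds the entries by their Toeplitz norms. Splitting off maximal levels one after the other gives
  $\|a\| \le C \|\pi_T(a)\|$ for $a$ of degree $e$ over a finite $\vee$-closed set of levels, with $C$ depending
  only on that set. Applied to $(a^* a)^{2^n}$, this yields $C = 1$; the $C^*$-identity then covers every degree.

  For general $a$, amenability of $K$ provides almost invariant unit vectors $\xi \in \ell^2(K)$ of finite support
  (Reiter), for which $y = \sum_{s,t} \xi(s) \xi(t) a_{s t^{-1}}$ is close to $a$. Iterating
  $Y \mapsto Y^* Y$ on the matrix $(a_{s t^{-1}})$, whose entries are homogeneous, the Cauchy-Schwarz inequality
  $\|\sum_u \xi_u v_u\|^2 \le \|\sum_u v_u^* v_u\|$ gives $\|y\| \le \|\pi_T(a)\|$.\<close>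


section \<open>Square roots and positivity\<close>

text \<open>The argument is quantitative: every step is a norm inequality between a finite span and
  its image, and completions enter only at the end. The image is taken among all bounded operators
  on \<open>ell2 P\<close>, because the estimates cut \<open>\<pi> x\<close> by the projections onto
  the levels of \<mu>. For homogeneous x, bounds on the single columns
  \<open>\<pi> x \<otimes> pr j\<close> suffice: \<open>adj A x \<otimes> x\<close> has degree e,
  and such elements commute with those projections.

  Matrix algebras over A are avoided, both at a fixed level and over K. A crude bound by the number
  of entries takes their place. Passing from Y to Y* Y squares the norm and the bound alike, so a
  fixed constant disappears after taking roots of order \<open>2 ^ n\<close>. The constant must
  therefore be the same for all powers, which is why sets of levels are closed under joins.

  Order theory rests on unitaries x + iy instead of spectra. Its two uses are that injective
  homomorphisms are isometric, which turns amenability of the kernel into a norm equality, and that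
  elements x* x are positive, which gives the Cauchy-Schwarz inequality.\<close>

context unital_cstar_algebra
begin

section \<open>Norm limits of sequences\<close>

definition conv :: "(nat \<Rightarrow> 'a) \<Rightarrow> 'a \<Rightarrow> bool" where
  "conv s x \<longleftrightarrow> (\<forall>n. s n \<in> carrier A) \<and> x \<in> carrier A \<and> (\<lambda>n. cnorm A (s n \<ominus> x)) \<longlonglongrightarrow> 0"

lemma convD: "conv s x \<Longrightarrow> s n \<in> carrier A" "conv s x \<Longrightarrow> x \<in> carrier A"
  by (auto simp: conv_def)

lemma conv_unique: "conv s x \<Longrightarrow> conv s y \<Longrightarrow> x = y"
  unfolding conv_def by (rule limit_unique[of s]) auto

lemma conv_const: "x \<in> carrier A \<Longrightarrow> conv (\<lambda>_. x) x"
  by (simp add: conv_def)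

lemma conv_bound:
  assumes "\<And>n. s n \<in> carrier A" "x \<in> carrier A" "\<And>n. cnorm A (s n \<ominus> x) \<le> f n" "f \<longlonglongrightarrow> 0"
  shows "conv s x"
  unfolding conv_def
  by (intro conjI allI tendsto_sandwich[OF _ _ tendsto_const assms(4)]) (use assms in auto)

lemma minusI: "\<lbrakk>x = y \<oplus> z; y \<in> carrier A; z \<in> carrier A\<rbrakk> \<Longrightarrow> x \<ominus> z = y"
  by (simp add: a_minus_def M.a_assoc M.r_neg)

lemma minus_add_cancel: "\<lbrakk>x \<in> carrier A; y \<in> carrier A\<rbrakk> \<Longrightarrow> (x \<ominus> y) \<oplus> y = x"
  by (simp add: a_minus_def M.a_assoc M.l_neg)

lemma conv_add:
  assumes "conv s x" "conv t y" shows "conv (\<lambda>n. s n \<oplus> t n) (x \<oplus> y)"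
proof (rule conv_bound)
  show "(\<lambda>n. cnorm A (s n \<ominus> x) + cnorm A (t n \<ominus> y)) \<longlonglongrightarrow> 0"
    using assms by (auto simp: conv_def intro: tendsto_eq_intros)
  show "cnorm A (s n \<oplus> t n \<ominus> (x \<oplus> y)) \<le> cnorm A (s n \<ominus> x) + cnorm A (t n \<ominus> y)" for n
    using cnorm_triangle[of "s n \<ominus> x" "t n \<ominus> y"] convD[OF assms(1)] convD[OF assms(2)]
    by (simp add: diff_add)
qed (use convD[OF assms(1)] convD[OF assms(2)] in auto)

lemma conv_smult:
  assumes "conv s x" shows "conv (\<lambda>n. c \<odot> s n) (c \<odot> x)"
proof (rule conv_bound)
  show "(\<lambda>n. cmod c * cnorm A (s n \<ominus> x)) \<longlonglongrightarrow> 0"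
    using assms by (auto simp: conv_def intro: tendsto_eq_intros)
  have "c \<odot> s n \<ominus> c \<odot> x = c \<odot> (s n \<ominus> x)" for n
    using convD[OF assms] by (simp add: minus_eq_smult laws mult.commute)
  then show "cnorm A (c \<odot> s n \<ominus> c \<odot> x) \<le> cmod c * cnorm A (s n \<ominus> x)" for n
    using convD[OF assms] by (simp add: cnorm_smult)
qed (use convD[OF assms] in auto)

lemma adj_zero_eq: "adj A \<zero> = \<zero>"
  using adj_smult[of \<zero> 0] by (simp add: adj_closed)

lemma conv_adj:
  assumes "conv s x" shows "conv (\<lambda>n. adj A (s n)) (adj A x)"
proof -
  have "adj A (s n) \<ominus> adj A x = adj A (s n \<ominus> x)" for n
    using convD[OF assms] by (simp add: minus_eq_smult laws)
  then show ?thesis using assms by (simp add: conv_def cnorm_adj adj_closed)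
qed

lemma conv_mult:
  assumes "conv s x" "conv t y" shows "conv (\<lambda>n. s n \<otimes> t n) (x \<otimes> y)"
proof (rule conv_bound)
  let ?a = "\<lambda>n. cnorm A (s n \<ominus> x)" and ?b = "\<lambda>n. cnorm A (t n \<ominus> y)"
  show "(\<lambda>n. ?a n * ?b n + ?a n * cnorm A y + cnorm A x * ?b n) \<longlonglongrightarrow> 0"
    using assms by (auto simp: conv_def intro!: tendsto_eq_intros)
  fix n
  note c = convD[OF assms(1)] convD[OF assms(2)]
  define a b where "a = s n \<ominus> x" and "b = t n \<ominus> y"
  have ab: "a \<in> carrier A" "b \<in> carrier A" using c by (simp_all add: a_def b_def)
  have "s n = a \<oplus> x" "t n = b \<oplus> y" using c by (simp_all add: a_def b_def minus_add_cancel)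
  then have "s n \<otimes> t n = (a \<otimes> b \<oplus> a \<otimes> y \<oplus> x \<otimes> b) \<oplus> x \<otimes> y"
    using ab c by (simp add: laws)
  then have "s n \<otimes> t n \<ominus> x \<otimes> y = a \<otimes> b \<oplus> a \<otimes> y \<oplus> x \<otimes> b"
    using ab c by (intro minusI) auto
  also have "cnorm A \<dots> \<le> cnorm A a * cnorm A b + cnorm A a * cnorm A y + cnorm A x * cnorm A b"
    using ab c cnorm_triangle[of "a \<otimes> b \<oplus> a \<otimes> y" "x \<otimes> b"] cnorm_triangle[of "a \<otimes> b" "a \<otimes> y"]
      cnorm_mult[of a b] cnorm_mult[of a y] cnorm_mult[of x b] by simp
  finally show "cnorm A (s n \<otimes> t n \<ominus> x \<otimes> y) \<le> ?a n * ?b n + ?a n * cnorm A y + cnorm A x * ?b n"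
    by (simp add: a_def b_def)
qed (use convD[OF assms(1)] convD[OF assms(2)] in auto)

lemma conv_norm:
  assumes "conv s x" shows "(\<lambda>n. cnorm A (s n)) \<longlonglongrightarrow> cnorm A x"
proof -
  have le: "\<bar>cnorm A (s n) - cnorm A x\<bar> \<le> cnorm A (s n \<ominus> x)" for n
  proof -
    note c = convD[OF assms]
    have "cnorm A (s n) \<le> cnorm A (s n \<ominus> x) + cnorm A x"
      using cnorm_triangle[of "s n \<ominus> x" x] c by (simp add: minus_add_cancel)
    moreover have "cnorm A x \<le> cnorm A (x \<ominus> s n) + cnorm A (s n)"
      using cnorm_triangle[of "x \<ominus> s n" "s n"] c by (simp add: minus_add_cancel)
    moreover have "cnorm A (x \<ominus> s n) = cnorm A (s n \<ominus> x)" using c by (intro cnorm_diff_commute)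
    ultimately show ?thesis by linarith
  qed
  have "(\<lambda>n. cnorm A (s n) - cnorm A x) \<longlonglongrightarrow> 0"
  proof (rule Lim_null_comparison[rotated])
    show "(\<lambda>n. cnorm A (s n \<ominus> x)) \<longlonglongrightarrow> 0" using assms by (simp add: conv_def)
  qed (simp add: le)
  then show ?thesis by (simp only: LIM_zero_iff)
qed

lemma conv_norm_le: "conv s x \<Longrightarrow> (\<And>n. cnorm A (s n) \<le> b) \<Longrightarrow> cnorm A x \<le> b"
  by (rule LIMSEQ_le_const2[OF conv_norm]) auto

lemma conv_Suc: "conv s x \<Longrightarrow> conv (\<lambda>n. s (Suc n)) x"
  by (auto simp: conv_def intro: LIMSEQ_Suc)

end

section \<open>Square roots by a dominated iteration\<close>

fun sqrt_maj :: "nat \<Rightarrow> real" where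
  "sqrt_maj 0 = 0"
| "sqrt_maj (Suc n) = (1 + (sqrt_maj n)\<^sup>2) / 2"

lemma sqrt_maj_bounds: "0 \<le> sqrt_maj n \<and> sqrt_maj n \<le> 1"
  by (induction n) (auto simp: power_le_one add_nonneg_nonneg)

lemma sqrt_maj_mono: "incseq sqrt_maj"
proof (rule incseq_SucI)
  fix n show "sqrt_maj n \<le> sqrt_maj (Suc n)"
    using zero_le_power2[of "1 - sqrt_maj n"] by (simp add: power2_eq_square algebra_simps)
qed

text \<open>A bounded increasing sequence. Differences of \<open>sqrt_iter\<close> will be bounded
  by differences of \<open>sqrt_maj\<close>, so the Cauchy property carries over and the real limit
  is never computed.\<close>

lemma sqrt_maj_Cauchy: "Cauchy sqrt_maj"
proof -
  have "convergent sqrt_maj"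
    using sqrt_maj_bounds incseqD[OF sqrt_maj_mono]
    by (intro Bseq_mono_convergent BseqI'[of _ 1]) auto
  then show ?thesis by (auto simp: convergent_def intro: LIMSEQ_imp_Cauchy)
qed

context unital_cstar_algebra
begin

text \<open>The iteration $y \mapsto (c + y^2)/2$ starting from $0$ has nonnegative coefficients, so for
  $\|c\| \le 1$ it is dominated by the same iteration for $c = 1$ in the reals; its limit is
  $1 - \sqrt{1 - c}$.\<close>

fun sqrt_iter :: "'a \<Rightarrow> nat \<Rightarrow> 'a" where
  "sqrt_iter c 0 = \<zero>"
| "sqrt_iter c (Suc n) = (1/2) \<odot> (c \<oplus> sqrt_iter c n \<otimes> sqrt_iter c n)"

text \<open>One factorization controls the iteration twice: applied to consecutive iterates it gives
  convergence, and applied to an iterate and a fixed point it gives uniqueness.\<close>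

lemma half_square_diff:
  assumes "c \<in> carrier A" "a \<in> carrier A" "b \<in> carrier A" "a \<otimes> b = b \<otimes> a"
  shows "(1/2) \<odot> (c \<oplus> a \<otimes> a) \<ominus> (1/2) \<odot> (c \<oplus> b \<otimes> b) = (1/2) \<odot> ((a \<ominus> b) \<otimes> (a \<oplus> b))"
proof -
  define d where "d = a \<ominus> b"
  have d: "d \<in> carrier A" using assms by (simp add: d_def)
  have ad: "a = d \<oplus> b" using assms by (simp add: d_def minus_add_cancel)
  have "d \<otimes> b \<oplus> b \<otimes> b = b \<otimes> d \<oplus> b \<otimes> b"
    using assms(3,4) d unfolding ad by (simp add: laws)
  then have db: "d \<otimes> b = b \<otimes> d" using assms d by simp
  have "(1/2) \<odot> (c \<oplus> a \<otimes> a) = (1/2) \<odot> (d \<otimes> (a \<oplus> b)) \<oplus> (1/2) \<odot> (c \<oplus> b \<otimes> b)"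
    using assms(1,3) d unfolding ad by (simp add: laws db M.a_ac)
  then show ?thesis unfolding d_def[symmetric] using assms d by (intro minusI) auto
qed

context fixes c assumes c: "c \<in> carrier A"
begin

lemma sqrt_iter_in [simp]: "sqrt_iter c n \<in> carrier A"
  by (induction n) (auto simp: c)

lemma sqrt_iter_adj: "adj A c = c \<Longrightarrow> adj A (sqrt_iter c n) = sqrt_iter c n"
  by (induction n) (auto simp: laws c adj_zero_eq)

lemma sqrt_iter_comm:
  assumes x: "x \<in> carrier A" "x \<otimes> c = c \<otimes> x"
  shows "x \<otimes> sqrt_iter c n = sqrt_iter c n \<otimes> x"
proof (induction n)
  case (Suc n)
  have "x \<otimes> (sqrt_iter c n \<otimes> sqrt_iter c n) = (sqrt_iter c n \<otimes> sqrt_iter c n) \<otimes> x"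
    using x by (metis Suc A.m_assoc sqrt_iter_in)
  then show ?case using x c by (simp add: laws)
qed (use x in auto)

lemma sqrt_iter_norm:
  assumes n: "cnorm A c \<le> 1"
  shows "cnorm A (sqrt_iter c m) \<le> sqrt_maj m"
proof (induction m)
  case (Suc m)
  have "cnorm A (sqrt_iter c m \<otimes> sqrt_iter c m) \<le> sqrt_maj m * sqrt_maj m"
    using cnorm_mult[of "sqrt_iter c m" "sqrt_iter c m"] Suc
    by (meson cnorm_nonneg mult_mono order_trans sqrt_iter_in)
  then show ?case using cnorm_triangle[of c "sqrt_iter c m \<otimes> sqrt_iter c m"] n c
    by (simp add: cnorm_smult power2_eq_square)
qed simp

text \<open>By \<open>half_square_diff\<close> the new increment is the old one times the sum of two
  iterates, halved. For \<open>sqrt_maj\<close> the same recursion holds exactly, so domination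
  passes from one increment to the next.\<close>

lemma sqrt_iter_diff:
  assumes n: "cnorm A c \<le> 1"
  shows "cnorm A (sqrt_iter c (Suc m) \<ominus> sqrt_iter c m) \<le> sqrt_maj (Suc m) - sqrt_maj m"
proof (induction m)
  case 0
  show ?case using n c by (simp add: cnorm_smult a_minus_def)
next
  case (Suc m)
  define a b where "a = sqrt_iter c (Suc m)" and "b = sqrt_iter c m"
  define d where "d = a \<ominus> b"
  have ab: "a \<in> carrier A" "b \<in> carrier A" "d \<in> carrier A"
    using sqrt_iter_in by (auto simp: a_def b_def d_def simp del: sqrt_iter.simps)
  have comm: "a \<otimes> b = b \<otimes> a" unfolding a_def b_def
    using c by (intro sqrt_iter_comm) (auto intro: sqrt_iter_comm[symmetric] simp del: sqrt_iter.simps)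
  have "(1/2) \<odot> (c \<oplus> a \<otimes> a) \<ominus> (1/2) \<odot> (c \<oplus> b \<otimes> b) = (1/2) \<odot> (d \<otimes> (a \<oplus> b))"
    using half_square_diff[OF c ab(1,2) comm] by (simp only: d_def)
  then have "cnorm A (sqrt_iter c (Suc (Suc m)) \<ominus> sqrt_iter c (Suc m)) = (1/2) * cnorm A (d \<otimes> (a \<oplus> b))"
    using ab by (simp add: a_def b_def cnorm_smult)
  also have "\<dots> \<le> (1/2) * ((sqrt_maj (Suc m) - sqrt_maj m) * (sqrt_maj (Suc m) + sqrt_maj m))"
  proof -
    have "cnorm A d \<le> sqrt_maj (Suc m) - sqrt_maj m" using Suc by (simp add: d_def a_def b_def)
    moreover have "cnorm A (a \<oplus> b) \<le> sqrt_maj (Suc m) + sqrt_maj m"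
      using cnorm_triangle[OF ab(1,2)] sqrt_iter_norm[OF n, of m] sqrt_iter_norm[OF n, of "Suc m"]
      unfolding a_def b_def by linarith
    ultimately have "cnorm A d * cnorm A (a \<oplus> b) \<le> (sqrt_maj (Suc m) - sqrt_maj m) * (sqrt_maj (Suc m) + sqrt_maj m)"
      using ab incseq_SucD[OF sqrt_maj_mono, of m] by (intro mult_mono) auto
    then show ?thesis using cnorm_mult[of d "a \<oplus> b"] ab by simp
  qed
  also have "\<dots> = sqrt_maj (Suc (Suc m)) - sqrt_maj (Suc m)"
    unfolding sqrt_maj.simps(2)[of "Suc m"] by (subst (2) sqrt_maj.simps(2)) (simp del: sqrt_maj.simps add: power2_eq_square field_simps)
  finally show ?case .
qed

lemma sqrt_iter_diff_le:
  assumes n: "cnorm A c \<le> 1"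
  shows "cnorm A (sqrt_iter c (m + k) \<ominus> sqrt_iter c m) \<le> sqrt_maj (m + k) - sqrt_maj m"
proof (induction k)
  case (Suc k)
  have "cnorm A (sqrt_iter c (m + Suc k) \<ominus> sqrt_iter c m) \<le>
      cnorm A (sqrt_iter c (Suc (m + k)) \<ominus> sqrt_iter c (m + k)) + cnorm A (sqrt_iter c (m + k) \<ominus> sqrt_iter c m)"
    unfolding add_Suc_right by (intro cnorm_diff_triangle sqrt_iter_in)
  then show ?case using sqrt_iter_diff[OF n, of "m + k"] Suc by simp
qed simp

text \<open>A total choice; it denotes a limit only when \<open>cnorm A c \<le> 1\<close>.\<close>

definition sqrt_lim :: 'a where "sqrt_lim = (SOME y. conv (sqrt_iter c) y)"

lemma sqrt_lim_conv:
  assumes n: "cnorm A c \<le> 1"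
  shows "conv (sqrt_iter c) sqrt_lim"
proof -
  have "\<exists>y\<in>carrier A. (\<lambda>k. cnorm A (sqrt_iter c k \<ominus> y)) \<longlonglongrightarrow> 0"
  proof (rule complete[OF sqrt_iter_in])
    fix e :: real assume "e > 0"
    then obtain N where N: "\<And>p q. p \<ge> N \<Longrightarrow> q \<ge> N \<Longrightarrow> norm (sqrt_maj p - sqrt_maj q) < e"
      using CauchyD[OF sqrt_maj_Cauchy] by blast
    have "cnorm A (sqrt_iter c p \<ominus> sqrt_iter c q) < e" if "p \<ge> q" "q \<ge> N" for p q
      using sqrt_iter_diff_le[OF n, of q "p - q"] N[of p q] that by auto
    moreover have "cnorm A (sqrt_iter c p \<ominus> sqrt_iter c q) = cnorm A (sqrt_iter c q \<ominus> sqrt_iter c p)" for p q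
      by (intro cnorm_diff_commute sqrt_iter_in)
    ultimately have "cnorm A (sqrt_iter c p \<ominus> sqrt_iter c q) < e" if "p \<ge> N" "q \<ge> N" for p q
      using that by (metis nat_le_linear)
    then show "\<exists>N. \<forall>p\<ge>N. \<forall>q\<ge>N. cnorm A (sqrt_iter c p \<ominus> sqrt_iter c q) < e" by blast
  qed
  then have "\<exists>y. conv (sqrt_iter c) y" by (auto simp: conv_def)
  then show ?thesis unfolding sqrt_lim_def by (rule someI_ex)
qed

lemma sqrt_lim_eq:
  assumes n: "cnorm A c \<le> 1"
  shows "sqrt_lim = (1/2) \<odot> (c \<oplus> sqrt_lim \<otimes> sqrt_lim)"
  using conv_Suc[OF sqrt_lim_conv[OF n]]
    conv_smult[OF conv_add[OF conv_const[OF c] conv_mult[OF sqrt_lim_conv[OF n] sqrt_lim_conv[OF n]]], of "1/2"]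
  by (auto intro: conv_unique)

lemma sqrt_lim_norm: "cnorm A c \<le> 1 \<Longrightarrow> cnorm A sqrt_lim \<le> 1"
  by (rule conv_norm_le[OF sqrt_lim_conv]) (use sqrt_iter_norm sqrt_maj_bounds in \<open>auto intro: order_trans\<close>)

lemma sqrt_lim_adj: "cnorm A c \<le> 1 \<Longrightarrow> adj A c = c \<Longrightarrow> adj A sqrt_lim = sqrt_lim"
  using conv_adj[OF sqrt_lim_conv] sqrt_lim_conv by (auto simp: sqrt_iter_adj intro: conv_unique)

lemma sqrt_lim_comm:
  assumes "cnorm A c \<le> 1" "x \<in> carrier A" "x \<otimes> c = c \<otimes> x"
  shows "x \<otimes> sqrt_lim = sqrt_lim \<otimes> x"
  using conv_mult[OF conv_const sqrt_lim_conv, of x] conv_mult[OF sqrt_lim_conv conv_const, of x] assms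
  by (auto simp: sqrt_iter_comm intro: conv_unique)

end

end

section \<open>Self-adjoint and positive elements\<close>

context unital_cstar_algebra
begin

definition sa :: "'a \<Rightarrow> bool" where
  "sa x \<longleftrightarrow> x \<in> carrier A \<and> adj A x = x"

lemma saD: "sa x \<Longrightarrow> x \<in> carrier A" "sa x \<Longrightarrow> adj A x = x"
  by (auto simp: sa_def)

lemma smult_cancel: "\<lbrakk>a + b = 0; x \<in> carrier A\<rbrakk> \<Longrightarrow> a \<odot> x \<oplus> b \<odot> x = \<zero>"
  by (simp flip: smult_add_left)

lemma smult_cancel2: "\<lbrakk>a + b = 0; x \<in> carrier A; z \<in> carrier A\<rbrakk> \<Longrightarrow> a \<odot> x \<oplus> (b \<odot> x \<oplus> z) = z"
  by (simp add: smult_cancel flip: M.a_assoc)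

lemma minus_minus_cancel: "\<lbrakk>x \<in> carrier A; y \<in> carrier A\<rbrakk> \<Longrightarrow> x \<ominus> (x \<ominus> y) = y"
  by (intro minusI) (simp_all add: M.a_comm[of y] minus_add_cancel)

lemma minus_add_minus: "\<lbrakk>x \<in> carrier A; y \<in> carrier A; z \<in> carrier A\<rbrakk> \<Longrightarrow> (x \<ominus> y) \<oplus> (y \<ominus> z) = x \<ominus> z"
  by (simp add: a_minus_def M.a_assoc M.r_neg1)

lemma cnorm_le_0: "\<lbrakk>cnorm A x \<le> 0; x \<in> carrier A\<rbrakk> \<Longrightarrow> x = \<zero>"
  using cnorm_nonneg[of x] cnorm_eq_0[of x] by linarith

lemma two_smult: "x \<in> carrier A \<Longrightarrow> 2 \<odot> x = x \<oplus> x"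
  using smult_add_left[of x 1 1] by simp

lemma smult_zero_right [simp]: "c \<odot> \<zero> = \<zero>"
  using smult_smult[of \<zero> c 0] by simp

abbreviation scl :: "real \<Rightarrow> 'a" where "scl r \<equiv> complex_of_real r \<odot> \<one>"

lemma cnorm_one_le: "cnorm A \<one> \<le> 1"
  by (rule cnorm_isometry_le) (auto simp: adj_one)

lemma cnorm_scl_le: "0 \<le> r \<Longrightarrow> cnorm A (scl r) \<le> r"
  using cnorm_one_le mult_left_mono[of "cnorm A \<one>" 1 r] by (simp add: cnorm_smult)

lemma sa_scl [simp]: "sa (scl r)" by (simp add: sa_def laws adj_one)
lemma sa_one [simp]: "sa \<one>" by (simp add: sa_def adj_one)
lemma sa_zero [simp]: "sa \<zero>" by (simp add: sa_def adj_zero_eq)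
lemma sa_add [simp]: "sa x \<Longrightarrow> sa y \<Longrightarrow> sa (x \<oplus> y)" by (simp add: sa_def laws)
lemma sa_rsmult: "sa x \<Longrightarrow> sa (complex_of_real r \<odot> x)" by (simp add: sa_def laws)
lemma sa_minus [simp]: "sa x \<Longrightarrow> sa y \<Longrightarrow> sa (x \<ominus> y)" by (simp add: sa_def laws minus_eq_smult)
lemma sa_mult: "sa x \<Longrightarrow> sa y \<Longrightarrow> x \<otimes> y = y \<otimes> x \<Longrightarrow> sa (x \<otimes> y)" by (simp add: sa_def laws)
lemma sa_square: "sa x \<Longrightarrow> sa (x \<otimes> x)" by (simp add: sa_def laws)
lemma sa_adj_mult: "x \<in> carrier A \<Longrightarrow> sa (adj A x \<otimes> x)" by (simp add: sa_def laws)

lemma cnorm_sa_square: "sa x \<Longrightarrow> cnorm A (x \<otimes> x) = (cnorm A x)\<^sup>2"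
  using cstar_identity[of x] by (simp add: sa_def)

text \<open>$x + iy$ is unitary.\<close>

lemma cnorm_le_one_of_squares:
  assumes "sa x" "sa y" "x \<otimes> y = y \<otimes> x" "x \<otimes> x \<oplus> y \<otimes> y = \<one>"
  shows "cnorm A x \<le> 1"
proof -
  note c = saD[OF assms(1)] saD[OF assms(2)]
  define u where "u = x \<oplus> \<i> \<odot> y"
  have u: "u \<in> carrier A" using c by (simp add: u_def)
  have ua: "adj A u = x \<oplus> (- \<i>) \<odot> y" using c by (simp add: u_def laws)
  have "adj A u \<otimes> u = x \<otimes> x \<oplus> y \<otimes> y \<oplus> (\<i> \<odot> (y \<otimes> x) \<oplus> (- \<i>) \<odot> (y \<otimes> x))"
    unfolding ua using c by (simp add: u_def laws assms(3) M.a_ac)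
  also have "\<dots> = \<one>" using c assms(4) by (simp add: smult_cancel)
  finally have "cnorm A u \<le> 1" using u by (intro cnorm_isometry_le)
  moreover have "x = (1/2) \<odot> (u \<oplus> adj A u)"
  proof -
    have "u \<oplus> adj A u = x \<oplus> x \<oplus> (\<i> \<odot> y \<oplus> (- \<i>) \<odot> y)"
      unfolding ua using c by (simp add: u_def laws M.a_ac)
    also have "\<dots> = 2 \<odot> x" using c by (subst smult_cancel) (auto simp: two_smult)
    finally show ?thesis using c by (simp add: smult_smult)
  qed
  ultimately show ?thesis
    using cnorm_triangle[of u "adj A u"] u cnorm_smult[of "u \<oplus> adj A u" "1/2"] cnorm_adj[of u] adj_closed[of u]
    by (simp add: norm_divide)
qed

text \<open>Positivity without a spectrum: for self-adjoint a, the inequality places the spectrum of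
  a in [0, 2s]. In this form sums and nonnegative multiples are immediate, while squares and
  elements x* x need proof.\<close>

definition Pos :: "'a \<Rightarrow> bool" where
  "Pos a \<longleftrightarrow> sa a \<and> (\<exists>s\<ge>0. cnorm A (scl s \<ominus> a) \<le> s)"

lemma Pos_sa [simp]: "Pos a \<Longrightarrow> sa a" by (simp add: Pos_def)
lemma Pos_in: "Pos a \<Longrightarrow> a \<in> carrier A" by (simp add: Pos_def sa_def)

lemma PosI: "sa a \<Longrightarrow> 0 \<le> s \<Longrightarrow> cnorm A (scl s \<ominus> a) \<le> s \<Longrightarrow> Pos a"
  by (auto simp: Pos_def)

lemma Pos_add: assumes "Pos a" "Pos b" shows "Pos (a \<oplus> b)"
proof -
  obtain s t where st: "0 \<le> s" "cnorm A (scl s \<ominus> a) \<le> s" "0 \<le> t" "cnorm A (scl t \<ominus> b) \<le> t"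
    using assms by (auto simp: Pos_def)
  have ab: "a \<in> carrier A" "b \<in> carrier A" using assms by (auto intro: Pos_in)
  have "scl (s + t) \<ominus> (a \<oplus> b) = (scl s \<ominus> a) \<oplus> (scl t \<ominus> b)"
    using ab by (simp add: laws minus_eq_smult M.a_ac)
  then have "cnorm A (scl (s + t) \<ominus> (a \<oplus> b)) \<le> s + t"
    using cnorm_triangle[of "scl s \<ominus> a" "scl t \<ominus> b"] ab st by simp
  then show ?thesis using assms st by (intro PosI[of _ "s + t"]) auto
qed

lemma Pos_smult: assumes "Pos a" "0 \<le> r" shows "Pos (complex_of_real r \<odot> a)"
proof -
  obtain s where s: "0 \<le> s" "cnorm A (scl s \<ominus> a) \<le> s" using assms by (auto simp: Pos_def)
  have a: "a \<in> carrier A" using assms by (auto intro: Pos_in)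
  have "scl (r * s) \<ominus> complex_of_real r \<odot> a = complex_of_real r \<odot> (scl s \<ominus> a)"
    using a by (simp add: laws minus_eq_smult mult.commute)
  then have "cnorm A (scl (r * s) \<ominus> complex_of_real r \<odot> a) \<le> r * s"
    using a s assms by (simp add: cnorm_smult mult_left_mono)
  then show ?thesis using assms s by (intro PosI[of _ "r * s"]) (auto simp: sa_rsmult)
qed

lemma Pos_zero [simp]: "Pos \<zero>" by (rule PosI[of _ 0]) auto

lemma Pos_scl: "0 \<le> r \<Longrightarrow> Pos (scl r)" by (rule PosI[of _ r]) auto

text \<open>The limit y satisfies \<open>2 \<odot> y = c \<oplus> y \<otimes> y\<close>, so z = 1 -
  y has square 1 - 2y + y y = 1 - c.\<close>

lemma sqrt_one_minus:
  assumes c: "sa c" and n: "cnorm A c \<le> 1"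
  defines "z \<equiv> \<one> \<ominus> sqrt_lim c"
  shows "sa z" "z \<otimes> z = \<one> \<ominus> c" "cnorm A (\<one> \<ominus> z) \<le> 1"
    "\<And>x. x \<in> carrier A \<Longrightarrow> x \<otimes> c = c \<otimes> x \<Longrightarrow> x \<otimes> z = z \<otimes> x"
proof -
  define y where "y = sqrt_lim c"
  note cc = saD[OF c]
  have y: "y \<in> carrier A" using convD(2)[OF sqrt_lim_conv[OF cc(1) n]] by (simp add: y_def)
  have ysa: "sa y" using sqrt_lim_adj[OF cc(1) n cc(2)] y by (simp add: sa_def y_def)
  have e: "y = (1/2) \<odot> (c \<oplus> y \<otimes> y)" using sqrt_lim_eq[OF cc(1) n] by (simp add: y_def)
  then have "2 \<odot> y = 2 \<odot> ((1/2) \<odot> (c \<oplus> y \<otimes> y))" by simp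
  then have 2: "2 \<odot> y = c \<oplus> y \<otimes> y" using cc y by (simp add: smult_smult)
  have z: "z = \<one> \<ominus> y" by (simp add: z_def y_def)
  show "sa z" using ysa by (simp add: z)
  have oz: "\<one> \<ominus> z = y" using y by (simp add: z minus_minus_cancel)
  then show "cnorm A (\<one> \<ominus> z) \<le> 1" using sqrt_lim_norm[OF cc(1) n] by (simp add: y_def)
  have "z \<otimes> z \<oplus> 2 \<odot> y = \<one> \<oplus> y \<otimes> y \<oplus> ((-2) \<odot> y \<oplus> 2 \<odot> y)"
    using y smult_add_left[of y "-1" "-1"] by (simp add: z minus_eq_smult laws M.a_ac)
  then have "z \<otimes> z \<oplus> (c \<oplus> y \<otimes> y) = \<one> \<oplus> y \<otimes> y"
    using y by (simp add: smult_cancel 2[symmetric])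
  then have "(z \<otimes> z \<oplus> c) \<oplus> y \<otimes> y = \<one> \<oplus> y \<otimes> y"
    using y cc z by (simp add: M.a_assoc)
  then have "z \<otimes> z \<oplus> c = \<one>"
    using y cc z minusI[of "\<one> \<oplus> y \<otimes> y" "z \<otimes> z \<oplus> c" "y \<otimes> y"] minusI[of "\<one> \<oplus> y \<otimes> y" \<one> "y \<otimes> y"]
    by simp
  then show "z \<otimes> z = \<one> \<ominus> c" using y cc z minusI[of \<one> "z \<otimes> z" c] by simp
  show "x \<otimes> z = z \<otimes> x" if "x \<in> carrier A" "x \<otimes> c = c \<otimes> x" for x
    using sqrt_lim_comm[OF cc(1) n that] that y by (simp add: z y_def[symmetric] minus_eq_smult laws)
qed

text \<open>Supplies the imaginary part z that makes h + iz unitary, as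
  \<open>cnorm_le_one_of_squares\<close> requires.\<close>

lemma complementary_square:
  assumes h: "sa h" and n: "cnorm A h \<le> 1"
  shows "\<exists>z. sa z \<and> z \<otimes> z = \<one> \<ominus> h \<otimes> h \<and> h \<otimes> z = z \<otimes> h"
proof -
  note hc = saD[OF h]
  have c: "sa (h \<otimes> h)" using h by (rule sa_square)
  have "cnorm A (h \<otimes> h) \<le> 1" using cnorm_sa_square[OF h] n hc by (simp add: power_le_one)
  note z = sqrt_one_minus[OF c this]
  then show ?thesis using z(1,2) z(4)[of h] hc
    by (intro exI[of _ "\<one> \<ominus> sqrt_lim (h \<otimes> h)"]) (simp add: A.m_assoc)
qed

text \<open>The complementary z is itself a contraction, since z + ih is unitary, and 1 - h h = z
  z.\<close>

lemma square_le_one: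
  assumes h: "sa h" and n: "cnorm A h \<le> 1"
  shows "cnorm A (\<one> \<ominus> h \<otimes> h) \<le> 1"
proof -
  note hc = saD[OF h]
  obtain z where zz: "sa z" "z \<otimes> z = \<one> \<ominus> h \<otimes> h" "h \<otimes> z = z \<otimes> h"
    using complementary_square[OF assms] by blast
  have "cnorm A z \<le> 1"
    using h zz hc by (intro cnorm_le_one_of_squares[of z h]) (auto simp: minus_add_cancel)
  then show ?thesis using cnorm_sa_square[OF zz(1)] zz saD[OF zz(1)] by (simp add: power_le_one)
qed

lemma Pos_square:
  assumes h: "sa h" shows "Pos (h \<otimes> h)"
proof (cases "cnorm A h = 0")
  case True
  then show ?thesis using h by (simp add: sa_def cnorm_eq_0)
next
  case False
  define t where "t = cnorm A h"
  have t: "t > 0" using False cnorm_nonneg[of h] saD[OF h] by (simp add: t_def less_le)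
  define k where "k = complex_of_real (1 / t) \<odot> h"
  have k: "sa k" using h unfolding k_def by (rule sa_rsmult)
  have "cnorm A k = 1" using t saD[OF h] by (simp add: k_def cnorm_smult t_def norm_divide)
  then have "Pos (k \<otimes> k)" using square_le_one[OF k] by (intro PosI[of _ 1]) (auto simp: sa_square k saD[OF k])
  then have "Pos (complex_of_real (t * t) \<odot> (k \<otimes> k))" by (rule Pos_smult) simp
  moreover have "complex_of_real (t * t) \<odot> (k \<otimes> k) = h \<otimes> h"
    using t saD[OF h] by (simp add: k_def laws)
  ultimately show ?thesis by simp
qed

text \<open>The bound in \<open>Pos\<close> makes c = 1 - a/s a contraction, so the iteration gives
  a root of 1 - c = a/s, which is rescaled by \<open>sqrt s\<close>. Commutation with whatever
  commutes with a is recorded because all later products of roots rely on it.\<close>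

lemma Pos_sqrt:
  assumes a: "Pos a"
  shows "\<exists>z. Pos z \<and> z \<otimes> z = a \<and> (\<forall>x\<in>carrier A. x \<otimes> a = a \<otimes> x \<longrightarrow> x \<otimes> z = z \<otimes> x)"
proof -
  obtain s where s: "0 \<le> s" "cnorm A (scl s \<ominus> a) \<le> s" using a by (auto simp: Pos_def)
  have ac: "a \<in> carrier A" using a by (rule Pos_in)
  show ?thesis
  proof (cases "s = 0")
    case True
    then have "\<zero> \<ominus> a = \<zero>" using s ac by (intro cnorm_le_0) auto
    then have "a = \<zero>" using ac eq_if_minus_zero[of \<zero> a] by simp
    then show ?thesis by (intro exI[of _ \<zero>]) auto
  next
    case False
    then have s0: "s > 0" using s by simp
    define c where "c = complex_of_real (1 / s) \<odot> (scl s \<ominus> a)"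
    have c: "sa c" unfolding c_def using a by (intro sa_rsmult) auto
    have n: "cnorm A c \<le> 1" using s0 s ac by (simp add: c_def cnorm_smult norm_divide)
    define z where "z = \<one> \<ominus> sqrt_lim c"
    note z = sqrt_one_minus[OF c n, folded z_def]
    have zc: "z \<in> carrier A" using z(1) by (rule saD)
    have "Pos z" using z(1,3) by (intro PosI[of _ 1]) (auto simp: zc)
    then have "Pos (complex_of_real (sqrt s) \<odot> z)" using s by (intro Pos_smult) auto
    moreover have oc: "\<one> \<ominus> c = complex_of_real (1 / s) \<odot> a"
      using s0 ac by (intro minusI) (simp_all add: c_def laws minus_eq_smult smult_cancel smult_cancel2)
    then have "(complex_of_real (sqrt s) \<odot> z) \<otimes> (complex_of_real (sqrt s) \<odot> z) = a"
      using z(2) zc ac s0 by (simp add: laws flip: of_real_mult)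
    moreover have "x \<otimes> (complex_of_real (sqrt s) \<odot> z) = (complex_of_real (sqrt s) \<odot> z) \<otimes> x"
      if "x \<in> carrier A" "x \<otimes> a = a \<otimes> x" for x
    proof -
      have "x \<otimes> c = c \<otimes> x" using that ac by (simp add: c_def minus_eq_smult laws)
      then show ?thesis using z(4)[OF that(1)] that(1) zc by (simp add: laws)
    qed
    ultimately show ?thesis by blast
  qed
qed

text \<open>From -r \<le> a \<le> r to a norm bound: for t > r put x = a/t and let y be the product
  of the roots of t - a and t + a, divided by t. Then x x + y y = 1 and everything commutes, so x is
  the real part of a unitary.\<close>

lemma cnorm_le_of_Pos:
  assumes a: "sa a" and p: "Pos (scl r \<ominus> a)" "Pos (scl r \<oplus> a)" and r: "0 \<le> r"
  shows "cnorm A a \<le> r"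
proof -
  \<comment> \<open>A strictly larger t is positive even when r = 0, so division by t is
    possible.\<close>
  have "cnorm A a \<le> t" if t: "t > r" for t
  proof -
    note ac = saD[OF a]
    have t0: "t > 0" using t r by simp
    have "scl t \<ominus> a = scl (t - r) \<oplus> (scl r \<ominus> a)" "scl t \<oplus> a = scl (t - r) \<oplus> (scl r \<oplus> a)"
      using smult_add_left[of \<one> "of_real (t - r)" "of_real r"] ac
      by (simp_all add: minus_eq_smult flip: M.a_assoc)
    then have m: "Pos (scl t \<ominus> a)" and q: "Pos (scl t \<oplus> a)"
      using Pos_add[OF Pos_scl[of "t - r"]] p t by auto
    obtain u where u: "Pos u" "u \<otimes> u = scl t \<ominus> a"
      "\<And>x. x \<in> carrier A \<Longrightarrow> x \<otimes> (scl t \<ominus> a) = (scl t \<ominus> a) \<otimes> x \<Longrightarrow> x \<otimes> u = u \<otimes> x"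
      using Pos_sqrt[OF m] by metis
    obtain v where v: "Pos v" "v \<otimes> v = scl t \<oplus> a"
      "\<And>x. x \<in> carrier A \<Longrightarrow> x \<otimes> (scl t \<oplus> a) = (scl t \<oplus> a) \<otimes> x \<Longrightarrow> x \<otimes> v = v \<otimes> x"
      using Pos_sqrt[OF q] by metis
    have uc: "u \<in> carrier A" and vc: "v \<in> carrier A" using u v by (auto intro: Pos_in)
    have au: "a \<otimes> u = u \<otimes> a" using ac by (intro u(3)) (simp_all add: minus_eq_smult laws)
    have av: "a \<otimes> v = v \<otimes> a" using ac by (intro v(3)) (simp_all add: laws)
    have uv: "u \<otimes> v = v \<otimes> u" using ac uc by (intro v(3)) (simp_all add: laws au)
    define x y where "x = complex_of_real (1 / t) \<odot> a" and "y = complex_of_real (1 / t) \<odot> (u \<otimes> v)"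
    have "u \<otimes> v \<otimes> (u \<otimes> v) = (u \<otimes> u) \<otimes> (v \<otimes> v)"
      using uc vc uv by (metis A.m_assoc A.m_closed)
    also have "\<dots> = complex_of_real (t * t) \<odot> \<one> \<oplus> (-1) \<odot> (a \<otimes> a)
        \<oplus> (complex_of_real t \<odot> a \<oplus> (- complex_of_real t) \<odot> a)"
      using ac unfolding u v by (simp add: minus_eq_smult laws M.a_ac)
    also have "\<dots> = complex_of_real (t * t) \<odot> \<one> \<oplus> (-1) \<odot> (a \<otimes> a)"
      using ac by (simp add: smult_cancel)
    finally have uvuv: "u \<otimes> v \<otimes> (u \<otimes> v) = complex_of_real (t * t) \<odot> \<one> \<oplus> (-1) \<odot> (a \<otimes> a)" .
    have "x \<otimes> x \<oplus> y \<otimes> y = complex_of_real (1 / (t * t)) \<odot> (a \<otimes> a \<oplus> (u \<otimes> v \<otimes> (u \<otimes> v)))"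
      using ac uc vc by (simp add: x_def y_def laws)
    also have "a \<otimes> a \<oplus> (u \<otimes> v \<otimes> (u \<otimes> v)) = complex_of_real (t * t) \<odot> \<one> \<oplus> (1 \<odot> (a \<otimes> a) \<oplus> (-1) \<odot> (a \<otimes> a))"
      unfolding uvuv using ac by (simp add: M.a_ac)
    also have "\<dots> = complex_of_real (t * t) \<odot> \<one>" using ac by (subst smult_cancel) auto
    finally have sq: "x \<otimes> x \<oplus> y \<otimes> y = \<one>" using t0 by (simp add: smult_smult)
    have "sa x" unfolding x_def by (rule sa_rsmult[OF a])
    moreover have "sa y" unfolding y_def by (rule sa_rsmult[OF sa_mult[OF Pos_sa[OF u(1)] Pos_sa[OF v(1)] uv]])
    moreover have "x \<otimes> y = y \<otimes> x"
    proof -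
      have "a \<otimes> (u \<otimes> v) = (u \<otimes> v) \<otimes> a" using au av ac uc vc by (metis A.m_assoc)
      then show ?thesis using ac uc vc by (simp add: x_def y_def smult_mult_left smult_mult_right)
    qed
    ultimately have "cnorm A x \<le> 1" using sq by (intro cnorm_le_one_of_squares)
    then show ?thesis using t0 ac by (simp add: x_def cnorm_smult norm_divide field_simps)
  qed
  then show ?thesis by (rule dense_ge)
qed

lemma Pos_scl_minus: "sa a \<Longrightarrow> cnorm A a \<le> r \<Longrightarrow> Pos (scl r \<ominus> a)"
proof (rule PosI[of _ r])
  assume a: "sa a" "cnorm A a \<le> r"
  have "scl r \<ominus> (scl r \<ominus> a) = a"
    using saD[OF a(1)] by (simp add: minus_minus_cancel)
  then show "cnorm A (scl r \<ominus> (scl r \<ominus> a)) \<le> r" using a by simp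
  show "0 \<le> r" using order_trans[OF cnorm_nonneg a(2)] saD[OF a(1)] by simp
qed auto

text \<open>With n the norm of b, n - a = (n - b) + (b - a) is a sum of positive elements, so a lies
  between -n and n.\<close>

lemma cnorm_mono:
  assumes a: "Pos a" and b: "Pos (b \<ominus> a)" "sa b"
  shows "cnorm A a \<le> cnorm A b"
proof -
  note c = Pos_in[OF a] saD(1)[OF b(2)]
  have "scl (cnorm A b) \<ominus> a = (scl (cnorm A b) \<ominus> b) \<oplus> (b \<ominus> a)"
    using c by (simp add: minus_add_minus)
  then have "Pos (scl (cnorm A b) \<ominus> a)"
    using Pos_add[OF Pos_scl_minus[OF b(2) order_refl] b(1)] by simp
  moreover have "Pos (scl (cnorm A b) \<oplus> a)" using a c by (intro Pos_add Pos_scl) auto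
  ultimately show ?thesis using a c by (intro cnorm_le_of_Pos) auto
qed

text \<open>The root u of a commutes with x, so the product is the square of the self-adjoint
  element x u.\<close>

lemma Pos_sandwich:
  assumes "Pos a" "sa x" "x \<otimes> a = a \<otimes> x"
  shows "Pos (x \<otimes> a \<otimes> x)"
proof -
  obtain u where u: "Pos u" "u \<otimes> u = a" "x \<otimes> u = u \<otimes> x"
    using Pos_sqrt[OF assms(1)] assms saD by metis
  have "x \<otimes> a \<otimes> x = (x \<otimes> u) \<otimes> (x \<otimes> u)"
    using u Pos_in[OF u(1)] saD[OF assms(2)] by (metis A.m_assoc A.m_closed)
  then show ?thesis using Pos_square[OF sa_mult[OF assms(2) Pos_sa[OF u(1)] u(3)]] by simp
qed

end

section \<open>Homomorphisms\<close>

lemma star_homD: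
  assumes "\<pi> \<in> star_hom A B"
  shows "x \<in> carrier A \<Longrightarrow> \<pi> x \<in> carrier B"
    and "\<lbrakk>x \<in> carrier A; y \<in> carrier A\<rbrakk> \<Longrightarrow> \<pi> (x \<otimes>\<^bsub>A\<^esub> y) = \<pi> x \<otimes>\<^bsub>B\<^esub> \<pi> y"
    and "\<lbrakk>x \<in> carrier A; y \<in> carrier A\<rbrakk> \<Longrightarrow> \<pi> (x \<oplus>\<^bsub>A\<^esub> y) = \<pi> x \<oplus>\<^bsub>B\<^esub> \<pi> y"
    and "\<pi> \<one>\<^bsub>A\<^esub> = \<one>\<^bsub>B\<^esub>"
    and "x \<in> carrier A \<Longrightarrow> \<pi> (c \<odot>\<^bsub>A\<^esub> x) = c \<odot>\<^bsub>B\<^esub> \<pi> x"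
    and "x \<in> carrier A \<Longrightarrow> \<pi> (adj A x) = adj B (\<pi> x)"
  using assms by (auto simp: star_hom_def ring_hom_def)

lemma (in unital_cstar_algebra) conv_geometric:
  assumes "\<And>n. s n \<in> carrier A" "x \<in> carrier A" "q < 1" "0 \<le> q"
    and "\<And>n. cnorm A (x \<ominus> s (Suc n)) \<le> q * cnorm A (x \<ominus> s n)"
  shows "conv s x"
proof (rule conv_bound)
  show "(\<lambda>n. q ^ n * cnorm A (x \<ominus> s 0)) \<longlonglongrightarrow> 0"
    using assms(3,4) by (auto intro!: tendsto_mult_left_zero LIMSEQ_power_zero)
  have "cnorm A (x \<ominus> s n) \<le> q ^ n * cnorm A (x \<ominus> s 0)" for n
  proof (induction n)
    case (Suc n)
    have "cnorm A (x \<ominus> s (Suc n)) \<le> q * cnorm A (x \<ominus> s n)" by (rule assms)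
    also have "\<dots> \<le> q * (q ^ n * cnorm A (x \<ominus> s 0))" using Suc assms(4) by (rule mult_left_mono)
    finally show ?case by (simp add: mult.assoc)
  qed simp
  then show "cnorm A (s n \<ominus> x) \<le> q ^ n * cnorm A (x \<ominus> s 0)" for n
    using cnorm_diff_commute[of "s n" x] assms by simp
qed (use assms in auto)

lemma (in unital_cstar_algebra) sqrt_lim_unique:
  assumes e: "e \<in> carrier A" "cnorm A e < 1" and c: "c \<in> carrier A" "cnorm A c \<le> 1"
    and eq: "c \<oplus> e \<otimes> e = 2 \<odot> e"
  shows "sqrt_lim c = e"
proof -
  have "conv (sqrt_iter c) e"
  proof (rule conv_geometric[of _ _ "(1 + cnorm A e) / 2"])
    fix n
    let ?y = "sqrt_iter c n"
    have y: "?y \<in> carrier A" "cnorm A ?y \<le> 1"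
      using c sqrt_iter_norm[OF c, of n] sqrt_maj_bounds[of n] by (simp, linarith)
    \<comment> \<open>Commutation of e with c is not assumed: it follows on multiplying
      \<open>eq\<close> by e from the left and from the right.\<close>
    have "e \<otimes> c \<oplus> e \<otimes> (e \<otimes> e) = c \<otimes> e \<oplus> e \<otimes> (e \<otimes> e)"
      using arg_cong[OF eq, of "\<lambda>x. e \<otimes> x"] arg_cong[OF eq, of "\<lambda>x. x \<otimes> e"] e c
      by (simp add: A.l_distr A.r_distr smult_mult_left smult_mult_right A.m_assoc)
    then have "e \<otimes> c = c \<otimes> e" using e c by simp
    then have comm: "e \<otimes> ?y = ?y \<otimes> e" using e c by (intro sqrt_iter_comm)
    have "e = (1/2) \<odot> (c \<oplus> e \<otimes> e)" using e eq by (simp add: smult_smult)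
    then have "e \<ominus> sqrt_iter c (Suc n) = (1/2) \<odot> (c \<oplus> e \<otimes> e) \<ominus> (1/2) \<odot> (c \<oplus> ?y \<otimes> ?y)"
      by simp
    also have "\<dots> = (1/2) \<odot> ((e \<ominus> ?y) \<otimes> (e \<oplus> ?y))" using e c y comm by (intro half_square_diff)
    finally have "cnorm A (e \<ominus> sqrt_iter c (Suc n)) = cnorm A ((e \<ominus> ?y) \<otimes> (e \<oplus> ?y)) / 2"
      using e y by (simp add: cnorm_smult)
    also have "\<dots> \<le> cnorm A (e \<ominus> ?y) * (1 + cnorm A e) / 2"
    proof -
      have "cnorm A (e \<oplus> ?y) \<le> 1 + cnorm A e" using cnorm_triangle[OF e(1) y(1)] y by linarith
      then have "cnorm A (e \<ominus> ?y) * cnorm A (e \<oplus> ?y) \<le> cnorm A (e \<ominus> ?y) * (1 + cnorm A e)"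
        using e y by (intro mult_left_mono) auto
      then show ?thesis using cnorm_mult[of "e \<ominus> ?y" "e \<oplus> ?y"] e y by simp
    qed
    finally show "cnorm A (e \<ominus> sqrt_iter c (Suc n)) \<le> (1 + cnorm A e) / 2 * cnorm A (e \<ominus> ?y)"
      by (simp add: mult.commute)
  qed (use e c in auto)
  then show ?thesis using sqrt_lim_conv[OF c] by (rule conv_unique[symmetric])
qed

context
  fixes A :: "'a cstar" and B :: "'b cstar" and \<pi>
  assumes A: "unital_cstar_algebra A" and B: "unital_cstar_algebra B" and \<pi>: "\<pi> \<in> star_hom A B"
begin

interpretation A: unital_cstar_algebra A by (rule A)
interpretation B: unital_cstar_algebra B by (rule B)

lemma star_hom_sa: "A.sa x \<Longrightarrow> B.sa (\<pi> x)"
  unfolding A.sa_def B.sa_def using star_homD(1,6)[OF \<pi>, of x] by metis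

lemma star_hom_minus:
  "\<lbrakk>x \<in> carrier A; y \<in> carrier A\<rbrakk> \<Longrightarrow> \<pi> (x \<ominus>\<^bsub>A\<^esub> y) = \<pi> x \<ominus>\<^bsub>B\<^esub> \<pi> y"
  using star_homD[OF \<pi>] by (simp add: A.minus_eq_smult B.minus_eq_smult)

text \<open>A self-adjoint contraction k has a partner z with k k + z z = 1. The relation survives
  \<pi>, so the image of k is again the real part of a unitary. Scaling and the C*-identity give the
  general case.\<close>

lemma star_hom_contractive:
  assumes x: "x \<in> carrier A" shows "cnorm B (\<pi> x) \<le> cnorm A x"
proof -
  note h = star_homD[OF \<pi>]
  have 1: "cnorm B (\<pi> k) \<le> 1" if k: "A.sa k" "cnorm A k \<le> 1" for k
  proof -
    obtain z where z: "A.sa z" "z \<otimes>\<^bsub>A\<^esub> z = \<one>\<^bsub>A\<^esub> \<ominus>\<^bsub>A\<^esub> k \<otimes>\<^bsub>A\<^esub> k" "k \<otimes>\<^bsub>A\<^esub> z = z \<otimes>\<^bsub>A\<^esub> k"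
      using A.complementary_square[OF k] by blast
    note c = A.saD[OF k(1)] A.saD[OF z(1)]
    have "z \<otimes>\<^bsub>A\<^esub> z \<oplus>\<^bsub>A\<^esub> k \<otimes>\<^bsub>A\<^esub> k = \<one>\<^bsub>A\<^esub>" using z c by (simp add: A.minus_add_cancel)
    then have "k \<otimes>\<^bsub>A\<^esub> k \<oplus>\<^bsub>A\<^esub> z \<otimes>\<^bsub>A\<^esub> z = \<one>\<^bsub>A\<^esub>" using c by (simp add: A.M.a_comm)
    then have "\<pi> (k \<otimes>\<^bsub>A\<^esub> k \<oplus>\<^bsub>A\<^esub> z \<otimes>\<^bsub>A\<^esub> z) = \<one>\<^bsub>B\<^esub>" using h by simp
    then have "\<pi> k \<otimes>\<^bsub>B\<^esub> \<pi> k \<oplus>\<^bsub>B\<^esub> \<pi> z \<otimes>\<^bsub>B\<^esub> \<pi> z = \<one>\<^bsub>B\<^esub>" using h c by simp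
    moreover have "\<pi> k \<otimes>\<^bsub>B\<^esub> \<pi> z = \<pi> z \<otimes>\<^bsub>B\<^esub> \<pi> k" using h(2)[of k z] h(2)[of z k] z c by simp
    ultimately show ?thesis using star_hom_sa k z by (intro B.cnorm_le_one_of_squares)
  qed
  have 2: "cnorm B (\<pi> k) \<le> cnorm A k" if k: "A.sa k" for k
  proof (cases "cnorm A k = 0")
    case True
    then have "k = \<zero>\<^bsub>A\<^esub>" using A.saD[OF k] A.cnorm_eq_0 by simp
    then show ?thesis using star_hom_zero[OF A B \<pi>] by simp
  next
    case False
    then have t: "cnorm A k > 0" using A.cnorm_nonneg[OF A.saD(1)[OF k]] by linarith
    have "cnorm B (\<pi> (complex_of_real (1 / cnorm A k) \<odot>\<^bsub>A\<^esub> k)) \<le> 1"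
      using t A.saD[OF k] by (intro 1 A.sa_rsmult k) (simp add: A.cnorm_smult norm_divide)
    then show ?thesis using t A.saD[OF k] h by (simp add: B.cnorm_smult norm_divide)
  qed
  have "(cnorm B (\<pi> x))\<^sup>2 = cnorm B (\<pi> (adj A x \<otimes>\<^bsub>A\<^esub> x))"
    using x h B.cstar_identity[of "\<pi> x"] A.adj_closed by simp
  also have "\<dots> \<le> (cnorm A x)\<^sup>2" using 2[OF A.sa_adj_mult[OF x]] A.cstar_identity[OF x] by simp
  finally show ?thesis by (rule power2_le_imp_le) (use x in simp)
qed

lemma star_hom_conv: "A.conv s x \<Longrightarrow> B.conv (\<lambda>n. \<pi> (s n)) (\<pi> x)"
proof (rule B.conv_bound)
  assume c: "A.conv s x"
  show "(\<lambda>n. cnorm A (s n \<ominus>\<^bsub>A\<^esub> x)) \<longlonglongrightarrow> 0" using c by (simp add: A.conv_def)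
  show "cnorm B (\<pi> (s n) \<ominus>\<^bsub>B\<^esub> \<pi> x) \<le> cnorm A (s n \<ominus>\<^bsub>A\<^esub> x)" for n
    using star_hom_contractive[of "s n \<ominus>\<^bsub>A\<^esub> x"] star_hom_minus[of "s n" x] A.convD[OF c] by simp
qed (auto dest: A.convD star_homD(1)[OF \<pi>])

lemma star_hom_sqrt_iter: "c \<in> carrier A \<Longrightarrow> \<pi> (A.sqrt_iter c n) = B.sqrt_iter (\<pi> c) n"
  using star_homD[OF \<pi>] star_hom_zero[OF A B \<pi>] by (induction n) simp_all

lemma star_hom_sqrt_lim:
  assumes "c \<in> carrier A" "cnorm A c \<le> 1"
  shows "\<pi> (A.sqrt_lim c) = B.sqrt_lim (\<pi> c)"
proof (rule B.conv_unique)
  show "B.conv (\<lambda>n. \<pi> (A.sqrt_iter c n)) (\<pi> (A.sqrt_lim c))"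
    using assms by (intro star_hom_conv A.sqrt_lim_conv)
  show "B.conv (\<lambda>n. \<pi> (A.sqrt_iter c n)) (B.sqrt_lim (\<pi> c))"
    using B.sqrt_lim_conv[of "\<pi> c"] star_hom_contractive[of c] assms star_homD(1)[OF \<pi>, of c]
    by (simp add: star_hom_sqrt_iter)
qed

text \<open>If $\|\pi(h)\| < r < \|h\| = 1$ for a square $h$, then $h - r + |h - r|$ lies in the kernel
  of $\pi$.\<close>

lemma star_hom_isometric:
  assumes inj: "inj_on \<pi> (carrier A)" and x: "x \<in> carrier A"
  shows "cnorm B (\<pi> x) = cnorm A x"
proof -
  note hm = star_homD[OF \<pi>]
  have 1: "\<not> cnorm B (\<pi> k) < 1" if k: "A.sa k" "cnorm A k = 1" for k
  proof
    assume lt: "cnorm B (\<pi> k) < 1"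
    define h where "h = k \<otimes>\<^bsub>A\<^esub> k"
    have h: "A.Pos h" "A.sa h" "h \<in> carrier A" and hn: "cnorm A h = 1"
      using A.Pos_square[OF k(1)] A.sa_square[OF k(1)] A.saD[OF A.sa_square[OF k(1)]]
        A.cnorm_sa_square[OF k(1)] k(2) by (simp_all add: h_def)
    have "cnorm B (\<pi> h) = (cnorm B (\<pi> k))\<^sup>2"
      using B.cnorm_sa_square[OF star_hom_sa[OF k(1)]] hm(2) A.saD[OF k(1)] by (simp add: h_def)
    also have "\<dots> < 1" using lt B.cnorm_nonneg[of "\<pi> k"] hm(1) A.saD[OF k(1)]
      by (simp add: power_less_one_iff abs_square_less_1)
    finally obtain r where r: "cnorm B (\<pi> h) < r" "r < 1" using dense by blast
    then have r0: "0 \<le> r" using B.cnorm_nonneg[of "\<pi> h"] hm(1) h by fastforce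
    define d where "d = h \<ominus>\<^bsub>A\<^esub> A.scl r"
    have d: "A.sa d" "d \<in> carrier A" using h by (auto simp: d_def A.saD)
    have one: "A.scl 1 = \<one>\<^bsub>A\<^esub>" by simp
    have "A.scl 1 \<oplus>\<^bsub>A\<^esub> d = A.scl (1 - r) \<oplus>\<^bsub>A\<^esub> h"
      using h A.smult_add_left[of "\<one>\<^bsub>A\<^esub>" 1 "- complex_of_real r"]
      by (simp add: d_def A.minus_eq_smult A.M.a_ac A.smult_smult)
    then have od: "\<one>\<^bsub>A\<^esub> \<oplus>\<^bsub>A\<^esub> d = A.scl (1 - r) \<oplus>\<^bsub>A\<^esub> h" by simp
    have "A.scl 1 \<ominus>\<^bsub>A\<^esub> d = A.scl r \<oplus>\<^bsub>A\<^esub> (A.scl 1 \<ominus>\<^bsub>A\<^esub> h)"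
      using h by (simp add: d_def A.minus_eq_smult A.laws A.M.a_ac)
    then have "A.Pos (A.scl 1 \<ominus>\<^bsub>A\<^esub> d)"
      using A.Pos_scl_minus[OF h(2), of 1] hn A.Pos_scl[OF r0] by (simp add: A.Pos_add)
    moreover have "A.Pos (A.scl 1 \<oplus>\<^bsub>A\<^esub> d)"
      using A.Pos_add[OF A.Pos_scl[of "1 - r"] h(1)] r od by simp
    ultimately have dn: "cnorm A d \<le> 1" using d by (intro A.cnorm_le_of_Pos) auto
    define c where "c = \<one>\<^bsub>A\<^esub> \<ominus>\<^bsub>A\<^esub> d \<otimes>\<^bsub>A\<^esub> d"
    have c: "A.sa c" "c \<in> carrier A" "cnorm A c \<le> 1"
      using A.square_le_one[OF d(1) dn] A.sa_square[OF d(1)] d by (simp_all add: c_def)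
    define y where "y = A.sqrt_lim c"
    have y: "y \<in> carrier A" "cnorm A y \<le> 1"
      using A.sqrt_lim_norm[OF c(2,3)] A.convD(2)[OF A.sqrt_lim_conv[OF c(2,3)]] by (simp_all add: y_def)
    have pid: "\<pi> d \<in> carrier B" and pih: "\<pi> h \<in> carrier B" using hm(1) d h by auto
    \<comment> \<open>In the image d is negative: e = 1 + \<pi> d = (1 - r) + \<pi> h has norm below
      1 and solves 2e - e e = 1 - \<pi> d \<pi> d. By uniqueness it is the limit of the iteration
      for \<open>\<pi> c\<close>, that is, the absolute value of \<open>\<pi> d\<close> is -\<pi>
      d.\<close>
    define e where "e = \<one>\<^bsub>B\<^esub> \<oplus>\<^bsub>B\<^esub> \<pi> d"
    have "B.sqrt_lim (\<pi> c) = e"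
    proof (rule B.sqrt_lim_unique)
      show "e \<in> carrier B" "\<pi> c \<in> carrier B" using pid hm(1) c by (simp_all add: e_def)
      have "e = \<pi> (\<one>\<^bsub>A\<^esub> \<oplus>\<^bsub>A\<^esub> d)" using hm d by (simp add: e_def)
      also have "\<dots> = B.scl (1 - r) \<oplus>\<^bsub>B\<^esub> \<pi> h" unfolding od using hm h by simp
      finally show "cnorm B e < 1"
        using B.cnorm_triangle[of "B.scl (1 - r)" "\<pi> h"] B.cnorm_scl_le[of "1 - r"] r pih by simp
      show "cnorm B (\<pi> c) \<le> 1" using star_hom_contractive[OF c(2)] c(3) by simp
      have "\<pi> c = \<one>\<^bsub>B\<^esub> \<ominus>\<^bsub>B\<^esub> \<pi> d \<otimes>\<^bsub>B\<^esub> \<pi> d"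
        using hm d star_hom_minus[of "\<one>\<^bsub>A\<^esub>" "d \<otimes>\<^bsub>A\<^esub> d"] by (simp add: c_def)
      then have "\<pi> c \<oplus>\<^bsub>B\<^esub> \<pi> d \<otimes>\<^bsub>B\<^esub> \<pi> d = \<one>\<^bsub>B\<^esub>" using pid by (simp add: B.minus_add_cancel)
      then have "\<one>\<^bsub>B\<^esub> \<oplus>\<^bsub>B\<^esub> (\<pi> d \<oplus>\<^bsub>B\<^esub> (\<pi> d \<oplus>\<^bsub>B\<^esub> (\<pi> c \<oplus>\<^bsub>B\<^esub> \<pi> d \<otimes>\<^bsub>B\<^esub> \<pi> d))) =
          \<one>\<^bsub>B\<^esub> \<oplus>\<^bsub>B\<^esub> (\<pi> d \<oplus>\<^bsub>B\<^esub> (\<pi> d \<oplus>\<^bsub>B\<^esub> \<one>\<^bsub>B\<^esub>))" by simp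
      then show "\<pi> c \<oplus>\<^bsub>B\<^esub> e \<otimes>\<^bsub>B\<^esub> e = 2 \<odot>\<^bsub>B\<^esub> e"
        using pid hm(1)[OF c(2)] by (simp add: e_def B.laws B.two_smult B.M.a_ac)
    qed
    then have "\<pi> y = \<pi> (\<one>\<^bsub>A\<^esub> \<oplus>\<^bsub>A\<^esub> d)"
      using star_hom_sqrt_lim[OF c(2,3)] hm d by (simp add: y_def e_def)
    \<comment> \<open>Injectivity pulls this back to A. As y is a contraction, 1 - y = r - h is
      positive, which contradicts that h has norm 1 > r.\<close>
    then have yd: "y = \<one>\<^bsub>A\<^esub> \<oplus>\<^bsub>A\<^esub> d" using inj y d by (auto dest: inj_onD)
    have "A.Pos (A.scl 1 \<ominus>\<^bsub>A\<^esub> (\<one>\<^bsub>A\<^esub> \<oplus>\<^bsub>A\<^esub> d))"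
      using y yd d by (intro A.Pos_scl_minus) auto
    moreover have "A.scl 1 \<ominus>\<^bsub>A\<^esub> (\<one>\<^bsub>A\<^esub> \<oplus>\<^bsub>A\<^esub> d) = A.scl r \<ominus>\<^bsub>A\<^esub> h"
    proof (rule A.minusI)
      have "(A.scl r \<ominus>\<^bsub>A\<^esub> h) \<oplus>\<^bsub>A\<^esub> (\<one>\<^bsub>A\<^esub> \<oplus>\<^bsub>A\<^esub> d) = ((A.scl r \<ominus>\<^bsub>A\<^esub> h) \<oplus>\<^bsub>A\<^esub> h) \<oplus>\<^bsub>A\<^esub> A.scl (1 - r)"
        unfolding od using h by (simp add: A.M.a_ac)
      also have "\<dots> = A.scl r \<oplus>\<^bsub>A\<^esub> A.scl (1 - r)" using h by (subst A.minus_add_cancel) auto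
      also have "\<dots> = A.scl 1" using A.smult_add_left[of "\<one>\<^bsub>A\<^esub>" r "1 - r"] by simp
      finally show "A.scl 1 = (A.scl r \<ominus>\<^bsub>A\<^esub> h) \<oplus>\<^bsub>A\<^esub> (\<one>\<^bsub>A\<^esub> \<oplus>\<^bsub>A\<^esub> d)" by simp
    qed (use h d in auto)
    ultimately have "A.Pos (A.scl r \<ominus>\<^bsub>A\<^esub> h)" by simp
    then have "cnorm A h \<le> r" using h r0 by (intro A.cnorm_le_of_Pos A.Pos_add A.Pos_scl) auto
    then show False using hn r by simp
  qed
  have 2: "cnorm A k \<le> cnorm B (\<pi> k)" if k: "A.sa k" for k
  proof (rule ccontr)
    assume "\<not> cnorm A k \<le> cnorm B (\<pi> k)"
    then have lt: "cnorm B (\<pi> k) < cnorm A k" by simp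
    note kc = A.saD[OF k]
    have t: "cnorm A k > 0" using lt B.cnorm_nonneg[of "\<pi> k"] hm(1)[OF kc(1)] by linarith
    have "\<not> cnorm B (\<pi> (complex_of_real (1 / cnorm A k) \<odot>\<^bsub>A\<^esub> k)) < 1"
      using t kc by (intro 1 A.sa_rsmult k) (simp add: A.cnorm_smult norm_divide)
    then show False using lt t hm kc by (simp add: B.cnorm_smult norm_divide)
  qed
  have "(cnorm A x)\<^sup>2 = cnorm A (adj A x \<otimes>\<^bsub>A\<^esub> x)" using A.cstar_identity[OF x] by simp
  also have "\<dots> \<le> cnorm B (\<pi> (adj A x \<otimes>\<^bsub>A\<^esub> x))" by (rule 2[OF A.sa_adj_mult[OF x]])
  also have "\<dots> = (cnorm B (\<pi> x))\<^sup>2"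
    using x hm B.cstar_identity[of "\<pi> x"] A.adj_closed by simp
  finally have "cnorm A x \<le> cnorm B (\<pi> x)" by (rule power2_le_imp_le) (use hm(1)[OF x] in simp)
  then show ?thesis using star_hom_contractive[OF x] by simp
qed

end

section \<open>Positivity of $x^* x$\<close>

context unital_cstar_algebra
begin

lemma Pos_cancel_smult:
  assumes "Pos (complex_of_real r \<odot> a)" "0 < r" "a \<in> carrier A"
  shows "Pos a"
  using Pos_smult[OF assms(1), of "1 / r"] assms(2,3) by (simp add: smult_smult)

lemma uminus_smult: "x \<in> carrier A \<Longrightarrow> \<ominus> (c \<odot> x) = c \<odot> (\<ominus> x)"
  by (simp add: a_inv_eq_smult smult_smult)

lemma Pos_mult_adj:
  assumes c: "c \<in> carrier A" and neg: "Pos (\<ominus> (adj A c \<otimes> c))"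
  shows "Pos (c \<otimes> adj A c)"
proof -
  define a where "a = adj A c"
  have a: "a \<in> carrier A" "adj A a = c" "adj A c = a" using c by (simp_all add: a_def adj_closed adj_adj)
  define s t where "s = c \<oplus> a" and "t = \<i> \<odot> (c \<oplus> (-1) \<odot> a)"
  have st: "sa s" "sa t" using a c by (auto simp: sa_def s_def t_def laws M.a_ac)
  define g where "g = \<ominus> (a \<otimes> c)"
  have g: "Pos g" "g = (-1) \<odot> (a \<otimes> c)" using neg a c by (simp_all add: g_def a_inv_eq_smult)
  define X Y Z W where "X = c \<otimes> c" and "Y = c \<otimes> a" and "Z = a \<otimes> c" and "W = a \<otimes> a"
  have in_A: "X \<in> carrier A" "Y \<in> carrier A" "Z \<in> carrier A" "W \<in> carrier A"
    using a c by (auto simp: X_def Y_def Z_def W_def)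
  have ss: "s \<otimes> s = X \<oplus> (Y \<oplus> (Z \<oplus> W))"
    using a c by (simp add: s_def X_def Y_def Z_def W_def A.l_distr A.r_distr M.a_ac)
  have "t \<otimes> t = (-1) \<odot> ((c \<oplus> (-1) \<odot> a) \<otimes> (c \<oplus> (-1) \<odot> a))"
    using a c by (simp add: t_def smult_mult_left smult_mult_right smult_smult)
  also have "(c \<oplus> (-1) \<odot> a) \<otimes> (c \<oplus> (-1) \<odot> a) = X \<oplus> ((-1) \<odot> Y \<oplus> ((-1) \<odot> Z \<oplus> W))"
    using a c by (simp add: X_def Y_def Z_def W_def A.l_distr A.r_distr smult_r_distr smult_mult_left smult_mult_right smult_smult M.a_ac)
  finally have tt: "t \<otimes> t = (-1) \<odot> X \<oplus> (Y \<oplus> (Z \<oplus> (-1) \<odot> W))"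
    using in_A by (simp add: smult_r_distr smult_smult)
  have gZ: "g = (-1) \<odot> Z" using g(2) by (simp add: Z_def)
  have "(s \<otimes> s \<oplus> t \<otimes> t) \<oplus> (g \<oplus> g) = (X \<oplus> (-1) \<odot> X) \<oplus> ((W \<oplus> (-1) \<odot> W) \<oplus> ((Z \<oplus> (-1) \<odot> Z) \<oplus> ((Z \<oplus> (-1) \<odot> Z) \<oplus> (Y \<oplus> Y))))"
    unfolding ss tt gZ using in_A by (simp add: M.a_ac)
  also have "\<dots> = complex_of_real 2 \<odot> (c \<otimes> a)"
    using in_A smult_cancel[of 1 "-1"] by (simp add: two_smult flip: Y_def)
  finally have "Pos (complex_of_real 2 \<odot> (c \<otimes> a))"
    using Pos_add[OF Pos_add[OF Pos_square[OF st(1)] Pos_square[OF st(2)]] Pos_add[OF g(1) g(1)]] by simp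
  then have "Pos (c \<otimes> a)" by (rule Pos_cancel_smult) (use a c in auto)
  then show ?thesis using a by simp
qed

text \<open>Put $f = cc^*$ and $g = -c^*c$, both positive. As $(1 + f) c = c (1 - g)$, we get
  $\|(1 + f) f (1 + f)\| \le \|f\|$, which forces $f = 0$.\<close>

lemma zero_if_neg_star_square_aux:
  assumes c: "c \<in> carrier A" and neg: "Pos (\<ominus> (adj A c \<otimes> c))" and n: "cnorm A c \<le> 1"
  shows "c = \<zero>"
proof -
  define a where "a = adj A c"
  have a: "a \<in> carrier A" "adj A a = c" "adj A c = a" "cnorm A a = cnorm A c"
    using c by (simp_all add: a_def adj_closed adj_adj cnorm_adj)
  define g where "g = \<ominus> (a \<otimes> c)"
  define f where "f = c \<otimes> a"
  define t where "t = cnorm A f"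
  have g: "Pos g" "g \<in> carrier A" "g = (-1) \<odot> (a \<otimes> c)"
    using neg a c by (simp_all add: g_def a_inv_eq_smult)
  have f: "Pos f" "f \<in> carrier A" using Pos_mult_adj[OF c neg] a c by (simp_all add: f_def)
  have t: "t = (cnorm A c)\<^sup>2" using cstar_identity[of a] a by (simp add: t_def f_def)
  have t0: "0 \<le> t" by (simp add: t)
  have one: "scl 1 = \<one>" by simp
  have "cnorm A (\<one> \<ominus> g) \<le> 1"
  proof (rule cnorm_le_of_Pos)
    show "Pos (scl 1 \<ominus> (\<one> \<ominus> g))" using g by (simp add: minus_minus_cancel)
    have "cnorm A (a \<otimes> c) \<le> 1" using cstar_identity[OF c] n c a by (simp add: power_le_one)
    then have "cnorm A g \<le> 1" using a c by (simp add: g(3) cnorm_smult)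
    then have "Pos (scl 1 \<oplus> (scl 1 \<ominus> g))" using g by (intro Pos_add Pos_scl Pos_scl_minus) auto
    then show "Pos (scl 1 \<oplus> (\<one> \<ominus> g))" by simp
  qed (use g in auto)
  moreover have fc: "(\<one> \<oplus> f) \<otimes> c = c \<otimes> (\<one> \<ominus> g)"
    using a c by (simp add: f_def g(3) minus_eq_smult laws)
  ultimately have fcn: "cnorm A ((\<one> \<oplus> f) \<otimes> c) \<le> cnorm A c"
    using cnorm_mult[of c "\<one> \<ominus> g"] mult_left_mono[of "cnorm A (\<one> \<ominus> g)" 1 "cnorm A c"] c g by simp
  define v where "v = a \<otimes> (\<one> \<oplus> f)"
  define q where "q = (\<one> \<oplus> f) \<otimes> f \<otimes> (\<one> \<oplus> f)"
  have fa: "adj A f = f" using saD[OF Pos_sa[OF f(1)]] by simp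
  have v: "v \<in> carrier A" "adj A v = (\<one> \<oplus> f) \<otimes> c" using a f fa by (simp_all add: v_def adj_mult adj_add adj_one)
  have qv: "q = adj A v \<otimes> v" using a c f unfolding v(2) by (simp add: q_def v_def f_def A.m_assoc)
  have "cnorm A v \<le> cnorm A c" using fcn v cnorm_adj[of v] by simp
  then have "cnorm A q \<le> t" using cstar_identity[of v] v by (simp add: qv t power_mono)
  moreover have qs: "sa q" unfolding qv using v by (intro sa_adj_mult)
  ultimately have p1: "Pos (scl t \<ominus> q)" by (intro Pos_scl_minus)
  define e where "e = f \<ominus> scl t"
  have e: "sa e" "e \<in> carrier A" "f = e \<oplus> scl t" using f by (auto simp: e_def minus_add_cancel)
  have p2: "Pos (e \<otimes> e \<oplus> e \<otimes> e)" using e by (intro Pos_add Pos_square)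
  have p3: "Pos (f \<otimes> f \<otimes> f)" using f by (intro Pos_sandwich) auto
  \<comment> \<open>The bound says q = f + 2 f f + f f f \<le> t. Dropping f f f and using f f \<ge>
    2t f - t t, which is the positivity of (f - t)(f - t), gives (1 + 4t) f \<le> t + 2 t t. As f
    has norm t, this reads (1 + 4t) t \<le> t + 2 t t, hence t = 0.\<close>
  define w where "w = complex_of_real (1 + 4 * t) \<odot> f"
  have wc: "w \<in> carrier A" "sa w"
    using f unfolding w_def by (simp, intro sa_rsmult Pos_sa)
  have ffe: "f \<otimes> f \<oplus> scl (t * t) = e \<otimes> e \<oplus> complex_of_real (2 * t) \<odot> f"
  proof -
    have "complex_of_real (2 * t) \<odot> f = complex_of_real t \<odot> f \<oplus> complex_of_real t \<odot> f"
      using f smult_add_left[of f t t] by simp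
    then show ?thesis using e(2) unfolding e(3) by (simp add: laws M.a_ac)
  qed
  have w: "w = f \<oplus> (complex_of_real (2 * t) \<odot> f \<oplus> complex_of_real (2 * t) \<odot> f)"
    unfolding w_def using f smult_add_left[of f 1 "4 * complex_of_real t"] smult_add_left[of f "2 * complex_of_real t" "2 * complex_of_real t"]
    by simp
  have tt: "scl (t + 2 * (t * t)) = scl t \<oplus> (scl (t * t) \<oplus> scl (t * t))"
    using smult_add_left[of \<one> t "2 * (t * t)"] smult_add_left[of \<one> "t * t" "t * t"] by simp
  have q: "q = f \<oplus> (f \<otimes> f \<oplus> f \<otimes> f \<oplus> f \<otimes> f \<otimes> f)"
    using f by (simp add: q_def laws M.a_ac)
  have "((scl t \<ominus> q) \<oplus> (e \<otimes> e \<oplus> e \<otimes> e) \<oplus> f \<otimes> f \<otimes> f) \<oplus> w =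
      (scl t \<ominus> q) \<oplus> f \<oplus> f \<otimes> f \<otimes> f \<oplus> (e \<otimes> e \<oplus> complex_of_real (2 * t) \<odot> f) \<oplus> (e \<otimes> e \<oplus> complex_of_real (2 * t) \<odot> f)"
    unfolding w using f e(2) saD[OF qs] by (simp add: M.a_ac del: smult_add_left)
  also have "\<dots> = ((scl t \<ominus> q) \<oplus> q) \<oplus> (scl (t * t) \<oplus> scl (t * t))"
    unfolding ffe[symmetric] using f saD(1)[OF qs] by (subst (2) q) (simp add: M.a_ac)
  also have "\<dots> = scl (t + 2 * (t * t))"
    unfolding tt using saD(1)[OF qs] by (subst minus_add_cancel) auto
  finally have "scl (t + 2 * (t * t)) \<ominus> w = (scl t \<ominus> q) \<oplus> (e \<otimes> e \<oplus> e \<otimes> e) \<oplus> f \<otimes> f \<otimes> f"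
    using wc f e(2) saD(1)[OF qs] by (intro minusI) auto
  then have "Pos (scl (t + 2 * (t * t)) \<ominus> w)" using p1 p2 p3 by (auto intro!: Pos_add)
  moreover have "Pos w" unfolding w_def using f t0 by (intro Pos_smult) auto
  then have "Pos (scl (t + 2 * (t * t)) \<oplus> w)" using t0 by (intro Pos_add Pos_scl) auto
  ultimately have "cnorm A w \<le> t + 2 * (t * t)" using t0 wc by (intro cnorm_le_of_Pos) auto
  moreover have "cnorm A w = (1 + 4 * t) * t"
    using t0 f by (simp only: w_def cnorm_smult t_def[symmetric] norm_of_real)
  ultimately have "t * t \<le> 0" by (simp add: algebra_simps)
  then have "t = 0" by (metis mult_eq_0_iff zero_le_square order_antisym)
  then show ?thesis using t c cnorm_eq_0 by simp
qed

lemma zero_if_neg_star_square: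
  assumes c: "c \<in> carrier A" and neg: "Pos (\<ominus> (adj A c \<otimes> c))"
  shows "c = \<zero>"
proof (rule ccontr)
  assume "c \<noteq> \<zero>"
  then have t: "cnorm A c > 0" using cnorm_nonneg[OF c] cnorm_eq_0[OF c] by linarith
  define d where "d = complex_of_real (1 / cnorm A c) \<odot> c"
  have d: "d \<in> carrier A" using c by (simp add: d_def)
  have eq: "\<ominus> (adj A d \<otimes> d) = complex_of_real (1 / cnorm A c * (1 / cnorm A c)) \<odot> (\<ominus> (adj A c \<otimes> c))"
    using c adj_closed[OF c] by (simp add: d_def laws uminus_smult)
  have "Pos (\<ominus> (adj A d \<otimes> d))" unfolding eq using neg by (rule Pos_smult) simp
  moreover have "cnorm A d = 1" using t c by (simp add: d_def cnorm_smult norm_divide)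
  ultimately have "d = \<zero>" using d by (intro zero_if_neg_star_square_aux) auto
  then show False using \<open>cnorm A d = 1\<close> by simp
qed

text \<open>Let p be the positive root of h h and m = p - h, twice the negative part of h. Since h m
  = -m p, the element d = x m satisfies d* d = -(m u)(m u) with u the root of p, so d = 0 by
  \<open>zero_if_neg_star_square\<close>. Then m p = 0, hence m m = 0 and h = p.\<close>

lemma Pos_star_square:
  assumes x: "x \<in> carrier A" shows "Pos (adj A x \<otimes> x)"
proof -
  define h where "h = adj A x \<otimes> x"
  have h: "sa h" "h \<in> carrier A" using sa_adj_mult[OF x] by (auto simp: h_def saD)
  obtain p where p: "Pos p" "p \<otimes> p = h \<otimes> h" and pc: "\<And>y. y \<in> carrier A \<Longrightarrow> y \<otimes> (h \<otimes> h) = (h \<otimes> h) \<otimes> y \<Longrightarrow> y \<otimes> p = p \<otimes> y"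
    using Pos_sqrt[OF Pos_square[OF h(1)]] by metis
  have hp: "h \<otimes> p = p \<otimes> h" using h by (intro pc) (simp_all add: A.m_assoc)
  obtain u where u: "Pos u" "u \<otimes> u = p" and uc: "\<And>y. y \<in> carrier A \<Longrightarrow> y \<otimes> p = p \<otimes> y \<Longrightarrow> y \<otimes> u = u \<otimes> y"
    using Pos_sqrt[OF p(1)] by metis
  note c = h(2) Pos_in[OF p(1)] Pos_in[OF u(1)]
  define m where "m = p \<ominus> h"
  have m: "sa m" "m \<in> carrier A" using p h c by (auto simp: m_def)
  have mp: "m \<otimes> p = p \<otimes> m" using c hp by (simp add: m_def minus_eq_smult laws)
  have mu: "m \<otimes> u = u \<otimes> m" using uc[OF m(2) mp] .
  have hm: "h \<otimes> m = \<ominus> (m \<otimes> p)" using c p(2) hp by (simp add: m_def minus_eq_smult a_inv_eq_smult laws M.a_ac)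
  define d where "d = x \<otimes> m"
  have d: "d \<in> carrier A" using x m by (simp add: d_def)
  have "adj A d \<otimes> d = m \<otimes> (h \<otimes> m)"
    using x m saD[OF m(1)] adj_closed[OF x] by (simp add: d_def h_def adj_mult A.m_assoc)
  also have "\<dots> = \<ominus> ((m \<otimes> u) \<otimes> (m \<otimes> u))"
  proof -
    have "m \<otimes> (m \<otimes> p) = (m \<otimes> u) \<otimes> (m \<otimes> u)"
      unfolding u(2)[symmetric] using mu m c by (metis A.m_assoc A.m_closed)
    then show ?thesis unfolding hm using m c by (simp add: a_inv_eq_smult laws)
  qed
  finally have dd: "adj A d \<otimes> d = \<ominus> ((m \<otimes> u) \<otimes> (m \<otimes> u))" .
  have mus: "sa (m \<otimes> u)" using m u mu by (intro sa_mult) auto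
  have "Pos (\<ominus> (adj A d \<otimes> d))" unfolding dd using Pos_square[OF mus] m c by simp
  then have "d = \<zero>" by (rule zero_if_neg_star_square[OF d])
  then have "\<ominus> ((m \<otimes> u) \<otimes> (m \<otimes> u)) = \<zero>" using dd by (simp add: adj_zero_eq)
  then have "cnorm A ((-1) \<odot> ((m \<otimes> u) \<otimes> (m \<otimes> u))) = 0" using m c by (simp flip: a_inv_eq_smult)
  then have "cnorm A (m \<otimes> u) = 0" using cnorm_sa_square[OF mus] m c by (simp add: cnorm_smult)
  then have "m \<otimes> u = \<zero>" using m c by (simp add: cnorm_eq_0)
  then have "m \<otimes> p = \<zero>" unfolding u(2)[symmetric] using m c by (metis A.m_assoc A.l_null)
  moreover have "m \<otimes> h = h \<otimes> m" using hp c by (simp add: m_def minus_eq_smult laws)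
  ultimately have "m \<otimes> m = \<zero>" using m c hm by (subst (2) m_def) (simp add: minus_eq_smult laws)
  then have "cnorm A m = 0" using cnorm_sa_square[OF m(1)] by simp
  then have "p \<ominus> h = \<zero>" using m cnorm_eq_0 by (simp add: m_def)
  then have "h = p" using c eq_if_minus_zero[of p h] by simp
  then show ?thesis using p(1) by (simp add: h_def)
qed

section \<open>Finite sums and the Cauchy-Schwarz inequality\<close>

lemma Pos_finsum: "finite F \<Longrightarrow> (\<And>u. u \<in> F \<Longrightarrow> Pos (v u)) \<Longrightarrow> Pos (finsum A v F)"
  by (induction F rule: finite_induct) (auto simp: Pi_def Pos_in intro!: Pos_add)

lemma adj_finsum:
  "finite F \<Longrightarrow> (\<And>u. u \<in> F \<Longrightarrow> v u \<in> carrier A) \<Longrightarrow> adj A (finsum A v F) = finsum A (\<lambda>u. adj A (v u)) F"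
  by (induction F rule: finite_induct) (auto simp: Pi_def adj_zero_eq adj_add adj_closed)

lemma smult_finsum:
  "finite F \<Longrightarrow> (\<And>u. u \<in> F \<Longrightarrow> v u \<in> carrier A) \<Longrightarrow> c \<odot> finsum A v F = finsum A (\<lambda>u. c \<odot> v u) F"
  by (induction F rule: finite_induct) (auto simp: Pi_def smult_r_distr)

lemma finsum_smult_const:
  "finite F \<Longrightarrow> x \<in> carrier A \<Longrightarrow> finsum A (\<lambda>u. f u \<odot> x) F = (\<Sum>u\<in>F. f u) \<odot> x"
  by (induction F rule: finite_induct) (auto simp: Pi_def smult_add_left)

lemma cnorm_finsum_le:
  "finite F \<Longrightarrow> (\<And>u. u \<in> F \<Longrightarrow> v u \<in> carrier A) \<Longrightarrow> cnorm A (finsum A v F) \<le> (\<Sum>u\<in>F. cnorm A (v u))"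
proof (induction F rule: finite_induct)
  case (insert a F)
  then show ?case using cnorm_triangle[of "v a" "finsum A v F"] by (fastforce simp: Pi_def)
qed simp

text \<open>A variance identity: because the squares of \<xi> sum to 1, the differences
  \<open>v u - \<xi> u y\<close> have sum of star squares V - Y, where V is the sum on the
  right-hand side and Y = y* y. So Y \<le> V, and the norm is monotone on positive elements.\<close>

lemma cnorm_Cauchy_Schwarz:
  assumes F: "finite F" and v: "\<And>u. u \<in> F \<Longrightarrow> v u \<in> carrier A"
    and \<xi>: "(\<Sum>u\<in>F. (\<xi> u)\<^sup>2) = 1"
  shows "(cnorm A (finsum A (\<lambda>u. complex_of_real (\<xi> u) \<odot> v u) F))\<^sup>2
    \<le> cnorm A (finsum A (\<lambda>u. adj A (v u) \<otimes> v u) F)"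
proof -
  define y where "y = finsum A (\<lambda>u. complex_of_real (\<xi> u) \<odot> v u) F"
  have y: "y \<in> carrier A" unfolding y_def using v by (intro M.finsum_closed) auto
  define Y where "Y = adj A y \<otimes> y"
  have Y: "Y \<in> carrier A" using y adj_closed by (simp add: Y_def)
  define d where "d u = v u \<oplus> complex_of_real (- \<xi> u) \<odot> y" for u
  have d: "d u \<in> carrier A" if "u \<in> F" for u using v[OF that] y by (simp add: d_def)
  have av: "adj A (v u) \<in> carrier A" if "u \<in> F" for u using v[OF that] by (rule adj_closed)
  have ay: "adj A y \<in> carrier A" using y by (rule adj_closed)
  have sum_y: "finsum A (\<lambda>u. complex_of_real (- \<xi> u) \<odot> (adj A y \<otimes> v u)) F = (-1) \<odot> Y"
  proof -
    have "(-1) \<odot> Y = (-1) \<odot> finsum A (\<lambda>u. adj A y \<otimes> (complex_of_real (\<xi> u) \<odot> v u)) F"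
      unfolding Y_def by (subst (2) y_def, subst finsum_rdistr) (use F v ay in auto)
    also have "\<dots> = finsum A (\<lambda>u. complex_of_real (- \<xi> u) \<odot> (adj A y \<otimes> v u)) F"
      using F v ay by (subst smult_finsum) (auto simp: smult_mult_right smult_smult intro!: M.finsum_cong')
    finally show ?thesis by simp
  qed
  have sum_ay: "finsum A (\<lambda>u. complex_of_real (- \<xi> u) \<odot> (adj A (v u) \<otimes> y)) F = (-1) \<odot> Y"
  proof -
    have "(-1) \<odot> Y = adj A ((-1) \<odot> Y)" using y ay by (simp add: Y_def laws)
    also have "\<dots> = finsum A (\<lambda>u. adj A (complex_of_real (- \<xi> u) \<odot> (adj A y \<otimes> v u))) F"
      unfolding sum_y[symmetric] using F v ay by (intro adj_finsum) auto
    also have "\<dots> = finsum A (\<lambda>u. complex_of_real (- \<xi> u) \<odot> (adj A (v u) \<otimes> y)) F"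
      using v ay av y by (intro M.finsum_cong') (auto simp: laws)
    finally show ?thesis by simp
  qed
  have sum_yy: "finsum A (\<lambda>u. complex_of_real ((\<xi> u)\<^sup>2) \<odot> Y) F = Y"
    using F Y by (subst finsum_smult_const) (simp_all only: of_real_sum[symmetric] \<xi> of_real_1 smult_1)
  have dd: "adj A (d u) \<otimes> d u = adj A (v u) \<otimes> v u \<oplus> complex_of_real (- \<xi> u) \<odot> (adj A (v u) \<otimes> y)
     \<oplus> complex_of_real (- \<xi> u) \<odot> (adj A y \<otimes> v u) \<oplus> complex_of_real ((\<xi> u)\<^sup>2) \<odot> Y" if "u \<in> F" for u
    using v[OF that] y ay av[OF that] by (simp add: d_def Y_def laws M.a_ac power2_eq_square)
  define V where "V = finsum A (\<lambda>u. adj A (v u) \<otimes> v u) F"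
  have V: "V \<in> carrier A" unfolding V_def using v av by (intro M.finsum_closed) auto
  have "finsum A (\<lambda>u. adj A (d u) \<otimes> d u) F = finsum A (\<lambda>u. adj A (v u) \<otimes> v u \<oplus> complex_of_real (- \<xi> u) \<odot> (adj A (v u) \<otimes> y)
     \<oplus> complex_of_real (- \<xi> u) \<odot> (adj A y \<otimes> v u) \<oplus> complex_of_real ((\<xi> u)\<^sup>2) \<odot> Y) F"
    using v y ay av Y dd by (intro M.finsum_cong') auto
  also have "\<dots> = V \<oplus> (-1) \<odot> Y \<oplus> (-1) \<odot> Y \<oplus> Y"
    using v y ay av Y sum_y sum_ay sum_yy by (simp add: M.finsum_addf Pi_def V_def)
  also have "\<dots> = V \<ominus> Y"
    using V Y smult_cancel[of "-1" 1 Y] by (simp add: minus_eq_smult M.a_assoc)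
  finally have eq: "finsum A (\<lambda>u. adj A (d u) \<otimes> d u) F = V \<ominus> Y" .
  have "Pos (V \<ominus> Y)" unfolding eq[symmetric] using F d by (intro Pos_finsum Pos_star_square)
  moreover have "Pos V" unfolding V_def using F v by (intro Pos_finsum Pos_star_square)
  moreover have "Pos Y" unfolding Y_def using y by (rule Pos_star_square)
  ultimately have "cnorm A Y \<le> cnorm A V" by (intro cnorm_mono) auto
  then show ?thesis using cstar_identity[OF y] by (simp add: Y_def V_def y_def)
qed

end

section \<open>Operators on $\ell^2(X)$\<close>

lemma ell2_support: "f \<in> ell2 X \<Longrightarrow> x \<notin> X \<Longrightarrow> f x = 0"
  by (simp add: ell2_def)

lemma L2_set_cmod_sq: "(L2_set (\<lambda>x. cmod (f x)) F)\<^sup>2 = (\<Sum>x\<in>F. (cmod (f x))\<^sup>2)"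
  by (simp add: L2_set_def sum_nonneg)

text \<open>All estimates are made on finite sets of coordinates, where \<open>L2_set\<close>
  already has the Minkowski and Hoelder inequalities; this lemma and \<open>ell2_norm_le\<close>
  pass them to the infinite sum.\<close>

lemma ell2I:
  assumes "\<And>x. x \<notin> X \<Longrightarrow> f x = 0"
    and "\<And>F. finite F \<Longrightarrow> F \<subseteq> X \<Longrightarrow> L2_set (\<lambda>x. cmod (f x)) F \<le> M"
  shows "f \<in> ell2 X"
proof -
  have "(\<lambda>x. (cmod (f x))\<^sup>2) summable_on X"
  proof (rule nonneg_bounded_partial_sums_imp_summable_on[of _ _ "M\<^sup>2"])
    have "(\<Sum>x\<in>F. (cmod (f x))\<^sup>2) \<le> M\<^sup>2" if "finite F" "F \<subseteq> X" for F
      unfolding L2_set_cmod_sq[symmetric] using assms(2)[OF that] by (intro power_mono) simp_all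
    then show "\<forall>\<^sub>F F in finite_subsets_at_top X. (\<Sum>x\<in>F. (cmod (f x))\<^sup>2) \<le> M\<^sup>2"
      by (auto intro: eventually_finite_subsets_at_top_weakI)
  qed simp
  then show ?thesis using assms(1) by (simp add: ell2_def)
qed

lemma ell2_norm_nonneg [simp]: "0 \<le> ell2_norm X f"
  by (simp add: ell2_norm_def infsum_nonneg)

lemma ell2_norm_sq: "(ell2_norm X f)\<^sup>2 = (\<Sum>\<^sub>\<infinity>x\<in>X. (cmod (f x))\<^sup>2)"
  by (simp add: ell2_norm_def infsum_nonneg)

lemma L2_set_le_ell2_norm:
  assumes "f \<in> ell2 X" "finite F" "F \<subseteq> X"
  shows "L2_set (\<lambda>x. cmod (f x)) F \<le> ell2_norm X f"
proof (rule power2_le_imp_le)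
  show "(L2_set (\<lambda>x. cmod (f x)) F)\<^sup>2 \<le> (ell2_norm X f)\<^sup>2"
    unfolding L2_set_cmod_sq ell2_norm_sq using assms by (intro finite_sum_le_infsum) (auto simp: ell2_def)
qed simp

lemma ell2_norm_le:
  assumes "f \<in> ell2 X" "0 \<le> M"
    and "\<And>F. finite F \<Longrightarrow> F \<subseteq> X \<Longrightarrow> L2_set (\<lambda>x. cmod (f x)) F \<le> M"
  shows "ell2_norm X f \<le> M"
proof (rule power2_le_imp_le[OF _ assms(2)])
  show "(ell2_norm X f)\<^sup>2 \<le> M\<^sup>2"
    unfolding ell2_norm_sq
  proof (rule infsum_le_finite_sums)
    show "(\<Sum>x\<in>F. (cmod (f x))\<^sup>2) \<le> M\<^sup>2" if "finite F" "F \<subseteq> X" for F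
      unfolding L2_set_cmod_sq[symmetric] using assms(3)[OF that] by (intro power_mono) simp_all
  qed (use assms(1) in \<open>simp add: ell2_def\<close>)
qed

lemma ell2_add_aux:
  assumes "f \<in> ell2 X" "g \<in> ell2 X" "finite F" "F \<subseteq> X"
  shows "L2_set (\<lambda>x. cmod (f x + g x)) F \<le> ell2_norm X f + ell2_norm X g"
proof -
  have "L2_set (\<lambda>x. cmod (f x + g x)) F \<le> L2_set (\<lambda>x. cmod (f x) + cmod (g x)) F"
    by (rule L2_set_mono) (auto intro: norm_triangle_ineq)
  also have "\<dots> \<le> L2_set (\<lambda>x. cmod (f x)) F + L2_set (\<lambda>x. cmod (g x)) F"
    by (rule L2_set_triangle_ineq)
  also have "\<dots> \<le> ell2_norm X f + ell2_norm X g"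
    using assms by (intro add_mono L2_set_le_ell2_norm)
  finally show ?thesis .
qed

lemma ell2_add [simp]: "f \<in> ell2 X \<Longrightarrow> g \<in> ell2 X \<Longrightarrow> (\<lambda>x. f x + g x) \<in> ell2 X"
  by (rule ell2I[OF _ ell2_add_aux]) (simp_all add: ell2_support)

lemma ell2_norm_add: "f \<in> ell2 X \<Longrightarrow> g \<in> ell2 X \<Longrightarrow> ell2_norm X (\<lambda>x. f x + g x) \<le> ell2_norm X f + ell2_norm X g"
  by (rule ell2_norm_le) (auto intro: ell2_add_aux add_nonneg_nonneg)

lemma ell2_scale_aux:
  assumes "f \<in> ell2 X" "finite F" "F \<subseteq> X"
  shows "L2_set (\<lambda>x. cmod (c * f x)) F \<le> cmod c * ell2_norm X f"
proof -
  have "L2_set (\<lambda>x. cmod (c * f x)) F = cmod c * L2_set (\<lambda>x. cmod (f x)) F"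
    by (simp add: norm_mult L2_set_right_distrib)
  then show ?thesis using L2_set_le_ell2_norm[OF assms] by (simp add: mult_left_mono)
qed

lemma ell2_scale [simp]: "f \<in> ell2 X \<Longrightarrow> (\<lambda>x. c * f x) \<in> ell2 X"
  by (rule ell2I[OF _ ell2_scale_aux]) (simp_all add: ell2_support)

lemma ell2_zero [simp]: "(\<lambda>_. 0) \<in> ell2 X"
  by (simp add: ell2_def)

lemma ell2_norm_zero [simp]: "ell2_norm X (\<lambda>_. 0) = 0"
  by (simp add: ell2_norm_def)

lemma ell2_norm_scale: "f \<in> ell2 X \<Longrightarrow> ell2_norm X (\<lambda>x. c * f x) = cmod c * ell2_norm X f"
  by (simp add: ell2_norm_def norm_mult power_mult_distrib real_sqrt_mult infsum_cmult_right')

lemma cmod_le_ell2_norm: "f \<in> ell2 X \<Longrightarrow> x \<in> X \<Longrightarrow> cmod (f x) \<le> ell2_norm X f"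
  using L2_set_le_ell2_norm[of f X "{x}"] by simp

lemma ell2_norm_eq_0: "f \<in> ell2 X \<Longrightarrow> ell2_norm X f = 0 \<Longrightarrow> f = (\<lambda>_. 0)"
  using cmod_le_ell2_norm[of f X] by (auto simp: fun_eq_iff ell2_support) (metis ell2_support norm_le_zero_iff)

subsection \<open>Inner product\<close>

lemma ell2_inner_aux:
  assumes "f \<in> ell2 X" "g \<in> ell2 X" "finite F" "F \<subseteq> X"
  shows "(\<Sum>x\<in>F. cmod (f x * cnj (g x))) \<le> ell2_norm X f * ell2_norm X g"
proof -
  have "(\<Sum>x\<in>F. cmod (f x * cnj (g x))) = (\<Sum>x\<in>F. \<bar>cmod (f x)\<bar> * \<bar>cmod (g x)\<bar>)"
    by (simp add: norm_mult)
  also have "\<dots> \<le> L2_set (\<lambda>x. cmod (f x)) F * L2_set (\<lambda>x. cmod (g x)) F" by (rule L2_set_mult_ineq)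
  also have "\<dots> \<le> ell2_norm X f * ell2_norm X g"
    using assms by (intro mult_mono L2_set_le_ell2_norm) auto
  finally show ?thesis .
qed

lemma ell2_inner_abs_summable:
  assumes "f \<in> ell2 X" "g \<in> ell2 X"
  shows "(\<lambda>x. cmod (f x * cnj (g x))) summable_on X"
proof (rule nonneg_bounded_partial_sums_imp_summable_on[of _ _ "ell2_norm X f * ell2_norm X g"])
  show "\<forall>\<^sub>F F in finite_subsets_at_top X. (\<Sum>x\<in>F. cmod (f x * cnj (g x))) \<le> ell2_norm X f * ell2_norm X g"
    using ell2_inner_aux[OF assms] by (auto intro: eventually_finite_subsets_at_top_weakI)
qed simp

lemma ell2_inner_summable: "f \<in> ell2 X \<Longrightarrow> g \<in> ell2 X \<Longrightarrow> (\<lambda>x. f x * cnj (g x)) summable_on X"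
  by (rule Infinite_Sum.abs_summable_summable) (rule ell2_inner_abs_summable)

lemma ell2_Cauchy_Schwarz:
  assumes "f \<in> ell2 X" "g \<in> ell2 X"
  shows "cmod (ell2_inner X f g) \<le> ell2_norm X f * ell2_norm X g"
proof -
  have "cmod (ell2_inner X f g) \<le> (\<Sum>\<^sub>\<infinity>x\<in>X. cmod (f x * cnj (g x)))"
    unfolding ell2_inner_def by (rule norm_infsum_bound[OF ell2_inner_abs_summable[OF assms]])
  also have "\<dots> \<le> ell2_norm X f * ell2_norm X g"
    by (rule infsum_le_finite_sums[OF ell2_inner_abs_summable[OF assms] ell2_inner_aux[OF assms]])
  finally show ?thesis .
qed

lemma ell2_inner_add_left:
  "\<lbrakk>f \<in> ell2 X; g \<in> ell2 X; h \<in> ell2 X\<rbrakk> \<Longrightarrow> ell2_inner X (\<lambda>x. f x + g x) h = ell2_inner X f h + ell2_inner X g h"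
  by (simp add: ell2_inner_def distrib_right infsum_add ell2_inner_summable)

lemma ell2_inner_scale_left:
  "ell2_inner X (\<lambda>x. c * f x) h = c * ell2_inner X f h"
  by (simp add: ell2_inner_def mult.assoc infsum_cmult_right')

lemma ell2_inner_commute: "ell2_inner X f g = cnj (ell2_inner X g f)"
  by (simp add: ell2_inner_def mult.commute flip: infsum_cnj)

lemma ell2_inner_add_right:
  "\<lbrakk>f \<in> ell2 X; g \<in> ell2 X; h \<in> ell2 X\<rbrakk> \<Longrightarrow> ell2_inner X h (\<lambda>x. f x + g x) = ell2_inner X h f + ell2_inner X h g"
  by (simp add: ell2_inner_add_left ell2_inner_commute[of X h])

lemma ell2_inner_scale_right:
  "ell2_inner X h (\<lambda>x. c * f x) = cnj c * ell2_inner X h f"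
  by (simp add: ell2_inner_scale_left ell2_inner_commute[of X h])

lemma ell2_inner_zero_right: "ell2_inner X h (\<lambda>_. 0) = 0"
  by (simp add: ell2_inner_def)

lemma ell2_inner_self:
  assumes "f \<in> ell2 X" shows "ell2_inner X f f = of_real ((ell2_norm X f)\<^sup>2)"
proof -
  have "(\<lambda>x. (cmod (f x))\<^sup>2) summable_on X" using assms by (simp add: ell2_def)
  then have "((\<lambda>x. complex_of_real ((cmod (f x))\<^sup>2)) has_sum of_real ((ell2_norm X f)\<^sup>2)) X"
    unfolding ell2_norm_sq has_sum_of_real_iff by (rule has_sum_infsum)
  then show ?thesis unfolding ell2_inner_def complex_norm_square[symmetric] of_real_power[symmetric]
    by (rule infsumI)
qed

definition ell2_basis :: "'i \<Rightarrow> 'i \<Rightarrow> complex" where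
  "ell2_basis x = (\<lambda>y. if y = x then 1 else 0)"

lemma ell2_finite_support:
  assumes "finite F" "F \<subseteq> X" "\<And>x. x \<notin> F \<Longrightarrow> f x = 0" shows "f \<in> ell2 X"
proof -
  have "{x \<in> X. (cmod (f x))\<^sup>2 \<noteq> 0} \<subseteq> F" using assms(3) by force
  then have "finite {x \<in> X. (cmod (f x))\<^sup>2 \<noteq> 0}" using assms(1) by (rule finite_subset)
  then show ?thesis unfolding ell2_def using assms(2,3) by (auto intro: finite_nonzero_values_imp_summable_on)
qed

lemma ell2_basis [simp]: "x \<in> X \<Longrightarrow> ell2_basis x \<in> ell2 X"
  by (rule ell2_finite_support[of "{x}"]) (auto simp: ell2_basis_def)

lemma ell2_inner_basis: "x \<in> X \<Longrightarrow> ell2_inner X f (ell2_basis x) = f x"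
proof -
  assume x: "x \<in> X"
  have "ell2_inner X f (ell2_basis x) = (\<Sum>\<^sub>\<infinity>y\<in>{x}. f y)"
    unfolding ell2_inner_def using x by (intro infsum_cong_neutral) (auto simp: ell2_basis_def)
  then show ?thesis by simp
qed

lemma ell2_eqI:
  assumes "f \<in> ell2 X" "g \<in> ell2 X" "\<And>h. h \<in> ell2 X \<Longrightarrow> ell2_inner X h f = ell2_inner X h g"
  shows "f = g"
proof
  fix x show "f x = g x"
  proof (cases "x \<in> X")
    case True
    then show ?thesis using assms(3)[of "ell2_basis x"] ell2_inner_basis[of x X]
      by (metis ell2_basis ell2_inner_commute complex_cnj_cnj)
  qed (use assms in \<open>simp add: ell2_support\<close>)
qed

definition ell2_restrict :: "'i set \<Rightarrow> ('i \<Rightarrow> complex) \<Rightarrow> 'i \<Rightarrow> complex" where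
  "ell2_restrict F f = (\<lambda>x. if x \<in> F then f x else 0)"

lemma ell2_tail:
  assumes f: "f \<in> ell2 X" and e: "e > 0"
  shows "\<exists>F. finite F \<and> F \<subseteq> X \<and> ell2_norm X (ell2_restrict (X - F) f) < e"
proof -
  let ?q = "\<lambda>x. (cmod (f x))\<^sup>2"
  have s: "?q summable_on X" using f by (simp add: ell2_def)
  obtain F where F: "finite F" "F \<subseteq> X" "dist (sum ?q F) (infsum ?q X) \<le> e\<^sup>2 / 2"
    using infsum_finite_approximation[OF s, of "e\<^sup>2 / 2"] e by auto
  moreover have "e\<^sup>2 / 2 < e\<^sup>2" using e by simp
  ultimately have d: "dist (sum ?q F) (infsum ?q X) < e\<^sup>2" by linarith
  have "infsum ?q X = infsum ?q F + infsum ?q (X - F)"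
    using infsum_Un_disjoint[of ?q F "X - F"] F s
    by (simp add: Un_absorb1 summable_on_subset_banach[OF s] summable_on_finite)
  then have "infsum ?q (X - F) < e\<^sup>2" using d F by (simp add: dist_real_def infsum_nonneg)
  moreover have "(ell2_norm X (ell2_restrict (X - F) f))\<^sup>2 = infsum ?q (X - F)"
    unfolding ell2_norm_sq by (rule infsum_cong_neutral) (auto simp: ell2_restrict_def)
  ultimately have "(ell2_norm X (ell2_restrict (X - F) f))\<^sup>2 < e\<^sup>2" by simp
  then have "ell2_norm X (ell2_restrict (X - F) f) < e" by (rule power2_less_imp_less) (use e in simp)
  then show ?thesis using F by blast
qed

subsection \<open>Bounded operators\<close>

lemma bounded_opsD:
  assumes "T \<in> bounded_ops X"
  shows "f \<in> ell2 X \<Longrightarrow> T f \<in> ell2 X" "T \<in> extensional (ell2 X)"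
    "f \<in> ell2 X \<Longrightarrow> g \<in> ell2 X \<Longrightarrow> T (\<lambda>x. f x + g x) = (\<lambda>x. T f x + T g x)"
    "f \<in> ell2 X \<Longrightarrow> T (\<lambda>x. c * f x) = (\<lambda>x. c * T f x)"
  using assms by (auto simp: bounded_ops_def PiE_def)

lemma bounded_opsI:
  assumes "T \<in> extensional (ell2 X)" "\<And>f. f \<in> ell2 X \<Longrightarrow> T f \<in> ell2 X"
    and "\<And>f g. f \<in> ell2 X \<Longrightarrow> g \<in> ell2 X \<Longrightarrow> T (\<lambda>x. f x + g x) = (\<lambda>x. T f x + T g x)"
    and "\<And>c f. f \<in> ell2 X \<Longrightarrow> T (\<lambda>x. c * f x) = (\<lambda>x. c * T f x)"
    and "\<And>f. f \<in> ell2 X \<Longrightarrow> ell2_norm X (T f) \<le> M * ell2_norm X f"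
  shows "T \<in> bounded_ops X"
  unfolding bounded_ops_def using assms(1-4) by (auto simp: PiE_def intro!: exI[of _ M] assms(5))

lemma bounded_ops_eqI:
  "S \<in> bounded_ops X \<Longrightarrow> T \<in> bounded_ops X \<Longrightarrow> (\<And>f. f \<in> ell2 X \<Longrightarrow> S f = T f) \<Longrightarrow> S = T"
  by (rule extensionalityI[of _ "ell2 X"]) (auto dest: bounded_opsD)

lemma ell2_operators_simps:
  "carrier (ell2_operators X) = bounded_ops X"
  "mult (ell2_operators X) S T = (\<lambda>f\<in>ell2 X. S (T f))"
  "one (ell2_operators X) = (\<lambda>f\<in>ell2 X. f)"
  "zero (ell2_operators X) = (\<lambda>f\<in>ell2 X. (\<lambda>_. 0))"
  "add (ell2_operators X) S T = (\<lambda>f\<in>ell2 X. (\<lambda>x. S f x + T f x))"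
  "smult (ell2_operators X) c T = (\<lambda>f\<in>ell2 X. (\<lambda>x. c * T f x))"
  by (simp_all add: ell2_operators_def)

abbreviation opnorm :: "'i set \<Rightarrow> (('i \<Rightarrow> complex) \<Rightarrow> 'i \<Rightarrow> complex) \<Rightarrow> real" where
  "opnorm X \<equiv> cnorm (ell2_operators X)"

lemma opnorm_def': "opnorm X T = Inf {M. 0 \<le> M \<and> (\<forall>f\<in>ell2 X. ell2_norm X (T f) \<le> M * ell2_norm X f)}"
  by (simp add: ell2_operators_def)

lemma opnorm_le:
  "0 \<le> M \<Longrightarrow> (\<And>f. f \<in> ell2 X \<Longrightarrow> ell2_norm X (T f) \<le> M * ell2_norm X f) \<Longrightarrow> opnorm X T \<le> M"
  unfolding opnorm_def' by (intro cInf_lower bdd_belowI[of _ 0]) auto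

context
  fixes T :: "('i \<Rightarrow> complex) \<Rightarrow> 'i \<Rightarrow> complex" and X
  assumes T: "T \<in> bounded_ops X"
begin

lemma bounded_ops_bound: "\<exists>M\<ge>0. \<forall>f\<in>ell2 X. ell2_norm X (T f) \<le> M * ell2_norm X f"
proof -
  obtain M where M: "\<forall>f\<in>ell2 X. ell2_norm X (T f) \<le> M * ell2_norm X f"
    using T by (auto simp: bounded_ops_def)
  have "ell2_norm X (T f) \<le> \<bar>M\<bar> * ell2_norm X f" if "f \<in> ell2 X" for f
    using M that mult_right_mono[of M "\<bar>M\<bar>" "ell2_norm X f"] by force
  then show ?thesis by (intro exI[of _ "\<bar>M\<bar>"]) auto
qed

lemma opnorm_nonneg: "0 \<le> opnorm X T"
  unfolding opnorm_def' using bounded_ops_bound by (intro cInf_greatest) auto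

lemma opnorm_apply:
  assumes f: "f \<in> ell2 X" shows "ell2_norm X (T f) \<le> opnorm X T * ell2_norm X f"
proof (cases "ell2_norm X f = 0")
  case True
  then show ?thesis using bounded_ops_bound f by fastforce
next
  case False
  then have p: "ell2_norm X f > 0" by (simp add: less_le)
  have "ell2_norm X (T f) / ell2_norm X f \<le> opnorm X T"
    unfolding opnorm_def' using bounded_ops_bound f p by (intro cInf_greatest) (auto simp: field_simps)
  then show ?thesis using p by (simp add: field_simps)
qed

end

lemma ell2_op_mult [simp]:
  "S \<in> bounded_ops X \<Longrightarrow> T \<in> bounded_ops X \<Longrightarrow> (\<lambda>f\<in>ell2 X. S (T f)) \<in> bounded_ops X"
  and opnorm_mult_le: "S \<in> bounded_ops X \<Longrightarrow> T \<in> bounded_ops X \<Longrightarrow> opnorm X (\<lambda>f\<in>ell2 X. S (T f)) \<le> opnorm X S * opnorm X T"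
proof -
  assume ST: "S \<in> bounded_ops X" "T \<in> bounded_ops X"
  have b: "ell2_norm X (S (T f)) \<le> opnorm X S * opnorm X T * ell2_norm X f" if "f \<in> ell2 X" for f
    using opnorm_apply[OF ST(1) bounded_opsD(1)[OF ST(2) that]] opnorm_apply[OF ST(2) that]
      mult_left_mono[OF opnorm_apply[OF ST(2) that] opnorm_nonneg[OF ST(1)]] by (simp add: mult.assoc)
  then show "(\<lambda>f\<in>ell2 X. S (T f)) \<in> bounded_ops X"
    by (intro bounded_opsI) (auto simp: bounded_opsD[OF ST(1)] bounded_opsD[OF ST(2)])
  show "opnorm X (\<lambda>f\<in>ell2 X. S (T f)) \<le> opnorm X S * opnorm X T"
    using b ST by (intro opnorm_le) (auto simp: opnorm_nonneg)
qed

lemma ell2_op_add [simp]: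
  "S \<in> bounded_ops X \<Longrightarrow> T \<in> bounded_ops X \<Longrightarrow> (\<lambda>f\<in>ell2 X. \<lambda>x. S f x + T f x) \<in> bounded_ops X"
  and opnorm_add_le: "S \<in> bounded_ops X \<Longrightarrow> T \<in> bounded_ops X \<Longrightarrow>
    opnorm X (\<lambda>f\<in>ell2 X. \<lambda>x. S f x + T f x) \<le> opnorm X S + opnorm X T"
proof -
  assume ST: "S \<in> bounded_ops X" "T \<in> bounded_ops X"
  have b: "ell2_norm X (\<lambda>x. S f x + T f x) \<le> (opnorm X S + opnorm X T) * ell2_norm X f" if "f \<in> ell2 X" for f
    using opnorm_apply[OF ST(1) that] opnorm_apply[OF ST(2) that]
      ell2_norm_add[OF bounded_opsD(1)[OF ST(1) that] bounded_opsD(1)[OF ST(2) that]]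
    by (simp add: distrib_right)
  then show "(\<lambda>f\<in>ell2 X. \<lambda>x. S f x + T f x) \<in> bounded_ops X"
    by (intro bounded_opsI[of _ _ "opnorm X S + opnorm X T"])
      (auto simp: bounded_opsD[OF ST(1)] bounded_opsD[OF ST(2)] fun_eq_iff algebra_simps)
  show "opnorm X (\<lambda>f\<in>ell2 X. \<lambda>x. S f x + T f x) \<le> opnorm X S + opnorm X T"
    using b ST by (intro opnorm_le) (auto simp: opnorm_nonneg)
qed

lemma ell2_op_smult [simp]:
  "T \<in> bounded_ops X \<Longrightarrow> (\<lambda>f\<in>ell2 X. \<lambda>x. c * T f x) \<in> bounded_ops X"
  by (rule bounded_opsI[of _ _ "cmod c * opnorm X T"])
    (auto simp: bounded_opsD ell2_norm_scale fun_eq_iff distrib_left mult.left_commute mult.assoc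
      intro!: mult_left_mono opnorm_apply)

lemma ell2_op_one [simp]: "(\<lambda>f\<in>ell2 X. f) \<in> bounded_ops X"
  by (rule bounded_opsI[of _ _ 1]) auto

lemma ell2_op_zero [simp]: "(\<lambda>f\<in>ell2 X. (\<lambda>_. 0)) \<in> bounded_ops X"
  by (rule bounded_opsI[of _ _ 0]) auto

text \<open>The property under the \<open>THE\<close> in \<open>ell2_operators\<close>, named so
  that existence and uniqueness can be settled before \<open>adj\<close> is used.\<close>

definition is_adj :: "'i set \<Rightarrow> (('i \<Rightarrow> complex) \<Rightarrow> 'i \<Rightarrow> complex) \<Rightarrow> (('i \<Rightarrow> complex) \<Rightarrow> 'i \<Rightarrow> complex) \<Rightarrow> bool" where
  "is_adj X T S \<longleftrightarrow> S \<in> bounded_ops X \<and>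
     (\<forall>f\<in>ell2 X. \<forall>g\<in>ell2 X. ell2_inner X (T f) g = ell2_inner X f (S g))"

lemma is_adj_unique: "is_adj X T S \<Longrightarrow> is_adj X T S' \<Longrightarrow> S = S'"
proof (rule bounded_ops_eqI)
  assume a: "is_adj X T S" "is_adj X T S'"
  fix g assume "g \<in> ell2 X"
  then show "S g = S' g" using a by (intro ell2_eqI) (auto simp: is_adj_def bounded_opsD)
qed (auto simp: is_adj_def)

lemma adj_eqI: "is_adj X T S \<Longrightarrow> adj (ell2_operators X) T = S"
  unfolding ell2_operators_def is_adj_def[symmetric] by (simp, rule the_equality) (auto intro: is_adj_unique)

lemma ell2_truncation:
  assumes T: "T \<in> bounded_ops X" and F: "finite F" "F \<subseteq> X"
  shows "ell2_restrict F f \<in> ell2 X"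
    and "g \<in> ell2 X \<Longrightarrow> ell2_inner X g (T (ell2_restrict F f)) = (\<Sum>x\<in>F. cnj (f x) * ell2_inner X g (T (ell2_basis x)))"
proof -
  have mem: "ell2_restrict F f \<in> ell2 X" if "finite F" "F \<subseteq> X" for F
    using that by (intro ell2_finite_support[of F]) (auto simp: ell2_restrict_def)
  then show "ell2_restrict F f \<in> ell2 X" using F by simp
  assume g: "g \<in> ell2 X"
  have T0: "T (\<lambda>_. 0) = (\<lambda>_. 0)" using bounded_opsD(4)[OF T ell2_zero, of 0] by simp
  show "ell2_inner X g (T (ell2_restrict F f)) = (\<Sum>x\<in>F. cnj (f x) * ell2_inner X g (T (ell2_basis x)))"
    using F
  proof (induction F rule: finite_induct)
    case empty
    have "ell2_restrict {} f = (\<lambda>_. 0)" by (simp add: ell2_restrict_def)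
    then show ?case by (simp add: T0 ell2_inner_zero_right)
  next
    case (insert a F)
    have "ell2_restrict (insert a F) f = (\<lambda>x. ell2_restrict F f x + f a * ell2_basis a x)"
      using insert by (auto simp: ell2_restrict_def ell2_basis_def fun_eq_iff)
    then have "T (ell2_restrict (insert a F) f) = (\<lambda>x. T (ell2_restrict F f) x + f a * T (ell2_basis a) x)"
      using insert mem[of F] by (simp add: bounded_opsD[OF T])
    then have "ell2_inner X g (T (ell2_restrict (insert a F) f)) =
        ell2_inner X g (T (ell2_restrict F f)) + cnj (f a) * ell2_inner X g (T (ell2_basis a))"
      using insert mem[of F] g by (simp add: ell2_inner_add_right ell2_inner_scale_right bounded_opsD[OF T])
    then show ?case using insert by simp
  qed
qed

text \<open>The adjoint is given by its matrix coefficients.\<close>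

lemma is_adj_exists:
  assumes T: "T \<in> bounded_ops X" shows "\<exists>S. is_adj X T S"
proof -
  define c where "c g x = (if x \<in> X then ell2_inner X g (T (ell2_basis x)) else 0)" for g x
  \<comment> \<open>Duality on a finite set: testing T against the truncated coefficient vector h
    gives the square of its norm n on one side and at most
    \<open>opnorm X T * ell2_norm X g * n\<close> on the other.\<close>
  have bd: "L2_set (\<lambda>x. cmod (c g x)) F \<le> opnorm X T * ell2_norm X g"
    if g: "g \<in> ell2 X" and F: "finite F" "F \<subseteq> X" for g F
  proof -
    define h where "h = ell2_restrict F (c g)"
    define n where "n = L2_set (\<lambda>x. cmod (c g x)) F"
    have h: "h \<in> ell2 X" using ell2_truncation(1)[OF T F] by (simp add: h_def)
    have hn: "ell2_norm X h = n"
    proof -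
      have "(ell2_norm X h)\<^sup>2 = (\<Sum>\<^sub>\<infinity>x\<in>F. (cmod (c g x))\<^sup>2)"
        unfolding ell2_norm_sq h_def using F by (intro infsum_cong_neutral) (auto simp: ell2_restrict_def)
      also have "\<dots> = n\<^sup>2" using F by (simp add: n_def L2_set_cmod_sq)
      finally show ?thesis by (simp add: n_def power2_eq_iff_nonneg)
    qed
    have "ell2_inner X g (T h) = (\<Sum>x\<in>F. cnj (c g x) * c g x)"
      unfolding h_def using ell2_truncation(2)[OF T F g] F by (simp add: c_def subset_iff)
    also have "\<dots> = of_real (n\<^sup>2)"
      unfolding n_def L2_set_cmod_sq of_real_sum
      by (intro sum.cong refl) (metis complex_norm_square mult.commute)
    finally have "n\<^sup>2 = cmod (ell2_inner X g (T h))" by (simp add: norm_power)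
    also have "\<dots> \<le> ell2_norm X g * (opnorm X T * n)"
      using ell2_Cauchy_Schwarz[OF g bounded_opsD(1)[OF T h]] opnorm_apply[OF T h] hn
        mult_left_mono[of "ell2_norm X (T h)" "opnorm X T * n" "ell2_norm X g"] by simp
    finally have "n * n \<le> (opnorm X T * ell2_norm X g) * n" by (simp add: power2_eq_square mult_ac)
    moreover have "0 \<le> n" by (simp add: n_def)
    ultimately show ?thesis unfolding n_def[symmetric]
      by (cases "n = 0") (auto simp: opnorm_nonneg[OF T] mult_le_cancel_right)
  qed
  have cin: "c g \<in> ell2 X" if "g \<in> ell2 X" for g
    by (rule ell2I[OF _ bd[OF that]]) (auto simp: c_def)
  have cn: "ell2_norm X (c g) \<le> opnorm X T * ell2_norm X g" if "g \<in> ell2 X" for g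
    by (rule ell2_norm_le[OF cin[OF that] _ bd[OF that]]) (auto simp: opnorm_nonneg[OF T])
  have S: "(\<lambda>g\<in>ell2 X. c g) \<in> bounded_ops X"
  proof (rule bounded_opsI[of _ _ "opnorm X T"])
    show "(\<lambda>g\<in>ell2 X. c g) (\<lambda>x. f x + g x) = (\<lambda>x. (\<lambda>g\<in>ell2 X. c g) f x + (\<lambda>g\<in>ell2 X. c g) g x)"
      if "f \<in> ell2 X" "g \<in> ell2 X" for f g
      using that by (auto simp: c_def fun_eq_iff ell2_inner_add_left bounded_opsD[OF T])
    show "(\<lambda>g\<in>ell2 X. c g) (\<lambda>x. d * f x) = (\<lambda>x. d * (\<lambda>g\<in>ell2 X. c g) f x)" if "f \<in> ell2 X" for d f
      using that by (auto simp: c_def fun_eq_iff ell2_inner_scale_left)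
  qed (use cin cn in auto)
  have "ell2_inner X (T f) g = ell2_inner X f (c g)" if f: "f \<in> ell2 X" and g: "g \<in> ell2 X" for f g
  proof -
    define C where "C = opnorm X T * ell2_norm X g + ell2_norm X (c g)"
    have C: "0 \<le> C" by (simp add: C_def opnorm_nonneg[OF T])
    have "cmod (ell2_inner X (T f) g - ell2_inner X f (c g)) \<le> e" if e: "e > 0" for e
    proof -
      \<comment> \<open>On the finite part u the identity is exact; the tail v costs at most C times
        its norm. The denominator is C + 1 because C may be 0.\<close>
      obtain F where F: "finite F" "F \<subseteq> X" and tl: "ell2_norm X (ell2_restrict (X - F) f) < e / (C + 1)"
        using ell2_tail[OF f, of "e / (C + 1)"] e C by auto
      define u v where "u = ell2_restrict F f" and "v = ell2_restrict (X - F) f"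
      have u: "u \<in> ell2 X" using ell2_truncation(1)[OF T F] by (simp add: u_def)
      have fuv: "f = (\<lambda>x. u x + v x)"
        using ell2_support[OF f] F by (auto simp: u_def v_def ell2_restrict_def fun_eq_iff)
      have "v = (\<lambda>x. f x + (-1) * u x)" by (simp add: fuv)
      then have v: "v \<in> ell2 X" using f u ell2_add[OF f ell2_scale[OF u]] by metis
      have Tf: "ell2_inner X (T f) g = ell2_inner X (T u) g + ell2_inner X (T v) g"
        by (subst fuv) (simp add: bounded_opsD[OF T] u v ell2_inner_add_left g)
      have fc: "ell2_inner X f (c g) = ell2_inner X u (c g) + ell2_inner X v (c g)"
        by (subst fuv) (simp add: u v ell2_inner_add_left cin[OF g])
      have "ell2_inner X (T u) g = cnj (ell2_inner X g (T u))" by (rule ell2_inner_commute)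
      also have "\<dots> = (\<Sum>x\<in>F. f x * cnj (c g x))"
        unfolding u_def ell2_truncation(2)[OF T F g] using F by (simp add: c_def subset_iff)
      also have "\<dots> = ell2_inner X u (c g)"
      proof -
        have "ell2_inner X u (c g) = (\<Sum>\<^sub>\<infinity>x\<in>F. f x * cnj (c g x))"
          unfolding ell2_inner_def u_def using F by (intro infsum_cong_neutral) (auto simp: ell2_restrict_def)
        then show ?thesis using F by simp
      qed
      finally have "ell2_inner X (T f) g - ell2_inner X f (c g) = ell2_inner X (T v) g - ell2_inner X v (c g)"
        unfolding Tf fc by simp
      also have "cmod \<dots> \<le> ell2_norm X (T v) * ell2_norm X g + ell2_norm X v * ell2_norm X (c g)"
        using norm_triangle_ineq4[of "ell2_inner X (T v) g" "ell2_inner X v (c g)"]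
          ell2_Cauchy_Schwarz[OF bounded_opsD(1)[OF T v] g] ell2_Cauchy_Schwarz[OF v cin[OF g]] by linarith
      also have "\<dots> \<le> C * ell2_norm X v"
        using mult_right_mono[OF opnorm_apply[OF T v], of "ell2_norm X g"]
        by (simp add: C_def algebra_simps)
      also have "\<dots> \<le> C * (e / (C + 1))" using tl C by (intro mult_left_mono) (auto simp: v_def)
      also have "\<dots> \<le> e" using C e by (simp add: field_simps)
      finally show ?thesis .
    qed
    then have "cmod (ell2_inner X (T f) g - ell2_inner X f (c g)) \<le> 0" by (rule field_le_epsilon[of _ 0, simplified])
    then show ?thesis by simp
  qed
  then show ?thesis using S by (intro exI[of _ "\<lambda>g\<in>ell2 X. c g"]) (simp add: is_adj_def)
qed

lemma is_adj_adj: "T \<in> bounded_ops X \<Longrightarrow> is_adj X T (adj (ell2_operators X) T)"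
  using is_adj_exists[of T X] adj_eqI[of X T] by auto

lemma bounded_ops_restrict_eqI:
  "T \<in> bounded_ops X \<Longrightarrow> (\<And>f. f \<in> ell2 X \<Longrightarrow> g f = T f) \<Longrightarrow> (\<lambda>f\<in>ell2 X. g f) = T"
  using bounded_opsD(2)[of T X] by (auto simp: fun_eq_iff restrict_def extensional_def)

text \<open>Each coordinate of \<open>s n f\<close> is a Cauchy sequence. The uniform bound on
  differences survives the limit on every finite set of coordinates, hence in the whole norm.
  Differences are written with the factor -1, as in \<open>unital_cstar_algebraI\<close>.\<close>

lemma ell2_ops_complete:
  fixes s :: "nat \<Rightarrow> ('i \<Rightarrow> complex) \<Rightarrow> 'i \<Rightarrow> complex"
  assumes s: "\<And>n. s n \<in> bounded_ops X"
    and c: "\<And>e. e > 0 \<Longrightarrow> \<exists>N. \<forall>m\<ge>N. \<forall>n\<ge>N. opnorm X (\<lambda>f\<in>ell2 X. \<lambda>x. s m f x + (-1) * s n f x) < e"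
  shows "\<exists>T\<in>bounded_ops X. (\<lambda>n. opnorm X (\<lambda>f\<in>ell2 X. \<lambda>x. s n f x + (-1) * T f x)) \<longlonglongrightarrow> 0"
proof -
  define d where "d m n = (\<lambda>f\<in>ell2 X. \<lambda>x. s m f x + (-1) * s n f x)" for m n
  have d: "d m n \<in> bounded_ops X" for m n
  proof -
    have "(\<lambda>f\<in>ell2 X. \<lambda>x. s m f x + (\<lambda>f\<in>ell2 X. \<lambda>x. (-1) * s n f x) f x) \<in> bounded_ops X"
      using s by (intro ell2_op_add ell2_op_smult)
    moreover have "(\<lambda>f\<in>ell2 X. \<lambda>x. s m f x + (\<lambda>f\<in>ell2 X. \<lambda>x. (-1) * s n f x) f x) = d m n"
      by (auto simp: d_def fun_eq_iff restrict_def)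
    ultimately show ?thesis by simp
  qed
  note S = bounded_opsD[OF s]
  have c: "\<exists>N. \<forall>m\<ge>N. \<forall>n\<ge>N. opnorm X (d m n) < e" if "e > 0" for e
    using c[OF that] by (simp add: d_def)
  have dl: "L2_set (\<lambda>x. cmod (s m f x - s n f x)) F \<le> e * ell2_norm X f"
    if "f \<in> ell2 X" "finite F" "F \<subseteq> X" "opnorm X (d m n) < e" for m n f F e
  proof -
    have "L2_set (\<lambda>x. cmod (s m f x - s n f x)) F = L2_set (\<lambda>x. cmod (d m n f x)) F"
      using that(1) by (simp add: d_def)
    also have "\<dots> \<le> ell2_norm X (d m n f)"
      using that by (intro L2_set_le_ell2_norm bounded_opsD(1)[OF d])
    also have "\<dots> \<le> opnorm X (d m n) * ell2_norm X f" using that by (intro opnorm_apply[OF d])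
    also have "\<dots> \<le> e * ell2_norm X f" using that by (intro mult_right_mono) auto
    finally show ?thesis .
  qed
  have conv: "convergent (\<lambda>n. s n f x)" if f: "f \<in> ell2 X" for f x
  proof (cases "x \<in> X")
    case False
    then have "s n f x = 0" for n using S(1)[OF f, of n] by (simp add: ell2_support)
    then show ?thesis by (simp add: convergent_const)
  next
    case True
    have "Cauchy (\<lambda>n. s n f x)"
    proof (rule CauchyI)
      fix e :: real assume e: "e > 0"
      define e' where "e' = e / (ell2_norm X f + 1)"
      have e': "e' > 0" "e' * ell2_norm X f < e" using e by (simp_all add: e'_def field_simps add_pos_nonneg)
      obtain N where N: "\<forall>m\<ge>N. \<forall>n\<ge>N. opnorm X (d m n) < e'" using c[OF e'(1)] by blast
      have "norm (s m f x - s n f x) < e" if "m \<ge> N" "n \<ge> N" for m n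
        using dl[OF f, of "{x}" m n e'] N that True e'(2) by simp
      then show "\<exists>M. \<forall>m\<ge>M. \<forall>n\<ge>M. norm (s m f x - s n f x) < e" by blast
    qed
    then show ?thesis by (rule Cauchy_convergent)
  qed
  define L where "L f x = lim (\<lambda>n. s n f x)" for f x
  have L: "(\<lambda>n. s n f x) \<longlonglongrightarrow> L f x" if "f \<in> ell2 X" for f x
    using conv[OF that] by (simp add: L_def convergent_LIMSEQ_iff)
  have Ls: "L f x = 0" if "f \<in> ell2 X" "x \<notin> X" for f x
  proof -
    have "s n f x = 0" for n using S(1)[OF that(1), of n] that(2) by (simp add: ell2_support)
    then show ?thesis using L[OF that(1), of x] by (simp add: LIMSEQ_const_iff)
  qed
  have lim: "L2_set (\<lambda>x. cmod (s m f x - L f x)) F \<le> e * ell2_norm X f"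
    if N: "\<forall>m\<ge>N. \<forall>n\<ge>N. opnorm X (d m n) < e" "m \<ge> N" and f: "f \<in> ell2 X" "finite F" "F \<subseteq> X" for N m f F e
  proof (rule LIMSEQ_le_const2)
    show "(\<lambda>n. L2_set (\<lambda>x. cmod (s m f x - s n f x)) F) \<longlonglongrightarrow> L2_set (\<lambda>x. cmod (s m f x - L f x)) F"
      unfolding L2_set_def by (intro tendsto_intros L f)
    show "\<exists>M. \<forall>n\<ge>M. L2_set (\<lambda>x. cmod (s m f x - s n f x)) F \<le> e * ell2_norm X f"
      using dl[OF f] N by blast
  qed
  have diff: "(\<lambda>x. s m f x - L f x) \<in> ell2 X" "ell2_norm X (\<lambda>x. s m f x - L f x) \<le> e * ell2_norm X f"
    if N: "\<forall>m\<ge>N. \<forall>n\<ge>N. opnorm X (d m n) < e" "m \<ge> N" and e: "e > 0" and f: "f \<in> ell2 X" for N m f e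
  proof -
    show "(\<lambda>x. s m f x - L f x) \<in> ell2 X"
      by (rule ell2I[OF _ lim[OF N f]]) (simp add: Ls f ell2_support[OF S(1)[OF f]])
    then show "ell2_norm X (\<lambda>x. s m f x - L f x) \<le> e * ell2_norm X f"
      by (rule ell2_norm_le[OF _ _ lim[OF N f]]) (use e in auto)
  qed
  obtain N where N: "\<forall>m\<ge>N. \<forall>n\<ge>N. opnorm X (d m n) < 1" using c[of 1] by auto
  have Leq: "L f = (\<lambda>x. s N f x + (-1) * (s N f x - L f x))" for f by (simp add: fun_eq_iff)
  have Lin: "L f \<in> ell2 X" if f: "f \<in> ell2 X" for f
    by (subst Leq) (intro ell2_add ell2_scale S(1) f diff(1)[OF N order_refl] zero_less_one)
  have Ln: "ell2_norm X (L f) \<le> (opnorm X (s N) + 1) * ell2_norm X f" if f: "f \<in> ell2 X" for f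
  proof -
    have "ell2_norm X (L f) \<le> ell2_norm X (s N f) + ell2_norm X (\<lambda>x. (-1) * (s N f x - L f x))"
      by (subst Leq) (intro ell2_norm_add ell2_scale S(1) f diff(1)[OF N order_refl] zero_less_one)
    also have "\<dots> = ell2_norm X (s N f) + ell2_norm X (\<lambda>x. s N f x - L f x)"
      using ell2_norm_scale[OF diff(1)[OF N order_refl zero_less_one f], of "-1"] by simp
    also have "\<dots> \<le> (opnorm X (s N) + 1) * ell2_norm X f"
      using opnorm_apply[OF s f, of N] diff(2)[OF N order_refl zero_less_one f] by (simp add: distrib_right)
    finally show ?thesis .
  qed
  define T where "T = (\<lambda>f\<in>ell2 X. L f)"
  have T: "T \<in> bounded_ops X"
  proof (rule bounded_opsI[of _ _ "opnorm X (s N) + 1"])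
    show "T (\<lambda>x. f x + g x) = (\<lambda>x. T f x + T g x)" if fg: "f \<in> ell2 X" "g \<in> ell2 X" for f g
    proof
      fix x
      have "(\<lambda>n. s n (\<lambda>x. f x + g x) x) \<longlonglongrightarrow> L f x + L g x"
        using tendsto_add[OF L[OF fg(1)] L[OF fg(2)]] by (simp add: S(3)[OF fg])
      then have "L (\<lambda>x. f x + g x) x = L f x + L g x"
        using L[OF ell2_add[OF fg]] by (rule LIMSEQ_unique[symmetric])
      then show "T (\<lambda>x. f x + g x) x = T f x + T g x" using fg by (simp add: T_def)
    qed
    show "T (\<lambda>x. a * f x) = (\<lambda>x. a * T f x)" if f: "f \<in> ell2 X" for a f
    proof
      fix x
      have "(\<lambda>n. s n (\<lambda>x. a * f x) x) \<longlonglongrightarrow> a * L f x"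
        using tendsto_mult_left[OF L[OF f]] by (simp add: S(4)[OF f])
      then have "L (\<lambda>x. a * f x) x = a * L f x"
        using L[OF ell2_scale[OF f]] by (rule LIMSEQ_unique[symmetric])
      then show "T (\<lambda>x. a * f x) x = a * T f x" using f by (simp add: T_def)
    qed
  qed (auto simp: T_def Lin Ln)
  have "(\<lambda>n. opnorm X (\<lambda>f\<in>ell2 X. \<lambda>x. s n f x + (-1) * T f x)) \<longlonglongrightarrow> 0"
  proof (rule LIMSEQ_I)
    fix e :: real assume e: "e > 0"
    obtain N where N: "\<forall>m\<ge>N. \<forall>n\<ge>N. opnorm X (d m n) < e / 2" using c[of "e/2"] e by auto
    have le: "opnorm X (\<lambda>f\<in>ell2 X. \<lambda>x. s m f x + (-1) * T f x) \<le> e / 2" if "m \<ge> N" for m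
      using diff(2)[OF N that] e by (intro opnorm_le) (auto simp: T_def)
    have "opnorm X (\<lambda>f\<in>ell2 X. \<lambda>x. s m f x + (-1) * T f x) \<ge> 0" for m
    proof -
      have "(\<lambda>f\<in>ell2 X. \<lambda>x. s m f x + (-1) * T f x) = (\<lambda>f\<in>ell2 X. \<lambda>x. s m f x + (\<lambda>f\<in>ell2 X. \<lambda>x. (-1) * T f x) f x)"
        by (auto simp: fun_eq_iff restrict_def)
      also have "\<dots> \<in> bounded_ops X" by (intro ell2_op_add ell2_op_smult s T)
      finally show ?thesis by (rule opnorm_nonneg)
    qed
    then show "\<exists>no. \<forall>n\<ge>no. norm (opnorm X (\<lambda>f\<in>ell2 X. \<lambda>x. s n f x + (-1) * T f x) - 0) < e"
      using le e by (intro exI[of _ N]) fastforce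
  qed
  then show ?thesis using T by blast
qed

context
  fixes X :: "'i set"
begin

abbreviation (input) "ad \<equiv> adj (ell2_operators X)"

lemma ad_in [simp]: "T \<in> bounded_ops X \<Longrightarrow> ad T \<in> bounded_ops X"
  using is_adj_adj by (auto simp: is_adj_def)

lemma ad_inner: "\<lbrakk>T \<in> bounded_ops X; f \<in> ell2 X; g \<in> ell2 X\<rbrakk> \<Longrightarrow> ell2_inner X (T f) g = ell2_inner X f (ad T g)"
  using is_adj_adj[of T X] by (auto simp: is_adj_def)

lemma ad_inner': "\<lbrakk>T \<in> bounded_ops X; f \<in> ell2 X; g \<in> ell2 X\<rbrakk> \<Longrightarrow> ell2_inner X (ad T f) g = ell2_inner X f (T g)"
  using ad_inner[of T g f] by (metis ell2_inner_commute)

lemma opnorm_ad_le: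
  assumes T: "T \<in> bounded_ops X" shows "opnorm X (ad T) \<le> opnorm X T"
proof (rule opnorm_le)
  fix g assume g: "g \<in> ell2 X"
  have h: "ad T g \<in> ell2 X" using bounded_opsD(1)[OF ad_in[OF T] g] .
  define n where "n = ell2_norm X (ad T g)"
  have "n\<^sup>2 = cmod (ell2_inner X (ad T g) (ad T g))" using ell2_inner_self[OF h] by (simp add: n_def norm_power)
  also have "\<dots> = cmod (ell2_inner X (T (ad T g)) g)" using ad_inner[OF T h g] by simp
  also have "\<dots> \<le> ell2_norm X (T (ad T g)) * ell2_norm X g"
    by (intro ell2_Cauchy_Schwarz bounded_opsD(1)[OF T] h g)
  also have "\<dots> \<le> opnorm X T * n * ell2_norm X g"
    unfolding n_def by (intro mult_right_mono opnorm_apply T h) auto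
  finally have "n * n \<le> (opnorm X T * ell2_norm X g) * n" by (simp add: power2_eq_square mult_ac)
  moreover have "0 \<le> n" by (simp add: n_def)
  ultimately show "ell2_norm X (ad T g) \<le> opnorm X T * ell2_norm X g" unfolding n_def[symmetric]
    by (cases "n = 0") (auto simp: opnorm_nonneg[OF T] mult_le_cancel_right)
qed (rule opnorm_nonneg[OF T])

lemma opnorm_cstar:
  assumes T: "T \<in> bounded_ops X" shows "opnorm X (\<lambda>f\<in>ell2 X. ad T (T f)) = (opnorm X T)\<^sup>2"
proof (rule antisym)
  have "opnorm X (\<lambda>f\<in>ell2 X. ad T (T f)) \<le> opnorm X (ad T) * opnorm X T"
    using T by (intro opnorm_mult_le) auto
  also have "\<dots> \<le> opnorm X T * opnorm X T" using opnorm_ad_le[OF T] opnorm_nonneg[OF T] by (rule mult_right_mono)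
  finally show "opnorm X (\<lambda>f\<in>ell2 X. ad T (T f)) \<le> (opnorm X T)\<^sup>2" by (simp add: power2_eq_square)
  define M where "M = opnorm X (\<lambda>f\<in>ell2 X. ad T (T f))"
  have TT: "(\<lambda>f\<in>ell2 X. ad T (T f)) \<in> bounded_ops X" using T by (intro ell2_op_mult) auto
  have M: "0 \<le> M" unfolding M_def by (rule opnorm_nonneg[OF TT])
  have "opnorm X T \<le> sqrt M"
  proof (rule opnorm_le)
    fix f assume f: "f \<in> ell2 X"
    have Tf: "T f \<in> ell2 X" using bounded_opsD(1)[OF T f] .
    have "(ell2_norm X (T f))\<^sup>2 = cmod (ell2_inner X (T f) (T f))" using ell2_inner_self[OF Tf] by (simp add: norm_power)
    also have "\<dots> = cmod (ell2_inner X f (ad T (T f)))" using ad_inner[OF T f Tf] by simp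
    also have "\<dots> \<le> ell2_norm X f * ell2_norm X (ad T (T f))"
      using T by (intro ell2_Cauchy_Schwarz f bounded_opsD(1)[OF _ Tf]) simp
    also have "\<dots> \<le> ell2_norm X f * (M * ell2_norm X f)"
      using opnorm_apply[OF TT f] f by (intro mult_left_mono) (auto simp: M_def)
    also have "\<dots> = (sqrt M * ell2_norm X f)\<^sup>2" using M by (simp add: power_mult_distrib power2_eq_square)
    finally show "ell2_norm X (T f) \<le> sqrt M * ell2_norm X f" by (rule power2_le_imp_le) (use M in simp)
  qed (use M in simp)
  then have "(opnorm X T)\<^sup>2 \<le> (sqrt M)\<^sup>2" using opnorm_nonneg[OF T] by (rule power_mono)
  then show "(opnorm X T)\<^sup>2 \<le> opnorm X (\<lambda>f\<in>ell2 X. ad T (T f))" using M by (simp add: M_def)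
qed

lemma opnorm_smult:
  assumes T: "T \<in> bounded_ops X" shows "opnorm X (\<lambda>f\<in>ell2 X. \<lambda>x. c * T f x) = cmod c * opnorm X T"
proof (rule antisym)
  have le: "opnorm X (\<lambda>f\<in>ell2 X. \<lambda>x. c * T f x) \<le> cmod c * opnorm X T" if "T \<in> bounded_ops X" for T c
    using that opnorm_apply[OF that]
    by (intro opnorm_le) (auto simp: opnorm_nonneg ell2_norm_scale bounded_opsD(1) mult.assoc intro!: mult_left_mono)
  show "opnorm X (\<lambda>f\<in>ell2 X. \<lambda>x. c * T f x) \<le> cmod c * opnorm X T" using T by (rule le)
  show "cmod c * opnorm X T \<le> opnorm X (\<lambda>f\<in>ell2 X. \<lambda>x. c * T f x)"
  proof (cases "c = 0")
    case False
    have "(\<lambda>f\<in>ell2 X. \<lambda>x. inverse c * (\<lambda>f\<in>ell2 X. \<lambda>x. c * T f x) f x) = T"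
      using False by (intro bounded_ops_restrict_eqI[OF T]) (simp add: fun_eq_iff)
    then have "opnorm X T \<le> cmod (inverse c) * opnorm X (\<lambda>f\<in>ell2 X. \<lambda>x. c * T f x)"
      using le[OF ell2_op_smult[OF T, of c], of "inverse c"] by simp
    then show ?thesis using False by (simp add: norm_inverse norm_divide field_simps)
  qed (use opnorm_nonneg[OF ell2_op_zero] in simp)
qed

lemma opnorm_eq_0:
  assumes T: "T \<in> bounded_ops X" shows "opnorm X T = 0 \<longleftrightarrow> T = (\<lambda>f\<in>ell2 X. (\<lambda>_. 0))"
proof
  assume z: "opnorm X T = 0"
  have "T f = (\<lambda>_. 0)" if f: "f \<in> ell2 X" for f
  proof (rule ell2_norm_eq_0)
    show "T f \<in> ell2 X" using bounded_opsD(1)[OF T f] .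
    show "ell2_norm X (T f) = 0" using opnorm_apply[OF T f] z by (intro antisym) simp_all
  qed
  then show "T = (\<lambda>f\<in>ell2 X. (\<lambda>_. 0))" by (intro bounded_ops_restrict_eqI[OF T, symmetric]) simp
next
  assume "T = (\<lambda>f\<in>ell2 X. (\<lambda>_. 0))"
  then have "opnorm X T \<le> 0" by (intro opnorm_le) auto
  then show "opnorm X T = 0" using opnorm_nonneg[OF T] by simp
qed

theorem unital_cstar_algebra_ell2_operators: "unital_cstar_algebra (ell2_operators X)"
proof (rule unital_cstar_algebraI, simp_all only: ell2_operators_simps)
  fix S T assume ST: "S \<in> bounded_ops X" "T \<in> bounded_ops X"
  note D = bounded_opsD[OF ST(1)] bounded_opsD[OF ST(2)] bounded_opsD[OF ad_in[OF ST(1)]] bounded_opsD[OF ad_in[OF ST(2)]]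
  show "ad (\<lambda>f\<in>ell2 X. \<lambda>x. S f x + T f x) = (\<lambda>f\<in>ell2 X. \<lambda>x. ad S f x + ad T f x)"
    using ST by (intro adj_eqI) (auto simp: is_adj_def D ell2_inner_add_left ell2_inner_add_right ad_inner)
  show "ad (\<lambda>f\<in>ell2 X. S (T f)) = (\<lambda>f\<in>ell2 X. ad T (ad S f))"
    using ST by (intro adj_eqI) (auto simp: is_adj_def D ad_inner)
next
  fix T :: "('i \<Rightarrow> complex) \<Rightarrow> 'i \<Rightarrow> complex" and c assume T: "T \<in> bounded_ops X"
  show "ad (\<lambda>f\<in>ell2 X. \<lambda>x. c * T f x) = (\<lambda>f\<in>ell2 X. \<lambda>x. cnj c * ad T f x)"
    using T by (intro adj_eqI) (auto simp: is_adj_def bounded_opsD ell2_inner_scale_left ell2_inner_scale_right ad_inner)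
next
  fix T :: "('i \<Rightarrow> complex) \<Rightarrow> 'i \<Rightarrow> complex" assume T: "T \<in> bounded_ops X"
  show "ad (ad T) = T" using T by (intro adj_eqI) (auto simp: is_adj_def ad_inner')
  show "opnorm X (\<lambda>f\<in>ell2 X. ad T (T f)) = (opnorm X T)\<^sup>2" by (rule opnorm_cstar[OF T])
  show "(opnorm X T = 0) = (T = (\<lambda>f\<in>ell2 X. (\<lambda>_. 0)))" by (rule opnorm_eq_0[OF T])
next
  fix s :: "nat \<Rightarrow> ('i \<Rightarrow> complex) \<Rightarrow> 'i \<Rightarrow> complex"
  have r: "(\<lambda>f\<in>ell2 X. \<lambda>x. a f x + (\<lambda>f\<in>ell2 X. \<lambda>x. - 1 * b f x) f x) = (\<lambda>f\<in>ell2 X. \<lambda>x. a f x + (-1) * b f x)"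
    for a b :: "('i \<Rightarrow> complex) \<Rightarrow> 'i \<Rightarrow> complex"
    by (rule restrict_ext) simp
  assume "\<And>n. s n \<in> bounded_ops X"
    "\<And>e. 0 < e \<Longrightarrow> \<exists>N. \<forall>m\<ge>N. \<forall>n\<ge>N. opnorm X (\<lambda>f\<in>ell2 X. \<lambda>x. s m f x + (\<lambda>f\<in>ell2 X. \<lambda>x. - 1 * s n f x) f x) < e"
  then show "\<exists>x\<in>bounded_ops X. (\<lambda>n. opnorm X (\<lambda>f\<in>ell2 X. \<lambda>xa. s n f xa + (\<lambda>f\<in>ell2 X. \<lambda>xa. - 1 * x f xa) f xa)) \<longlonglongrightarrow> 0"
    unfolding r by (rule ell2_ops_complete)
qed (auto simp: bounded_opsD opnorm_smult opnorm_add_le opnorm_mult_le algebra_simps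
    intro!: restrict_ext bounded_ops_restrict_eqI)

end

subsection \<open>Partial composition operators\<close>

text \<open>For injective \<phi> on D these are partial permutation operators. They are closed under
  products and adjoints and include the Toeplitz operators, their adjoints and the diagonal
  projections, so operator identities become identities of partial maps.\<close>

definition pmap_op :: "'i set \<Rightarrow> 'i set \<Rightarrow> ('i \<Rightarrow> 'i) \<Rightarrow> ('i \<Rightarrow> complex) \<Rightarrow> 'i \<Rightarrow> complex" where
  "pmap_op X D \<phi> = (\<lambda>f\<in>ell2 X. \<lambda>y. if y \<in> D then f (\<phi> y) else 0)"

lemma pmap_op_in [simp]:
  assumes D: "D \<subseteq> X" "inj_on \<phi> D" "\<phi> ` D \<subseteq> X" shows "pmap_op X D \<phi> \<in> bounded_ops X"
proof -
  have bd: "L2_set (\<lambda>y. cmod (pmap_op X D \<phi> f y)) F \<le> ell2_norm X f"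
    if f: "f \<in> ell2 X" and F: "finite F" "F \<subseteq> X" for f F
  proof -
    have "(\<Sum>y\<in>F. (cmod (pmap_op X D \<phi> f y))\<^sup>2) = (\<Sum>y\<in>F \<inter> D. (cmod (f (\<phi> y)))\<^sup>2)"
      using F f by (intro sum.mono_neutral_cong_right) (auto simp: pmap_op_def)
    also have "\<dots> = (\<Sum>x\<in>\<phi> ` (F \<inter> D). (cmod (f x))\<^sup>2)"
      using D by (subst sum.reindex) (auto intro: inj_on_subset)
    finally have "L2_set (\<lambda>y. cmod (pmap_op X D \<phi> f y)) F = L2_set (\<lambda>x. cmod (f x)) (\<phi> ` (F \<inter> D))"
      by (simp add: L2_set_def)
    also have "\<dots> \<le> ell2_norm X f" using D F f by (intro L2_set_le_ell2_norm) auto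
    finally show ?thesis .
  qed
  have in_X: "pmap_op X D \<phi> f \<in> ell2 X" if "f \<in> ell2 X" for f
    by (rule ell2I[OF _ bd[OF that]]) (use D that in \<open>auto simp: pmap_op_def\<close>)
  show ?thesis
  proof (rule bounded_opsI[of _ _ 1])
    show "ell2_norm X (pmap_op X D \<phi> f) \<le> 1 * ell2_norm X f" if "f \<in> ell2 X" for f
      using ell2_norm_le[OF in_X[OF that] _ bd[OF that]] by simp
    show "pmap_op X D \<phi> f \<in> ell2 X" if "f \<in> ell2 X" for f using in_X[OF that] .
  qed (auto simp: pmap_op_def)
qed

lemma pmap_op_cong: "D = E \<Longrightarrow> (\<And>y. y \<in> E \<Longrightarrow> \<phi> y = \<psi> y) \<Longrightarrow> pmap_op X D \<phi> = pmap_op X E \<psi>"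
  by (auto simp: pmap_op_def fun_eq_iff intro!: restrict_ext)

lemma pmap_op_mult:
  assumes "E \<subseteq> X" "inj_on \<psi> E" "\<psi> ` E \<subseteq> X"
  shows "mult (ell2_operators X) (pmap_op X D \<phi>) (pmap_op X E \<psi>) = pmap_op X {y \<in> D. \<phi> y \<in> E} (\<lambda>y. \<psi> (\<phi> y))"
proof -
  have "pmap_op X E \<psi> f \<in> ell2 X" if "f \<in> ell2 X" for f
    using bounded_opsD(1)[OF pmap_op_in[OF assms] that] .
  then show ?thesis by (auto simp: ell2_operators_simps pmap_op_def fun_eq_iff intro!: restrict_ext)
qed

lemma pmap_op_adj:
  assumes b: "bij_betw \<phi> D E" and inv: "\<And>y. y \<in> D \<Longrightarrow> \<psi> (\<phi> y) = y" and DE: "D \<subseteq> X" "E \<subseteq> X"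
  shows "adj (ell2_operators X) (pmap_op X D \<phi>) = pmap_op X E \<psi>"
proof (rule adj_eqI)
  have im: "\<phi> ` D = E" "inj_on \<phi> D" using b by (auto simp: bij_betw_def)
  have b': "bij_betw \<psi> E D" using im inv by (auto simp: bij_betw_def inj_on_def image_iff)
  have "ell2_inner X (pmap_op X D \<phi> f) g = ell2_inner X f (pmap_op X E \<psi> g)" if f: "f \<in> ell2 X" "g \<in> ell2 X" for f g
  proof -
    have "ell2_inner X (pmap_op X D \<phi> f) g = (\<Sum>\<^sub>\<infinity>y\<in>D. f (\<phi> y) * cnj (g (\<psi> (\<phi> y))))"
      unfolding ell2_inner_def using DE f by (intro infsum_cong_neutral) (auto simp: pmap_op_def inv)
    also have "\<dots> = (\<Sum>\<^sub>\<infinity>x\<in>E. f x * cnj (g (\<psi> x)))" by (rule infsum_reindex_bij_betw[OF b])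
    also have "\<dots> = ell2_inner X f (pmap_op X E \<psi> g)"
      unfolding ell2_inner_def using DE f by (intro infsum_cong_neutral) (auto simp: pmap_op_def)
    finally show ?thesis .
  qed
  then show "is_adj X (pmap_op X D \<phi>) (pmap_op X E \<psi>)"
    using b' DE by (auto simp: is_adj_def bij_betw_def)
qed

section \<open>Order and Toeplitz representation\<close>

context
  fixes G :: "('g, 'm) monoid_scheme" (structure) and P
  assumes qlo: "quasi_lattice_ordered G P"
begin

interpretation group G using qlo by (simp add: quasi_lattice_ordered_def)

lemma le_of_mult_right: "x \<in> carrier G \<Longrightarrow> p \<in> P \<Longrightarrow> le_of G P x (x \<otimes> p)"
  using qlo_carrier[OF qlo] by (simp add: le_of_def flip: m_assoc)

lemma le_ofD:
  assumes "le_of G P x y" "x \<in> carrier G" "y \<in> carrier G"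
  shows "inv x \<otimes> y \<in> P" "x \<otimes> (inv x \<otimes> y) = y"
  using assms by (simp_all add: le_of_def flip: m_assoc)

lemma le_of_refl: "x \<in> carrier G \<Longrightarrow> le_of G P x x"
  using qlo_one[OF qlo] by (simp add: le_of_def)

lemma le_of_trans:
  assumes "le_of G P x y" "le_of G P y z" "x \<in> carrier G" "y \<in> carrier G" "z \<in> carrier G"
  shows "le_of G P x z"
proof -
  have "(inv x \<otimes> y) \<otimes> (inv y \<otimes> z) \<in> P" using assms(1,2) using qlo_mult[OF qlo, of "inv x \<otimes> y" "inv y \<otimes> z"] by (simp add: le_of_def)
  moreover have "(inv x \<otimes> y) \<otimes> (inv y \<otimes> z) = inv x \<otimes> z"
    using assms(3-5) by (simp add: m_assoc) (simp flip: m_assoc)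
  ultimately show ?thesis by (simp add: le_of_def)
qed

lemma le_of_antisym:
  assumes "le_of G P x y" "le_of G P y x" "x \<in> carrier G" "y \<in> carrier G"
  shows "x = y"
proof -
  have "inv (inv y \<otimes> x) = inv x \<otimes> y" using assms(3,4) by (simp add: inv_mult_group)
  then have "inv x \<otimes> y \<in> P \<inter> (\<lambda>p. inv p) ` P" using assms(1,2) by (force simp: le_of_def)
  moreover have "P \<inter> (\<lambda>p. inv p) ` P = {\<one>}" using qlo by (simp add: quasi_lattice_ordered_def)
  ultimately have "inv x \<otimes> y = \<one>" by blast
  then show ?thesis using assms(3,4) le_ofD(2)[OF assms(1)] by simp
qed

lemma is_lub_unique: "is_lub G P F u \<Longrightarrow> is_lub G P F v \<Longrightarrow> u = v"
  by (rule le_of_antisym) (auto simp: is_lub_def upper_bounds_def dest: qlo_carrier[OF qlo])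

lemma join_eqI: "is_lub G P {x, y} z \<Longrightarrow> join G P x y = Some z"
  unfolding join_def by (auto simp: is_lub_def[of _ _ _ z] intro!: the_equality) (auto simp: is_lub_def intro: is_lub_unique)

lemma join_SomeE:
  assumes "join G P x y = Some z" "x \<in> carrier G" "y \<in> carrier G"
  shows "z \<in> P" "le_of G P x z" "le_of G P y z"
    "\<And>u. u \<in> P \<Longrightarrow> le_of G P x u \<Longrightarrow> le_of G P y u \<Longrightarrow> le_of G P z u"
  using join_SomeD[OF qlo assms(2,3,1)] by (auto simp: is_lub_def upper_bounds_def)

lemma join_NoneD: "join G P x y = None \<Longrightarrow> u \<in> P \<Longrightarrow> le_of G P x u \<Longrightarrow> \<not> le_of G P y u"
  by (auto simp: join_def upper_bounds_def split: if_splits)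

lemma join_not_None: "u \<in> P \<Longrightarrow> le_of G P x u \<Longrightarrow> le_of G P y u \<Longrightarrow> join G P x y \<noteq> None"
  using join_NoneD by blast

lemma toeplitz_pmap: "toeplitz G P p = pmap_op P {y \<in> P. le_of G P p y} (\<lambda>y. inv p \<otimes> y)"
  by (simp add: toeplitz_def pmap_op_def)

context fixes p assumes p: "p \<in> P"
begin

lemma toeplitz_bij: "bij_betw (\<lambda>y. inv p \<otimes> y) {y \<in> P. le_of G P p y} P"
  by (rule bij_betw_byWitness[of _ "\<lambda>y. p \<otimes> y"])
    (use p qlo_carrier[OF qlo] qlo_mult[OF qlo] le_of_mult_right in \<open>auto simp: le_of_def simp flip: m_assoc\<close>)

lemma toeplitz_in: "toeplitz G P p \<in> bounded_ops P"
  unfolding toeplitz_pmap using toeplitz_bij by (intro pmap_op_in) (auto simp: bij_betw_def)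

lemma toeplitz_adj: "adj (ell2_operators P) (toeplitz G P p) = pmap_op P P (\<lambda>y. p \<otimes> y)"
  unfolding toeplitz_pmap
  by (rule pmap_op_adj[OF toeplitz_bij]) (use p qlo_carrier[OF qlo] in \<open>auto simp flip: m_assoc\<close>)

lemma inj_mult: "inj_on (\<lambda>y. p \<otimes> y) P"
  using p qlo_carrier[OF qlo] by (auto simp: inj_on_def)

lemma range_proj_toeplitz: "range_proj (ell2_operators P) (toeplitz G P p) = pmap_op P {y \<in> P. le_of G P p y} (\<lambda>y. y)"
  unfolding range_proj_def toeplitz_adj unfolding toeplitz_pmap
  by (subst pmap_op_mult)
    (use p qlo_carrier[OF qlo] qlo_mult[OF qlo] inj_mult in \<open>auto simp: le_of_def intro!: pmap_op_cong simp flip: m_assoc\<close>)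

end

lemma toeplitz_one: "toeplitz G P \<one> = (\<lambda>f\<in>ell2 P. f)"
  unfolding toeplitz_pmap pmap_op_def
  using qlo_carrier[OF qlo] by (auto simp: fun_eq_iff le_of_def ell2_support intro!: restrict_ext)

text \<open>The range projection of p is the diagonal projection onto the elements above p.
  Covariance then says that the elements above both p and r are those above their join, or that
  there are none.\<close>

theorem covariant_rep_toeplitz: "covariant_rep G P (ell2_operators P) (toeplitz G P)"
  unfolding covariant_rep_def isometric_rep_def
proof (intro conjI ballI)
  note c = qlo_carrier[OF qlo] and m = qlo_mult[OF qlo]
  show "toeplitz G P p \<in> carrier (ell2_operators P)" if "p \<in> P" for p
    using toeplitz_in[OF that] by (simp add: ell2_operators_simps)
  show "toeplitz G P \<one> = \<one>\<^bsub>ell2_operators P\<^esub>" by (simp add: toeplitz_one ell2_operators_simps)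
  show "adj (ell2_operators P) (toeplitz G P p) \<otimes>\<^bsub>ell2_operators P\<^esub> toeplitz G P p = \<one>\<^bsub>ell2_operators P\<^esub>"
    if p: "p \<in> P" for p
  proof -
    have "adj (ell2_operators P) (toeplitz G P p) \<otimes>\<^bsub>ell2_operators P\<^esub> toeplitz G P p =
        pmap_op P {y \<in> P. p \<otimes> y \<in> {y \<in> P. le_of G P p y}} (\<lambda>y. inv p \<otimes> (p \<otimes> y))"
      unfolding toeplitz_adj[OF p] unfolding toeplitz_pmap
      using toeplitz_bij[OF p] by (intro pmap_op_mult) (auto simp: bij_betw_def)
    also have "\<dots> = toeplitz G P \<one>"
      unfolding toeplitz_pmap by (rule pmap_op_cong) (use p c m in \<open>auto simp: le_of_def simp flip: m_assoc\<close>)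
    finally show ?thesis by (simp add: toeplitz_one ell2_operators_simps)
  qed
  show "toeplitz G P p \<otimes>\<^bsub>ell2_operators P\<^esub> toeplitz G P r = toeplitz G P (p \<otimes> r)" if p: "p \<in> P" "r \<in> P" for p r
  proof -
    have "toeplitz G P p \<otimes>\<^bsub>ell2_operators P\<^esub> toeplitz G P r =
        pmap_op P {y \<in> {y \<in> P. le_of G P p y}. inv p \<otimes> y \<in> {y \<in> P. le_of G P r y}} (\<lambda>y. inv r \<otimes> (inv p \<otimes> y))"
      unfolding toeplitz_pmap using toeplitz_bij[OF p(2)] by (intro pmap_op_mult) (auto simp: bij_betw_def)
    also have "\<dots> = toeplitz G P (p \<otimes> r)"
      unfolding toeplitz_pmap
    proof (rule pmap_op_cong)
      have i: "inv (p \<otimes> r) \<otimes> y = inv r \<otimes> (inv p \<otimes> y)" if "y \<in> P" for y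
        using p c that by (simp add: inv_mult_group m_assoc)
      then show "inv r \<otimes> (inv p \<otimes> y) = inv (p \<otimes> r) \<otimes> y" if "y \<in> {y \<in> P. le_of G P (p \<otimes> r) y}" for y
        using that by simp
      have "le_of G P p y" if y: "y \<in> P" "le_of G P (p \<otimes> r) y" for y
        using le_of_trans[OF le_of_mult_right[of p r] y(2)] p c y by auto
      then show "{y \<in> {y \<in> P. le_of G P p y}. inv p \<otimes> y \<in> {y \<in> P. le_of G P r y}} = {y \<in> P. le_of G P (p \<otimes> r) y}"
        using i by (auto simp: le_of_def)
    qed
    finally show ?thesis .
  qed
  show "range_proj (ell2_operators P) (toeplitz G P p) \<otimes>\<^bsub>ell2_operators P\<^esub> range_proj (ell2_operators P) (toeplitz G P r) =
      (case join G P p r of Some s \<Rightarrow> range_proj (ell2_operators P) (toeplitz G P s) | None \<Rightarrow> \<zero>\<^bsub>ell2_operators P\<^esub>)"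
    if p: "p \<in> P" "r \<in> P" for p r
  proof -
    have pc: "p \<in> carrier G" "r \<in> carrier G" using p c by auto
    have "range_proj (ell2_operators P) (toeplitz G P p) \<otimes>\<^bsub>ell2_operators P\<^esub> range_proj (ell2_operators P) (toeplitz G P r) =
        pmap_op P {y \<in> {y \<in> P. le_of G P p y}. y \<in> {y \<in> P. le_of G P r y}} (\<lambda>y. y)"
      unfolding range_proj_toeplitz[OF p(1)] range_proj_toeplitz[OF p(2)]
      by (intro pmap_op_mult) (auto simp: inj_on_def)
    also have "\<dots> = (case join G P p r of Some s \<Rightarrow> range_proj (ell2_operators P) (toeplitz G P s) | None \<Rightarrow> \<zero>\<^bsub>ell2_operators P\<^esub>)"
    proof (cases "join G P p r")
      case None
      then have e: "{y \<in> {y \<in> P. le_of G P p y}. y \<in> {y \<in> P. le_of G P r y}} = {}"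
        using join_NoneD by blast
      show ?thesis unfolding e using None by (simp add: pmap_op_def ell2_operators_simps)
    next
      case (Some s)
      note j = join_SomeE[OF Some pc]
      have "{y \<in> {y \<in> P. le_of G P p y}. y \<in> {y \<in> P. le_of G P r y}} = {y \<in> P. le_of G P s y}"
        using j pc c le_of_trans[OF j(2), of _] le_of_trans[OF j(3), of _] by blast
      then show ?thesis using Some j(1) by (simp add: range_proj_toeplitz)
    qed
    finally show ?thesis .
  qed
qed

end

section \<open>Projections onto the levels of \<mu>\<close>

lemma cproj_simps:
  assumes "S \<subseteq> X"
  shows "pmap_op X S (\<lambda>y. y) \<in> bounded_ops X"
    and "adj (ell2_operators X) (pmap_op X S (\<lambda>y. y)) = pmap_op X S (\<lambda>y. y)"
    and "S' \<subseteq> X \<Longrightarrow> pmap_op X S (\<lambda>y. y) \<otimes>\<^bsub>ell2_operators X\<^esub> pmap_op X S' (\<lambda>y. y) = pmap_op X (S \<inter> S') (\<lambda>y. y)"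
  using assms by (auto intro!: pmap_op_in pmap_op_adj[of _ S S] pmap_op_cong simp: pmap_op_mult bij_betw_def)

text \<open>Both sides restrict the same partial map, because \<open>inv p \<otimes> y\<close> has
  level j exactly when y has level \<mu>(p) j.\<close>

lemma toeplitz_level_proj:
  fixes G (structure)
  assumes q: "quasi_lattice_ordered G P" and \<mu>: "\<mu> \<in> hom G K" "group K" and p: "p \<in> P" and j: "j \<in> carrier K"
  shows "toeplitz G P p \<otimes>\<^bsub>ell2_operators P\<^esub> pmap_op P {x \<in> P. \<mu> x = j} (\<lambda>y. y) =
    pmap_op P {x \<in> P. \<mu> x = \<mu> p \<otimes>\<^bsub>K\<^esub> j} (\<lambda>y. y) \<otimes>\<^bsub>ell2_operators P\<^esub> toeplitz G P p"
proof -
  interpret group G using q by (simp add: quasi_lattice_ordered_def)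
  interpret K: group K by fact
  interpret group_hom G K \<mu> using \<mu> by unfold_locales
  note c = qlo_carrier[OF q]
  have "\<mu> (inv p \<otimes> y) = j \<longleftrightarrow> \<mu> y = \<mu> p \<otimes>\<^bsub>K\<^esub> j" if "y \<in> P" for y
  proof -
    have "\<mu> (inv p \<otimes> y) = inv\<^bsub>K\<^esub> \<mu> p \<otimes>\<^bsub>K\<^esub> \<mu> y" using c p that by simp
    then show ?thesis using c p that j by (metis K.inv_solve_left hom_closed)
  qed
  moreover have "toeplitz G P p \<otimes>\<^bsub>ell2_operators P\<^esub> pmap_op P {x \<in> P. \<mu> x = j} (\<lambda>y. y) =
      pmap_op P {y \<in> {y \<in> P. le_of G P p y}. inv p \<otimes> y \<in> {x \<in> P. \<mu> x = j}} (\<lambda>y. inv p \<otimes> y)"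
    unfolding toeplitz_pmap[OF q] by (intro pmap_op_mult) auto
  moreover have "pmap_op P {x \<in> P. \<mu> x = \<mu> p \<otimes>\<^bsub>K\<^esub> j} (\<lambda>y. y) \<otimes>\<^bsub>ell2_operators P\<^esub> toeplitz G P p =
      pmap_op P {y \<in> {x \<in> P. \<mu> x = \<mu> p \<otimes>\<^bsub>K\<^esub> j}. y \<in> {y \<in> P. le_of G P p y}} (\<lambda>y. inv p \<otimes> y)"
    unfolding toeplitz_pmap[OF q]
    using toeplitz_bij[OF q p] by (intro pmap_op_mult) (auto simp: bij_betw_def)
  ultimately show ?thesis
    by (simp only:) (rule pmap_op_cong, auto simp: le_of_def)
qed

section \<open>Reiter's condition\<close>

definition sublinear_on :: "('z \<Rightarrow> real) set \<Rightarrow> (('z \<Rightarrow> real) \<Rightarrow> real) \<Rightarrow> bool" where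
  "sublinear_on V p \<longleftrightarrow>
     (\<forall>v\<in>V. \<forall>w\<in>V. p (\<lambda>z. v z + w z) \<le> p v + p w) \<and>
     (\<forall>c>0. \<forall>v\<in>V. p (\<lambda>z. c * v z) \<le> c * p v)"

lemma le_Inf_add:
  fixes x :: real
  assumes "A \<noteq> {}" "B \<noteq> {}" "\<And>a b. a \<in> A \<Longrightarrow> b \<in> B \<Longrightarrow> x \<le> a + b"
  shows "x \<le> Inf A + Inf B"
proof -
  have "x - b \<le> Inf A" if "b \<in> B" for b
    using assms(1) assms(3)[OF _ that] by (intro cInf_greatest) (auto simp: algebra_simps)
  then have "x - Inf A \<le> Inf B" using assms(2) by (intro cInf_greatest) (auto simp: algebra_simps)
  then show ?thesis by simp
qed

locale function_subspace =
  fixes V :: "('z \<Rightarrow> real) set"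
  assumes add: "v \<in> V \<Longrightarrow> w \<in> V \<Longrightarrow> (\<lambda>z. v z + w z) \<in> V"
    and scale: "v \<in> V \<Longrightarrow> (\<lambda>z. c * v z) \<in> V"
    and zero: "(\<lambda>_. 0) \<in> V"
begin

lemma uminus: "v \<in> V \<Longrightarrow> (\<lambda>z. - v z) \<in> V"
  using scale[of v "-1"] by simp

context fixes p assumes p: "sublinear_on V p"
begin

lemma sublinear_add: "v \<in> V \<Longrightarrow> w \<in> V \<Longrightarrow> p (\<lambda>z. v z + w z) \<le> p v + p w"
  using p by (simp add: sublinear_on_def)

text \<open>The definition asks for one inequality only, the one that infima inherit at once;
  scaling back by the inverse of c gives the other.\<close>

lemma sublinear_scale: assumes "0 < c" "v \<in> V" shows "p (\<lambda>z. c * v z) = c * p v"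
proof (rule antisym)
  show "p (\<lambda>z. c * v z) \<le> c * p v" using p assms by (simp add: sublinear_on_def)
  have "p (\<lambda>z. inverse c * (c * v z)) \<le> inverse c * p (\<lambda>z. c * v z)"
    using p assms scale[OF assms(2), of c] unfolding sublinear_on_def by (meson positive_imp_inverse_positive)
  then show "c * p v \<le> p (\<lambda>z. c * v z)" using assms by (simp add: field_simps)
qed

lemma sublinear_zero: "p (\<lambda>_. 0) = 0"
  using sublinear_scale[of 2 "\<lambda>_. 0"] zero by simp

lemma sublinear_lower: "v \<in> V \<Longrightarrow> - p (\<lambda>z. - v z) \<le> p v"
  using sublinear_add[of v "\<lambda>z. - v z"] uminus[of v] sublinear_zero by simp

end

text \<open>A device for lowering q along x: t = 0 shows that r lies below q, and t = 1 gives the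
  third bound. If q is minimal then r = q, and the third bound becomes superadditivity of q.\<close>

lemma sublinear_shift:
  assumes q: "sublinear_on V q" and x: "x \<in> V"
  defines "r \<equiv> (\<lambda>v. INF t\<in>{0..}. q (\<lambda>z. v z + t * x z) - t * q x)"
  shows "sublinear_on V r" and "v \<in> V \<Longrightarrow> r v \<le> q v" and "v \<in> V \<Longrightarrow> r v \<le> q (\<lambda>z. v z + x z) - q x"
proof -
  have vt: "(\<lambda>z. v z + t * x z) \<in> V" if "v \<in> V" for v t using add[OF that scale[OF x]] .
  have tx: "q (\<lambda>z. t * x z) = t * q x" if "t \<ge> 0" for t
    using sublinear_scale[OF q, of t x] sublinear_zero[OF q] x that by (cases "t = 0") auto
  have low: "- q (\<lambda>z. - v z) \<le> q (\<lambda>z. v z + t * x z) - t * q x" if "v \<in> V" "t \<ge> 0" for v t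
    using sublinear_add[OF q vt[OF that(1), of t] uminus[OF that(1)]] tx[OF that(2)] by simp
  have bdd: "bdd_below ((\<lambda>t. q (\<lambda>z. v z + t * x z) - t * q x) ` {0..})" if "v \<in> V" for v
    using low[OF that] by (intro bdd_belowI2) auto
  have up: "r v \<le> q (\<lambda>z. v z + t * x z) - t * q x" if "v \<in> V" "t \<ge> 0" for v t
    unfolding r_def using that by (intro cINF_lower bdd) auto
  show "r v \<le> q v" if "v \<in> V" for v using up[OF that, of 0] by simp
  show "r v \<le> q (\<lambda>z. v z + x z) - q x" if "v \<in> V" for v using up[OF that, of 1] by simp
  have hom: "r (\<lambda>z. c * v z) \<le> c * r v" if "c > 0" "v \<in> V" for c v
  proof -
    have "r (\<lambda>z. c * v z) / c \<le> r v"
      unfolding r_def[of]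
    proof (rule cINF_greatest)
      fix t :: real assume "t \<in> {0..}"
      then have t: "0 \<le> c * t" using that by simp
      have "r (\<lambda>z. c * v z) \<le> q (\<lambda>z. c * v z + (c * t) * x z) - (c * t) * q x"
        using up[OF scale[OF that(2)] t] .
      also have "(\<lambda>z. c * v z + (c * t) * x z) = (\<lambda>z. c * (v z + t * x z))" by (simp add: algebra_simps)
      also have "q \<dots> - (c * t) * q x = c * (q (\<lambda>z. v z + t * x z) - t * q x)"
        using sublinear_scale[OF q that(1) vt[OF that(2), of t]] by (simp add: algebra_simps)
      finally show "(INF t\<in>{0..}. q (\<lambda>z. c * v z + t * x z) - t * q x) / c \<le> q (\<lambda>z. v z + t * x z) - t * q x"
        using that by (simp add: r_def field_simps)
    qed simp
    then show ?thesis using that by (simp add: field_simps)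
  qed
  have "r (\<lambda>z. v z + w z) \<le> r v + r w" if vw: "v \<in> V" "w \<in> V" for v w
    unfolding r_def[of]
  proof (rule le_Inf_add)
    fix a b assume "a \<in> (\<lambda>t. q (\<lambda>z. v z + t * x z) - t * q x) ` {0..}" "b \<in> (\<lambda>t. q (\<lambda>z. w z + t * x z) - t * q x) ` {0..}"
    then obtain t u where t: "t \<ge> 0" "a = q (\<lambda>z. v z + t * x z) - t * q x" and u: "u \<ge> 0" "b = q (\<lambda>z. w z + u * x z) - u * q x"
      by auto
    have "r (\<lambda>z. v z + w z) \<le> q (\<lambda>z. (v z + w z) + (t + u) * x z) - (t + u) * q x"
      using up[OF add[OF vw], of "t + u"] t u by simp
    also have "(\<lambda>z. (v z + w z) + (t + u) * x z) = (\<lambda>z. (v z + t * x z) + (w z + u * x z))" by (simp add: algebra_simps)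
    also have "q \<dots> - (t + u) * q x \<le> a + b"
      using sublinear_add[OF q vt[OF vw(1), of t] vt[OF vw(2), of u]] t u by (simp add: algebra_simps)
    finally show "(INF t\<in>{0..}. q (\<lambda>z. v z + w z + t * x z) - t * q x) \<le> a + b" by (simp add: r_def)
  qed auto
  then show "sublinear_on V r" using hom by (simp add: sublinear_on_def)
qed

text \<open>Hahn-Banach: a minimal sublinear functional is linear.\<close>

lemma linear_below_sublinear:
  assumes p: "sublinear_on V p"
  shows "\<exists>\<phi>. (\<forall>v\<in>V. \<phi> v \<le> p v) \<and> (\<forall>v\<in>V. \<forall>w\<in>V. \<phi> (\<lambda>z. v z + w z) = \<phi> v + \<phi> w)"
proof -
  \<comment> \<open>Fixing the value 0 off V makes comparison on V antisymmetric. In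
    \<open>R q r\<close> the functional r is the lower one, so the maximal element from Zorn's lemma
    is a minimal functional.\<close>
  define Q where "Q = {q. sublinear_on V q \<and> (\<forall>v\<in>V. q v \<le> p v) \<and> (\<forall>v. v \<notin> V \<longrightarrow> q v = 0)}"
  define R where "R q r \<longleftrightarrow> (\<forall>v\<in>V. r v \<le> (q v :: real))" for q r
  have ext: "(\<lambda>v. if v \<in> V then q v else 0) \<in> Q" if "sublinear_on V q" "\<And>v. v \<in> V \<Longrightarrow> q v \<le> p v" for q
    using that add scale by (auto simp: Q_def sublinear_on_def)
  have "\<exists>q\<in>Q. \<forall>r\<in>Q. R q r \<longrightarrow> r = q"
  proof (rule predicate_Zorn)
    show "partial_order_on Q (relation_of R Q)"
    proof (rule partial_order_on_relation_ofI)
      show "a = b" if "a \<in> Q" "b \<in> Q" "R a b" "R b a" for a b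
        using that by (auto simp: R_def Q_def fun_eq_iff) (metis order_antisym)
    qed (force simp: R_def)+
    fix C assume C: "C \<in> Chains (relation_of R Q)"
    then have CQ: "C \<subseteq> Q" and tot: "\<And>q r. q \<in> C \<Longrightarrow> r \<in> C \<Longrightarrow> R q r \<or> R r q"
      by (auto simp: Chains_def relation_of_def)
    show "\<exists>u\<in>Q. \<forall>a\<in>C. R a u"
    proof (cases "C = {}")
      case True
      then show ?thesis using ext[OF p] by auto
    next
      case False
      define u where "u v = (INF q\<in>C. q v)" for v
      \<comment> \<open>A lower bound common to the whole chain, so that the pointwise infimum is
        finite.\<close>
      have low: "- p (\<lambda>z. - v z) \<le> q v" if "v \<in> V" "q \<in> C" for v q
        using sublinear_lower[of q v] CQ that uminus[OF that(1)] by (force simp: Q_def)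
      have bdd: "bdd_below ((\<lambda>q. q v) ` C)" if "v \<in> V" for v
        using low[OF that] by (intro bdd_belowI2) auto
      have up: "u v \<le> q v" if "v \<in> V" "q \<in> C" for v q
        unfolding u_def using that by (intro cINF_lower bdd)
      have "u (\<lambda>z. v z + w z) \<le> u v + u w" if vw: "v \<in> V" "w \<in> V" for v w
        unfolding u_def[of v] u_def[of w]
      proof (rule le_Inf_add)
        fix a b assume "a \<in> (\<lambda>q. q v) ` C" "b \<in> (\<lambda>q. q w) ` C"
        then obtain q r where q: "q \<in> C" "a = q v" and r: "r \<in> C" "b = r w" by auto
        obtain s where s: "s \<in> C" "s v \<le> q v" "s w \<le> r w"
          using tot[OF q(1) r(1)] q r vw by (auto simp: R_def)
        have "u (\<lambda>z. v z + w z) \<le> s (\<lambda>z. v z + w z)" by (rule up[OF add[OF vw] s(1)])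
        also have "\<dots> \<le> s v + s w" using s(1) CQ vw by (intro sublinear_add) (auto simp: Q_def)
        also have "\<dots> \<le> a + b" using s q r by simp
        finally show "u (\<lambda>z. v z + w z) \<le> a + b" .
      qed (use False in auto)
      moreover have "u (\<lambda>z. c * v z) \<le> c * u v" if cv: "c > 0" "v \<in> V" for c v
      proof -
        have "u (\<lambda>z. c * v z) / c \<le> u v"
          unfolding u_def[of v]
        proof (rule cINF_greatest[OF False])
          fix q assume q: "q \<in> C"
          have "u (\<lambda>z. c * v z) \<le> q (\<lambda>z. c * v z)" by (rule up[OF scale[OF cv(2)] q])
          also have "\<dots> = c * q v" using q CQ cv by (intro sublinear_scale) (auto simp: Q_def)
          finally show "u (\<lambda>z. c * v z) / c \<le> q v" using cv by (simp add: field_simps)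
        qed
        then show ?thesis using cv by (simp add: field_simps)
      qed
      ultimately have "sublinear_on V u" by (simp add: sublinear_on_def)
      moreover have "u v \<le> p v" if "v \<in> V" for v
        using False up[OF that] CQ that unfolding Q_def by fastforce
      ultimately have "(\<lambda>v. if v \<in> V then u v else 0) \<in> Q" by (rule ext)
      moreover have "R q (\<lambda>v. if v \<in> V then u v else 0)" if "q \<in> C" for q
        using up that by (auto simp: R_def)
      ultimately show ?thesis by blast
    qed
  qed
  then obtain q where q: "q \<in> Q" and min: "\<And>r. r \<in> Q \<Longrightarrow> R q r \<Longrightarrow> r = q" by blast
  have sub: "sublinear_on V q" and qp: "\<And>v. v \<in> V \<Longrightarrow> q v \<le> p v" using q by (auto simp: Q_def)
  have "q v + q x \<le> q (\<lambda>z. v z + x z)" if v: "v \<in> V" and x: "x \<in> V" for v x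
  proof -
    define r where "r = (\<lambda>v. INF t\<in>{0..}. q (\<lambda>z. v z + t * x z) - t * q x)"
    have r: "sublinear_on V r" "\<And>v. v \<in> V \<Longrightarrow> r v \<le> q v" "\<And>v. v \<in> V \<Longrightarrow> r v \<le> q (\<lambda>z. v z + x z) - q x"
      unfolding r_def by (rule sublinear_shift[OF sub x]; assumption?)+
    have "(\<lambda>v. if v \<in> V then r v else 0) \<in> Q" using r(1) r(2) qp by (intro ext) (auto intro: order_trans)
    moreover have "R q (\<lambda>v. if v \<in> V then r v else 0)" using r(2) by (auto simp: R_def)
    ultimately have "(\<lambda>v. if v \<in> V then r v else 0) = q" by (rule min)
    then have "r v = q v" using v by (auto dest: fun_cong[of _ _ v])
    then show ?thesis using r(3)[OF v] by simp
  qed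
  then have "q (\<lambda>z. v z + x z) = q v + q x" if "v \<in> V" "x \<in> V" for v x
    using sublinear_add[OF sub that] that by (intro antisym) auto
  then show ?thesis using qp by blast
qed

end

section \<open>The l1 norm on finitely supported functions\<close>

definition l1 :: "('z \<Rightarrow> real) \<Rightarrow> real" where
  "l1 v = (\<Sum>z | v z \<noteq> 0. \<bar>v z\<bar>)"

lemma l1_eq: "finite F \<Longrightarrow> {z. v z \<noteq> 0} \<subseteq> F \<Longrightarrow> l1 v = (\<Sum>z\<in>F. \<bar>v z\<bar>)"
  unfolding l1_def by (rule sum.mono_neutral_left) auto

lemma finite_supp_add:
  fixes v w :: "'z \<Rightarrow> real"
  shows "finite {z. v z \<noteq> 0} \<Longrightarrow> finite {z. w z \<noteq> 0} \<Longrightarrow> finite {z. v z + w z \<noteq> 0}"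
  by (rule finite_subset[of _ "{z. v z \<noteq> 0} \<union> {z. w z \<noteq> 0}"]) auto

lemma finite_supp_scale:
  fixes v :: "'z \<Rightarrow> real"
  shows "finite {z. v z \<noteq> 0} \<Longrightarrow> finite {z. c * v z \<noteq> 0}"
  by (rule finite_subset[of _ "{z. v z \<noteq> 0}"]) auto

lemma l1_add:
  assumes "finite {z. v z \<noteq> 0}" "finite {z. w z \<noteq> 0}"
  shows "l1 (\<lambda>z. v z + w z) \<le> l1 v + l1 w"
proof -
  let ?F = "{z. v z \<noteq> 0} \<union> {z. w z \<noteq> 0}"
  have F: "finite ?F" using assms by simp
  have "l1 (\<lambda>z. v z + w z) = (\<Sum>z\<in>?F. \<bar>v z + w z\<bar>)" "l1 v = (\<Sum>z\<in>?F. \<bar>v z\<bar>)" "l1 w = (\<Sum>z\<in>?F. \<bar>w z\<bar>)"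
    using F by (auto intro!: l1_eq)
  then show ?thesis by (simp add: sum.distrib[symmetric] sum_mono abs_triangle_ineq)
qed

lemma l1_scale: "l1 (\<lambda>z. c * v z) = \<bar>c\<bar> * l1 v"
  by (cases "c = 0") (simp_all add: l1_def abs_mult sum_distrib_left)

lemma l1_nonneg: "0 \<le> l1 v" by (simp add: l1_def sum_nonneg)

interpretation fin_supp: function_subspace "{v :: 'z \<Rightarrow> real. finite {z. v z \<noteq> 0}}"
  by unfold_locales (use finite_supp_add finite_supp_scale in auto)

lemma l1_norm_lower:
  assumes "finite {z. v z \<noteq> 0}" "finite {z. w z \<noteq> 0}"
  shows "l1 w - l1 v \<le> l1 (\<lambda>z. v z + w z)"
proof -
  have "l1 (\<lambda>z. (v z + w z) + (-1) * v z) \<le> l1 (\<lambda>z. v z + w z) + l1 (\<lambda>z. (-1) * v z)"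
    by (intro l1_add finite_supp_add finite_supp_scale assms)
  then show ?thesis by (simp add: l1_scale[of "-1", simplified])
qed

section \<open>From an invariant mean to almost invariant vectors\<close>

context
  fixes K :: "('k, 'n) monoid_scheme" (structure) and m
  assumes K: "group K" and m: "invariant_mean K m"
begin

interpretation group K by (rule K)

text \<open>All translation differences of g for s in S are packed into one function of (s, x); a
  single l1 norm is then the sum of the individual ones, and one functional handles all s at
  once.\<close>

definition translation_diff :: "'k set \<Rightarrow> ('k \<Rightarrow> real) \<Rightarrow> 'k \<times> 'k \<Rightarrow> real" where
  "translation_diff S g = (\<lambda>(s, x). if s \<in> S \<and> x \<in> carrier K then g (inv s \<otimes> x) - g x else 0)"

text \<open>Not normalized: the infimum over this set is sublinear because the set is a
  cone.\<close>

definition densities :: "('k \<Rightarrow> real) set" where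
  "densities = {g. finite {x. g x \<noteq> 0} \<and> {x. g x \<noteq> 0} \<subseteq> carrier K \<and> (\<forall>x. 0 \<le> g x)}"

lemma translation_diff_supp:
  assumes g: "g \<in> densities" and S: "finite S" "S \<subseteq> carrier K"
  shows "finite {z. translation_diff S g z \<noteq> 0}"
proof (rule finite_subset)
  let ?F = "{x. g x \<noteq> 0}"
  show "{z. translation_diff S g z \<noteq> 0} \<subseteq> S \<times> (?F \<union> (\<lambda>(s, x). s \<otimes> x) ` (S \<times> ?F))"
  proof
    fix z assume z: "z \<in> {z. translation_diff S g z \<noteq> 0}"
    obtain s x where zsx: "z = (s, x)" by (cases z)
    have sx: "s \<in> S" "x \<in> carrier K" "g (inv s \<otimes> x) \<noteq> 0 \<or> g x \<noteq> 0"
      using z zsx by (auto simp: translation_diff_def split: if_splits)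
    have "x = s \<otimes> (inv s \<otimes> x)" using sx S by (auto simp flip: m_assoc)
    then have "x \<in> ?F \<union> (\<lambda>(s, x). s \<otimes> x) ` (S \<times> ?F)" using sx by force
    then show "z \<in> S \<times> (?F \<union> (\<lambda>(s, x). s \<otimes> x) ` (S \<times> ?F))" using sx zsx by blast
  qed
  show "finite (S \<times> (?F \<union> (\<lambda>(s, x). s \<otimes> x) ` (S \<times> ?F)))"
    using S g by (auto simp: densities_def)
qed

lemma mean_sum:
  assumes "finite S" "\<And>s. s \<in> S \<Longrightarrow> bounded (h s ` carrier K)"
  shows "m (\<lambda>x. \<Sum>s\<in>S. h s x) = (\<Sum>s\<in>S. m (h s)) \<and> bounded ((\<lambda>x. \<Sum>s\<in>S. h s x) ` carrier K)"
  using assms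
proof (induction S rule: finite_induct)
  case empty
  have b: "bounded ((\<lambda>x. 0 :: real) ` carrier K)" by (auto intro!: boundedI[of _ 0])
  have "\<forall>c f. bounded (f ` carrier K) \<longrightarrow> m (\<lambda>x. c * f x) = c * m f" using m by (simp add: invariant_mean_def)
  from this[rule_format, of "\<lambda>_. 0" 0, OF b] have "m (\<lambda>x. 0) = 0" by simp
  then show ?case using b by simp
next
  case (insert a S)
  have b: "bounded (h a ` carrier K)" "bounded ((\<lambda>x. \<Sum>s\<in>S. h s x) ` carrier K)" using insert by auto
  have "bounded ((\<lambda>x. h a x + (\<Sum>s\<in>S. h s x)) ` carrier K)" using b by (rule bounded_plus_comp)
  moreover have "m (\<lambda>x. h a x + (\<Sum>s\<in>S. h s x)) = m (h a) + m (\<lambda>x. \<Sum>s\<in>S. h s x)"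
    using m b unfolding invariant_mean_def by blast
  ultimately show ?case using insert by simp
qed

text \<open>If no density were almost invariant, Hahn-Banach would give a functional bounded by the
  l1 norm that is at least e on the translation differences of every point mass. Such a functional
  is a family of bounded functions h s on K with the sum over s of h s (s k) - h s k at least e for
  every k, while an invariant mean of that sum is 0.\<close>

lemma Reiter_aux:
  fixes e :: real
  assumes S: "finite S" "S \<subseteq> carrier K" and e: "e > 0"
  shows "\<exists>g\<in>densities. l1 (translation_diff S g) < e * l1 g"
proof (rule ccontr)
  assume "\<not> ?thesis"
  then have neg: "e * l1 g \<le> l1 (translation_diff S g)" if "g \<in> densities" for g using that by force
  let ?V = "{v :: 'k \<times> 'k \<Rightarrow> real. finite {z. v z \<noteq> 0}}"
  let ?L = "translation_diff S"
  have L: "?L g \<in> ?V" if "g \<in> densities" for g using translation_diff_supp[OF that S] by simp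
  have d0: "(\<lambda>_. 0) \<in> densities" by (simp add: densities_def)
  have dadd: "(\<lambda>x. g x + h x) \<in> densities" if "g \<in> densities" "h \<in> densities" for g h
    using that finite_supp_add[of g h] by (auto simp: densities_def) force
  have dscale: "(\<lambda>x. c * g x) \<in> densities" if "g \<in> densities" "c > 0" for g c
    using that by (auto simp: densities_def)
  have Ladd: "?L (\<lambda>x. g x + h x) = (\<lambda>z. ?L g z + ?L h z)" for g h
    by (auto simp: translation_diff_def)
  have Lscale: "?L (\<lambda>x. c * g x) = (\<lambda>z. c * ?L g z)" for g c
    by (auto simp: translation_diff_def algebra_simps)
  have tadd: "l1 (\<lambda>x. g x + h x) = l1 g + l1 h" if "g \<in> densities" "h \<in> densities" for g h
  proof -
    let ?F = "{x. g x \<noteq> 0} \<union> {x. h x \<noteq> 0}"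
    have F: "finite ?F" using that by (simp add: densities_def)
    have "l1 (\<lambda>z. g z + h z) = (\<Sum>z\<in>?F. \<bar>g z + h z\<bar>)" "l1 g = (\<Sum>z\<in>?F. \<bar>g z\<bar>)" "l1 h = (\<Sum>z\<in>?F. \<bar>h z\<bar>)"
      using F by (auto intro!: l1_eq)
    then show ?thesis using that by (simp add: densities_def sum.distrib)
  qed
  \<comment> \<open>The assumed bound \<open>neg\<close> is exactly what keeps this infimum finite:
    by the triangle inequality every term is at least \<open>- l1 v\<close>.\<close>
  define p where "p v = (INF g\<in>densities. l1 (\<lambda>z. v z + ?L g z) - e * l1 g)" for v
  have low: "- l1 v \<le> l1 (\<lambda>z. v z + ?L g z) - e * l1 g" if "v \<in> ?V" "g \<in> densities" for v g
    using l1_norm_lower[of v "?L g"] neg[OF that(2)] L[OF that(2)] that(1) by simp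
  have bdd: "bdd_below ((\<lambda>g. l1 (\<lambda>z. v z + ?L g z) - e * l1 g) ` densities)" if "v \<in> ?V" for v
    using low[OF that] by (intro bdd_belowI2) auto
  have up: "p v \<le> l1 (\<lambda>z. v z + ?L g z) - e * l1 g" if "v \<in> ?V" "g \<in> densities" for v g
    unfolding p_def using that by (intro cINF_lower bdd)
  have padd: "p (\<lambda>z. v z + w z) \<le> p v + p w" if vw: "v \<in> ?V" "w \<in> ?V" for v w
    unfolding p_def[of v] p_def[of w]
  proof (rule le_Inf_add)
    fix a b assume "a \<in> (\<lambda>g. l1 (\<lambda>z. v z + ?L g z) - e * l1 g) ` densities"
      "b \<in> (\<lambda>g. l1 (\<lambda>z. w z + ?L g z) - e * l1 g) ` densities"
    then obtain g h where g: "g \<in> densities" "a = l1 (\<lambda>z. v z + ?L g z) - e * l1 g"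
      and h: "h \<in> densities" "b = l1 (\<lambda>z. w z + ?L h z) - e * l1 h" by auto
    have "p (\<lambda>z. v z + w z) \<le> l1 (\<lambda>z. (v z + w z) + (?L g z + ?L h z)) - e * (l1 g + l1 h)"
      using up[OF fin_supp.add[OF vw] dadd[OF g(1) h(1)]] by (simp add: Ladd tadd g h)
    also have "(\<lambda>z. (v z + w z) + (?L g z + ?L h z)) = (\<lambda>z. (v z + ?L g z) + (w z + ?L h z))" by (simp add: algebra_simps)
    also have "l1 \<dots> \<le> l1 (\<lambda>z. v z + ?L g z) + l1 (\<lambda>z. w z + ?L h z)"
      using fin_supp.add[OF vw(1) L[OF g(1)]] fin_supp.add[OF vw(2) L[OF h(1)]] by (intro l1_add) auto
    finally show "p (\<lambda>z. v z + w z) \<le> a + b" using g h by (simp add: algebra_simps)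
  qed (use d0 in auto)
  have pscale: "p (\<lambda>z. c * v z) \<le> c * p v" if cv: "c > 0" "v \<in> ?V" for c v
  proof -
    have "p (\<lambda>z. c * v z) / c \<le> p v"
      unfolding p_def[of v]
    proof (rule cINF_greatest)
      fix g assume g: "g \<in> densities"
      have "p (\<lambda>z. c * v z) \<le> l1 (\<lambda>z. c * v z + ?L (\<lambda>x. c * g x) z) - e * l1 (\<lambda>x. c * g x)"
        by (rule up[OF fin_supp.scale[OF cv(2)] dscale[OF g cv(1)]])
      also have "(\<lambda>z. c * v z + ?L (\<lambda>x. c * g x) z) = (\<lambda>z. c * (v z + ?L g z))" by (simp add: Lscale algebra_simps)
      also have "l1 \<dots> - e * l1 (\<lambda>x. c * g x) = c * (l1 (\<lambda>z. v z + ?L g z) - e * l1 g)"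
        unfolding l1_scale using cv by (simp add: algebra_simps)
      finally show "p (\<lambda>z. c * v z) / c \<le> l1 (\<lambda>z. v z + ?L g z) - e * l1 g" using cv by (simp add: field_simps)
    qed (use d0 in auto)
    then show ?thesis using cv by (simp add: field_simps)
  qed
  have "sublinear_on ?V p" using padd pscale by (auto simp: sublinear_on_def)
  from fin_supp.linear_below_sublinear[OF this] obtain \<phi>
    where le: "\<And>v. v \<in> ?V \<Longrightarrow> \<phi> v \<le> p v" and lin: "\<And>v w. v \<in> ?V \<Longrightarrow> w \<in> ?V \<Longrightarrow> \<phi> (\<lambda>z. v z + w z) = \<phi> v + \<phi> w"
    by blast
  have ub: "\<phi> v \<le> l1 v" if "v \<in> ?V" for v
  proof -
    have "?L (\<lambda>_. 0) = (\<lambda>_. 0)" by (auto simp: translation_diff_def)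
    then show ?thesis using le[OF that] up[OF that d0] by (simp add: l1_def)
  qed
  have \<phi>0: "\<phi> (\<lambda>_. 0) = 0" using lin[OF fin_supp.zero fin_supp.zero] by simp
  have neg\<phi>: "\<phi> (\<lambda>z. - v z) = - \<phi> v" if "v \<in> ?V" for v
    using lin[OF that fin_supp.uminus[OF that]] \<phi>0 by simp
  have lb: "- l1 v \<le> \<phi> v" if "v \<in> ?V" for v
    using ub[OF fin_supp.uminus[OF that]] neg\<phi>[OF that] l1_scale[of "-1" v] by simp
  define \<delta> :: "'k \<times> 'k \<Rightarrow> 'k \<times> 'k \<Rightarrow> real" where "\<delta> a = (\<lambda>z. if z = a then 1 else 0)" for a
  have \<delta>: "\<delta> a \<in> ?V" "l1 (\<delta> a) = 1" for a
  proof -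
    have "{z. \<delta> a z \<noteq> 0} = {a}" by (auto simp: \<delta>_def)
    then show "\<delta> a \<in> ?V" "l1 (\<delta> a) = 1" by (auto simp: l1_def \<delta>_def)
  qed
  define h where "h s x = \<phi> (\<delta> (s, x))" for s x
  have hb: "\<bar>h s x\<bar> \<le> 1" for s x using ub[OF \<delta>(1)] lb[OF \<delta>(1)] \<delta>(2) by (auto simp: h_def abs_le_iff)
  \<comment> \<open>Take g to be the point mass at k. Choosing g itself in the infimum for v = -L g
    cancels v and leaves -e, so \<phi>(L g) is at least e; and L g is the sum over s of the point
    mass at (s, s k) minus that at (s, k).\<close>
  have key: "e \<le> (\<Sum>s\<in>S. h s (s \<otimes> k) - h s k)" if k: "k \<in> carrier K" for k
  proof -
    define g where "g x = (if x = k then 1 else 0 :: real)" for x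
    have gs: "{x. g x \<noteq> 0} = {k}" by (auto simp: g_def)
    have g: "g \<in> densities" "l1 g = 1" using k by (auto simp: densities_def gs l1_def) (auto simp: g_def)
    have "p (\<lambda>z. - ?L g z) \<le> - e" using up[OF fin_supp.uminus[OF L[OF g(1)]] g(1)] g(2) by (simp add: l1_def)
    then have "e \<le> \<phi> (?L g)" using le[OF fin_supp.uminus[OF L[OF g(1)]]] neg\<phi>[OF L[OF g(1)]] by simp
    also have "\<phi> (translation_diff S g) = (\<Sum>s\<in>S. h s (s \<otimes> k) - h s k)"
      using S
    proof (induction S rule: finite_induct)
      case empty
      have "translation_diff {} g = (\<lambda>_. 0)" by (auto simp: translation_diff_def)
      then show ?case using \<phi>0 by simp
    next
      case (insert s S)
      have s: "s \<in> carrier K" using insert by simp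
      have T: "translation_diff S g \<in> ?V" using translation_diff_supp[OF g(1), of S] insert by simp
      have iff: "inv s \<otimes> x = k \<longleftrightarrow> x = s \<otimes> k" if "x \<in> carrier K" for x
        using s k that by (metis inv_solve_left)
      have "translation_diff (insert s S) g = (\<lambda>z. translation_diff S g z + (\<delta> (s, s \<otimes> k) z + - \<delta> (s, k) z))"
        using insert(2) s k iff by (auto simp: translation_diff_def \<delta>_def g_def fun_eq_iff)
      then have "\<phi> (translation_diff (insert s S) g) = \<phi> (\<lambda>z. translation_diff S g z + (\<delta> (s, s \<otimes> k) z + - \<delta> (s, k) z))"
        by (rule arg_cong)
      also have "\<dots> = \<phi> (translation_diff S g) + (\<phi> (\<delta> (s, s \<otimes> k)) + \<phi> (\<lambda>z. - \<delta> (s, k) z))"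
        using lin[OF T fin_supp.add[OF \<delta>(1) fin_supp.uminus[OF \<delta>(1)]], of "(s, s \<otimes> k)" "(s, k)"]
          lin[OF \<delta>(1) fin_supp.uminus[OF \<delta>(1)], of "(s, s \<otimes> k)" "(s, k)"] by (simp only:)
      finally show ?case using insert neg\<phi>[OF \<delta>(1)] by (simp add: h_def)
    qed
    finally show ?thesis .
  qed
  have hbd: "bounded (f ` carrier K)" if "\<And>x. \<bar>f x\<bar> \<le> B" for f :: "'k \<Rightarrow> real" and B
    using that by (intro boundedI[of _ B]) auto
  have b2: "\<bar>h s (s \<otimes> x) - h s x\<bar> \<le> 2" for s x
    using hb[of s "s \<otimes> x"] hb[of s x] by linarith
  have madd: "m (\<lambda>x. f x + g x) = m f + m g" if "bounded (f ` carrier K)" "bounded (g ` carrier K)" for f g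
    using m that unfolding invariant_mean_def by blast
  have mscale: "m (\<lambda>x. c * f x) = c * m f" if "bounded (f ` carrier K)" for c f
    using m that unfolding invariant_mean_def by blast
  have "m (\<lambda>x. \<Sum>s\<in>S. h s (s \<otimes> x) - h s x) = (\<Sum>s\<in>S. m (\<lambda>x. h s (s \<otimes> x) - h s x))"
  proof (rule conjunct1[OF mean_sum[OF S(1)]])
    show "bounded ((\<lambda>x. h s (s \<otimes> x) - h s x) ` carrier K)" for s
      by (rule hbd[OF b2])
  qed
  also have "\<dots> = 0"
  proof (rule sum.neutral, rule ballI)
    fix s assume "s \<in> S"
    then have s: "s \<in> carrier K" using S by auto
    have b: "bounded (h s ` carrier K)" "bounded ((\<lambda>x. h s (s \<otimes> x)) ` carrier K)" "bounded ((\<lambda>x. (-1) * h s x) ` carrier K)"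
      using hb[of s] by (auto intro!: hbd[of _ 1])
    have "m (\<lambda>x. h s (inv (inv s) \<otimes> x)) = m (h s)"
      using m b(1) inv_closed[OF s] unfolding invariant_mean_def by blast
    then have "m (\<lambda>x. h s (s \<otimes> x)) = m (h s)" using s by simp
    then show "m (\<lambda>x. h s (s \<otimes> x) - h s x) = 0"
      using madd[OF b(2,3)] mscale[OF b(1), of "-1"] by simp
  qed
  finally have m0: "m (\<lambda>x. \<Sum>s\<in>S. h s (s \<otimes> x) - h s x) = 0" .
  have bs: "bounded ((\<lambda>x. \<Sum>s\<in>S. h s (s \<otimes> x) - h s x) ` carrier K)"
  proof (rule conjunct2[OF mean_sum[OF S(1)]])
    show "bounded ((\<lambda>x. h s (s \<otimes> x) - h s x) ` carrier K)" for s
      by (rule hbd[OF b2])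
  qed
  have bc: "bounded ((\<lambda>x. 1 :: real) ` carrier K)" "bounded ((\<lambda>x. (- e) * 1) ` carrier K)"
    by (auto intro!: hbd)
  have "0 \<le> m (\<lambda>x. (\<Sum>s\<in>S. h s (s \<otimes> x) - h s x) + (- e) * 1)"
  proof -
    have "bounded ((\<lambda>x. (\<Sum>s\<in>S. h s (s \<otimes> x) - h s x) + (- e) * 1) ` carrier K)"
      using bs bc(2) by (rule bounded_plus_comp)
    moreover have "\<forall>x\<in>carrier K. 0 \<le> (\<Sum>s\<in>S. h s (s \<otimes> x) - h s x) + (- e) * 1" using key by simp
    ultimately show ?thesis using m unfolding invariant_mean_def by blast
  qed
  also have "\<dots> = m (\<lambda>x. \<Sum>s\<in>S. h s (s \<otimes> x) - h s x) + (- e) * m (\<lambda>_. 1)"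
    using madd[OF bs bc(2)] mscale[OF bc(1), of "- e"] by simp
  also have "\<dots> = - e" using m0 m by (simp add: invariant_mean_def)
  finally show False using e by simp
qed

text \<open>Pass to square roots of a normalized density: since the square of a difference of roots
  is at most the difference of the squares in absolute value, l1 invariance becomes l2 invariance.
  For unit vectors the squared distance is 2 minus twice the inner product.\<close>

lemma Reiter:
  fixes e :: real
  assumes S: "finite S" "S \<subseteq> carrier K" and e: "e > 0"
  shows "\<exists>F \<xi>. finite F \<and> F \<subseteq> carrier K \<and> (\<forall>x. x \<notin> F \<longrightarrow> \<xi> x = 0) \<and> (\<Sum>x\<in>F. (\<xi> x)\<^sup>2) = 1 \<and>
    (\<forall>s\<in>S. \<bar>1 - (\<Sum>t\<in>F. \<xi> (s \<otimes> t) * \<xi> t)\<bar> \<le> e)"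
proof -
  obtain g where g: "g \<in> densities" "l1 (translation_diff S g) < e * l1 g" using Reiter_aux[OF assms] by blast
  have "l1 g \<noteq> 0" using g(2) l1_nonneg[of "translation_diff S g"] by auto
  then have l1g: "l1 g > 0" using l1_nonneg[of g] by simp
  define F where "F = {x. g x \<noteq> 0}"
  define f where "f x = g x / l1 g" for x
  define \<xi> where "\<xi> x = sqrt (f x)" for x
  have F: "finite F" "F \<subseteq> carrier K" and f0: "\<And>x. 0 \<le> f x" "\<And>x. x \<notin> F \<Longrightarrow> f x = 0"
    using g l1g by (auto simp: F_def f_def densities_def)
  have \<xi>: "\<xi> x = 0" if "x \<notin> F" for x using f0(2)[OF that] by (simp add: \<xi>_def)
  have \<xi>sq: "(\<xi> x)\<^sup>2 = f x" "0 \<le> \<xi> x" for x using f0(1) by (auto simp: \<xi>_def)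
  have "l1 g = (\<Sum>x\<in>F. \<bar>g x\<bar>)" by (simp add: l1_def F_def)
  then have "l1 g = (\<Sum>x\<in>F. g x)" using g by (simp add: densities_def)
  then have sum1: "(\<Sum>x\<in>F. (\<xi> x)\<^sup>2) = 1" using l1g by (simp add: \<xi>sq f_def flip: sum_divide_distrib)
  have "\<bar>1 - (\<Sum>t\<in>F. \<xi> (s \<otimes> t) * \<xi> t)\<bar> \<le> e" if s: "s \<in> S" for s
  proof -
    have sc: "s \<in> carrier K" using s S by auto
    \<comment> \<open>The support together with its translate, so that both vectors are summed over
      the same finite set.\<close>
    define U where "U = F \<union> (\<lambda>t. s \<otimes> t) ` F"
    have U: "finite U" "U \<subseteq> carrier K" using F sc by (auto simp: U_def)
    have inv_s: "inv s \<otimes> (s \<otimes> t) = t" if "t \<in> F" for t using that F sc by (auto simp flip: m_assoc)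
    then have inj: "inj_on (\<lambda>t. s \<otimes> t) F" by (rule inj_on_inverseI)
    have out: "\<xi> (inv s \<otimes> x) = 0" if "x \<in> U" "x \<notin> (\<lambda>t. s \<otimes> t) ` F" for x
    proof (rule \<xi>)
      have "x = s \<otimes> (inv s \<otimes> x)" using that U sc by (auto simp flip: m_assoc)
      then show "inv s \<otimes> x \<notin> F" using that by (metis image_eqI)
    qed
    have re: "(\<Sum>x\<in>U. \<xi> (inv s \<otimes> x) * G x) = (\<Sum>t\<in>F. \<xi> t * G (s \<otimes> t))" for G
    proof -
      have "(\<Sum>x\<in>U. \<xi> (inv s \<otimes> x) * G x) = (\<Sum>x\<in>(\<lambda>t. s \<otimes> t) ` F. \<xi> (inv s \<otimes> x) * G x)"
        using U out by (intro sum.mono_neutral_right) (auto simp: U_def)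
      also have "\<dots> = (\<Sum>t\<in>F. \<xi> t * G (s \<otimes> t))"
        by (subst sum.reindex[OF inj]) (simp add: inv_s)
      finally show ?thesis .
    qed
    have a: "(\<Sum>x\<in>U. (\<xi> (inv s \<otimes> x))\<^sup>2) = 1"
      using re[of "\<lambda>x. \<xi> (inv s \<otimes> x)"] sum1 by (simp add: power2_eq_square inv_s)
    have b: "(\<Sum>x\<in>U. (\<xi> x)\<^sup>2) = 1"
      unfolding sum1[symmetric] using U \<xi> by (intro sum.mono_neutral_right) (auto simp: U_def)
    have "(\<Sum>x\<in>U. (\<xi> (inv s \<otimes> x) - \<xi> x)\<^sup>2) \<le> (\<Sum>x\<in>U. \<bar>f (inv s \<otimes> x) - f x\<bar>)"
    proof (rule sum_mono)
      fix x
      let ?a = "\<xi> (inv s \<otimes> x)" and ?b = "\<xi> x"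
      have "(?a - ?b)\<^sup>2 = \<bar>?a - ?b\<bar> * \<bar>?a - ?b\<bar>" by (simp add: power2_eq_square)
      also have "\<dots> \<le> \<bar>?a - ?b\<bar> * \<bar>?a + ?b\<bar>"
        using \<xi>sq(2)[of x] \<xi>sq(2)[of "inv s \<otimes> x"] by (intro mult_left_mono) auto
      also have "\<dots> = \<bar>?a\<^sup>2 - ?b\<^sup>2\<bar>" by (simp add: power2_eq_square algebra_simps flip: abs_mult)
      finally show "(?a - ?b)\<^sup>2 \<le> \<bar>f (inv s \<otimes> x) - f x\<bar>" by (simp add: \<xi>sq)
    qed
    also have "\<dots> = (\<Sum>x\<in>U. \<bar>translation_diff S g (s, x)\<bar>) / l1 g"
      using U s l1g by (auto simp: translation_diff_def f_def sum_divide_distrib abs_divide simp flip: diff_divide_distrib intro!: sum.cong)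
    also have "(\<Sum>x\<in>U. \<bar>translation_diff S g (s, x)\<bar>) \<le> l1 (translation_diff S g)"
    proof -
      let ?W = "Pair s ` U \<union> {z. translation_diff S g z \<noteq> 0}"
      have W: "finite ?W" using U translation_diff_supp[OF g(1) S] by simp
      have "(\<Sum>x\<in>U. \<bar>translation_diff S g (s, x)\<bar>) = (\<Sum>z\<in>Pair s ` U. \<bar>translation_diff S g z\<bar>)"
        by (subst sum.reindex) (auto simp: inj_on_def)
      also have "\<dots> \<le> (\<Sum>z\<in>?W. \<bar>translation_diff S g z\<bar>)" using W by (intro sum_mono2) auto
      also have "\<dots> = l1 (translation_diff S g)" using W by (intro l1_eq[symmetric]) auto
      finally show ?thesis .
    qed
    finally have "(\<Sum>x\<in>U. (\<xi> (inv s \<otimes> x) - \<xi> x)\<^sup>2) \<le> l1 (translation_diff S g) / l1 g"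
      using l1g by (simp add: divide_right_mono)
    also have "\<dots> \<le> e" using g(2) l1g by (simp add: field_simps)
    finally have le: "(\<Sum>x\<in>U. (\<xi> (inv s \<otimes> x) - \<xi> x)\<^sup>2) \<le> e" .
    have "(\<Sum>x\<in>U. (\<xi> (inv s \<otimes> x) - \<xi> x)\<^sup>2) =
        (\<Sum>x\<in>U. (\<xi> (inv s \<otimes> x))\<^sup>2) + (\<Sum>x\<in>U. (\<xi> x)\<^sup>2) - 2 * (\<Sum>x\<in>U. \<xi> (inv s \<otimes> x) * \<xi> x)"
      by (simp add: power2_diff sum.distrib sum_subtractf sum_distrib_left mult.assoc)
    also have "\<dots> = 2 - 2 * (\<Sum>t\<in>F. \<xi> (s \<otimes> t) * \<xi> t)" unfolding a b re by (simp add: mult.commute)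
    finally have eq: "(\<Sum>x\<in>U. (\<xi> (inv s \<otimes> x) - \<xi> x)\<^sup>2) = 2 - 2 * (\<Sum>t\<in>F. \<xi> (s \<otimes> t) * \<xi> t)" .
    moreover have "0 \<le> (\<Sum>x\<in>U. (\<xi> (inv s \<otimes> x) - \<xi> x)\<^sup>2)" by (simp add: sum_nonneg)
    ultimately show ?thesis using le e by linarith
  qed
  then show ?thesis using F \<xi> sum1 by blast
qed

end

section \<open>Spans of monomials\<close>

text \<open>A ratio x / y above 1 has unbounded powers, whatever C is. This is the step by which
  every crude constant in the development is removed.\<close>

lemma le_of_power_le:
  fixes x y C :: real
  assumes "0 \<le> x" "0 \<le> y" "\<And>n. x ^ (2 ^ n) \<le> C * y ^ (2 ^ n)"
  shows "x \<le> y"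
proof (rule ccontr)
  assume "\<not> x \<le> y"
  then have lt: "y < x" by simp
  have "y \<noteq> 0" using assms(3)[of 0] lt by auto
  then have y: "y > 0" using assms(2) by simp
  define r where "r = x / y"
  have r: "r > 1" using lt y by (simp add: r_def)
  obtain n where n: "C < r ^ n" using real_arch_pow[OF r] by blast
  have "r ^ n \<le> r ^ (2 ^ n)" using r by (intro power_increasing) (auto intro: less_imp_le less_exp)
  also have "\<dots> \<le> C" using assms(3)[of n] y by (simp add: r_def power_divide divide_le_eq)
  finally show False using n by simp
qed

text \<open>Built one scaled generator at a time, so that an induction only has to treat a single
  generator added to an element already handled.\<close>

inductive_set lspan :: "'a cstar \<Rightarrow> 'a set \<Rightarrow> 'a set" for A (structure) and S where
  zero: "\<zero> \<in> lspan A S"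
| step: "x \<in> S \<Longrightarrow> y \<in> lspan A S \<Longrightarrow> c \<odot> x \<oplus> y \<in> lspan A S"

lemma lspan_mono: "x \<in> lspan A S \<Longrightarrow> S \<subseteq> S' \<Longrightarrow> x \<in> lspan A S'"
  by (induction rule: lspan.induct) (auto intro: lspan.intros)

context unital_cstar_algebra
begin

lemma lspan_in: "x \<in> lspan A S \<Longrightarrow> S \<subseteq> carrier A \<Longrightarrow> x \<in> carrier A"
  by (induction rule: lspan.induct) auto

lemma lspan_base: "x \<in> S \<Longrightarrow> S \<subseteq> carrier A \<Longrightarrow> x \<in> lspan A S"
  using lspan.step[OF _ lspan.zero, of x S A 1] by (auto simp: subset_iff)

lemma lspan_add:
  assumes "x \<in> lspan A S" "y \<in> lspan A S" "S \<subseteq> carrier A"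
  shows "x \<oplus> y \<in> lspan A S"
  using assms(1)
proof (induction rule: lspan.induct)
  case zero
  then show ?case using assms lspan_in[OF assms(2)] by simp
next
  case (step x z c)
  then have "c \<odot> x \<oplus> (z \<oplus> y) \<in> lspan A S" by (intro lspan.step)
  moreover have "x \<in> carrier A" "z \<in> carrier A" "y \<in> carrier A" using step assms lspan_in by auto
  ultimately show ?case by (simp add: M.a_assoc)
qed

lemma lspan_smult:
  assumes "x \<in> lspan A S" "S \<subseteq> carrier A" shows "c \<odot> x \<in> lspan A S"
  using assms(1)
proof (induction rule: lspan.induct)
  case (step x y d)
  then have "(c * d) \<odot> x \<oplus> c \<odot> y \<in> lspan A S" by (intro lspan.step)
  moreover have "x \<in> carrier A" "y \<in> carrier A" using step assms lspan_in by auto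
  ultimately show ?case by (simp add: smult_r_distr smult_smult)
qed (simp add: lspan.zero)

lemma lspan_finsum:
  assumes "finite F" "\<And>u. u \<in> F \<Longrightarrow> v u \<in> lspan A S" "S \<subseteq> carrier A"
  shows "finsum A v F \<in> lspan A S"
  using assms(1,2)
proof (induction F rule: finite_induct)
  case (insert u F)
  then have "v u \<oplus> finsum A v F \<in> lspan A S" using assms(3) by (intro lspan_add) auto
  moreover have "v \<in> F \<rightarrow> carrier A" "v u \<in> carrier A" using insert lspan_in assms(3) by auto
  ultimately show ?case using insert by simp
qed (simp add: lspan.zero)

lemma lspan_adj:
  assumes "x \<in> lspan A S" "S \<subseteq> carrier A" "T \<subseteq> carrier A" "\<And>s. s \<in> S \<Longrightarrow> adj A s \<in> T"
  shows "adj A x \<in> lspan A T"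
  using assms(1)
proof (induction rule: lspan.induct)
  case (step x y c)
  have "x \<in> carrier A" "y \<in> carrier A" using step assms lspan_in by auto
  then show ?case using step assms by (auto simp: adj_add adj_smult intro!: lspan.step)
qed (simp add: adj_zero_eq lspan.zero)

lemma lspan_mult:
  assumes "x \<in> lspan A S" "y \<in> lspan A T" "S \<subseteq> carrier A" "T \<subseteq> carrier A" "U \<subseteq> carrier A"
    and m: "\<And>s t. s \<in> S \<Longrightarrow> t \<in> T \<Longrightarrow> s \<otimes> t \<in> lspan A U"
  shows "x \<otimes> y \<in> lspan A U"
proof -
  have yc: "y \<in> carrier A" using assms lspan_in by auto
  have s: "s \<otimes> y \<in> lspan A U" if "s \<in> S" for s
    using assms(2)
  proof (induction rule: lspan.induct)
    case (step t z c)
    have c: "s \<in> carrier A" "t \<in> carrier A" "z \<in> carrier A" using step assms that lspan_in by auto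
    have "c \<odot> (s \<otimes> t) \<oplus> s \<otimes> z \<in> lspan A U"
      using step m[OF that] assms(5) by (intro lspan_add lspan_smult) auto
    then show ?case using c by (simp add: A.r_distr smult_mult_right)
  qed (use that assms in \<open>auto simp: lspan.zero\<close>)
  show ?thesis using assms(1)
  proof (induction rule: lspan.induct)
    case (step x z c)
    have c: "x \<in> carrier A" "z \<in> carrier A" using step assms lspan_in by auto
    have "c \<odot> (x \<otimes> y) \<oplus> z \<otimes> y \<in> lspan A U"
      using step s assms(5) by (intro lspan_add lspan_smult) auto
    then show ?case using c yc by (simp add: A.l_distr smult_mult_left)
  qed (simp add: lspan.zero yc)
qed

lemma lspan_Un:
  assumes "x \<in> lspan A (S \<union> T)" "S \<subseteq> carrier A" "T \<subseteq> carrier A"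
  shows "\<exists>a\<in>lspan A S. \<exists>b\<in>lspan A T. x = a \<oplus> b"
  using assms(1)
proof (induction rule: lspan.induct)
  case zero
  show ?case by (intro bexI[of _ \<zero>]) (simp_all add: lspan.zero)
next
  case (step x y c)
  then obtain a b where ab: "a \<in> lspan A S" "b \<in> lspan A T" "y = a \<oplus> b" by blast
  have abc: "a \<in> carrier A" "b \<in> carrier A" "x \<in> carrier A" using ab step assms lspan_in by auto
  show ?case
  proof (cases "x \<in> S")
    case True
    then have "c \<odot> x \<oplus> a \<in> lspan A S" using ab by (intro lspan.step)
    moreover have "c \<odot> x \<oplus> y = (c \<odot> x \<oplus> a) \<oplus> b" using abc ab by (simp add: M.a_assoc)
    ultimately show ?thesis using ab by blast
  next
    case False
    then have "c \<odot> x \<oplus> b \<in> lspan A T" using ab step by (intro lspan.step) auto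
    moreover have "c \<odot> x \<oplus> y = a \<oplus> (c \<odot> x \<oplus> b)" using abc ab by (simp add: M.a_ac)
    ultimately show ?thesis using ab by blast
  qed
qed

text \<open>The $C^*$-identity turns a bound with a constant on a $*$-closed set into a bound without.\<close>

lemma cnorm_le_by_powers:
  assumes B: "B \<subseteq> carrier A" "\<And>b. b \<in> B \<Longrightarrow> adj A b \<otimes> b \<in> B"
    and bd: "\<And>b M. b \<in> B \<Longrightarrow> 0 \<le> M \<Longrightarrow> \<Phi> b M \<Longrightarrow> cnorm A b \<le> C * M"
    and sq: "\<And>b M. b \<in> B \<Longrightarrow> 0 \<le> M \<Longrightarrow> \<Phi> b M \<Longrightarrow> \<Phi> (adj A b \<otimes> b) (M\<^sup>2)"
    and b: "b \<in> B" "0 \<le> M" "\<Phi> b M"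
  shows "cnorm A b \<le> M"
proof -
  define s where "s n = ((\<lambda>b. adj A b \<otimes> b) ^^ n) b" for n
  have s: "s n \<in> B \<and> \<Phi> (s n) (M ^ (2 ^ n)) \<and> cnorm A (s n) = cnorm A b ^ (2 ^ n)" for n
  proof (induction n)
    case (Suc n)
    have eq: "s (Suc n) = adj A (s n) \<otimes> s n" by (simp add: s_def)
    have "s n \<in> carrier A" using Suc B by auto
    then show ?case using Suc B(2)[of "s n"] sq[of "s n" "M ^ (2 ^ n)"] b(2)
      by (simp add: eq cstar_identity mult.commute flip: power_mult)
  qed (use b in \<open>simp add: s_def\<close>)
  have pw: "cnorm A b ^ (2 ^ n) \<le> C * M ^ (2 ^ n)" for n
    using bd[of "s n" "M ^ (2 ^ n)"] s[of n] b(2) by simp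
  have "0 \<le> cnorm A b" using b(1) B(1) by auto
  then show ?thesis using b(2) pw by (rule le_of_power_le)
qed

lemma cnorm_projection_le:
  assumes "p \<in> carrier A" "adj A p = p" "p \<otimes> p = p" shows "cnorm A p \<le> 1"
proof -
  have "(cnorm A p)\<^sup>2 = cnorm A p" using cstar_identity[OF assms(1)] assms by simp
  then have "cnorm A p = 0 \<or> cnorm A p = 1" by (auto simp: power2_eq_square)
  then show ?thesis by auto
qed

lemma cnorm_mult_le_right:
  "\<lbrakk>x \<in> carrier A; y \<in> carrier A; cnorm A y \<le> 1\<rbrakk> \<Longrightarrow> cnorm A (x \<otimes> y) \<le> cnorm A x"
  using cnorm_mult[of x y] mult_left_mono[of "cnorm A y" 1 "cnorm A x"] by simp

lemma cnorm_mult_le_left: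
  "\<lbrakk>x \<in> carrier A; y \<in> carrier A; cnorm A x \<le> 1\<rbrakk> \<Longrightarrow> cnorm A (x \<otimes> y) \<le> cnorm A y"
  using cnorm_mult[of x y] mult_right_mono[of "cnorm A x" 1 "cnorm A y"] by simp

lemma finsum_swap:
  assumes "finite F" "finite H" "\<And>s t. s \<in> F \<Longrightarrow> t \<in> H \<Longrightarrow> f s t \<in> carrier A"
  shows "finsum A (\<lambda>s. finsum A (f s) H) F = finsum A (\<lambda>t. finsum A (\<lambda>s. f s t) F) H"
  using assms(1,3)
proof (induction F rule: finite_induct)
  case empty
  then show ?case using assms(2) by simp
next
  case (insert a F)
  have "finsum A (\<lambda>t. finsum A (\<lambda>s. f s t) (insert a F)) H = finsum A (\<lambda>t. f a t \<oplus> finsum A (\<lambda>s. f s t) F) H"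
    using insert by (intro M.finsum_cong') (auto simp: Pi_def)
  also have "\<dots> = finsum A (f a) H \<oplus> finsum A (\<lambda>t. finsum A (\<lambda>s. f s t) F) H"
    using insert by (intro M.finsum_addf) (auto intro!: M.finsum_closed)
  finally show ?case using insert by (simp add: Pi_def)
qed

lemma finsum_neutral_subset:
  assumes "finite F" "H \<subseteq> F" "\<And>j. j \<in> H \<Longrightarrow> f j \<in> carrier A" "\<And>j. j \<in> F - H \<Longrightarrow> f j = \<zero>"
  shows "finsum A f F = finsum A f H"
proof -
  have "finsum A f F = finsum A f (H \<union> (F - H))" using assms(2) by (simp add: Un_absorb1)
  also have "\<dots> = finsum A f H \<oplus> finsum A f (F - H)"
    using assms by (intro M.finsum_Un_disjoint) (auto intro: finite_subset)
  also have "finsum A f (F - H) = finsum A (\<lambda>_. \<zero>) (F - H)" using assms by (intro M.finsum_cong') auto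
  finally show ?thesis using assms by (simp add: Pi_def)
qed

end

lemma (in unital_cstar_algebra) finsum_single:
  assumes "finite F" "i \<in> F" "f i \<in> carrier A" "\<And>j. j \<in> F \<Longrightarrow> j \<noteq> i \<Longrightarrow> f j = \<zero>"
  shows "finsum A f F = f i"
  using finsum_neutral_subset[of F "{i}" f] assms by (auto simp: Pi_def)

lemma star_hom_finsum:
  assumes "unital_cstar_algebra A" "unital_cstar_algebra B" "\<pi> \<in> star_hom A B"
    and "finite F" "\<And>u. u \<in> F \<Longrightarrow> v u \<in> carrier A"
  shows "\<pi> (finsum A v F) = finsum B (\<lambda>u. \<pi> (v u)) F"
proof -
  interpret A: unital_cstar_algebra A by fact
  interpret B: unital_cstar_algebra B by fact
  show ?thesis using assms(4,5)
    by (induction F rule: finite_induct)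
      (auto simp: Pi_def star_homD[OF assms(3)] star_hom_zero[OF assms(1-3)])
qed

section \<open>Monomials in a covariant representation\<close>

locale qlo_rep = unital_cstar_algebra A for A :: "'a cstar" (structure) +
  fixes G :: "('g, 'm) monoid_scheme" and P :: "'g set" and W :: "'g \<Rightarrow> 'a"
  assumes qlo: "quasi_lattice_ordered G P" and cov: "covariant_rep G P A W"
begin

sublocale G: group G using qlo by (simp add: quasi_lattice_ordered_def)

lemma P_carrier: "p \<in> P \<Longrightarrow> p \<in> carrier G" using qlo_carrier[OF qlo] .

lemma W_in: "p \<in> P \<Longrightarrow> W p \<in> carrier A"
  using cov by (simp add: covariant_rep_def isometric_rep_def)

lemma W_adj_in: "p \<in> P \<Longrightarrow> adj A (W p) \<in> carrier A"
  using W_in adj_closed by blast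

lemma W_isometry: "p \<in> P \<Longrightarrow> adj A (W p) \<otimes> W p = \<one>"
  using cov by (simp add: covariant_rep_def isometric_rep_def)

lemma W_norm: "p \<in> P \<Longrightarrow> cnorm A (W p) \<le> 1" "p \<in> P \<Longrightarrow> cnorm A (adj A (W p)) \<le> 1"
  using cnorm_isometry_le[OF W_in W_isometry] cnorm_adj[OF W_in] by auto

lemma W_mult: "p \<in> P \<Longrightarrow> r \<in> P \<Longrightarrow> W (p \<otimes>\<^bsub>G\<^esub> r) = W p \<otimes> W r"
  using cov by (simp add: covariant_rep_def isometric_rep_def)

lemma W_one: "W \<one>\<^bsub>G\<^esub> = \<one>"
  using cov by (simp add: covariant_rep_def isometric_rep_def)

text \<open>Inserting the isometry relations produces the product of the two range projections;
  covariance replaces it by that of the join z, or by 0, and factoring z through r and through s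
  cancels the outer isometries. Products of monomials therefore reduce to monomials.\<close>

lemma adj_W_mult_W:
  assumes r: "r \<in> P" and s: "s \<in> P"
  shows "adj A (W r) \<otimes> W s = (case join G P r s of None \<Rightarrow> \<zero>
    | Some z \<Rightarrow> W (inv\<^bsub>G\<^esub> r \<otimes>\<^bsub>G\<^esub> z) \<otimes> adj A (W (inv\<^bsub>G\<^esub> s \<otimes>\<^bsub>G\<^esub> z)))"
proof -
  note c = W_in[OF r] W_in[OF s] W_adj_in[OF r] W_adj_in[OF s]
  have "adj A (W r) \<otimes> W s = (adj A (W r) \<otimes> W r) \<otimes> adj A (W r) \<otimes> (W s \<otimes> (adj A (W s) \<otimes> W s))"
    using c by (simp add: W_isometry[OF r] W_isometry[OF s])
  also have "\<dots> = adj A (W r) \<otimes> (range_proj A (W r) \<otimes> range_proj A (W s)) \<otimes> W s"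
    unfolding range_proj_def using c by (simp add: A.m_assoc)
  also have "\<dots> = adj A (W r) \<otimes> (case join G P r s of Some z \<Rightarrow> range_proj A (W z) | None \<Rightarrow> \<zero>) \<otimes> W s"
    using cov r s by (simp add: covariant_rep_def)
  finally have eq: "adj A (W r) \<otimes> W s = adj A (W r) \<otimes> (case join G P r s of Some z \<Rightarrow> range_proj A (W z) | None \<Rightarrow> \<zero>) \<otimes> W s" .
  show ?thesis
  proof (cases "join G P r s")
    case None
    then show ?thesis using eq c by simp
  next
    case (Some z)
    note j = join_SomeE[OF qlo Some P_carrier[OF r] P_carrier[OF s]]
    define a b where "a = inv\<^bsub>G\<^esub> r \<otimes>\<^bsub>G\<^esub> z" and "b = inv\<^bsub>G\<^esub> s \<otimes>\<^bsub>G\<^esub> z"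
    have ab: "a \<in> P" "b \<in> P" "z = r \<otimes>\<^bsub>G\<^esub> a" "z = s \<otimes>\<^bsub>G\<^esub> b"
      using le_ofD[OF qlo j(2)] le_ofD[OF qlo j(3)] P_carrier r s j(1) by (simp_all add: a_def b_def)
    note c' = W_in[OF ab(1)] W_in[OF ab(2)] W_adj_in[OF ab(1)] W_adj_in[OF ab(2)]
    have "range_proj A (W z) = W r \<otimes> W a \<otimes> (adj A (W b) \<otimes> adj A (W s))"
      unfolding range_proj_def using c c' W_mult[OF r ab(1)] W_mult[OF s ab(2)] ab(3,4)
      by (metis adj_mult)
    then have "adj A (W r) \<otimes> W s = (adj A (W r) \<otimes> W r) \<otimes> (W a \<otimes> adj A (W b)) \<otimes> (adj A (W s) \<otimes> W s)"
      unfolding eq using Some c c' by (simp add: A.m_assoc)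
    then show ?thesis using Some c' by (simp add: W_isometry[OF r] W_isometry[OF s] a_def b_def)
  qed
qed

definition mon :: "'g \<Rightarrow> 'g \<Rightarrow> 'a" where "mon p r = W p \<otimes> adj A (W r)"

text \<open>Indexed by a set of pairs, so that closure of a span under products and adjoints becomes
  a condition on pairs, checked through \<open>monoms_span_mult\<close> and
  \<open>monoms_span_adj\<close>.\<close>

definition monoms :: "('g \<times> 'g) set \<Rightarrow> 'a set" where "monoms I = (\<lambda>(p, r). mon p r) ` I"

lemma mon_in [simp]: "p \<in> P \<Longrightarrow> r \<in> P \<Longrightarrow> mon p r \<in> carrier A"
  by (simp add: mon_def W_in W_adj_in)

lemma monoms_in: "I \<subseteq> P \<times> P \<Longrightarrow> monoms I \<subseteq> carrier A"
  by (auto simp: monoms_def)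

lemma monoms_span_in: "x \<in> lspan A (monoms I) \<Longrightarrow> I \<subseteq> P \<times> P \<Longrightarrow> x \<in> carrier A"
  using lspan_in monoms_in by blast

lemma adj_mon: "p \<in> P \<Longrightarrow> r \<in> P \<Longrightarrow> adj A (mon p r) = mon r p"
  by (simp add: mon_def W_in W_adj_in adj_mult adj_adj)

lemma mon_mult:
  assumes P: "p \<in> P" "r \<in> P" "s \<in> P" "t \<in> P"
  shows "mon p r \<otimes> mon s t = (case join G P r s of None \<Rightarrow> \<zero>
    | Some z \<Rightarrow> mon (p \<otimes>\<^bsub>G\<^esub> (inv\<^bsub>G\<^esub> r \<otimes>\<^bsub>G\<^esub> z)) (t \<otimes>\<^bsub>G\<^esub> (inv\<^bsub>G\<^esub> s \<otimes>\<^bsub>G\<^esub> z)))"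
proof -
  have eq: "mon p r \<otimes> mon s t = W p \<otimes> (adj A (W r) \<otimes> W s) \<otimes> adj A (W t)"
    using P W_in W_adj_in by (simp add: mon_def A.m_assoc)
  show ?thesis
  proof (cases "join G P r s")
    case None
    then show ?thesis using P W_in W_adj_in by (simp add: eq adj_W_mult_W)
  next
    case (Some z)
    note j = join_SomeE[OF qlo Some P_carrier[OF P(2)] P_carrier[OF P(3)]]
    have "inv\<^bsub>G\<^esub> r \<otimes>\<^bsub>G\<^esub> z \<in> P" "inv\<^bsub>G\<^esub> s \<otimes>\<^bsub>G\<^esub> z \<in> P" using j by (simp_all add: le_of_def)
    then show ?thesis using Some P W_in W_adj_in
      unfolding eq adj_W_mult_W[OF P(2,3)] Some option.case by (simp add: mon_def W_mult adj_mult A.m_assoc)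
  qed
qed

lemma monoms_span_mult:
  assumes "x \<in> lspan A (monoms I)" "y \<in> lspan A (monoms J)" "I \<subseteq> P \<times> P" "J \<subseteq> P \<times> P" "H \<subseteq> P \<times> P"
    and "\<And>p r s t z. (p, r) \<in> I \<Longrightarrow> (s, t) \<in> J \<Longrightarrow> join G P r s = Some z \<Longrightarrow>
      (p \<otimes>\<^bsub>G\<^esub> (inv\<^bsub>G\<^esub> r \<otimes>\<^bsub>G\<^esub> z), t \<otimes>\<^bsub>G\<^esub> (inv\<^bsub>G\<^esub> s \<otimes>\<^bsub>G\<^esub> z)) \<in> H"
  shows "x \<otimes> y \<in> lspan A (monoms H)"
proof (rule lspan_mult[OF assms(1,2)])
  fix u v assume "u \<in> monoms I" "v \<in> monoms J"
  then obtain p r s t where I: "(p, r) \<in> I" "u = mon p r" and J: "(s, t) \<in> J" "v = mon s t"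
    by (auto simp: monoms_def)
  have prst: "p \<in> P" "r \<in> P" "s \<in> P" "t \<in> P" using I J assms(3,4) by auto
  show "u \<otimes> v \<in> lspan A (monoms H)"
  proof (cases "join G P r s")
    case None
    then show ?thesis using mon_mult[OF prst] I J by (simp add: lspan.zero)
  next
    case (Some z)
    have "mon (p \<otimes>\<^bsub>G\<^esub> (inv\<^bsub>G\<^esub> r \<otimes>\<^bsub>G\<^esub> z)) (t \<otimes>\<^bsub>G\<^esub> (inv\<^bsub>G\<^esub> s \<otimes>\<^bsub>G\<^esub> z)) \<in> monoms H"
      using assms(6)[OF I(1) J(1) Some] by (force simp: monoms_def)
    then show ?thesis using I J mon_mult[OF prst] Some lspan_base[OF _ monoms_in[OF assms(5)]] by simp
  qed
qed (use assms monoms_in in auto)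

lemma monoms_span_adj:
  assumes "x \<in> lspan A (monoms I)" "I \<subseteq> P \<times> P" "H \<subseteq> P \<times> P" "\<And>p r. (p, r) \<in> I \<Longrightarrow> (r, p) \<in> H"
  shows "adj A x \<in> lspan A (monoms H)"
proof (rule lspan_adj[OF assms(1)])
  fix s assume "s \<in> monoms I"
  then obtain p r where "(p, r) \<in> I" "s = mon p r" by (auto simp: monoms_def)
  then show "adj A s \<in> monoms H" using assms adj_mon[of p r] by (force simp: monoms_def)
qed (use assms monoms_in in auto)

end

section \<open>Controlled maps\<close>

text \<open>The model case: \<open>E\<close> is $B(\ell^2(P))$, and \<open>pr j\<close> is the projection onto the closed span of the basis
  vectors $\epsilon_x$ with $\mu(x) = j$.\<close>

locale controlled_rep = qlo_rep A G P W + E: unital_cstar_algebra E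
  for A :: "'a cstar" (structure) and G :: "('g, 'm) monoid_scheme" and P W and E :: "'e cstar" +
  fixes K :: "('k, 'n) monoid_scheme" and Q :: "'k set" and \<mu> :: "'g \<Rightarrow> 'k"
    and \<pi> :: "'a \<Rightarrow> 'e" and pr :: "'k \<Rightarrow> 'e"
  assumes qloK: "quasi_lattice_ordered K Q" and ctrl: "controlled_map G P K Q \<mu>"
    and \<pi>: "\<pi> \<in> star_hom A E"
    and pr_in: "j \<in> carrier K \<Longrightarrow> pr j \<in> carrier E"
    and pr_adj: "j \<in> carrier K \<Longrightarrow> adj E (pr j) = pr j"
    and pr_idem: "j \<in> carrier K \<Longrightarrow> pr j \<otimes>\<^bsub>E\<^esub> pr j = pr j"
    and pr_orth: "i \<in> carrier K \<Longrightarrow> j \<in> carrier K \<Longrightarrow> i \<noteq> j \<Longrightarrow> pr i \<otimes>\<^bsub>E\<^esub> pr j = \<zero>\<^bsub>E\<^esub>"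
    and pr_zero: "j \<in> carrier K \<Longrightarrow> j \<notin> Q \<Longrightarrow> pr j = \<zero>\<^bsub>E\<^esub>"
    and pr_W: "p \<in> P \<Longrightarrow> j \<in> carrier K \<Longrightarrow> \<pi> (W p) \<otimes>\<^bsub>E\<^esub> pr j = pr (\<mu> p \<otimes>\<^bsub>K\<^esub> j) \<otimes>\<^bsub>E\<^esub> \<pi> (W p)"
    and kernel_isometric: "d \<in> lspan A (monoms ({n \<in> P. \<mu> n = \<one>\<^bsub>K\<^esub>} \<times> {n \<in> P. \<mu> n = \<one>\<^bsub>K\<^esub>})) \<Longrightarrow>
      cnorm A d \<le> cnorm E (\<pi> d \<otimes>\<^bsub>E\<^esub> pr \<one>\<^bsub>K\<^esub>)"
begin

sublocale K: group K using qloK by (simp add: quasi_lattice_ordered_def)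

sublocale \<mu>: group_hom G K \<mu>
  using ctrl by unfold_locales (simp add: controlled_map_def)

lemmas \<pi>_simps = star_homD[OF \<pi>]

abbreviation NP :: "'g set" where "NP \<equiv> {n \<in> P. \<mu> n = \<one>\<^bsub>K\<^esub>}"

lemma A_alg: "unital_cstar_algebra A" and E_alg: "unital_cstar_algebra E"
  by unfold_locales

lemma \<pi>_zero: "\<pi> \<zero>\<^bsub>A\<^esub> = \<zero>\<^bsub>E\<^esub>"
  by (rule star_hom_zero[OF A_alg E_alg \<pi>])

lemma ctrl_simps:
  "\<lbrakk>x \<in> carrier G; y \<in> carrier G; le_of G P x y\<rbrakk> \<Longrightarrow> le_of K Q (\<mu> x) (\<mu> y)"
  "\<lbrakk>x \<in> carrier G; y \<in> carrier G; join G P x y = Some z\<rbrakk> \<Longrightarrow> join K Q (\<mu> x) (\<mu> y) = Some (\<mu> z)"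
  "\<lbrakk>k \<in> Q; x \<in> P; \<mu> x = k\<rbrakk> \<Longrightarrow> \<exists>\<sigma>\<in>minimal_elements G P \<mu> k. le_of G P \<sigma> x"
  "\<lbrakk>k \<in> Q; \<sigma> \<in> minimal_elements G P \<mu> k; \<tau> \<in> minimal_elements G P \<mu> k; join G P \<sigma> \<tau> \<noteq> None\<rbrakk> \<Longrightarrow> \<sigma> = \<tau>"
proof -
  note d = ctrl[unfolded controlled_map_def, THEN conjunct2]
  note c = d[THEN conjunct1] d[THEN conjunct2, THEN conjunct1]
    d[THEN conjunct2, THEN conjunct2, THEN conjunct1] d[THEN conjunct2, THEN conjunct2, THEN conjunct2]
  show "\<lbrakk>x \<in> carrier G; y \<in> carrier G; le_of G P x y\<rbrakk> \<Longrightarrow> le_of K Q (\<mu> x) (\<mu> y)"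
    by (rule c(1)[rule_format])
  show "\<lbrakk>x \<in> carrier G; y \<in> carrier G; join G P x y = Some z\<rbrakk> \<Longrightarrow> join K Q (\<mu> x) (\<mu> y) = Some (\<mu> z)"
    by (rule c(2)[rule_format])
  show "\<lbrakk>k \<in> Q; x \<in> P; \<mu> x = k\<rbrakk> \<Longrightarrow> \<exists>\<sigma>\<in>minimal_elements G P \<mu> k. le_of G P \<sigma> x"
    by (rule c(3)[rule_format])
  show "\<lbrakk>k \<in> Q; \<sigma> \<in> minimal_elements G P \<mu> k; \<tau> \<in> minimal_elements G P \<mu> k; join G P \<sigma> \<tau> \<noteq> None\<rbrakk> \<Longrightarrow> \<sigma> = \<tau>"
    by (rule c(4)[rule_format])
qed

lemma \<mu>_P: "p \<in> P \<Longrightarrow> \<mu> p \<in> Q"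
proof -
  assume p: "p \<in> P"
  have "le_of G P \<one>\<^bsub>G\<^esub> p" using p P_carrier by (simp add: le_of_def)
  then have "le_of K Q (\<mu> \<one>\<^bsub>G\<^esub>) (\<mu> p)" using p P_carrier by (intro ctrl_simps) auto
  then show ?thesis using p P_carrier by (simp add: le_of_def)
qed

lemma Q_carrier: "k \<in> Q \<Longrightarrow> k \<in> carrier K" by (rule qlo_carrier[OF qloK])

lemma \<mu>_carrier: "p \<in> P \<Longrightarrow> \<mu> p \<in> carrier K" using P_carrier by simp

lemma \<mu>_join: "p \<in> P \<Longrightarrow> r \<in> P \<Longrightarrow> join G P p r = Some z \<Longrightarrow> join K Q (\<mu> p) (\<mu> r) = Some (\<mu> z)"
  using P_carrier by (intro ctrl_simps) auto

lemma \<pi>W_in: "p \<in> P \<Longrightarrow> \<pi> (W p) \<in> carrier E" "p \<in> P \<Longrightarrow> adj E (\<pi> (W p)) \<in> carrier E"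
  using \<pi>_simps(1) W_in E.adj_closed by auto

lemma pr_W_adj:
  assumes p: "p \<in> P" and j: "j \<in> carrier K"
  shows "adj E (\<pi> (W p)) \<otimes>\<^bsub>E\<^esub> pr j = pr (inv\<^bsub>K\<^esub> \<mu> p \<otimes>\<^bsub>K\<^esub> j) \<otimes>\<^bsub>E\<^esub> adj E (\<pi> (W p))"
proof -
  define i where "i = inv\<^bsub>K\<^esub> \<mu> p \<otimes>\<^bsub>K\<^esub> j"
  have i: "i \<in> carrier K" "\<mu> p \<otimes>\<^bsub>K\<^esub> i = j" using \<mu>_carrier[OF p] j by (simp_all add: i_def flip: K.m_assoc)
  have "adj E (\<pi> (W p) \<otimes>\<^bsub>E\<^esub> pr i) = adj E (pr j \<otimes>\<^bsub>E\<^esub> \<pi> (W p))" using pr_W[OF p i(1)] i(2) by simp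
  then show ?thesis using i(1) j p by (simp add: E.adj_mult pr_in pr_adj \<pi>W_in i_def)
qed

lemma \<pi>_mon: "p \<in> P \<Longrightarrow> r \<in> P \<Longrightarrow> \<pi> (mon p r) = \<pi> (W p) \<otimes>\<^bsub>E\<^esub> adj E (\<pi> (W r))"
  using W_in W_adj_in \<pi>_simps by (simp add: mon_def)

lemma mon_pr:
  assumes p: "p \<in> P" "r \<in> P" and j: "j \<in> carrier K"
  shows "\<pi> (mon p r) \<otimes>\<^bsub>E\<^esub> pr j = pr (\<mu> p \<otimes>\<^bsub>K\<^esub> inv\<^bsub>K\<^esub> \<mu> r \<otimes>\<^bsub>K\<^esub> j) \<otimes>\<^bsub>E\<^esub> \<pi> (mon p r)"
proof -
  have c: "\<mu> p \<in> carrier K" "\<mu> r \<in> carrier K" using p \<mu>_carrier by auto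
  have "\<pi> (mon p r) \<otimes>\<^bsub>E\<^esub> pr j = \<pi> (W p) \<otimes>\<^bsub>E\<^esub> (adj E (\<pi> (W r)) \<otimes>\<^bsub>E\<^esub> pr j)"
    using p j by (simp add: \<pi>_mon E.A.m_assoc \<pi>W_in pr_in)
  also have "\<dots> = (\<pi> (W p) \<otimes>\<^bsub>E\<^esub> pr (inv\<^bsub>K\<^esub> \<mu> r \<otimes>\<^bsub>K\<^esub> j)) \<otimes>\<^bsub>E\<^esub> adj E (\<pi> (W r))"
    using p j c by (simp add: pr_W_adj E.A.m_assoc \<pi>W_in pr_in)
  also have "\<dots> = pr (\<mu> p \<otimes>\<^bsub>K\<^esub> (inv\<^bsub>K\<^esub> \<mu> r \<otimes>\<^bsub>K\<^esub> j)) \<otimes>\<^bsub>E\<^esub> \<pi> (mon p r)"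
    using p j c by (simp add: pr_W \<pi>_mon E.A.m_assoc \<pi>W_in pr_in)
  finally show ?thesis using j c by (simp add: K.m_assoc)
qed

text \<open>The adjoint of W r moves level j to the level obtained by dividing by \<mu>(r), which
  lies outside Q unless \<mu>(r) \<le> j. This triangularity lets levels be separated one by
  one.\<close>

lemma mon_pr_zero:
  assumes p: "p \<in> P" "r \<in> P" and j: "j \<in> carrier K" "\<not> le_of K Q (\<mu> r) j"
  shows "\<pi> (mon p r) \<otimes>\<^bsub>E\<^esub> pr j = \<zero>\<^bsub>E\<^esub>"
proof -
  have "pr (inv\<^bsub>K\<^esub> \<mu> r \<otimes>\<^bsub>K\<^esub> j) = \<zero>\<^bsub>E\<^esub>"
    using p j \<mu>_carrier by (intro pr_zero) (auto simp: le_of_def)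
  then have "adj E (\<pi> (W r)) \<otimes>\<^bsub>E\<^esub> pr j = \<zero>\<^bsub>E\<^esub>" using p j by (simp add: pr_W_adj \<pi>W_in)
  then show ?thesis using p j by (simp add: \<pi>_mon E.A.m_assoc \<pi>W_in pr_in)
qed

section \<open>The grading by K\<close>

definition deg :: "'k \<Rightarrow> ('g \<times> 'g) set" where
  "deg k = {(p, r). p \<in> P \<and> r \<in> P \<and> \<mu> p \<otimes>\<^bsub>K\<^esub> inv\<^bsub>K\<^esub> \<mu> r = k}"

abbreviation Deg :: "'k \<Rightarrow> 'a set" where "Deg k \<equiv> lspan A (monoms (deg k))"

lemma deg_sub: "deg k \<subseteq> P \<times> P" by (auto simp: deg_def)

lemma Deg_in: "x \<in> Deg k \<Longrightarrow> x \<in> carrier A" using monoms_span_in deg_sub by blast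

text \<open>Homogeneous elements act as block shifts: degree k carries level j to level k j, as each
  monomial does.\<close>

lemma Deg_pr:
  assumes "x \<in> Deg k" and k: "k \<in> carrier K" and "j \<in> carrier K"
  shows "\<pi> x \<otimes>\<^bsub>E\<^esub> pr j = pr (k \<otimes>\<^bsub>K\<^esub> j) \<otimes>\<^bsub>E\<^esub> \<pi> x"
  using assms(1)
proof (induction rule: lspan.induct)
  case (step x y c)
  then obtain p r where pr: "x = mon p r" "p \<in> P" "r \<in> P" "k = \<mu> p \<otimes>\<^bsub>K\<^esub> inv\<^bsub>K\<^esub> \<mu> r"
    by (auto simp: monoms_def deg_def)
  have "\<pi> x \<otimes>\<^bsub>E\<^esub> pr j = pr (k \<otimes>\<^bsub>K\<^esub> j) \<otimes>\<^bsub>E\<^esub> \<pi> x"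
    using mon_pr[OF pr(2,3) assms(3)] by (simp add: pr(1,4))
  moreover have "x \<in> carrier A" "y \<in> carrier A" "k \<otimes>\<^bsub>K\<^esub> j \<in> carrier K"
    using pr step Deg_in assms(3) \<mu>_carrier by auto
  ultimately show ?case using step assms(3)
    by (simp add: \<pi>_simps pr_in E.A.l_distr E.A.r_distr E.smult_mult_left E.smult_mult_right)
qed (use assms(3) k in \<open>simp add: \<pi>_zero pr_in\<close>)

lemma monom_product_in:
  assumes "p \<in> P" "r \<in> P" "s \<in> P" "t \<in> P" "join G P r s = Some z"
  shows "p \<otimes>\<^bsub>G\<^esub> (inv\<^bsub>G\<^esub> r \<otimes>\<^bsub>G\<^esub> z) \<in> P" "t \<otimes>\<^bsub>G\<^esub> (inv\<^bsub>G\<^esub> s \<otimes>\<^bsub>G\<^esub> z) \<in> P"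
    "\<mu> (p \<otimes>\<^bsub>G\<^esub> (inv\<^bsub>G\<^esub> r \<otimes>\<^bsub>G\<^esub> z)) = \<mu> p \<otimes>\<^bsub>K\<^esub> inv\<^bsub>K\<^esub> \<mu> r \<otimes>\<^bsub>K\<^esub> \<mu> z"
    "\<mu> (t \<otimes>\<^bsub>G\<^esub> (inv\<^bsub>G\<^esub> s \<otimes>\<^bsub>G\<^esub> z)) = \<mu> t \<otimes>\<^bsub>K\<^esub> inv\<^bsub>K\<^esub> \<mu> s \<otimes>\<^bsub>K\<^esub> \<mu> z"
proof -
  note j = join_SomeE[OF qlo assms(5) P_carrier[OF assms(2)] P_carrier[OF assms(3)]]
  show "p \<otimes>\<^bsub>G\<^esub> (inv\<^bsub>G\<^esub> r \<otimes>\<^bsub>G\<^esub> z) \<in> P" "t \<otimes>\<^bsub>G\<^esub> (inv\<^bsub>G\<^esub> s \<otimes>\<^bsub>G\<^esub> z) \<in> P"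
    using j assms qlo_mult[OF qlo] by (simp_all add: le_of_def)
  show "\<mu> (p \<otimes>\<^bsub>G\<^esub> (inv\<^bsub>G\<^esub> r \<otimes>\<^bsub>G\<^esub> z)) = \<mu> p \<otimes>\<^bsub>K\<^esub> inv\<^bsub>K\<^esub> \<mu> r \<otimes>\<^bsub>K\<^esub> \<mu> z"
    "\<mu> (t \<otimes>\<^bsub>G\<^esub> (inv\<^bsub>G\<^esub> s \<otimes>\<^bsub>G\<^esub> z)) = \<mu> t \<otimes>\<^bsub>K\<^esub> inv\<^bsub>K\<^esub> \<mu> s \<otimes>\<^bsub>K\<^esub> \<mu> z"
    using j(1) assms P_carrier by (simp_all add: K.m_assoc)
qed

lemma Deg_mult:
  assumes "x \<in> Deg k" "y \<in> Deg l" "k \<in> carrier K" "l \<in> carrier K"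
  shows "x \<otimes> y \<in> Deg (k \<otimes>\<^bsub>K\<^esub> l)"
proof (rule monoms_span_mult[OF assms(1,2) deg_sub deg_sub deg_sub])
  fix p r s t z assume a: "(p, r) \<in> deg k" "(s, t) \<in> deg l" and j: "join G P r s = Some z"
  then have P: "p \<in> P" "r \<in> P" "s \<in> P" "t \<in> P" and kl: "k = \<mu> p \<otimes>\<^bsub>K\<^esub> inv\<^bsub>K\<^esub> \<mu> r" "l = \<mu> s \<otimes>\<^bsub>K\<^esub> inv\<^bsub>K\<^esub> \<mu> t"
    by (auto simp: deg_def)
  note c = P[THEN \<mu>_carrier]
  have z: "\<mu> z \<in> carrier K" using join_SomeD(2)[OF qlo P_carrier P_carrier j] P \<mu>_carrier by auto
  have "(\<mu> p \<otimes>\<^bsub>K\<^esub> inv\<^bsub>K\<^esub> \<mu> r \<otimes>\<^bsub>K\<^esub> \<mu> z) \<otimes>\<^bsub>K\<^esub> inv\<^bsub>K\<^esub> (\<mu> t \<otimes>\<^bsub>K\<^esub> inv\<^bsub>K\<^esub> \<mu> s \<otimes>\<^bsub>K\<^esub> \<mu> z) =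
      \<mu> p \<otimes>\<^bsub>K\<^esub> inv\<^bsub>K\<^esub> \<mu> r \<otimes>\<^bsub>K\<^esub> (\<mu> z \<otimes>\<^bsub>K\<^esub> inv\<^bsub>K\<^esub> \<mu> z) \<otimes>\<^bsub>K\<^esub> (\<mu> s \<otimes>\<^bsub>K\<^esub> inv\<^bsub>K\<^esub> \<mu> t)"
    using c z by (simp only: K.inv_mult_group K.m_assoc K.inv_closed K.m_closed K.inv_inv)
  then show "(p \<otimes>\<^bsub>G\<^esub> (inv\<^bsub>G\<^esub> r \<otimes>\<^bsub>G\<^esub> z), t \<otimes>\<^bsub>G\<^esub> (inv\<^bsub>G\<^esub> s \<otimes>\<^bsub>G\<^esub> z)) \<in> deg (k \<otimes>\<^bsub>K\<^esub> l)"
    using monom_product_in[OF P j] c z by (simp add: deg_def kl)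
qed

lemma Deg_adj:
  assumes "x \<in> Deg k" "k \<in> carrier K" shows "adj A x \<in> Deg (inv\<^bsub>K\<^esub> k)"
  using assms \<mu>_carrier by (intro monoms_span_adj[OF assms(1) deg_sub deg_sub]) (auto simp: deg_def K.inv_mult_group)

lemma pr_norm: "j \<in> carrier K \<Longrightarrow> cnorm E (pr j) \<le> 1"
  by (rule E.cnorm_projection_le) (auto simp: pr_in pr_adj pr_idem)

lemma \<pi>_in: "x \<in> carrier A \<Longrightarrow> \<pi> x \<in> carrier E" by (rule \<pi>_simps)

text \<open>In degree e the image commutes with \<open>pr j\<close>, so cutting by
  \<open>pr j\<close> respects products and adjoints. This supplies the squaring hypothesis of
  \<open>cnorm_le_by_powers\<close>.\<close>

lemma Deg_one_square_pr:
  assumes "x \<in> Deg \<one>\<^bsub>K\<^esub>" "j \<in> carrier K"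
  shows "cnorm E (\<pi> (adj A x \<otimes> x) \<otimes>\<^bsub>E\<^esub> pr j) = (cnorm E (\<pi> x \<otimes>\<^bsub>E\<^esub> pr j))\<^sup>2"
proof -
  have x: "x \<in> carrier A" "\<pi> x \<in> carrier E" "adj E (\<pi> x) \<in> carrier E"
    using Deg_in[OF assms(1)] \<pi>_in E.adj_closed by auto
  have "\<pi> x \<otimes>\<^bsub>E\<^esub> pr j = pr j \<otimes>\<^bsub>E\<^esub> \<pi> x" using Deg_pr[OF assms(1) K.one_closed assms(2)] assms(2) by simp
  then have c: "adj E (\<pi> x) \<otimes>\<^bsub>E\<^esub> pr j = pr j \<otimes>\<^bsub>E\<^esub> adj E (\<pi> x)"
    using x assms(2) by (metis E.adj_mult pr_adj pr_in)
  have "adj E (\<pi> x \<otimes>\<^bsub>E\<^esub> pr j) \<otimes>\<^bsub>E\<^esub> (\<pi> x \<otimes>\<^bsub>E\<^esub> pr j) = (pr j \<otimes>\<^bsub>E\<^esub> adj E (\<pi> x)) \<otimes>\<^bsub>E\<^esub> (\<pi> x \<otimes>\<^bsub>E\<^esub> pr j)"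
    using x assms(2) by (simp add: E.adj_mult pr_adj pr_in)
  also have "\<dots> = adj E (\<pi> x) \<otimes>\<^bsub>E\<^esub> (pr j \<otimes>\<^bsub>E\<^esub> \<pi> x) \<otimes>\<^bsub>E\<^esub> pr j"
    unfolding c[symmetric] using x assms(2) by (simp add: E.A.m_assoc pr_in)
  also have "\<dots> = adj E (\<pi> x) \<otimes>\<^bsub>E\<^esub> \<pi> x \<otimes>\<^bsub>E\<^esub> (pr j \<otimes>\<^bsub>E\<^esub> pr j)"
    unfolding \<open>\<pi> x \<otimes>\<^bsub>E\<^esub> pr j = pr j \<otimes>\<^bsub>E\<^esub> \<pi> x\<close>[symmetric] using x assms(2) by (simp add: E.A.m_assoc pr_in)
  also have "\<dots> = \<pi> (adj A x \<otimes> x) \<otimes>\<^bsub>E\<^esub> pr j"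
    using x assms(2) adj_closed by (simp add: pr_idem \<pi>_simps)
  finally show ?thesis using E.cstar_identity[of "\<pi> x \<otimes>\<^bsub>E\<^esub> pr j"] x assms(2) by (simp add: pr_in)
qed

subsection \<open>Matrix units at a fixed level\<close>

context fixes l assumes l: "l \<in> Q"
begin

abbreviation "Mins \<equiv> minimal_elements G P \<mu> l"

lemma Mins_D: "\<sigma> \<in> Mins \<Longrightarrow> \<sigma> \<in> P" "\<sigma> \<in> Mins \<Longrightarrow> \<mu> \<sigma> = l"
  by (auto simp: minimal_elements_def)

lemma Mins_decompose:
  assumes "p \<in> P" "\<mu> p = l"
  shows "\<exists>\<sigma>\<in>Mins. \<exists>n\<in>NP. p = \<sigma> \<otimes>\<^bsub>G\<^esub> n"
proof -
  obtain \<sigma> where \<sigma>: "\<sigma> \<in> Mins" "le_of G P \<sigma> p" using ctrl_simps(3)[OF l assms] by blast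
  define n where "n = inv\<^bsub>G\<^esub> \<sigma> \<otimes>\<^bsub>G\<^esub> p"
  note s = Mins_D[OF \<sigma>(1)]
  have n: "n \<in> P" "p = \<sigma> \<otimes>\<^bsub>G\<^esub> n" using le_ofD[OF qlo \<sigma>(2)] s assms P_carrier by (simp_all add: n_def)
  have "\<mu> n = inv\<^bsub>K\<^esub> l \<otimes>\<^bsub>K\<^esub> l" using s assms P_carrier by (simp add: n_def)
  then show ?thesis using \<sigma> n Q_carrier[OF l] by auto
qed

text \<open>Index pairs of matrices over the kernel algebra: the monomial of a pair is W \<sigma>
  times a kernel monomial times the adjoint of W \<tau>, with row \<sigma> and column \<tau>.
  Restricting to a set S that will be finite makes a sum of range projections available as
  unit.\<close>

definition units :: "'g set \<Rightarrow> ('g \<times> 'g) set" where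
  "units S = {(\<sigma> \<otimes>\<^bsub>G\<^esub> n, \<tau> \<otimes>\<^bsub>G\<^esub> m) |\<sigma> \<tau> n m. \<sigma> \<in> S \<and> \<tau> \<in> S \<and> n \<in> NP \<and> m \<in> NP}"

lemma units_sub: "S \<subseteq> Mins \<Longrightarrow> units S \<subseteq> P \<times> P"
  using Mins_D(1) qlo_mult[OF qlo] by (auto simp: units_def)

lemma units_deg: "S \<subseteq> Mins \<Longrightarrow> units S \<subseteq> deg \<one>\<^bsub>K\<^esub>"
proof clarify
  fix p r assume S: "S \<subseteq> Mins" and "(p, r) \<in> units S"
  then obtain \<sigma> \<tau> n m where u: "p = \<sigma> \<otimes>\<^bsub>G\<^esub> n" "r = \<tau> \<otimes>\<^bsub>G\<^esub> m" "\<sigma> \<in> S" "\<tau> \<in> S" "n \<in> NP" "m \<in> NP"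
    by (auto simp: units_def)
  then have "\<sigma> \<in> P" "\<tau> \<in> P" "\<mu> \<sigma> = l" "\<mu> \<tau> = l" using S Mins_D by auto
  then show "(p, r) \<in> deg \<one>\<^bsub>K\<^esub>" using u P_carrier Q_carrier[OF l] qlo_mult[OF qlo] by (auto simp: deg_def)
qed

text \<open>Condition (1) on \<mu> forces the join of two elements of level l to have level l again,
  so the factors that complete r and s to z lie in the kernel and are absorbed into n and
  m'.\<close>

lemma units_mult:
  assumes S: "S \<subseteq> Mins" and x: "x \<in> lspan A (monoms (units S))" and y: "y \<in> lspan A (monoms (units S))"
  shows "x \<otimes> y \<in> lspan A (monoms (units S))"
proof (rule monoms_span_mult[OF x y units_sub[OF S] units_sub[OF S] units_sub[OF S]])
  fix p r s t z assume "(p, r) \<in> units S" "(s, t) \<in> units S" and j: "join G P r s = Some z"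
  then obtain \<sigma> \<tau> \<sigma>' \<tau>' n m n' m' where u: "p = \<sigma> \<otimes>\<^bsub>G\<^esub> n" "r = \<tau> \<otimes>\<^bsub>G\<^esub> m" "\<sigma> \<in> S" "\<tau> \<in> S" "n \<in> NP" "m \<in> NP"
     and v: "s = \<sigma>' \<otimes>\<^bsub>G\<^esub> n'" "t = \<tau>' \<otimes>\<^bsub>G\<^esub> m'" "\<sigma>' \<in> S" "\<tau>' \<in> S" "n' \<in> NP" "m' \<in> NP"
    by (auto simp: units_def)
  have M: "\<sigma> \<in> P" "\<tau> \<in> P" "\<sigma>' \<in> P" "\<tau>' \<in> P" "\<mu> \<tau> = l" "\<mu> \<sigma>' = l" using u v S Mins_D by auto
  have N: "n \<in> P" "m \<in> P" "n' \<in> P" "m' \<in> P" using u v by auto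
  note c = M(1-4)[THEN P_carrier] N[THEN P_carrier]
  have P: "p \<in> P" "r \<in> P" "s \<in> P" "t \<in> P" using u v M N qlo_mult[OF qlo] by auto
  note J = join_SomeE[OF qlo j P_carrier[OF P(2)] P_carrier[OF P(3)]]
  have lc: "l \<in> carrier K" using Q_carrier[OF l] .
  have "join K Q l l = Some (\<mu> z)" using \<mu>_join[OF P(2,3) j] u v M c lc by simp
  moreover have "join K Q l l = Some l"
    using l lc by (intro join_eqI[OF qloK]) (auto simp: is_lub_def upper_bounds_def le_of_refl[OF qloK])
  ultimately have \<mu>z: "\<mu> z = l" by simp
  have zc: "z \<in> carrier G" using P_carrier[OF J(1)] .
  have a: "inv\<^bsub>G\<^esub> r \<otimes>\<^bsub>G\<^esub> z \<in> NP" "inv\<^bsub>G\<^esub> s \<otimes>\<^bsub>G\<^esub> z \<in> NP"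
    using J(2,3) zc c M u v lc \<mu>z by (auto simp: le_of_def)
  have "n \<otimes>\<^bsub>G\<^esub> (inv\<^bsub>G\<^esub> r \<otimes>\<^bsub>G\<^esub> z) \<in> NP" "m' \<otimes>\<^bsub>G\<^esub> (inv\<^bsub>G\<^esub> s \<otimes>\<^bsub>G\<^esub> z) \<in> NP"
    using a u v qlo_mult[OF qlo] P_carrier by (auto simp del: \<mu>.hom_inv)
  moreover have "p \<otimes>\<^bsub>G\<^esub> (inv\<^bsub>G\<^esub> r \<otimes>\<^bsub>G\<^esub> z) = \<sigma> \<otimes>\<^bsub>G\<^esub> (n \<otimes>\<^bsub>G\<^esub> (inv\<^bsub>G\<^esub> r \<otimes>\<^bsub>G\<^esub> z))"
    "t \<otimes>\<^bsub>G\<^esub> (inv\<^bsub>G\<^esub> s \<otimes>\<^bsub>G\<^esub> z) = \<tau>' \<otimes>\<^bsub>G\<^esub> (m' \<otimes>\<^bsub>G\<^esub> (inv\<^bsub>G\<^esub> s \<otimes>\<^bsub>G\<^esub> z))"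
    using c a[THEN CollectD] P_carrier by (simp_all add: u(1) v(2) G.m_assoc)
  ultimately show "(p \<otimes>\<^bsub>G\<^esub> (inv\<^bsub>G\<^esub> r \<otimes>\<^bsub>G\<^esub> z), t \<otimes>\<^bsub>G\<^esub> (inv\<^bsub>G\<^esub> s \<otimes>\<^bsub>G\<^esub> z)) \<in> units S"
    using u(3) v(4) unfolding units_def by blast
qed

lemma units_adj:
  assumes S: "S \<subseteq> Mins" and x: "x \<in> lspan A (monoms (units S))"
  shows "adj A x \<in> lspan A (monoms (units S))"
  by (rule monoms_span_adj[OF x units_sub[OF S] units_sub[OF S]]) (auto simp: units_def)

text \<open>Distinct minimal elements have no join by condition (3), so covariance makes their
  ranges orthogonal.\<close>

lemma Mins_isometries:
  assumes "\<sigma> \<in> Mins" "\<tau> \<in> Mins"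
  shows "adj A (W \<sigma>) \<otimes> W \<tau> = (if \<sigma> = \<tau> then \<one> else \<zero>)"
proof (cases "\<sigma> = \<tau>")
  case False
  then have "join G P \<sigma> \<tau> = None" using ctrl_simps(4)[OF l assms] by blast
  then show ?thesis using False adj_W_mult_W[of \<sigma> \<tau>] Mins_D(1) assms by simp
qed (use W_isometry Mins_D assms in simp)

text \<open>Extraction of the matrix entry at (\<rho>, \<tau>): orthogonality of the ranges kills
  every other row and column and leaves a kernel element.\<close>

lemma units_coefficient:
  assumes S: "S \<subseteq> Mins" and x: "x \<in> lspan A (monoms (units S))" and \<rho>: "\<rho> \<in> Mins" "\<tau> \<in> Mins"
  shows "adj A (W \<rho>) \<otimes> x \<otimes> W \<tau> \<in> lspan A (monoms (NP \<times> NP))"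
  using x
proof (induction rule: lspan.induct)
  note w = W_in[OF Mins_D(1)[OF \<rho>(1)]] W_in[OF Mins_D(1)[OF \<rho>(2)]] W_adj_in[OF Mins_D(1)[OF \<rho>(1)]] W_adj_in[OF Mins_D(1)[OF \<rho>(2)]]
  have sub: "NP \<times> NP \<subseteq> P \<times> P" by auto
  case zero
  then show ?case using w by (simp add: lspan.zero)
next
  note w = W_in[OF Mins_D(1)[OF \<rho>(1)]] W_in[OF Mins_D(1)[OF \<rho>(2)]] W_adj_in[OF Mins_D(1)[OF \<rho>(1)]] W_adj_in[OF Mins_D(1)[OF \<rho>(2)]]
  have sub: "NP \<times> NP \<subseteq> P \<times> P" by auto
  case (step x y c)
  then obtain \<sigma> \<tau>' n m where u: "x = mon (\<sigma> \<otimes>\<^bsub>G\<^esub> n) (\<tau>' \<otimes>\<^bsub>G\<^esub> m)" "\<sigma> \<in> S" "\<tau>' \<in> S" "n \<in> NP" "m \<in> NP"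
    by (auto simp: units_def monoms_def)
  have M: "\<sigma> \<in> Mins" "\<tau>' \<in> Mins" using u S by auto
  note M' = M[THEN Mins_D(1)]
  have N: "n \<in> P" "m \<in> P" using u by auto
  note c = M'[THEN W_in] M'[THEN W_adj_in] N[THEN W_in] N[THEN W_adj_in]
  have xe: "x = W \<sigma> \<otimes> (W n \<otimes> (adj A (W m) \<otimes> adj A (W \<tau>')))"
    using c M' N by (simp add: u(1) mon_def W_mult adj_mult A.m_assoc)
  have xc: "x \<in> carrier A" using c by (simp add: xe)
  have yc: "y \<in> carrier A" using step monoms_span_in units_sub[OF S] by blast
  have "adj A (W \<rho>) \<otimes> x \<otimes> W \<tau> = (adj A (W \<rho>) \<otimes> W \<sigma>) \<otimes> (W n \<otimes> (adj A (W m))) \<otimes> (adj A (W \<tau>') \<otimes> W \<tau>)"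
    using c w by (simp add: xe A.m_assoc)
  also have "\<dots> = (if \<rho> = \<sigma> \<and> \<tau>' = \<tau> then mon n m else \<zero>)"
    using c by (simp add: Mins_isometries \<rho> M mon_def)
  finally have "adj A (W \<rho>) \<otimes> x \<otimes> W \<tau> \<in> lspan A (monoms (NP \<times> NP))"
    using u(4,5) by (auto intro!: lspan_base monoms_in[OF sub] lspan.zero simp: monoms_def)
  then have "c \<odot> (adj A (W \<rho>) \<otimes> x \<otimes> W \<tau>) \<oplus> adj A (W \<rho>) \<otimes> y \<otimes> W \<tau> \<in> lspan A (monoms (NP \<times> NP))"
    using step monoms_in[OF sub] by (intro lspan_add lspan_smult) auto
  then show ?case using xc yc w by (simp add: A.l_distr A.r_distr smult_mult_left smult_mult_right)
qed

lemma units_left_id: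
  assumes S: "finite S" "S \<subseteq> Mins" and x: "x \<in> lspan A (monoms (units S))"
  shows "finsum A (\<lambda>\<rho>. W \<rho> \<otimes> adj A (W \<rho>)) S \<otimes> x = x"
  using x
proof (induction rule: lspan.induct)
  have ec: "finsum A (\<lambda>\<rho>. W \<rho> \<otimes> adj A (W \<rho>)) S \<in> carrier A"
    using S Mins_D W_in W_adj_in by (intro M.finsum_closed) auto
  case zero
  then show ?case using ec by simp
next
  have ec: "finsum A (\<lambda>\<rho>. W \<rho> \<otimes> adj A (W \<rho>)) S \<in> carrier A"
    using S Mins_D W_in W_adj_in by (intro M.finsum_closed) auto
  case (step x y c)
  then obtain \<sigma> \<tau>' n m where u: "x = mon (\<sigma> \<otimes>\<^bsub>G\<^esub> n) (\<tau>' \<otimes>\<^bsub>G\<^esub> m)" "\<sigma> \<in> S" "\<tau>' \<in> S" "n \<in> NP" "m \<in> NP"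
    by (auto simp: units_def monoms_def)
  have M: "\<sigma> \<in> Mins" "\<tau>' \<in> Mins" using u S by auto
  note M' = M[THEN Mins_D(1)]
  have N: "n \<in> P" "m \<in> P" using u by auto
  note c = M'[THEN W_in] M'[THEN W_adj_in] N[THEN W_in] N[THEN W_adj_in]
  have xe: "x = W \<sigma> \<otimes> (W n \<otimes> (adj A (W m) \<otimes> adj A (W \<tau>')))"
    using c M' N by (simp add: u(1) mon_def W_mult adj_mult A.m_assoc)
  have xc: "x \<in> carrier A" using c by (simp add: xe)
  have yc: "y \<in> carrier A" using step monoms_span_in units_sub[OF S(2)] by blast
  have SW: "W \<rho> \<in> carrier A" "adj A (W \<rho>) \<in> carrier A" "\<rho> \<in> Mins" if "\<rho> \<in> S" for \<rho>
    using that S Mins_D W_in W_adj_in by auto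
  have "finsum A (\<lambda>\<rho>. W \<rho> \<otimes> adj A (W \<rho>)) S \<otimes> W \<sigma> = finsum A (\<lambda>\<rho>. W \<rho> \<otimes> adj A (W \<rho>) \<otimes> W \<sigma>) S"
    using S SW c by (intro finsum_ldistr) auto
  also have "\<dots> = W \<sigma> \<otimes> adj A (W \<sigma>) \<otimes> W \<sigma>"
  proof (rule finsum_single[OF S(1) u(2)])
    show "W \<rho> \<otimes> adj A (W \<rho>) \<otimes> W \<sigma> = \<zero>" if "\<rho> \<in> S" "\<rho> \<noteq> \<sigma>" for \<rho>
      using that SW[OF that(1)] c M by (simp add: A.m_assoc Mins_isometries)
  qed (use c in auto)
  also have "\<dots> = W \<sigma>" using c M by (simp add: A.m_assoc Mins_isometries)
  finally have "finsum A (\<lambda>\<rho>. W \<rho> \<otimes> adj A (W \<rho>)) S \<otimes> x = x"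
    unfolding xe using c ec by (simp flip: A.m_assoc)
  then show ?case using step xc yc ec by (simp add: A.r_distr smult_mult_right)
qed

text \<open>The unit e of the span splits x into \<open>card S\<close> squared entries. An entry d
  is bounded through \<open>kernel_isometric\<close>, and \<pi>(d) cut at level e is obtained from
  \<pi>(x) cut at level l by multiplying with contractions on both sides.\<close>

lemma units_bound:
  assumes S: "finite S" "S \<subseteq> Mins" and x: "x \<in> lspan A (monoms (units S))"
    and M: "0 \<le> M" "cnorm E (\<pi> x \<otimes>\<^bsub>E\<^esub> pr l) \<le> M"
  shows "cnorm A x \<le> (real (card S))\<^sup>2 * M"
proof -
  define e where "e = finsum A (\<lambda>\<rho>. W \<rho> \<otimes> adj A (W \<rho>)) S"
  have SW: "W \<rho> \<in> carrier A" "adj A (W \<rho>) \<in> carrier A" "\<rho> \<in> Mins" "\<rho> \<in> P" if "\<rho> \<in> S" for \<rho>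
    using that S Mins_D W_in W_adj_in by auto
  have xc: "x \<in> carrier A" using x monoms_span_in units_sub[OF S(2)] by blast
  have ec: "e \<in> carrier A" unfolding e_def using SW by (intro M.finsum_closed) auto
  have ea: "adj A e = e" unfolding e_def using S SW by (subst adj_finsum) (auto simp: adj_mult adj_adj intro!: M.finsum_cong')
  have ex: "e \<otimes> x = x" unfolding e_def by (rule units_left_id[OF S x])
  have "e \<otimes> adj A x = adj A x" unfolding e_def by (rule units_left_id[OF S units_adj[OF S(2) x]])
  then have xe: "x \<otimes> e = x" using ea ec xc by (metis adj_adj adj_closed adj_mult)
  have "x = e \<otimes> x \<otimes> e" using ex xe by simp
  also have "\<dots> = finsum A (\<lambda>\<rho>. finsum A (\<lambda>\<tau>. W \<rho> \<otimes> (adj A (W \<rho>) \<otimes> x \<otimes> W \<tau>) \<otimes> adj A (W \<tau>)) S) S"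
  proof -
    have "e \<otimes> x \<otimes> e = finsum A (\<lambda>\<rho>. W \<rho> \<otimes> adj A (W \<rho>) \<otimes> (x \<otimes> e)) S"
    proof -
      have ey: "e \<otimes> y = finsum A (\<lambda>\<rho>. W \<rho> \<otimes> adj A (W \<rho>) \<otimes> y) S" if "y \<in> carrier A" for y
        unfolding e_def using S SW that by (intro finsum_ldistr) auto
      show ?thesis using ec xc ey[of "x \<otimes> e"] A.m_assoc[of e x e] by simp
    qed
    also have "\<dots> = finsum A (\<lambda>\<rho>. finsum A (\<lambda>\<tau>. W \<rho> \<otimes> (adj A (W \<rho>) \<otimes> x \<otimes> W \<tau>) \<otimes> adj A (W \<tau>)) S) S"
    proof (rule M.finsum_cong'[OF refl])
      fix \<rho> assume r: "\<rho> \<in> S"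
      have "W \<rho> \<otimes> adj A (W \<rho>) \<otimes> (x \<otimes> e) = (W \<rho> \<otimes> adj A (W \<rho>) \<otimes> x) \<otimes> e" using SW[OF r] xc ec by (simp add: A.m_assoc)
      also have "\<dots> = finsum A (\<lambda>\<tau>. (W \<rho> \<otimes> adj A (W \<rho>) \<otimes> x) \<otimes> (W \<tau> \<otimes> adj A (W \<tau>))) S"
        unfolding e_def using S SW r xc by (intro finsum_rdistr) auto
      also have "\<dots> = finsum A (\<lambda>\<tau>. W \<rho> \<otimes> (adj A (W \<rho>) \<otimes> x \<otimes> W \<tau>) \<otimes> adj A (W \<tau>)) S"
        using SW r xc by (intro M.finsum_cong') (auto simp: A.m_assoc)
      finally show "W \<rho> \<otimes> adj A (W \<rho>) \<otimes> (x \<otimes> e) = finsum A (\<lambda>\<tau>. W \<rho> \<otimes> (adj A (W \<rho>) \<otimes> x \<otimes> W \<tau>) \<otimes> adj A (W \<tau>)) S" .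
    qed (use SW xc in \<open>auto intro!: M.finsum_closed\<close>)
    finally show ?thesis .
  qed
  finally have xx: "x = finsum A (\<lambda>\<rho>. finsum A (\<lambda>\<tau>. W \<rho> \<otimes> (adj A (W \<rho>) \<otimes> x \<otimes> W \<tau>) \<otimes> adj A (W \<tau>)) S) S" .
  have b: "cnorm A (W \<rho> \<otimes> (adj A (W \<rho>) \<otimes> x \<otimes> W \<tau>) \<otimes> adj A (W \<tau>)) \<le> M" if r: "\<rho> \<in> S" "\<tau> \<in> S" for \<rho> \<tau>
  proof -
    define d where "d = adj A (W \<rho>) \<otimes> x \<otimes> W \<tau>"
    note c = SW[OF r(1)] SW[OF r(2)]
    have dc: "d \<in> carrier A" using c xc by (simp add: d_def)
    have "cnorm A (W \<rho> \<otimes> d \<otimes> adj A (W \<tau>)) \<le> cnorm A (W \<rho> \<otimes> d)"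
      using c dc W_norm by (intro cnorm_mult_le_right) auto
    also have "\<dots> \<le> cnorm A d" using c dc W_norm by (intro cnorm_mult_le_left) auto
    also have "\<dots> \<le> cnorm E (\<pi> d \<otimes>\<^bsub>E\<^esub> pr \<one>\<^bsub>K\<^esub>)"
      unfolding d_def using c by (intro kernel_isometric units_coefficient[OF S(2) x])
    also have "\<pi> d \<otimes>\<^bsub>E\<^esub> pr \<one>\<^bsub>K\<^esub> = adj E (\<pi> (W \<rho>)) \<otimes>\<^bsub>E\<^esub> ((\<pi> x \<otimes>\<^bsub>E\<^esub> pr l) \<otimes>\<^bsub>E\<^esub> \<pi> (W \<tau>))"
    proof -
      have "\<pi> (W \<tau>) \<otimes>\<^bsub>E\<^esub> pr \<one>\<^bsub>K\<^esub> = pr l \<otimes>\<^bsub>E\<^esub> \<pi> (W \<tau>)"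
        using pr_W[of \<tau> "\<one>\<^bsub>K\<^esub>"] c Mins_D(2) Q_carrier[OF l] by simp
      then show ?thesis using c xc l Q_carrier by (simp add: d_def \<pi>_simps E.A.m_assoc pr_in E.adj_closed)
    qed
    also have "cnorm E \<dots> \<le> cnorm E ((\<pi> x \<otimes>\<^bsub>E\<^esub> pr l) \<otimes>\<^bsub>E\<^esub> \<pi> (W \<tau>))"
      using c xc l Q_carrier W_norm star_hom_contractive[OF A_alg E_alg \<pi>, of "W \<rho>"]
      by (intro E.cnorm_mult_le_left) (auto simp: \<pi>_in pr_in E.adj_closed E.cnorm_adj intro: order_trans)
    also have "\<dots> \<le> cnorm E (\<pi> x \<otimes>\<^bsub>E\<^esub> pr l)"
      using c xc l Q_carrier W_norm(1)[of \<tau>] star_hom_contractive[OF A_alg E_alg \<pi>, of "W \<tau>"]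
      by (intro E.cnorm_mult_le_right) (auto simp: \<pi>_in pr_in intro: order_trans)
    finally show ?thesis using M(2) by (simp add: d_def)
  qed
  have "cnorm A x \<le> (\<Sum>\<rho>\<in>S. cnorm A (finsum A (\<lambda>\<tau>. W \<rho> \<otimes> (adj A (W \<rho>) \<otimes> x \<otimes> W \<tau>) \<otimes> adj A (W \<tau>)) S))"
    by (subst xx) (use S SW xc in \<open>intro cnorm_finsum_le, auto intro!: M.finsum_closed\<close>)
  also have "\<dots> \<le> (\<Sum>\<rho>\<in>S. \<Sum>\<tau>\<in>S. cnorm A (W \<rho> \<otimes> (adj A (W \<rho>) \<otimes> x \<otimes> W \<tau>) \<otimes> adj A (W \<tau>)))"
    using S SW xc by (intro sum_mono cnorm_finsum_le) auto
  also have "\<dots> \<le> (\<Sum>\<rho>\<in>S. \<Sum>\<tau>\<in>S. M)" using b by (intro sum_mono)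
  also have "\<dots> = (real (card S))\<^sup>2 * M" by (simp add: power2_eq_square)
  finally show ?thesis .
qed

text \<open>The squared cardinality depends only on S, and the span over S contains all the iterated
  star squares of x, so the power argument removes it.\<close>

lemma units_isometric:
  assumes S: "finite S" "S \<subseteq> Mins" and x: "x \<in> lspan A (monoms (units S))"
  shows "cnorm A x \<le> cnorm E (\<pi> x \<otimes>\<^bsub>E\<^esub> pr l)"
proof (rule cnorm_le_by_powers[where B = "lspan A (monoms (units S))" and \<Phi> = "\<lambda>b M. cnorm E (\<pi> b \<otimes>\<^bsub>E\<^esub> pr l) \<le> M"])
  have mono: "b \<in> Deg \<one>\<^bsub>K\<^esub>" if "b \<in> lspan A (monoms (units S))" for b
    using that units_deg[OF S(2)] by (rule_tac lspan_mono) (auto simp: monoms_def)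
  have lc: "l \<in> carrier K" using l Q_carrier by simp
  show "lspan A (monoms (units S)) \<subseteq> carrier A" using monoms_span_in units_sub[OF S(2)] by blast
  show "adj A b \<otimes> b \<in> lspan A (monoms (units S))" if "b \<in> lspan A (monoms (units S))" for b
    using that S(2) by (intro units_mult units_adj)
  show "cnorm A b \<le> (real (card S))\<^sup>2 * M" if "b \<in> lspan A (monoms (units S))" "0 \<le> M" "cnorm E (\<pi> b \<otimes>\<^bsub>E\<^esub> pr l) \<le> M" for b M
    using units_bound[OF S that] .
  show "cnorm E (\<pi> (adj A b \<otimes> b) \<otimes>\<^bsub>E\<^esub> pr l) \<le> M\<^sup>2"
    if "b \<in> lspan A (monoms (units S))" "0 \<le> M" "cnorm E (\<pi> b \<otimes>\<^bsub>E\<^esub> pr l) \<le> M" for b M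
    unfolding Deg_one_square_pr[OF mono[OF that(1)] lc]
    using that(3) mono[OF that(1)] Deg_in \<pi>_in pr_in lc by (intro power_mono) auto
  show "0 \<le> cnorm E (\<pi> x \<otimes>\<^bsub>E\<^esub> pr l)" using mono[OF x] Deg_in \<pi>_in pr_in lc by auto
qed (use x in auto)

lemma units_exhaust:
  assumes "x \<in> lspan A (monoms {(p, r). p \<in> P \<and> r \<in> P \<and> \<mu> p = l \<and> \<mu> r = l})"
  shows "\<exists>S. finite S \<and> S \<subseteq> Mins \<and> x \<in> lspan A (monoms (units S))"
  using assms
proof (induction rule: lspan.induct)
  case zero
  then show ?case by (intro exI[of _ "{}"]) (simp add: lspan.zero)
next
  case (step x y c)
  then obtain S where S: "finite S" "S \<subseteq> Mins" "y \<in> lspan A (monoms (units S))" by blast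
  obtain p r where p: "x = mon p r" "p \<in> P" "r \<in> P" "\<mu> p = l" "\<mu> r = l"
    using step by (auto simp: monoms_def)
  obtain \<sigma> n where \<sigma>: "\<sigma> \<in> Mins" "n \<in> NP" "p = \<sigma> \<otimes>\<^bsub>G\<^esub> n" using Mins_decompose[OF p(2,4)] by blast
  obtain \<tau> m where \<tau>: "\<tau> \<in> Mins" "m \<in> NP" "r = \<tau> \<otimes>\<^bsub>G\<^esub> m" using Mins_decompose[OF p(3,5)] by blast
  define S' where "S' = insert \<sigma> (insert \<tau> S)"
  have S': "finite S'" "S' \<subseteq> Mins" using S \<sigma> \<tau> by (auto simp: S'_def)
  have "units S \<subseteq> units S'" unfolding units_def S'_def by blast
  then have y: "y \<in> lspan A (monoms (units S'))" using S(3) by (rule_tac lspan_mono) (auto simp: monoms_def)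
  have "(p, r) \<in> units S'" unfolding units_def S'_def using \<sigma> \<tau> by blast
  then have "x \<in> monoms (units S')" unfolding monoms_def p(1) by force
  then have "c \<odot> x \<oplus> y \<in> lspan A (monoms (units S'))" using y by (rule lspan.step)
  then show ?case using S' by blast
qed

lemma level_isometric:
  assumes "x \<in> lspan A (monoms {(p, r). p \<in> P \<and> r \<in> P \<and> \<mu> p = l \<and> \<mu> r = l})"
  shows "cnorm A x \<le> cnorm E (\<pi> x \<otimes>\<^bsub>E\<^esub> pr l)"
  using units_exhaust[OF assms] units_isometric by blast

end

end

text \<open>Take the least upper bounds of all subsets of F. Uniqueness allows at most one for each
  subset, and a join of two of them is the least upper bound of the union of their subsets.\<close>

lemma finite_join_closure:
  assumes q: "quasi_lattice_ordered K Q" and F: "finite F" "F \<subseteq> Q"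
  shows "\<exists>H. finite H \<and> F \<subseteq> H \<and> H \<subseteq> Q \<and> (\<forall>x\<in>H. \<forall>y\<in>H. \<forall>z. join K Q x y = Some z \<longrightarrow> z \<in> H)"
proof -
  define H where "H = {z. \<exists>J\<subseteq>F. is_lub K Q J z}"
  have FC: "F \<subseteq> carrier K" using F qlo_carrier[OF q] by auto
  have "H \<subseteq> (\<lambda>J. THE z. is_lub K Q J z) ` Pow F"
  proof
    fix z assume "z \<in> H"
    then obtain J where J: "J \<subseteq> F" "is_lub K Q J z" by (auto simp: H_def)
    then have "(THE z. is_lub K Q J z) = z" using is_lub_unique[OF q] by (intro the_equality)
    then show "z \<in> (\<lambda>J. THE z. is_lub K Q J z) ` Pow F" using J by force
  qed
  from finite_subset[OF this] have fin: "finite H" using F by simp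
  have HQ: "H \<subseteq> Q" by (auto simp: H_def is_lub_def upper_bounds_def)
  have FH: "F \<subseteq> H"
  proof
    fix f assume f: "f \<in> F"
    then have "is_lub K Q {f} f" using F FC le_of_refl[OF q] by (auto simp: is_lub_def upper_bounds_def)
    then show "f \<in> H" using f unfolding H_def by blast
  qed
  have "z \<in> H" if xy: "x \<in> H" "y \<in> H" and j: "join K Q x y = Some z" for x y z
  proof -
    obtain J1 J2 where J: "J1 \<subseteq> F" "is_lub K Q J1 x" "J2 \<subseteq> F" "is_lub K Q J2 y" using xy by (auto simp: H_def)
    have c: "x \<in> carrier K" "y \<in> carrier K" using xy HQ qlo_carrier[OF q] by auto
    note z = join_SomeE[OF q j c]
    have zc: "z \<in> carrier K" using z(1) qlo_carrier[OF q] by auto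
    have "is_lub K Q (J1 \<union> J2) z"
      unfolding is_lub_def
    proof
      have "le_of K Q f z" if f: "f \<in> J1" for f
        using f J FC c zc z(2) by (intro le_of_trans[OF q _ z(2)]) (auto simp: is_lub_def upper_bounds_def)
      moreover have "le_of K Q f z" if f: "f \<in> J2" for f
        using f J FC c zc z(3) by (intro le_of_trans[OF q _ z(3)]) (auto simp: is_lub_def upper_bounds_def)
      ultimately show "z \<in> upper_bounds K Q (J1 \<union> J2)" using z(1) by (auto simp: upper_bounds_def)
      show "\<forall>u\<in>upper_bounds K Q (J1 \<union> J2). le_of K Q z u"
        using J z(4) by (auto simp: is_lub_def upper_bounds_def)
    qed
    then show ?thesis using J unfolding H_def by blast
  qed
  then show ?thesis using fin FH HQ by blast
qed

context controlled_rep
begin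

subsection \<open>The core\<close>

definition core :: "'k set \<Rightarrow> ('g \<times> 'g) set" where
  "core F = {(p, r). p \<in> P \<and> r \<in> P \<and> \<mu> p = \<mu> r \<and> \<mu> p \<in> F}"

lemma core_sub: "core F \<subseteq> P \<times> P" by (auto simp: core_def)

lemma core_deg: "x \<in> lspan A (monoms (core F)) \<Longrightarrow> x \<in> Deg \<one>\<^bsub>K\<^esub>"
  using \<mu>_carrier by (erule_tac lspan_mono) (auto simp: monoms_def core_def deg_def)

lemma core_pr_zero:
  assumes x: "x \<in> lspan A (monoms (core F))" and j: "j \<in> carrier K" "\<And>k. k \<in> F \<Longrightarrow> \<not> le_of K Q k j"
  shows "\<pi> x \<otimes>\<^bsub>E\<^esub> pr j = \<zero>\<^bsub>E\<^esub>"
  using x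
proof (induction rule: lspan.induct)
  case (step x y c)
  then obtain p r where x: "x = mon p r" "p \<in> P" "r \<in> P" "\<mu> r \<in> F" by (auto simp: monoms_def core_def)
  have "\<pi> x \<otimes>\<^bsub>E\<^esub> pr j = \<zero>\<^bsub>E\<^esub>" unfolding x(1) using x j by (intro mon_pr_zero) auto
  moreover have "x \<in> carrier A" "y \<in> carrier A" using x step monoms_span_in core_sub by auto
  ultimately show ?case using step j by (simp add: \<pi>_simps pr_in E.A.l_distr E.smult_mult_left)
qed (use j in \<open>simp add: \<pi>_zero pr_in\<close>)

text \<open>Split off a maximal level $l$: the remaining levels are visible at the other indices, and then
  level $l$ is visible at $l$.\<close>

lemma core_bound:
  assumes "finite F" "F \<subseteq> Q"
  shows "\<exists>C\<ge>0. \<forall>x\<in>lspan A (monoms (core F)). \<forall>M\<ge>0.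
    (\<forall>j\<in>F. cnorm E (\<pi> x \<otimes>\<^bsub>E\<^esub> pr j) \<le> M) \<longrightarrow> cnorm A x \<le> C * M"
  using assms
proof (induction "card F" arbitrary: F)
  case 0
  then have "F = {}" by simp
  then have e: "monoms (core F) = {}" by (simp add: core_def monoms_def)
  have "cnorm A x \<le> 0" if "x \<in> lspan A (monoms (core F))" for x
    using that unfolding e by (cases rule: lspan.cases) auto
  then show ?case by (intro exI[of _ 0]) auto
next
  case (Suc n)
  have "F \<noteq> {}" using Suc.hyps(2) by auto
  have "\<exists>l\<in>F. \<forall>j\<in>F. le_of K Q l j \<longrightarrow> j = l"
  proof -
    define R where "R x y \<longleftrightarrow> le_of K Q x y \<and> x \<noteq> y" for x y
    have FC: "x \<in> carrier K" if "x \<in> F" for x using that Suc.prems Q_carrier by auto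
    have "asymp_on F R" using le_of_antisym[OF qloK] FC by (auto simp: asymp_on_def R_def)
    moreover have "transp_on F R"
      using le_of_trans[OF qloK] le_of_antisym[OF qloK] FC unfolding transp_on_def R_def by metis
    ultimately show ?thesis
      using Finite_Set.bex_max_element[OF Suc.prems(1), of R] \<open>F \<noteq> {}\<close> by (auto simp: R_def)
  qed
  then obtain l where l: "l \<in> F" and max: "\<And>j. j \<in> F \<Longrightarrow> le_of K Q l j \<Longrightarrow> j = l" by blast
  define F' where "F' = F - {l}"
  have F': "finite F'" "F' \<subseteq> Q" "F = insert l F'" "n = card F'" "l \<notin> F'" using Suc l by (auto simp: F'_def)
  have lQ: "l \<in> Q" and lc: "l \<in> carrier K" using l Suc.prems Q_carrier by auto
  obtain C where C: "C \<ge> 0" "\<And>x M. x \<in> lspan A (monoms (core F')) \<Longrightarrow> M \<ge> 0 \<Longrightarrow>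
    (\<And>j. j \<in> F' \<Longrightarrow> cnorm E (\<pi> x \<otimes>\<^bsub>E\<^esub> pr j) \<le> M) \<Longrightarrow> cnorm A x \<le> C * M"
    using Suc.hyps(1)[OF F'(4,1,2)] by blast
  \<comment> \<open>The part b away from l costs C M by induction; subtracting it at level l leaves
    a with norm at most M + C M.\<close>
  have "cnorm A x \<le> (1 + 2 * C) * M"
    if x: "x \<in> lspan A (monoms (core F))" and M: "M \<ge> 0" "\<And>j. j \<in> F \<Longrightarrow> cnorm E (\<pi> x \<otimes>\<^bsub>E\<^esub> pr j) \<le> M" for x M
  proof -
    have "monoms (core F) = monoms (core {l}) \<union> monoms (core F')"
      unfolding F'(3) by (auto simp: monoms_def core_def)
    then obtain a b where ab: "a \<in> lspan A (monoms (core {l}))" "b \<in> lspan A (monoms (core F'))" "x = a \<oplus> b"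
      using lspan_Un[of x "monoms (core {l})" "monoms (core F')"] x monoms_in[OF core_sub] by auto
    have abc: "a \<in> carrier A" "b \<in> carrier A" using ab monoms_span_in core_sub by blast+
    have b: "cnorm A b \<le> C * M"
    proof (rule C(2)[OF ab(2) M(1)])
      fix j assume j: "j \<in> F'"
      then have jc: "j \<in> carrier K" using F' Q_carrier by auto
      have "\<pi> a \<otimes>\<^bsub>E\<^esub> pr j = \<zero>\<^bsub>E\<^esub>"
        using max[of j] j F' jc by (intro core_pr_zero[OF ab(1)]) auto
      then have "\<pi> x \<otimes>\<^bsub>E\<^esub> pr j = \<pi> b \<otimes>\<^bsub>E\<^esub> pr j"
        using abc jc by (simp add: ab(3) \<pi>_simps pr_in E.A.l_distr)
      then show "cnorm E (\<pi> b \<otimes>\<^bsub>E\<^esub> pr j) \<le> M" using M(2)[of j] j F' by simp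
    qed
    have "{(p, r). p \<in> P \<and> r \<in> P \<and> \<mu> p = l \<and> \<mu> r = l} = core {l}" by (auto simp: core_def)
    then have "cnorm A a \<le> cnorm E (\<pi> a \<otimes>\<^bsub>E\<^esub> pr l)" using level_isometric[OF lQ, of a] ab(1) by simp
    also have "\<pi> a \<otimes>\<^bsub>E\<^esub> pr l = \<pi> x \<otimes>\<^bsub>E\<^esub> pr l \<ominus>\<^bsub>E\<^esub> \<pi> b \<otimes>\<^bsub>E\<^esub> pr l"
      using abc lc by (intro E.minusI[symmetric]) (simp_all add: ab(3) \<pi>_simps pr_in E.A.l_distr)
    also have "cnorm E \<dots> \<le> cnorm E (\<pi> x \<otimes>\<^bsub>E\<^esub> pr l) + cnorm E (\<pi> b \<otimes>\<^bsub>E\<^esub> pr l)"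
    proof -
      have c: "\<pi> x \<otimes>\<^bsub>E\<^esub> pr l \<in> carrier E" "\<pi> b \<otimes>\<^bsub>E\<^esub> pr l \<in> carrier E"
        using abc lc by (simp_all add: ab(3) \<pi>_in pr_in)
      show ?thesis using E.cnorm_triangle[OF c(1) E.smult_in[OF c(2), of "-1"]] c(2)
        by (simp add: E.minus_eq_smult E.cnorm_smult)
    qed
    also have "cnorm E (\<pi> b \<otimes>\<^bsub>E\<^esub> pr l) \<le> cnorm A b"
      using E.cnorm_mult_le_right[OF \<pi>_in[OF abc(2)] pr_in[OF lc] pr_norm[OF lc]]
        star_hom_contractive[OF A_alg E_alg \<pi> abc(2)] by simp
    finally have "cnorm A a \<le> M + C * M" using M(2)[OF l] b by simp
    then show ?thesis using cnorm_triangle[OF abc] b by (simp add: ab(3) algebra_simps)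
  qed
  then show ?case using C(1) by (intro exI[of _ "1 + 2 * C"]) auto
qed

lemma core_isometric:
  assumes x: "x \<in> Deg \<one>\<^bsub>K\<^esub>" and M: "0 \<le> M" "\<And>j. j \<in> carrier K \<Longrightarrow> cnorm E (\<pi> x \<otimes>\<^bsub>E\<^esub> pr j) \<le> M"
  shows "cnorm A x \<le> M"
proof -
  have "\<exists>F. finite F \<and> F \<subseteq> Q \<and> x \<in> lspan A (monoms (core F))"
    using x
  proof (induction rule: lspan.induct)
    case zero
    then show ?case by (intro exI[of _ "{}"]) (simp add: lspan.zero)
  next
    case (step x y c)
    then obtain F where F: "finite F" "F \<subseteq> Q" "y \<in> lspan A (monoms (core F))" by blast
    obtain p r where p: "x = mon p r" "p \<in> P" "r \<in> P" "\<mu> p \<otimes>\<^bsub>K\<^esub> inv\<^bsub>K\<^esub> \<mu> r = \<one>\<^bsub>K\<^esub>"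
      using step by (auto simp: monoms_def deg_def)
    have "\<mu> p = \<mu> r" using p(4) \<mu>_carrier[OF p(2)] \<mu>_carrier[OF p(3)] by (metis K.inv_closed K.inv_equality K.inv_inv)
    then have "x \<in> monoms (core (insert (\<mu> p) F))" using p by (force simp: monoms_def core_def)
    moreover have "y \<in> lspan A (monoms (core (insert (\<mu> p) F)))"
      by (rule lspan_mono[OF F(3)]) (auto simp: monoms_def core_def)
    ultimately have "c \<odot> x \<oplus> y \<in> lspan A (monoms (core (insert (\<mu> p) F)))" by (rule lspan.step)
    then show ?case using F \<mu>_P[OF p(2)] by (intro exI[of _ "insert (\<mu> p) F"]) auto
  qed
  then obtain F0 where F0: "finite F0" "F0 \<subseteq> Q" "x \<in> lspan A (monoms (core F0))" by blast
  obtain F where F: "finite F" "F0 \<subseteq> F" "F \<subseteq> Q" and cl: "\<And>i j z. i \<in> F \<Longrightarrow> j \<in> F \<Longrightarrow> join K Q i j = Some z \<Longrightarrow> z \<in> F"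
    using finite_join_closure[OF qloK F0(1,2)] by blast
  have xF: "x \<in> lspan A (monoms (core F))"
    using F(2) by (intro lspan_mono[OF F0(3)]) (auto simp: monoms_def core_def)
  obtain C where C: "\<And>x M. x \<in> lspan A (monoms (core F)) \<Longrightarrow> M \<ge> 0 \<Longrightarrow>
    (\<forall>j\<in>F. cnorm E (\<pi> x \<otimes>\<^bsub>E\<^esub> pr j) \<le> M) \<Longrightarrow> cnorm A x \<le> C * M"
    using core_bound[OF F(1,3)] by blast
  have FC: "j \<in> carrier K" if "j \<in> F" for j using that F Q_carrier by auto
  show ?thesis
  proof (rule cnorm_le_by_powers[where B = "lspan A (monoms (core F))" and \<Phi> = "\<lambda>b M. \<forall>j\<in>F. cnorm E (\<pi> b \<otimes>\<^bsub>E\<^esub> pr j) \<le> M"])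
    show "lspan A (monoms (core F)) \<subseteq> carrier A" using monoms_span_in core_sub by blast
    show "cnorm A b \<le> C * M" if "b \<in> lspan A (monoms (core F))" "0 \<le> M" "\<forall>j\<in>F. cnorm E (\<pi> b \<otimes>\<^bsub>E\<^esub> pr j) \<le> M" for b M
      using C that by blast
    show "\<forall>j\<in>F. cnorm E (\<pi> (adj A b \<otimes> b) \<otimes>\<^bsub>E\<^esub> pr j) \<le> M\<^sup>2"
      if "b \<in> lspan A (monoms (core F))" "0 \<le> M" "\<forall>j\<in>F. cnorm E (\<pi> b \<otimes>\<^bsub>E\<^esub> pr j) \<le> M" for b M
    proof
      fix j assume j: "j \<in> F"
      have d: "b \<in> Deg \<one>\<^bsub>K\<^esub>" using core_deg[OF that(1)] .
      have "0 \<le> cnorm E (\<pi> b \<otimes>\<^bsub>E\<^esub> pr j)" using Deg_in[OF d] \<pi>_in pr_in FC[OF j] by simp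
      then show "cnorm E (\<pi> (adj A b \<otimes> b) \<otimes>\<^bsub>E\<^esub> pr j) \<le> M\<^sup>2"
        unfolding Deg_one_square_pr[OF d FC[OF j]] using that(3) j by (intro power_mono) auto
    qed
    show "adj A b \<otimes> b \<in> lspan A (monoms (core F))" if b: "b \<in> lspan A (monoms (core F))" for b
    proof (rule monoms_span_mult[OF _ b core_sub core_sub core_sub])
      show "adj A b \<in> lspan A (monoms (core F))"
        by (rule monoms_span_adj[OF b core_sub core_sub]) (auto simp: core_def)
      fix p r s t z assume a: "(p, r) \<in> core F" "(s, t) \<in> core F" and j: "join G P r s = Some z"
      then have p: "p \<in> P" "r \<in> P" "s \<in> P" "t \<in> P" "\<mu> p = \<mu> r" "\<mu> s = \<mu> t" "\<mu> r \<in> F" "\<mu> s \<in> F"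
        by (auto simp: core_def)
      \<comment> \<open>By condition (1) both halves of a product monomial have level
        \<open>\<mu> z\<close>, the join of the two levels, which belongs to F because F is closed
        under joins.\<close>
      have "join K Q (\<mu> r) (\<mu> s) = Some (\<mu> z)" using \<mu>_join[OF p(2,3) j] .
      then have zF: "\<mu> z \<in> F" using cl p by blast
      have zP: "z \<in> P" using join_SomeD(2)[OF qlo P_carrier P_carrier j] p by auto
      show "(p \<otimes>\<^bsub>G\<^esub> (inv\<^bsub>G\<^esub> r \<otimes>\<^bsub>G\<^esub> z), t \<otimes>\<^bsub>G\<^esub> (inv\<^bsub>G\<^esub> s \<otimes>\<^bsub>G\<^esub> z)) \<in> core F"
        using monom_product_in[OF p(1-4) j] p zF \<mu>_carrier[OF zP] \<mu>_carrier[OF p(2)] \<mu>_carrier[OF p(4)]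
        by (simp add: core_def)
    qed
  qed (use xF M FC in auto)
qed

text \<open>The hypothesis is on each column separately: in \<open>mat_norm\<close> every column is
  bounded through a different block, and no bound on \<pi>(x) as a whole is at hand.\<close>

lemma Deg_isometric:
  assumes x: "x \<in> Deg k" and k: "k \<in> carrier K"
    and M: "0 \<le> M" "\<And>j. j \<in> carrier K \<Longrightarrow> cnorm E (\<pi> x \<otimes>\<^bsub>E\<^esub> pr j) \<le> M"
  shows "cnorm A x \<le> M"
proof -
  have c: "x \<in> carrier A" "\<pi> x \<in> carrier E" "adj E (\<pi> x) \<in> carrier E" using Deg_in[OF x] \<pi>_in E.adj_closed by auto
  have "adj A x \<otimes> x \<in> Deg (inv\<^bsub>K\<^esub> k \<otimes>\<^bsub>K\<^esub> k)" using x k by (intro Deg_mult Deg_adj) auto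
  then have d: "adj A x \<otimes> x \<in> Deg \<one>\<^bsub>K\<^esub>" using k by simp
  have "cnorm A (adj A x \<otimes> x) \<le> M\<^sup>2"
  proof (rule core_isometric[OF d])
    fix j assume j: "j \<in> carrier K"
    have "\<pi> (adj A x \<otimes> x) \<otimes>\<^bsub>E\<^esub> pr j = pr j \<otimes>\<^bsub>E\<^esub> \<pi> (adj A x \<otimes> x)" using Deg_pr[OF d K.one_closed j] j by simp
    then have "\<pi> (adj A x \<otimes> x) \<otimes>\<^bsub>E\<^esub> pr j = pr j \<otimes>\<^bsub>E\<^esub> (\<pi> (adj A x \<otimes> x) \<otimes>\<^bsub>E\<^esub> pr j)"
      using c j adj_closed by (simp add: pr_in pr_idem \<pi>_in flip: E.A.m_assoc)
    also have "\<dots> = adj E (\<pi> x \<otimes>\<^bsub>E\<^esub> pr j) \<otimes>\<^bsub>E\<^esub> (\<pi> x \<otimes>\<^bsub>E\<^esub> pr j)"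
      using c j adj_closed by (simp add: \<pi>_simps E.adj_mult pr_adj pr_in E.A.m_assoc)
    finally have "cnorm E (\<pi> (adj A x \<otimes> x) \<otimes>\<^bsub>E\<^esub> pr j) = (cnorm E (\<pi> x \<otimes>\<^bsub>E\<^esub> pr j))\<^sup>2"
      using E.cstar_identity[of "\<pi> x \<otimes>\<^bsub>E\<^esub> pr j"] c j by (simp add: pr_in)
    then show "cnorm E (\<pi> (adj A x \<otimes> x) \<otimes>\<^bsub>E\<^esub> pr j) \<le> M\<^sup>2"
      using M(2)[OF j] c j by (simp add: power_mono pr_in)
  qed simp
  then have "(cnorm A x)\<^sup>2 \<le> M\<^sup>2" using cstar_identity[OF c(1)] by simp
  then show ?thesis using M(1) by (rule power2_le_imp_le)
qed

subsection \<open>Averaging over the quotient group\<close>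

context
  fixes a :: "'k \<Rightarrow> 'a" and S :: "'k set" and F :: "'k set" and \<xi> :: "'k \<Rightarrow> real"
  assumes a: "\<And>k. k \<in> carrier K \<Longrightarrow> a k \<in> Deg k" and S: "finite S" "S \<subseteq> carrier K"
    and a0: "\<And>k. k \<in> carrier K \<Longrightarrow> k \<notin> S \<Longrightarrow> a k = \<zero>"
    and F: "finite F" "F \<subseteq> carrier K" and \<xi>1: "(\<Sum>t\<in>F. (\<xi> t)\<^sup>2) = 1"
begin

text \<open>Entries of a matrix over F, kept as a function instead of an element of a matrix
  algebra. With Y the matrix at n = 0, the one at n > 0 is the power of Y* Y with exponent
  \<open>2 ^ (n - 1)\<close>.\<close>

fun mat :: "nat \<Rightarrow> 'k \<Rightarrow> 'k \<Rightarrow> 'a" where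
  "mat 0 s t = a (s \<otimes>\<^bsub>K\<^esub> inv\<^bsub>K\<^esub> t)"
| "mat (Suc n) s t = finsum A (\<lambda>u. adj A (mat n u s) \<otimes> mat n u t) F"

lemma mat_Deg: "s \<in> F \<Longrightarrow> t \<in> F \<Longrightarrow> mat n s t \<in> Deg (s \<otimes>\<^bsub>K\<^esub> inv\<^bsub>K\<^esub> t)"
proof (induction n arbitrary: s t)
  case 0
  then show ?case using a F by (simp add: subset_iff)
next
  case (Suc n)
  have c: "s \<in> carrier K" "t \<in> carrier K" using Suc F by auto
  have "adj A (mat n u s) \<otimes> mat n u t \<in> Deg (s \<otimes>\<^bsub>K\<^esub> inv\<^bsub>K\<^esub> t)" if u: "u \<in> F" for u
  proof -
    have uc: "u \<in> carrier K" using u F by auto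
    have "adj A (mat n u s) \<otimes> mat n u t \<in> Deg (inv\<^bsub>K\<^esub> (u \<otimes>\<^bsub>K\<^esub> inv\<^bsub>K\<^esub> s) \<otimes>\<^bsub>K\<^esub> (u \<otimes>\<^bsub>K\<^esub> inv\<^bsub>K\<^esub> t))"
      using Suc u c uc by (intro Deg_mult Deg_adj) auto
    moreover have "inv\<^bsub>K\<^esub> (u \<otimes>\<^bsub>K\<^esub> inv\<^bsub>K\<^esub> s) \<otimes>\<^bsub>K\<^esub> (u \<otimes>\<^bsub>K\<^esub> inv\<^bsub>K\<^esub> t) = s \<otimes>\<^bsub>K\<^esub> (inv\<^bsub>K\<^esub> u \<otimes>\<^bsub>K\<^esub> u) \<otimes>\<^bsub>K\<^esub> inv\<^bsub>K\<^esub> t"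
      using c uc by (simp only: K.inv_mult_group K.m_assoc K.inv_closed K.m_closed K.inv_inv)
    ultimately show ?thesis using c uc by simp
  qed
  then show ?case using F monoms_in[OF deg_sub] by (auto intro!: lspan_finsum)
qed

lemma mat_in: "s \<in> F \<Longrightarrow> t \<in> F \<Longrightarrow> mat n s t \<in> carrier A"
  using mat_Deg Deg_in by blast

definition total :: 'a where "total = finsum A a S"

lemma a_in: "k \<in> carrier K \<Longrightarrow> a k \<in> carrier A" using a Deg_in by blast

lemma total_in: "total \<in> carrier A"
  unfolding total_def using a_in S by (intro M.finsum_closed) auto

text \<open>The component of degree i carries level t to level i t, so between levels s and t only i
  = s inv(t) survives; when that degree is not in S, both sides vanish.\<close>

lemma total_component:
  assumes s: "s \<in> carrier K" and t: "t \<in> carrier K"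
  shows "pr s \<otimes>\<^bsub>E\<^esub> \<pi> total \<otimes>\<^bsub>E\<^esub> pr t = \<pi> (a (s \<otimes>\<^bsub>K\<^esub> inv\<^bsub>K\<^esub> t)) \<otimes>\<^bsub>E\<^esub> pr t"
proof -
  define k where "k = s \<otimes>\<^bsub>K\<^esub> inv\<^bsub>K\<^esub> t"
  have k: "k \<in> carrier K" "k \<otimes>\<^bsub>K\<^esub> t = s" using s t by (simp_all add: k_def K.m_assoc)
  have aS: "a i \<in> carrier A" "\<pi> (a i) \<in> carrier E" if "i \<in> S" for i using that S a_in \<pi>_in by auto
  have one: "pr s \<otimes>\<^bsub>E\<^esub> \<pi> (a i) \<otimes>\<^bsub>E\<^esub> pr t = (if i = k then \<pi> (a i) \<otimes>\<^bsub>E\<^esub> pr t else \<zero>\<^bsub>E\<^esub>)" if i: "i \<in> carrier K" for i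
  proof -
    have ai: "\<pi> (a i) \<in> carrier E" using a_in[OF i] \<pi>_in by simp
    have "pr s \<otimes>\<^bsub>E\<^esub> \<pi> (a i) \<otimes>\<^bsub>E\<^esub> pr t = (pr s \<otimes>\<^bsub>E\<^esub> pr (i \<otimes>\<^bsub>K\<^esub> t)) \<otimes>\<^bsub>E\<^esub> \<pi> (a i)"
      using ai s t i Deg_pr[OF a[OF i] i t] by (simp add: E.A.m_assoc pr_in)
    moreover have "i \<otimes>\<^bsub>K\<^esub> t = s \<longleftrightarrow> i = k" using i s t K.inv_solve_right[of i s t] by (auto simp: k_def)
    ultimately show ?thesis
      using ai s t i Deg_pr[OF a[OF i] i t] k pr_idem[OF s] pr_orth[OF s, of "i \<otimes>\<^bsub>K\<^esub> t"] by auto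
  qed
  have "pr s \<otimes>\<^bsub>E\<^esub> \<pi> total \<otimes>\<^bsub>E\<^esub> pr t = pr s \<otimes>\<^bsub>E\<^esub> finsum E (\<lambda>i. \<pi> (a i)) S \<otimes>\<^bsub>E\<^esub> pr t"
    unfolding total_def using star_hom_finsum[OF A_alg E_alg \<pi> S(1), of a] aS by simp
  also have "\<dots> = finsum E (\<lambda>i. pr s \<otimes>\<^bsub>E\<^esub> \<pi> (a i)) S \<otimes>\<^bsub>E\<^esub> pr t"
    using S s aS by (subst E.finsum_rdistr) (auto simp: pr_in)
  also have "\<dots> = finsum E (\<lambda>i. pr s \<otimes>\<^bsub>E\<^esub> \<pi> (a i) \<otimes>\<^bsub>E\<^esub> pr t) S"
    using S s t aS by (intro E.finsum_ldistr) (auto simp: pr_in)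
  also have "\<dots> = \<pi> (a k) \<otimes>\<^bsub>E\<^esub> pr t"
  proof (cases "k \<in> S")
    case True
    then show ?thesis
      using E.finsum_single[OF S(1) True, of "\<lambda>i. pr s \<otimes>\<^bsub>E\<^esub> \<pi> (a i) \<otimes>\<^bsub>E\<^esub> pr t"] one[OF k(1)] one S s t aS pr_in
      by (auto simp: subset_iff)
  next
    case False
    have "finsum E (\<lambda>i. pr s \<otimes>\<^bsub>E\<^esub> \<pi> (a i) \<otimes>\<^bsub>E\<^esub> pr t) S = finsum E (\<lambda>_. \<zero>\<^bsub>E\<^esub>) S"
      using one S False by (intro E.M.finsum_cong') auto
    then show ?thesis using False a0[OF k(1)] t by (simp add: \<pi>_zero pr_in)
  qed
  finally show ?thesis by (simp add: k_def)
qed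

definition rproj :: "'k \<Rightarrow> 'e" where "rproj r = finsum E (\<lambda>u. pr (u \<otimes>\<^bsub>K\<^esub> r)) F"

text \<open>On the vectors whose degree lies in \<open>F r\<close>, the matrix with entries $a_{st^{-1}}$ is a compression of
  \<open>\<pi> total\<close>; \<open>zmat\<close> follows the iteration $Y \mapsto Y^* Y$ on that block.\<close>

fun zmat :: "'k \<Rightarrow> nat \<Rightarrow> 'e" where
  "zmat r 0 = \<pi> total"
| "zmat r (Suc n) = adj E (zmat r n) \<otimes>\<^bsub>E\<^esub> rproj r \<otimes>\<^bsub>E\<^esub> zmat r n"

context fixes r assumes r: "r \<in> carrier K"
begin

lemma FK: "u \<in> F \<Longrightarrow> u \<in> carrier K" "u \<in> F \<Longrightarrow> u \<otimes>\<^bsub>K\<^esub> r \<in> carrier K"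
  using F r by auto

lemma rproj_in: "rproj r \<in> carrier E"
  unfolding rproj_def using FK by (intro E.M.finsum_closed) (auto simp: pr_in)

lemma zmat_in: "zmat r n \<in> carrier E"
  by (induction n) (auto simp: total_in \<pi>_in rproj_in E.adj_closed)

lemma rproj_norm: "cnorm E (rproj r) \<le> 1"
proof (rule E.cnorm_projection_le[OF rproj_in])
  show "adj E (rproj r) = rproj r"
    unfolding rproj_def using F FK by (subst E.adj_finsum) (auto simp: pr_in pr_adj intro!: E.M.finsum_cong')
  have "rproj r \<otimes>\<^bsub>E\<^esub> pr (u \<otimes>\<^bsub>K\<^esub> r) = pr (u \<otimes>\<^bsub>K\<^esub> r)" if u: "u \<in> F" for u
  proof -
    have "rproj r \<otimes>\<^bsub>E\<^esub> pr (u \<otimes>\<^bsub>K\<^esub> r) = finsum E (\<lambda>v. pr (v \<otimes>\<^bsub>K\<^esub> r) \<otimes>\<^bsub>E\<^esub> pr (u \<otimes>\<^bsub>K\<^esub> r)) F"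
      unfolding rproj_def using F FK u by (intro E.finsum_ldistr) (auto simp: pr_in)
    also have "\<dots> = pr (u \<otimes>\<^bsub>K\<^esub> r) \<otimes>\<^bsub>E\<^esub> pr (u \<otimes>\<^bsub>K\<^esub> r)"
    proof (rule E.finsum_single[OF F(1) u])
      show "pr (v \<otimes>\<^bsub>K\<^esub> r) \<otimes>\<^bsub>E\<^esub> pr (u \<otimes>\<^bsub>K\<^esub> r) = \<zero>\<^bsub>E\<^esub>" if "v \<in> F" "v \<noteq> u" for v
        using that u FK r by (intro pr_orth) auto
    qed (use FK u in \<open>auto simp: pr_in\<close>)
    finally show ?thesis using FK u by (simp add: pr_idem)
  qed
  then have "finsum E (\<lambda>u. rproj r \<otimes>\<^bsub>E\<^esub> pr (u \<otimes>\<^bsub>K\<^esub> r)) F = rproj r"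
    unfolding rproj_def[of r] using FK by (intro E.M.finsum_cong') (auto simp: pr_in)
  moreover have "rproj r \<otimes>\<^bsub>E\<^esub> rproj r = finsum E (\<lambda>u. rproj r \<otimes>\<^bsub>E\<^esub> pr (u \<otimes>\<^bsub>K\<^esub> r)) F"
    by (subst (2) rproj_def, rule E.finsum_rdistr) (use F FK rproj_in in \<open>auto simp: pr_in\<close>)
  ultimately show "rproj r \<otimes>\<^bsub>E\<^esub> rproj r = rproj r" by simp
qed

lemma zmat_norm: "cnorm E (zmat r n) \<le> cnorm E (\<pi> total) ^ (2 ^ n)"
proof (induction n)
  case (Suc n)
  note c = zmat_in[of n] E.adj_closed[OF zmat_in[of n]] rproj_in
  have "cnorm E (zmat r (Suc n)) \<le> cnorm E (adj E (zmat r n) \<otimes>\<^bsub>E\<^esub> rproj r) * cnorm E (zmat r n)"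
    using c by (simp add: E.cnorm_mult)
  also have "\<dots> \<le> cnorm E (zmat r n) * cnorm E (zmat r n)"
    using E.cnorm_mult_le_right[OF c(2,3) rproj_norm] c by (intro mult_right_mono) (auto simp: E.cnorm_adj)
  also have "\<dots> \<le> cnorm E (\<pi> total) ^ (2 ^ n) * cnorm E (\<pi> total) ^ (2 ^ n)"
    using Suc c by (intro mult_mono) (auto simp: total_in \<pi>_in)
  finally show ?case by (simp add: power_add[symmetric] mult_2)
qed simp

text \<open>Induction on n: the factor \<open>rproj r\<close> between the adjoint and
  \<open>zmat r n\<close> is a sum over u in F of level projections, which matches the sum over u in
  the matrix product. Homogeneity of the entries moves the projections past them.\<close>

lemma mat_zmat:
  "s \<in> F \<Longrightarrow> t \<in> F \<Longrightarrow>
    \<pi> (mat n s t) \<otimes>\<^bsub>E\<^esub> pr (t \<otimes>\<^bsub>K\<^esub> r) = pr (s \<otimes>\<^bsub>K\<^esub> r) \<otimes>\<^bsub>E\<^esub> zmat r n \<otimes>\<^bsub>E\<^esub> pr (t \<otimes>\<^bsub>K\<^esub> r)"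
proof (induction n arbitrary: s t)
  case 0
  have "s \<otimes>\<^bsub>K\<^esub> r \<otimes>\<^bsub>K\<^esub> inv\<^bsub>K\<^esub> (t \<otimes>\<^bsub>K\<^esub> r) = s \<otimes>\<^bsub>K\<^esub> (r \<otimes>\<^bsub>K\<^esub> inv\<^bsub>K\<^esub> r) \<otimes>\<^bsub>K\<^esub> inv\<^bsub>K\<^esub> t"
    using FK[OF 0(1)] FK[OF 0(2)] r by (simp only: K.inv_mult_group K.m_assoc K.inv_closed K.m_closed)
  also have "\<dots> = s \<otimes>\<^bsub>K\<^esub> inv\<^bsub>K\<^esub> t" using FK[OF 0(1)] FK[OF 0(2)] r by simp
  finally show ?case using total_component[of "s \<otimes>\<^bsub>K\<^esub> r" "t \<otimes>\<^bsub>K\<^esub> r"] FK 0 by simp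
next
  case (Suc n)
  note s = FK[OF Suc.prems(1)] and t = FK[OF Suc.prems(2)]
  let ?ps = "pr (s \<otimes>\<^bsub>K\<^esub> r)" and ?pt = "pr (t \<otimes>\<^bsub>K\<^esub> r)" and ?Z = "zmat r n"
  have Z: "?Z \<in> carrier E" "adj E ?Z \<in> carrier E" using zmat_in E.adj_closed by auto
  have ps: "?ps \<in> carrier E" "?pt \<in> carrier E" using s t pr_in by auto
  have m: "mat n u v \<in> carrier A" "\<pi> (mat n u v) \<in> carrier E" "adj E (\<pi> (mat n u v)) \<in> carrier E" if "u \<in> F" "v \<in> F" for u v
    using that mat_in \<pi>_in E.adj_closed by auto
  have summand: "\<pi> (adj A (mat n u s) \<otimes> mat n u t) \<otimes>\<^bsub>E\<^esub> ?pt = (?ps \<otimes>\<^bsub>E\<^esub> adj E ?Z) \<otimes>\<^bsub>E\<^esub> (pr (u \<otimes>\<^bsub>K\<^esub> r) \<otimes>\<^bsub>E\<^esub> (?Z \<otimes>\<^bsub>E\<^esub> ?pt))"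
    if u: "u \<in> F" for u
  proof -
    let ?pu = "pr (u \<otimes>\<^bsub>K\<^esub> r)"
    have pu: "?pu \<in> carrier E" using FK u pr_in by auto
    note mu = m[OF u Suc.prems(1)] m[OF u Suc.prems(2)]
    have "adj E (\<pi> (mat n u s) \<otimes>\<^bsub>E\<^esub> ?ps) = adj E (?pu \<otimes>\<^bsub>E\<^esub> ?Z \<otimes>\<^bsub>E\<^esub> ?ps)"
      using Suc.IH[OF u Suc.prems(1)] by simp
    then have h: "?ps \<otimes>\<^bsub>E\<^esub> adj E (\<pi> (mat n u s)) = ?ps \<otimes>\<^bsub>E\<^esub> (adj E ?Z \<otimes>\<^bsub>E\<^esub> ?pu)"
      using mu pu ps Z FK u s by (simp add: E.adj_mult pr_adj)
    have k: "u \<otimes>\<^bsub>K\<^esub> inv\<^bsub>K\<^esub> s \<in> carrier K" using FK u s by simp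
    have "(u \<otimes>\<^bsub>K\<^esub> inv\<^bsub>K\<^esub> s) \<otimes>\<^bsub>K\<^esub> (s \<otimes>\<^bsub>K\<^esub> r) = u \<otimes>\<^bsub>K\<^esub> (inv\<^bsub>K\<^esub> s \<otimes>\<^bsub>K\<^esub> s) \<otimes>\<^bsub>K\<^esub> r"
      using FK u s r by (simp only: K.m_assoc K.inv_closed K.m_closed)
    also have "\<dots> = u \<otimes>\<^bsub>K\<^esub> r" using FK u s r by simp
    finally have "\<pi> (mat n u s) \<otimes>\<^bsub>E\<^esub> ?ps = ?pu \<otimes>\<^bsub>E\<^esub> \<pi> (mat n u s)"
      using Deg_pr[OF mat_Deg[OF u Suc.prems(1)] k s(2)] by simp
    then have "adj E (\<pi> (mat n u s) \<otimes>\<^bsub>E\<^esub> ?ps) = adj E (?pu \<otimes>\<^bsub>E\<^esub> \<pi> (mat n u s))" by simp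
    then have ad: "adj E (\<pi> (mat n u s)) \<otimes>\<^bsub>E\<^esub> ?pu = ?ps \<otimes>\<^bsub>E\<^esub> adj E (\<pi> (mat n u s))"
      using mu pu ps FK u s by (simp add: E.adj_mult pr_adj)
    have "\<pi> (adj A (mat n u s) \<otimes> mat n u t) \<otimes>\<^bsub>E\<^esub> ?pt = adj E (\<pi> (mat n u s)) \<otimes>\<^bsub>E\<^esub> (\<pi> (mat n u t) \<otimes>\<^bsub>E\<^esub> ?pt)"
      using mu ps adj_closed by (simp add: \<pi>_simps E.A.m_assoc)
    also have "\<dots> = (adj E (\<pi> (mat n u s)) \<otimes>\<^bsub>E\<^esub> ?pu) \<otimes>\<^bsub>E\<^esub> (?Z \<otimes>\<^bsub>E\<^esub> ?pt)"
      unfolding Suc.IH[OF u Suc.prems(2)] using mu ps pu Z by (simp add: E.A.m_assoc)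
    also have "\<dots> = (?ps \<otimes>\<^bsub>E\<^esub> (adj E ?Z \<otimes>\<^bsub>E\<^esub> ?pu)) \<otimes>\<^bsub>E\<^esub> (?Z \<otimes>\<^bsub>E\<^esub> ?pt)" unfolding ad h ..
    finally show ?thesis using ps pu Z by (simp add: E.A.m_assoc)
  qed
  have "\<pi> (mat (Suc n) s t) \<otimes>\<^bsub>E\<^esub> ?pt = finsum E (\<lambda>u. \<pi> (adj A (mat n u s) \<otimes> mat n u t)) F \<otimes>\<^bsub>E\<^esub> ?pt"
    using star_hom_finsum[OF A_alg E_alg \<pi> F(1), of "\<lambda>u. adj A (mat n u s) \<otimes> mat n u t"] m Suc.prems adj_closed
    by simp
  also have "\<dots> = finsum E (\<lambda>u. \<pi> (adj A (mat n u s) \<otimes> mat n u t) \<otimes>\<^bsub>E\<^esub> ?pt) F"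
    using F m Suc.prems adj_closed ps by (intro E.finsum_ldistr) (auto simp: \<pi>_in)
  also have "\<dots> = finsum E (\<lambda>u. (?ps \<otimes>\<^bsub>E\<^esub> adj E ?Z) \<otimes>\<^bsub>E\<^esub> (pr (u \<otimes>\<^bsub>K\<^esub> r) \<otimes>\<^bsub>E\<^esub> (?Z \<otimes>\<^bsub>E\<^esub> ?pt))) F"
    using summand ps Z FK pr_in by (intro E.M.finsum_cong') auto
  also have "\<dots> = (?ps \<otimes>\<^bsub>E\<^esub> adj E ?Z) \<otimes>\<^bsub>E\<^esub> finsum E (\<lambda>u. pr (u \<otimes>\<^bsub>K\<^esub> r) \<otimes>\<^bsub>E\<^esub> (?Z \<otimes>\<^bsub>E\<^esub> ?pt)) F"
    using F ps Z FK pr_in by (intro E.finsum_rdistr[symmetric]) auto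
  also have "finsum E (\<lambda>u. pr (u \<otimes>\<^bsub>K\<^esub> r) \<otimes>\<^bsub>E\<^esub> (?Z \<otimes>\<^bsub>E\<^esub> ?pt)) F = rproj r \<otimes>\<^bsub>E\<^esub> (?Z \<otimes>\<^bsub>E\<^esub> ?pt)"
    unfolding rproj_def using F ps Z FK pr_in by (intro E.finsum_ldistr[symmetric]) auto
  finally show ?case using ps Z rproj_in by (simp add: E.A.m_assoc)
qed

end

lemma mat_norm:
  assumes s: "s \<in> F" and t: "t \<in> F" shows "cnorm A (mat n s t) \<le> cnorm E (\<pi> total) ^ (2 ^ n)"
proof (rule Deg_isometric[OF mat_Deg[OF s t]])
  have st: "s \<in> carrier K" "t \<in> carrier K" using s t F by auto
  then show "s \<otimes>\<^bsub>K\<^esub> inv\<^bsub>K\<^esub> t \<in> carrier K" by simp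
  show "0 \<le> cnorm E (\<pi> total) ^ (2 ^ n)" by (simp add: total_in \<pi>_in)
  fix j assume j: "j \<in> carrier K"
  \<comment> \<open>Every level j has the form t r for this r, and the bound on
    \<open>zmat r n\<close> does not depend on r.\<close>
  define r where "r = inv\<^bsub>K\<^esub> t \<otimes>\<^bsub>K\<^esub> j"
  have r: "r \<in> carrier K" "t \<otimes>\<^bsub>K\<^esub> r = j" using st j by (simp_all add: r_def flip: K.m_assoc)
  note c = pr_in[OF j] pr_norm[OF j] zmat_in[OF r(1), of n]
  have sr: "s \<otimes>\<^bsub>K\<^esub> r \<in> carrier K" using st r by simp
  have "cnorm E (\<pi> (mat n s t) \<otimes>\<^bsub>E\<^esub> pr j) = cnorm E (pr (s \<otimes>\<^bsub>K\<^esub> r) \<otimes>\<^bsub>E\<^esub> zmat r n \<otimes>\<^bsub>E\<^esub> pr j)"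
    using mat_zmat[OF r(1) s t, of n] r by simp
  also have "\<dots> \<le> cnorm E (pr (s \<otimes>\<^bsub>K\<^esub> r) \<otimes>\<^bsub>E\<^esub> zmat r n)"
    using c sr by (intro E.cnorm_mult_le_right) (auto simp: pr_in)
  also have "\<dots> \<le> cnorm E (zmat r n)" using c sr pr_norm by (intro E.cnorm_mult_le_left) (auto simp: pr_in)
  also have "\<dots> \<le> cnorm E (\<pi> total) ^ (2 ^ n)" by (rule zmat_norm[OF r(1)])
  finally show "cnorm E (\<pi> (mat n s t) \<otimes>\<^bsub>E\<^esub> pr j) \<le> cnorm E (\<pi> total) ^ (2 ^ n)" .
qed

definition avg :: "nat \<Rightarrow> 'a" where
  "avg n = finsum A (\<lambda>s. finsum A (\<lambda>t. complex_of_real (\<xi> s * \<xi> t) \<odot> mat n s t) F) F"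

lemma avg_in: "avg n \<in> carrier A"
  unfolding avg_def using mat_in by (auto intro!: M.finsum_closed)

text \<open>Grouping by rows writes \<open>avg n\<close> as the \<xi>-weighted sum of the v u. The
  Cauchy-Schwarz bound, the sum of the star squares of the v u, is the quadratic form of the next
  matrix at \<xi>.\<close>

lemma avg_square_le: "(cnorm A (avg n))\<^sup>2 \<le> cnorm A (avg (Suc n))"
proof -
  define v where "v u = finsum A (\<lambda>t. complex_of_real (\<xi> t) \<odot> mat n u t) F" for u
  have v: "v u \<in> carrier A" if "u \<in> F" for u unfolding v_def using mat_in that by (auto intro!: M.finsum_closed)
  have 1: "avg n = finsum A (\<lambda>u. complex_of_real (\<xi> u) \<odot> v u) F"
    unfolding avg_def
  proof (rule M.finsum_cong'[OF refl])
    fix u assume u: "u \<in> F"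
    show "finsum A (\<lambda>t. complex_of_real (\<xi> u * \<xi> t) \<odot> mat n u t) F = complex_of_real (\<xi> u) \<odot> v u"
      unfolding v_def using F mat_in u by (subst smult_finsum) (auto simp: smult_smult intro!: M.finsum_cong')
  qed (use v in auto)
  have vv: "adj A (v u) \<otimes> v u = finsum A (\<lambda>s. finsum A (\<lambda>t. complex_of_real (\<xi> s * \<xi> t) \<odot> (adj A (mat n u s) \<otimes> mat n u t)) F) F"
    if u: "u \<in> F" for u
  proof -
    have m: "mat n u t \<in> carrier A" "adj A (mat n u t) \<in> carrier A" if "t \<in> F" for t using mat_in[OF u that] adj_closed by auto
    have "adj A (v u) = finsum A (\<lambda>s. complex_of_real (\<xi> s) \<odot> adj A (mat n u s)) F"
      unfolding v_def using F m by (subst adj_finsum) (auto simp: adj_smult intro!: M.finsum_cong')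
    then have "adj A (v u) \<otimes> v u = finsum A (\<lambda>s. (complex_of_real (\<xi> s) \<odot> adj A (mat n u s)) \<otimes> v u) F"
      using F m v[OF u] by (simp add: finsum_ldistr Pi_def)
    also have "\<dots> = finsum A (\<lambda>s. finsum A (\<lambda>t. complex_of_real (\<xi> s * \<xi> t) \<odot> (adj A (mat n u s) \<otimes> mat n u t)) F) F"
    proof (rule M.finsum_cong'[OF refl])
      fix s assume s: "s \<in> F"
      show "(complex_of_real (\<xi> s) \<odot> adj A (mat n u s)) \<otimes> v u = finsum A (\<lambda>t. complex_of_real (\<xi> s * \<xi> t) \<odot> (adj A (mat n u s) \<otimes> mat n u t)) F"
        unfolding v_def using F m s by (subst finsum_rdistr) (auto simp: smult_mult_left smult_mult_right smult_smult mult.commute intro!: M.finsum_cong')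
    qed (use m in \<open>auto intro!: M.finsum_closed\<close>)
    finally show ?thesis .
  qed
  have m: "adj A (mat n u s) \<otimes> mat n u t \<in> carrier A" if "u \<in> F" "s \<in> F" "t \<in> F" for u s t
    using that mat_in adj_closed by auto
  have "finsum A (\<lambda>u. adj A (v u) \<otimes> v u) F = finsum A (\<lambda>u. finsum A (\<lambda>s. finsum A (\<lambda>t. complex_of_real (\<xi> s * \<xi> t) \<odot> (adj A (mat n u s) \<otimes> mat n u t)) F) F) F"
    using vv m by (intro M.finsum_cong') (auto intro!: M.finsum_closed)
  also have "\<dots> = finsum A (\<lambda>s. finsum A (\<lambda>u. finsum A (\<lambda>t. complex_of_real (\<xi> s * \<xi> t) \<odot> (adj A (mat n u s) \<otimes> mat n u t)) F) F) F"
    using F m by (intro finsum_swap) (auto intro!: M.finsum_closed)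
  also have "\<dots> = finsum A (\<lambda>s. finsum A (\<lambda>t. finsum A (\<lambda>u. complex_of_real (\<xi> s * \<xi> t) \<odot> (adj A (mat n u s) \<otimes> mat n u t)) F) F) F"
    using F m by (intro M.finsum_cong' finsum_swap) (auto intro!: M.finsum_closed)
  also have "\<dots> = avg (Suc n)"
    unfolding avg_def
  proof (rule M.finsum_cong'[OF refl])
    fix s assume s: "s \<in> F"
    show "finsum A (\<lambda>t. finsum A (\<lambda>u. complex_of_real (\<xi> s * \<xi> t) \<odot> (adj A (mat n u s) \<otimes> mat n u t)) F) F =
        finsum A (\<lambda>t. complex_of_real (\<xi> s * \<xi> t) \<odot> mat (Suc n) s t) F"
      using F m s by (intro M.finsum_cong') (auto simp: smult_finsum intro!: M.finsum_closed)
  qed (use m in \<open>auto intro!: M.finsum_closed\<close>)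
  finally show ?thesis using cnorm_Cauchy_Schwarz[where v = v, OF F(1) v \<xi>1] by (simp add: 1)
qed

text \<open>Iterated squaring bounds a high power of the norm of \<open>avg 0\<close> by the norm of
  \<open>avg n\<close>, which is estimated entry by entry. The resulting constant depends on \<xi>
  alone and disappears by \<open>le_of_power_le\<close>.\<close>

lemma avg_norm: "cnorm A (avg 0) \<le> cnorm E (\<pi> total)"
proof (rule le_of_power_le)
  fix n
  have "cnorm A (avg 0) ^ (2 ^ n) \<le> cnorm A (avg n)"
  proof (induction n)
    case (Suc n)
    have "cnorm A (avg 0) ^ (2 ^ Suc n) = (cnorm A (avg 0) ^ (2 ^ n))\<^sup>2" by (simp add: mult.commute flip: power_mult)
    also have "\<dots> \<le> (cnorm A (avg n))\<^sup>2" using Suc avg_in by (intro power_mono) auto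
    also have "\<dots> \<le> cnorm A (avg (Suc n))" by (rule avg_square_le)
    finally show ?case .
  qed simp
  also have "cnorm A (avg n) \<le> (\<Sum>s\<in>F. cnorm A (finsum A (\<lambda>t. complex_of_real (\<xi> s * \<xi> t) \<odot> mat n s t) F))"
    unfolding avg_def using F mat_in by (intro cnorm_finsum_le) (auto intro!: M.finsum_closed)
  also have "\<dots> \<le> (\<Sum>s\<in>F. \<Sum>t\<in>F. cnorm A (complex_of_real (\<xi> s * \<xi> t) \<odot> mat n s t))"
    using F mat_in by (intro sum_mono cnorm_finsum_le) auto
  also have "\<dots> \<le> (\<Sum>s\<in>F. \<Sum>t\<in>F. \<bar>\<xi> s * \<xi> t\<bar> * cnorm E (\<pi> total) ^ (2 ^ n))"
    using mat_in mat_norm by (intro sum_mono) (auto simp: cnorm_smult norm_mult abs_mult intro!: mult_left_mono)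
  also have "\<dots> = (\<Sum>s\<in>F. \<Sum>t\<in>F. \<bar>\<xi> s * \<xi> t\<bar>) * cnorm E (\<pi> total) ^ (2 ^ n)"
    by (simp add: sum_distrib_right)
  finally show "cnorm A (avg 0) ^ 2 ^ n \<le> (\<Sum>s\<in>F. \<Sum>t\<in>F. \<bar>\<xi> s * \<xi> t\<bar>) * cnorm E (\<pi> total) ^ 2 ^ n" .
qed (use avg_in total_in \<pi>_in in auto)

text \<open>Collecting the terms with s = k t shows that averaging multiplies each component by a
  positive definite function of its degree, the one that Reiter's condition brings close to
  1.\<close>

lemma avg_eq:
  assumes \<xi>0: "\<And>x. x \<notin> F \<Longrightarrow> \<xi> x = 0"
  shows "avg 0 = finsum A (\<lambda>k. complex_of_real (\<Sum>t\<in>F. \<xi> (k \<otimes>\<^bsub>K\<^esub> t) * \<xi> t) \<odot> a k) S"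
proof -
  have FK: "u \<in> carrier K" if "u \<in> F" for u using that F by auto
  have SK: "k \<in> carrier K" if "k \<in> S" for k using that S by auto
  have row: "finsum A (\<lambda>s. complex_of_real (\<xi> s * \<xi> t) \<odot> a (s \<otimes>\<^bsub>K\<^esub> inv\<^bsub>K\<^esub> t)) F =
      finsum A (\<lambda>k. complex_of_real (\<xi> (k \<otimes>\<^bsub>K\<^esub> t) * \<xi> t) \<odot> a k) S" if t: "t \<in> F" for t
  proof -
    \<comment> \<open>A common index set for both forms of the row: off F the weight \<xi> vanishes,
      and off the translate of S the component a vanishes.\<close>
    define U where "U = F \<union> (\<lambda>k. k \<otimes>\<^bsub>K\<^esub> t) ` S"
    have U: "finite U" "F \<subseteq> U" "U \<subseteq> carrier K" using F S t by (auto simp: U_def)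
    let ?f = "\<lambda>s. complex_of_real (\<xi> s * \<xi> t) \<odot> a (s \<otimes>\<^bsub>K\<^esub> inv\<^bsub>K\<^esub> t)"
    have f: "?f s \<in> carrier A" if "s \<in> U" for s using that U a_in FK[OF t] by auto
    have kt: "k \<otimes>\<^bsub>K\<^esub> t \<otimes>\<^bsub>K\<^esub> inv\<^bsub>K\<^esub> t = k" if "k \<in> carrier K" for k using that FK[OF t] by (simp add: K.m_assoc)
    have "finsum A ?f F = finsum A ?f U"
      using U f \<xi>0 a_in FK[OF t] by (intro finsum_neutral_subset[symmetric]) auto
    also have "\<dots> = finsum A ?f ((\<lambda>k. k \<otimes>\<^bsub>K\<^esub> t) ` S)"
    proof (rule finsum_neutral_subset)
      fix s assume s: "s \<in> U - (\<lambda>k. k \<otimes>\<^bsub>K\<^esub> t) ` S"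
      have sc: "s \<in> carrier K" using s U by auto
      have "s = (s \<otimes>\<^bsub>K\<^esub> inv\<^bsub>K\<^esub> t) \<otimes>\<^bsub>K\<^esub> t" using sc FK[OF t] by (simp add: K.m_assoc)
      then have "s \<otimes>\<^bsub>K\<^esub> inv\<^bsub>K\<^esub> t \<notin> S" using s by blast
      then show "?f s = \<zero>" using a0 sc FK[OF t] by simp
    qed (use U f in \<open>auto simp: U_def\<close>)
    also have "\<dots> = finsum A (\<lambda>k. ?f (k \<otimes>\<^bsub>K\<^esub> t)) S"
    proof (rule M.finsum_reindex)
      show "inj_on (\<lambda>k. k \<otimes>\<^bsub>K\<^esub> t) S" by (rule inj_on_inverseI[of _ "\<lambda>k. k \<otimes>\<^bsub>K\<^esub> inv\<^bsub>K\<^esub> t"]) (use kt SK in auto)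
    qed (use f in \<open>auto simp: U_def\<close>)
    also have "\<dots> = finsum A (\<lambda>k. complex_of_real (\<xi> (k \<otimes>\<^bsub>K\<^esub> t) * \<xi> t) \<odot> a k) S"
      using kt SK a_in by (intro M.finsum_cong') auto
    finally show ?thesis .
  qed
  have ast: "a (s \<otimes>\<^bsub>K\<^esub> inv\<^bsub>K\<^esub> t) \<in> carrier A" if "s \<in> F" "t \<in> F" for s t using that FK a_in by auto
  have aS: "a k \<in> carrier A" if "k \<in> S" for k using that SK a_in by auto
  have "avg 0 = finsum A (\<lambda>t. finsum A (\<lambda>s. complex_of_real (\<xi> s * \<xi> t) \<odot> a (s \<otimes>\<^bsub>K\<^esub> inv\<^bsub>K\<^esub> t)) F) F"
    unfolding avg_def mat.simps using F ast by (intro finsum_swap) auto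
  also have "\<dots> = finsum A (\<lambda>t. finsum A (\<lambda>k. complex_of_real (\<xi> (k \<otimes>\<^bsub>K\<^esub> t) * \<xi> t) \<odot> a k) S) F"
    by (rule M.finsum_cong'[OF refl _ row]) (use aS in \<open>auto intro!: M.finsum_closed\<close>)
  also have "\<dots> = finsum A (\<lambda>k. finsum A (\<lambda>t. complex_of_real (\<xi> (k \<otimes>\<^bsub>K\<^esub> t) * \<xi> t) \<odot> a k) F) S"
    using F S aS by (intro finsum_swap) auto
  also have "\<dots> = finsum A (\<lambda>k. complex_of_real (\<Sum>t\<in>F. \<xi> (k \<otimes>\<^bsub>K\<^esub> t) * \<xi> t) \<odot> a k) S"
    using F aS by (intro M.finsum_cong') (auto simp: finsum_smult_const)
  finally show ?thesis .
qed

end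

text \<open>The family is total on K and zero off S because \<open>mat\<close> evaluates it at every
  s inv(t) with s and t in F, whether or not that degree occurs in x.\<close>

lemma homogeneous_decomposition:
  assumes "x \<in> lspan A (monoms (P \<times> P))"
  shows "\<exists>S a. finite S \<and> S \<subseteq> carrier K \<and> (\<forall>k\<in>carrier K. a k \<in> Deg k) \<and>
    (\<forall>k\<in>carrier K. k \<notin> S \<longrightarrow> a k = \<zero>) \<and> x = finsum A a S"
  using assms
proof (induction rule: lspan.induct)
  case zero
  show ?case by (intro exI[of _ "{}"] exI[of _ "\<lambda>_. \<zero>"]) (simp add: lspan.zero)
next
  case (step x y c)
  then obtain S a where S: "finite S" "S \<subseteq> carrier K" and a: "\<And>k. k \<in> carrier K \<Longrightarrow> a k \<in> Deg k"
    "\<And>k. k \<in> carrier K \<Longrightarrow> k \<notin> S \<Longrightarrow> a k = \<zero>" "y = finsum A a S" by blast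
  obtain p r where p: "x = mon p r" "p \<in> P" "r \<in> P" using step by (auto simp: monoms_def)
  define k where "k = \<mu> p \<otimes>\<^bsub>K\<^esub> inv\<^bsub>K\<^esub> \<mu> r"
  have k: "k \<in> carrier K" using p \<mu>_carrier by (simp add: k_def)
  have x: "x \<in> monoms (deg k)" "x \<in> carrier A" using p by (auto simp: monoms_def deg_def k_def)
  have ac: "a i \<in> carrier A" if "i \<in> carrier K" for i using a(1)[OF that] Deg_in by blast
  define b where "b = a(k := c \<odot> x \<oplus> a k)"
  have bD: "b i \<in> Deg i" if "i \<in> carrier K" for i
    using a(1)[OF that] x by (auto simp: b_def intro: lspan.step)
  have bc: "b i \<in> carrier A" if "i \<in> carrier K" for i using bD[OF that] Deg_in by blast
  have "finsum A b (insert k S) = finsum A b (insert k (S - {k}))" by simp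
  also have "\<dots> = b k \<oplus> finsum A b (S - {k})" using S bc k by (intro M.finsum_insert) auto
  also have "b k = c \<odot> x \<oplus> a k" by (simp add: b_def)
  also have "finsum A b (S - {k}) = finsum A a (S - {k})"
    using S ac by (intro M.finsum_cong') (auto simp: b_def)
  also have "(c \<odot> x \<oplus> a k) \<oplus> finsum A a (S - {k}) = c \<odot> x \<oplus> (a k \<oplus> finsum A a (S - {k}))"
    using x ac k S by (subst M.a_assoc) (auto intro!: M.finsum_closed)
  also have "a k \<oplus> finsum A a (S - {k}) = finsum A a (insert k (S - {k}))"
    using S ac k by (subst M.finsum_insert) auto
  also have "\<dots> = finsum A a (insert k S)" by simp
  also have "\<dots> = finsum A a S"
    using S ac k a(2) by (intro finsum_neutral_subset) auto
  finally have "c \<odot> x \<oplus> y = finsum A b (insert k S)" using a(3) by simp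
  moreover have "b i = \<zero>" if "i \<in> carrier K" "i \<notin> insert k S" for i
    using a(2)[of i] that by (simp add: b_def)
  ultimately show ?case using S k bD by (intro exI[of _ "insert k S"] exI[of _ b]) auto
qed

text \<open>The averaged element y obeys the exact bound, and the remainder x - y carries the
  coefficients 1 - \<phi>(k), which are as small as desired on the finitely many degrees of
  x.\<close>

theorem span_isometric:
  assumes am: "amenable_group K" and x: "x \<in> lspan A (monoms (P \<times> P))"
  shows "cnorm A x \<le> cnorm E (\<pi> x)"
proof -
  obtain S a where S: "finite S" "S \<subseteq> carrier K" and a: "\<And>k. k \<in> carrier K \<Longrightarrow> a k \<in> Deg k"
    "\<And>k. k \<in> carrier K \<Longrightarrow> k \<notin> S \<Longrightarrow> a k = \<zero>" and xa: "x = finsum A a S"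
    using homogeneous_decomposition[OF x] by blast
  obtain m where m: "invariant_mean K m" using am by (auto simp: amenable_group_def)
  have ac: "a k \<in> carrier A" if "k \<in> S" for k using a(1) that S Deg_in by blast
  define C where "C = (\<Sum>k\<in>S. cnorm A (a k))"
  have C: "0 \<le> C" unfolding C_def using ac by (intro sum_nonneg) auto
  have "cnorm A x \<le> cnorm E (\<pi> x) + e" if e: "e > 0" for e
  proof -
    \<comment> \<open>The remainder has norm at most d C; dividing by C + 1 makes this at most e and
      stays meaningful for C = 0.\<close>
    define d where "d = e / (C + 1)"
    have d: "d > 0" "d * C \<le> e" using e C by (simp_all add: d_def field_simps)
    obtain F \<xi> where F: "finite F" "F \<subseteq> carrier K" "\<And>x. x \<notin> F \<Longrightarrow> \<xi> x = 0" "(\<Sum>x\<in>F. (\<xi> x)\<^sup>2) = 1"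
      and ap: "\<And>s. s \<in> S \<Longrightarrow> \<bar>1 - (\<Sum>t\<in>F. \<xi> (s \<otimes>\<^bsub>K\<^esub> t) * \<xi> t)\<bar> \<le> d"
      using Reiter[OF K.group_axioms m S d(1)] by blast
    define y where "y = avg a F \<xi> 0"
    have xt: "x = total a S" using total_def[OF a(1) S a(2) F(1,2,4)] xa by simp
    have y: "cnorm A y \<le> cnorm E (\<pi> x)"
      unfolding y_def xt by (rule avg_norm[OF a(1) S a(2) F(1,2,4)])
    have yc: "y \<in> carrier A" unfolding y_def by (rule avg_in[OF a(1) S a(2) F(1,2,4)])
    let ?\<phi> = "\<lambda>k. \<Sum>t\<in>F. \<xi> (k \<otimes>\<^bsub>K\<^esub> t) * \<xi> t"
    have ye: "y = finsum A (\<lambda>k. complex_of_real (?\<phi> k) \<odot> a k) S"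
      unfolding y_def by (rule avg_eq[OF a(1) S a(2) F(1,2,4) F(3)])
    define z where "z = finsum A (\<lambda>k. complex_of_real (1 - ?\<phi> k) \<odot> a k) S"
    have zc: "z \<in> carrier A" unfolding z_def using ac by (auto intro!: M.finsum_closed)
    have "z \<oplus> y = finsum A (\<lambda>k. complex_of_real (1 - ?\<phi> k) \<odot> a k \<oplus> complex_of_real (?\<phi> k) \<odot> a k) S"
      unfolding z_def ye using ac by (intro M.finsum_addf[symmetric]) auto
    also have "\<dots> = finsum A a S"
    proof (rule M.finsum_cong'[OF refl])
      fix k assume k: "k \<in> S"
      show "complex_of_real (1 - ?\<phi> k) \<odot> a k \<oplus> complex_of_real (?\<phi> k) \<odot> a k = a k"
        using smult_add_left[OF ac[OF k], of "complex_of_real (1 - ?\<phi> k)" "complex_of_real (?\<phi> k)"] ac[OF k]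
        by (simp del: of_real_diff of_real_sum add: of_real_add[symmetric])
    qed (use ac in auto)
    finally have "cnorm A x \<le> cnorm A z + cnorm A y" using cnorm_triangle[OF zc yc] xa by simp
    also have "cnorm A z \<le> (\<Sum>k\<in>S. cnorm A (complex_of_real (1 - ?\<phi> k) \<odot> a k))"
      unfolding z_def using S ac by (intro cnorm_finsum_le) auto
    also have "\<dots> \<le> (\<Sum>k\<in>S. d * cnorm A (a k))"
    proof (rule sum_mono)
      fix k assume k: "k \<in> S"
      have "cnorm A (complex_of_real (1 - ?\<phi> k) \<odot> a k) = \<bar>1 - ?\<phi> k\<bar> * cnorm A (a k)"
        using ac[OF k] by (simp only: cnorm_smult norm_of_real)
      then show "cnorm A (complex_of_real (1 - ?\<phi> k) \<odot> a k) \<le> d * cnorm A (a k)"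
        using ap[OF k] ac[OF k] by (simp add: mult_right_mono)
    qed
    also have "\<dots> = d * C" by (simp add: C_def sum_distrib_left)
    finally show ?thesis using y d by simp
  qed
  then show ?thesis by (rule field_le_epsilon)
qed

end

section \<open>The theorem\<close>

lemma (in qlo_rep) span_algebra:
  assumes "x \<in> lspan A (monoms (P \<times> P))" "y \<in> lspan A (monoms (P \<times> P))"
  shows "x \<otimes> y \<in> lspan A (monoms (P \<times> P))"
proof (rule monoms_span_mult[OF assms])
  fix p r s t z assume "(p, r) \<in> P \<times> P" "(s, t) \<in> P \<times> P" and j: "join G P r s = Some z"
  then have P: "p \<in> P" "r \<in> P" "s \<in> P" "t \<in> P" by auto
  note j = join_SomeE[OF qlo j P_carrier[OF P(2)] P_carrier[OF P(3)]]
  show "(p \<otimes>\<^bsub>G\<^esub> (inv\<^bsub>G\<^esub> r \<otimes>\<^bsub>G\<^esub> z), t \<otimes>\<^bsub>G\<^esub> (inv\<^bsub>G\<^esub> s \<otimes>\<^bsub>G\<^esub> z)) \<in> P \<times> P"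
    using P j(2,3) qlo_mult[OF qlo] by (simp add: le_of_def)
qed auto

text \<open>The formal *-polynomials that approximate x evaluate into the span of monomials, since
  that span contains 1, all W p and their adjoints and is closed under products.\<close>

lemma (in qlo_rep) span_dense:
  assumes x: "x \<in> cstar_span A (W ` P)"
  shows "\<exists>s. conv s x \<and> (\<forall>n. s n \<in> lspan A (monoms (P \<times> P)))"
proof -
  \<comment> \<open>\<open>cstar_span_approx\<close> wants an element of the carrier at every g; the
    value 1 off P already lies in the span of monomials.\<close>
  define V where "V p = (if p \<in> P then W p else \<one>)" for p
  have V: "V p \<in> carrier A" for p using W_in by (simp add: V_def)
  have sub: "P \<times> P \<subseteq> P \<times> P" by simp
  note mc = monoms_in[OF sub]
  have "V ` P = W ` P" by (auto simp: V_def)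
  then have "x \<in> cstar_span A (V ` P)" using x by simp
  from cstar_span_approx[OF V this] obtain t where t: "approx V x t" by blast
  have oneP: "\<one>\<^bsub>G\<^esub> \<in> P" using qlo_one[OF qlo] .
  have base: "mon p r \<in> lspan A (monoms (P \<times> P))" if "p \<in> P" "r \<in> P" for p r
    using that by (intro lspan_base mc) (auto simp: monoms_def)
  have m1: "mon p \<one>\<^bsub>G\<^esub> = W p" "mon \<one>\<^bsub>G\<^esub> p = adj A (W p)" if "p \<in> P" for p
    using that W_in W_adj_in by (simp_all add: mon_def W_one adj_one)
  have one: "\<one> \<in> lspan A (monoms (P \<times> P))" using base[OF oneP oneP] m1[OF oneP] by (simp add: W_one)
  have letter: "V p \<in> lspan A (monoms (P \<times> P))" "adj A (V p) \<in> lspan A (monoms (P \<times> P))" for p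
  proof -
    show "V p \<in> lspan A (monoms (P \<times> P))" using one base[OF _ oneP, of p] m1[of p] by (auto simp: V_def)
    show "adj A (V p) \<in> lspan A (monoms (P \<times> P))" using one base[OF oneP, of p] m1[of p] by (auto simp: V_def adj_one)
  qed
  have word: "eval_word V w \<in> lspan A (monoms (P \<times> P))" for w
    by (induction w) (auto simp: one intro!: span_algebra letter)
  have poly: "eval_poly V l \<in> lspan A (monoms (P \<times> P))" for l
    by (induction l) (auto simp: lspan.zero intro!: lspan_add lspan_smult word mc)
  have inC: "x \<in> carrier A" using cstar_span_in_carrier[OF x] W_in by auto
  have "conv (\<lambda>n. eval_poly V (t n)) x"
    using t poly monoms_span_in[OF poly sub] inC by (auto simp: conv_def approx_def[OF V])
  then show ?thesis using poly by blast
qed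

text \<open>Changes only the codomain, so that images can be multiplied with the level projections
  inside the algebra of all bounded operators.\<close>

lemma star_hom_reduced:
  assumes q: "quasi_lattice_ordered G P" and \<pi>: "\<pi> \<in> star_hom A (reduced_cstar G P)"
  shows "\<pi> \<in> star_hom A (ell2_operators P)"
proof -
  have "x \<in> carrier (ell2_operators P)" if "x \<in> carrier (reduced_cstar G P)" for x
    using that toeplitz_in[OF q]
    by (intro unital_cstar_algebra.cstar_span_in_carrier[OF unital_cstar_algebra_ell2_operators, of x P "toeplitz G P ` P"])
      (auto simp: reduced_cstar_def ell2_operators_simps)
  then show ?thesis using \<pi> by (auto simp: star_hom_def ring_hom_def reduced_cstar_def)
qed

lemma unital_cstar_algebra_reduced:
  assumes q: "quasi_lattice_ordered G P" shows "unital_cstar_algebra (reduced_cstar G P)"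
  unfolding reduced_cstar_def
  by (rule unital_cstar_algebra.cstar_generated[OF unital_cstar_algebra_ell2_operators])
    (use toeplitz_in[OF q] in \<open>auto simp: ell2_operators_simps\<close>)

lemma covariant_rep_reduced:
  assumes q: "quasi_lattice_ordered G P" shows "covariant_rep G P (reduced_cstar G P) (toeplitz G P)"
proof -
  have "toeplitz G P p \<in> cstar_span (ell2_operators P) (toeplitz G P ` P)" if "p \<in> P" for p
    using that by (auto intro: cstar_span.base)
  then show ?thesis
    using covariant_rep_toeplitz[OF q]
    unfolding covariant_rep_def isometric_rep_def range_proj_def reduced_cstar_def cstar_generated_simps
    by blast
qed

text \<open>Vectors are functions that vanish off the index set, so the smaller space is literally a
  subset of the larger one and no embedding map is needed.\<close>

lemma ell2_subset:
  assumes f: "f \<in> ell2 X" and XY: "X \<subseteq> Y"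
  shows "f \<in> ell2 Y" "ell2_norm Y f = ell2_norm X f"
proof -
  have "(\<lambda>x. (cmod (f x))\<^sup>2) summable_on Y \<longleftrightarrow> (\<lambda>x. (cmod (f x))\<^sup>2) summable_on X"
    using XY ell2_support[OF f] by (intro summable_on_cong_neutral) auto
  then show "f \<in> ell2 Y" using f XY by (auto simp: ell2_def)
  have "(\<Sum>\<^sub>\<infinity>x\<in>Y. (cmod (f x))\<^sup>2) = (\<Sum>\<^sub>\<infinity>x\<in>X. (cmod (f x))\<^sup>2)"
    using XY ell2_support[OF f] by (intro infsum_cong_neutral) auto
  then show "ell2_norm Y f = ell2_norm X f" by (simp add: ell2_norm_def)
qed

section \<open>The kernel as a quasi-lattice ordered group\<close>

context
  fixes G :: "('g, 'm) monoid_scheme" and P :: "'g set"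
    and K :: "('k, 'n) monoid_scheme" and Q :: "'k set" and \<mu> :: "'g \<Rightarrow> 'k"
  assumes q: "quasi_lattice_ordered G P" and qK: "quasi_lattice_ordered K Q"
    and ctrl: "controlled_map G P K Q \<mu>"
begin

interpretation G: group G using q by (simp add: quasi_lattice_ordered_def)
interpretation K: group K using qK by (simp add: quasi_lattice_ordered_def)
interpretation \<mu>: group_hom G K \<mu> using ctrl by unfold_locales (simp add: controlled_map_def)

abbreviation (input) "N \<equiv> kernel G K \<mu>"
abbreviation (input) "GN \<equiv> G\<lparr>carrier := kernel G K \<mu>\<rparr>"
abbreviation (input) "PN \<equiv> kernel G K \<mu> \<inter> P"

lemma inv_kernel: "x \<in> N \<Longrightarrow> inv\<^bsub>GN\<^esub> x = inv\<^bsub>G\<^esub> x"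
  using G.m_inv_consistent[OF \<mu>.subgroup_kernel] by simp

lemma le_of_kernel: "x \<in> N \<Longrightarrow> y \<in> N \<Longrightarrow> le_of GN PN x y \<longleftrightarrow> le_of G P x y"
  using subgroup.m_inv_closed[OF \<mu>.subgroup_kernel] subgroup.m_closed[OF \<mu>.subgroup_kernel]
  by (simp add: le_of_def inv_kernel)

text \<open>By condition (1) a join of two kernel elements is mapped to the join of e with itself,
  so it stays in the kernel. Covariance for (G, P) therefore restricts to covariance for the kernel
  pair.\<close>

lemma join_kernel:
  assumes n: "n \<in> PN" "m \<in> PN"
  shows "join GN PN n m = join G P n m"
proof (cases "join G P n m")
  case None
  then have "upper_bounds G P {n, m} = {}" by (auto simp: join_def split: if_splits)
  then have "upper_bounds GN PN {n, m} = {}" using n by (auto simp: upper_bounds_def le_of_kernel)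
  then show ?thesis using None by (simp add: join_def)
next
  case (Some z)
  have c: "n \<in> carrier G" "m \<in> carrier G" using n by (auto simp: kernel_def)
  note j = join_SomeE[OF q Some c]
  have "join K Q (\<mu> n) (\<mu> m) = Some (\<mu> z)" using ctrl c Some by (simp add: controlled_map_def)
  moreover have "is_lub K Q {\<one>\<^bsub>K\<^esub>, \<one>\<^bsub>K\<^esub>} \<one>\<^bsub>K\<^esub>"
    using qlo_one[OF qK] le_of_refl[OF qK] by (auto simp: is_lub_def upper_bounds_def)
  then have "join K Q \<one>\<^bsub>K\<^esub> \<one>\<^bsub>K\<^esub> = Some \<one>\<^bsub>K\<^esub>" by (rule join_eqI[OF qK])
  ultimately have z: "z \<in> PN" using n j(1) qlo_carrier[OF q] by (auto simp: kernel_def)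
  have "upper_bounds GN PN {n, m} = upper_bounds G P {n, m} \<inter> N"
    using n by (auto simp: upper_bounds_def le_of_kernel)
  moreover have "upper_bounds G P {n, m} \<noteq> {}" using j by (auto simp: upper_bounds_def)
  have lub: "is_lub GN PN {n, m} z"
    using z n j by (auto simp: is_lub_def upper_bounds_def le_of_kernel)
  have uniq: "u = z" if "is_lub GN PN {n, m} u" for u
  proof (rule le_of_antisym[OF q])
    show "le_of G P u z" "le_of G P z u"
      using that lub z n by (auto simp: is_lub_def upper_bounds_def le_of_kernel)
    show "u \<in> carrier G" "z \<in> carrier G"
      using that z by (auto simp: is_lub_def upper_bounds_def kernel_def)
  qed
  have "(THE u. is_lub GN PN {n, m} u) = z" using lub uniq by (rule the_equality)
  moreover have "upper_bounds GN PN {n, m} \<noteq> {}" using lub by (auto simp: is_lub_def)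
  ultimately show ?thesis using Some by (simp add: join_def)
qed

lemma covariant_rep_kernel:
  assumes "covariant_rep G P A W" shows "covariant_rep GN PN A W"
  using assms join_kernel by (auto simp: covariant_rep_def isometric_rep_def)

text \<open>Translation by a kernel element preserves the kernel and its complement, so vectors
  supported on the kernel are treated alike by both Toeplitz operators.\<close>

lemma toeplitz_kernel:
  assumes qN: "quasi_lattice_ordered GN PN" and n: "n \<in> PN" and f: "f \<in> ell2 PN"
  shows "toeplitz GN PN n f = toeplitz G P n f"
    and "adj (ell2_operators PN) (toeplitz GN PN n) f = adj (ell2_operators P) (toeplitz G P n) f"
proof -
  have fP: "f \<in> ell2 P" using ell2_subset(1)[OF f, of P] by blast
  have nc: "n \<in> carrier G" "n \<in> N" "n \<in> P" "\<mu> n = \<one>\<^bsub>K\<^esub>" using n by (auto simp: kernel_def)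
  have out: "f y = 0" if "y \<notin> N" for y using ell2_support[OF f] that by blast
  have ker: "inv\<^bsub>G\<^esub> n \<otimes>\<^bsub>G\<^esub> y \<in> N \<longleftrightarrow> y \<in> N" "n \<otimes>\<^bsub>G\<^esub> y \<in> N \<longleftrightarrow> y \<in> N" if "y \<in> P" for y
    using that qlo_carrier[OF q] nc by (simp_all add: kernel_def)
  show "toeplitz GN PN n f = toeplitz G P n f"
  proof
    fix y
    show "toeplitz GN PN n f y = toeplitz G P n f y"
    proof (cases "y \<in> N")
      case True
      then show ?thesis using f fP nc by (simp add: toeplitz_def le_of_kernel inv_kernel)
    next
      case False
      then show ?thesis using f fP out ker(1)[of y] by (simp add: toeplitz_def)
    qed
  qed
  show "adj (ell2_operators PN) (toeplitz GN PN n) f = adj (ell2_operators P) (toeplitz G P n) f"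
    unfolding toeplitz_adj[OF qN n] toeplitz_adj[OF q nc(3)]
  proof
    fix y
    show "pmap_op PN PN (\<lambda>y. n \<otimes>\<^bsub>GN\<^esub> y) f y = pmap_op P P (\<lambda>y. n \<otimes>\<^bsub>G\<^esub> y) f y"
      using f fP out ker(2)[of y] by (cases "y \<in> N") (auto simp: pmap_op_def)
  qed
qed

text \<open>Lift d to an element d' of the universal algebra of the kernel pair. The map \<theta>
  back to the algebra of (G, P) is contractive, amenability makes \<pi>N isometric at d', and
  \<pi>N(d') is the restriction of \<pi>(d) to vectors supported on the kernel.\<close>

lemma kernel_rep_isometric:
  assumes am: "amenable_qlo GN PN"
    and \<pi>: "\<pi> \<in> star_hom (universal_cstar G P) (ell2_operators P)"
    and \<pi>T: "\<And>p. p \<in> P \<Longrightarrow> \<pi> (universal_rep G P p) = toeplitz G P p"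
    and d: "d \<in> lspan (universal_cstar G P) (qlo_rep.monoms (universal_cstar G P) (universal_rep G P) (PN \<times> PN))"
  shows "cnorm (universal_cstar G P) d \<le>
    opnorm P (\<pi> d \<otimes>\<^bsub>ell2_operators P\<^esub> pmap_op P PN (\<lambda>y. y))"
proof -
  let ?A = "universal_cstar G P" and ?W = "universal_rep G P" and ?AN = "universal_cstar GN PN"
    and ?WN = "universal_rep GN PN"
  have qN: "quasi_lattice_ordered GN PN" using am by (simp add: amenable_qlo_def)
  interpret A: unital_cstar_algebra ?A by (rule universal_cstar_algebra)
  interpret AN: unital_cstar_algebra ?AN by (rule universal_cstar_algebra)
  interpret E: unital_cstar_algebra "ell2_operators P" by (rule unital_cstar_algebra_ell2_operators)
  interpret EN: unital_cstar_algebra "ell2_operators PN" by (rule unital_cstar_algebra_ell2_operators)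
  interpret R: qlo_rep ?A G P ?W by unfold_locales (use q universal_rep_covariant[OF q] in auto)
  interpret RN: qlo_rep ?AN GN PN ?WN by unfold_locales (use qN universal_rep_covariant[OF qN] in auto)
  obtain \<pi>N where \<pi>N0: "\<pi>N \<in> star_hom ?AN (reduced_cstar GN PN)"
    and \<pi>NT: "\<And>p. p \<in> PN \<Longrightarrow> \<pi>N (?WN p) = toeplitz GN PN p" and inj: "inj_on \<pi>N (carrier ?AN)"
    using am unfolding amenable_qlo_def by blast
  have \<pi>N: "\<pi>N \<in> star_hom ?AN (ell2_operators PN)" by (rule star_hom_reduced[OF qN \<pi>N0])
  obtain \<theta> where \<theta>: "\<theta> \<in> star_hom ?AN ?A" "\<And>p. p \<in> PN \<Longrightarrow> \<theta> (?WN p) = ?W p"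
    using universal_rep_universal[OF qN A.unital_cstar_algebra_axioms covariant_rep_kernel[OF universal_rep_covariant[OF q]]]
    by blast
  note h = star_homD[OF \<pi>] and hN = star_homD[OF \<pi>N] and h\<theta> = star_homD[OF \<theta>(1)]
  \<comment> \<open>The images are compared vector by vector on \<open>ell2 PN\<close>, because
    \<pi>N(d') is extensional on that smaller space and cannot equal \<pi>(d) as a function.\<close>
  have "\<exists>d'\<in>carrier ?AN. \<theta> d' = d \<and> (\<forall>f\<in>ell2 PN. \<pi>N d' f = \<pi> d f)"
    using d
  proof (induction rule: lspan.induct)
    case zero
    have "\<pi>N \<zero>\<^bsub>?AN\<^esub> f = \<pi> \<zero>\<^bsub>?A\<^esub> f" if f: "f \<in> ell2 PN" for f
      using f ell2_subset(1)[OF f, of P] star_hom_zero[OF AN.unital_cstar_algebra_axioms EN.unital_cstar_algebra_axioms \<pi>N]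
        star_hom_zero[OF A.unital_cstar_algebra_axioms E.unital_cstar_algebra_axioms \<pi>]
      by (simp add: ell2_operators_simps)
    then show ?case
      using star_hom_zero[OF AN.unital_cstar_algebra_axioms A.unital_cstar_algebra_axioms \<theta>(1)]
      by (intro bexI[of _ "\<zero>\<^bsub>?AN\<^esub>"]) auto
  next
    case (step x y c)
    then obtain y' where y': "y' \<in> carrier ?AN" "\<theta> y' = y" "\<And>f. f \<in> ell2 PN \<Longrightarrow> \<pi>N y' f = \<pi> y f" by blast
    obtain n m where nm: "x = R.mon n m" "n \<in> PN" "m \<in> PN" using step.hyps(1) by (auto simp: R.monoms_def)
    define x' where "x' = RN.mon n m"
    have nmP: "n \<in> P" "m \<in> P" using nm by auto
    note c = R.W_in[OF nmP(1)] R.W_adj_in[OF nmP(2)] R.W_in[OF nmP(2)]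
    note cN = RN.W_in[OF nm(2)] RN.W_adj_in[OF nm(3)] RN.W_in[OF nm(3)]
    have x': "x' \<in> carrier ?AN" using nm by (simp add: x'_def)
    have xc: "x \<in> carrier ?A" using nmP by (simp add: nm(1))
    have sub: "PN \<times> PN \<subseteq> P \<times> P" by auto
    have yc: "y \<in> carrier ?A" using R.monoms_span_in[OF step.hyps(2) sub] .
    have \<theta>x: "\<theta> x' = x" using cN h\<theta> \<theta>(2) nm by (simp add: x'_def RN.mon_def R.mon_def)
    have \<pi>x: "\<pi>N x' f = \<pi> x f" if f: "f \<in> ell2 PN" for f
    proof -
      have fP: "f \<in> ell2 P" using ell2_subset(1)[OF f, of P] by blast
      have g: "adj (ell2_operators PN) (toeplitz GN PN m) f \<in> ell2 PN"
        using bounded_opsD(1)[OF ad_in[OF toeplitz_in[OF qN nm(3)]] f] .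
      have "\<pi>N x' f = toeplitz GN PN n (adj (ell2_operators PN) (toeplitz GN PN m) f)"
        using cN hN \<pi>NT nm f by (simp add: x'_def RN.mon_def ell2_operators_simps)
      also have "\<dots> = toeplitz G P n (adj (ell2_operators P) (toeplitz G P m) f)"
        using toeplitz_kernel(1)[OF qN nm(2) g] toeplitz_kernel(2)[OF qN nm(3) f] by simp
      also have "\<dots> = \<pi> x f"
        using c h \<pi>T nmP fP by (simp add: nm(1) R.mon_def ell2_operators_simps)
      finally show ?thesis .
    qed
    have "\<pi>N (c \<odot>\<^bsub>?AN\<^esub> x' \<oplus>\<^bsub>?AN\<^esub> y') f = \<pi> (c \<odot>\<^bsub>?A\<^esub> x \<oplus>\<^bsub>?A\<^esub> y) f" if f: "f \<in> ell2 PN" for f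
      using f ell2_subset(1)[OF f, of P] hN(3,5) h(3,5) x' y' xc yc \<pi>x[OF f] by (simp add: ell2_operators_simps)
    moreover have "\<theta> (c \<odot>\<^bsub>?AN\<^esub> x' \<oplus>\<^bsub>?AN\<^esub> y') = c \<odot>\<^bsub>?A\<^esub> x \<oplus>\<^bsub>?A\<^esub> y"
      using h\<theta>(3,5) x' y' \<theta>x by simp
    ultimately show ?case using x' y'(1) by (intro bexI[of _ "c \<odot>\<^bsub>?AN\<^esub> x' \<oplus>\<^bsub>?AN\<^esub> y'"]) auto
  qed
  then obtain d' where d': "d' \<in> carrier ?AN" "\<theta> d' = d" "\<And>f. f \<in> ell2 PN \<Longrightarrow> \<pi>N d' f = \<pi> d f" by blast
  have dc: "d \<in> carrier ?A" using h\<theta>(1)[OF d'(1)] d'(2) by simp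
  have \<pi>d: "\<pi> d \<in> bounded_ops P" using h(1)[OF dc] by (simp add: ell2_operators_simps)
  have \<pi>d': "\<pi>N d' \<in> bounded_ops PN" using hN(1)[OF d'(1)] by (simp add: ell2_operators_simps)
  let ?T = "\<pi> d \<otimes>\<^bsub>ell2_operators P\<^esub> pmap_op P PN (\<lambda>y. y)"
  have pP: "pmap_op P PN (\<lambda>y. y) \<in> bounded_ops P" by (rule cproj_simps) auto
  have T: "?T \<in> bounded_ops P" using \<pi>d pP by (simp add: ell2_operators_simps)
  have "cnorm ?A d \<le> cnorm ?AN d'"
    using star_hom_contractive[OF AN.unital_cstar_algebra_axioms A.unital_cstar_algebra_axioms \<theta>(1) d'(1)] d'(2) by simp
  also have "\<dots> = opnorm PN (\<pi>N d')"
    using star_hom_isometric[OF AN.unital_cstar_algebra_axioms EN.unital_cstar_algebra_axioms \<pi>N inj d'(1)] by simp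
  also have "\<dots> \<le> opnorm P ?T"
  proof (rule opnorm_le[OF opnorm_nonneg[OF T]])
    fix f assume f: "f \<in> ell2 PN"
    have fP: "f \<in> ell2 P" "ell2_norm P f = ell2_norm PN f" using ell2_subset[OF f, of P] by auto
    have "pmap_op P PN (\<lambda>y. y) f = f" using fP ell2_support[OF f] by (auto simp: pmap_op_def fun_eq_iff)
    then have Tf: "?T f = \<pi>N d' f" using fP d'(3)[OF f] by (simp add: ell2_operators_simps)
    have "ell2_norm PN (\<pi>N d' f) = ell2_norm P (?T f)"
      unfolding Tf using ell2_subset(2)[OF bounded_opsD(1)[OF \<pi>d' f], of P] by auto
    also have "\<dots> \<le> opnorm P ?T * ell2_norm PN f" using opnorm_apply[OF T fP(1)] fP(2) by simp
    finally show "ell2_norm PN (\<pi>N d' f) \<le> opnorm P ?T * ell2_norm PN f" .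
  qed
  finally show ?thesis .
qed

end

text \<open>Density is applied inside \<open>universal_cstar\<close>, whose carrier is a span formed
  in the product of all covariant representations; the same closure has to be recognized when formed
  inside the smaller algebra.\<close>

lemma cstar_span_generated:
  assumes B: "unital_cstar_algebra B" and S: "S \<subseteq> carrier B" and x: "x \<in> cstar_span B S"
  shows "x \<in> cstar_span (cstar_generated B S) S"
proof -
  interpret B: unital_cstar_algebra B by (rule B)
  interpret C: unital_cstar_algebra "cstar_generated B S" using S by (rule B.cstar_generated)
  have "x \<in> cstar_span B S \<and> x \<in> cstar_span (cstar_generated B S) S" using x
  proof (induction rule: cstar_span.induct)
    case one
    then show ?case using cstar_span.one[of "cstar_generated B S" S] by (auto intro: cstar_span.one)
  next
    case (add x y)
    then show ?case using cstar_span.add[of x "cstar_generated B S" S y] by (auto intro: cstar_span.add)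
  next
    case (smult x c)
    then show ?case using cstar_span.smult[of x "cstar_generated B S" S c] by (auto intro: cstar_span.smult)
  next
    case (mult x y)
    then show ?case using cstar_span.mult[of x "cstar_generated B S" S y] by (auto intro: cstar_span.mult)
  next
    case (adj x)
    then show ?case using cstar_span.adj[of x "cstar_generated B S" S] by (auto intro: cstar_span.adj)
  next
    case (limit s x)
    have xB: "x \<in> cstar_span B S" using limit by (intro cstar_span.limit[of s B S x]) auto
    \<comment> \<open>Additive inverses are defined relative to the carrier; in both algebras they
      agree with multiplication by -1.\<close>
    have "s n \<ominus>\<^bsub>cstar_generated B S\<^esub> x = s n \<ominus>\<^bsub>B\<^esub> x" for n
      using C.minus_eq_smult[of x "s n"] B.minus_eq_smult[of x "s n"] xB limit by simp
    then show ?case using limit xB cstar_span.limit[of s "cstar_generated B S" S x] by simp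
  qed (auto intro: cstar_span.base)
  then show ?thesis by simp
qed

theorem theorem3p2:
  fixes G :: "('g, 'm) monoid_scheme" and P :: "'g set"
    and K :: "('k, 'n) monoid_scheme" and Q :: "'k set"
    and \<mu> :: "'g \<Rightarrow> 'k"
  assumes "quasi_lattice_ordered G P"
    and "quasi_lattice_ordered K Q"
    and "controlled_map G P K Q \<mu>"
    and "amenable_group K"
    and "amenable_qlo (G\<lparr>carrier := kernel G K \<mu>\<rparr>) (kernel G K \<mu> \<inter> P)"
  shows "amenable_qlo G P"
proof -
  note q = assms(1) and qK = assms(2) and ctrl = assms(3)
  let ?A = "universal_cstar G P" and ?W = "universal_rep G P" and ?E = "ell2_operators P"
  obtain \<pi> where \<pi>0: "\<pi> \<in> star_hom ?A (reduced_cstar G P)" and \<pi>T: "\<And>p. p \<in> P \<Longrightarrow> \<pi> (?W p) = toeplitz G P p"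
    using universal_rep_universal[OF q unital_cstar_algebra_reduced[OF q] covariant_rep_reduced[OF q]] by blast
  have \<pi>: "\<pi> \<in> star_hom ?A ?E" by (rule star_hom_reduced[OF q \<pi>0])
  define pr where "pr j = pmap_op P {x \<in> P. \<mu> x = j} (\<lambda>y. y)" for j
  interpret A: unital_cstar_algebra ?A by (rule universal_cstar_algebra)
  interpret E: unital_cstar_algebra ?E by (rule unital_cstar_algebra_ell2_operators)
  interpret R: qlo_rep ?A G P ?W by unfold_locales (use q universal_rep_covariant[OF q] in auto)
  have K: "group K" using qK by (simp add: quasi_lattice_ordered_def)
  interpret K: group K by (rule K)
  have \<mu>: "\<mu> \<in> hom G K" using ctrl by (simp add: controlled_map_def)
  interpret \<mu>: group_hom G K \<mu> using \<mu> by unfold_locales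
  have NP: "kernel G K \<mu> \<inter> P = {n \<in> P. \<mu> n = \<one>\<^bsub>K\<^esub>}" using R.P_carrier by (auto simp: kernel_def)
  have \<mu>Q: "\<mu> x \<in> Q" if "x \<in> P" for x
  proof -
    have "le_of G P \<one>\<^bsub>G\<^esub> x" using that R.P_carrier by (simp add: le_of_def)
    then have "le_of K Q (\<mu> \<one>\<^bsub>G\<^esub>) (\<mu> x)"
      using ctrl[unfolded controlled_map_def, THEN conjunct2, THEN conjunct1] that R.P_carrier by blast
    then show ?thesis using that R.P_carrier by (simp add: le_of_def)
  qed
  have sub: "{x \<in> P. \<mu> x = j} \<subseteq> P" for j by auto
  interpret C: controlled_rep ?A G P ?W ?E K Q \<mu> \<pi> pr
  proof unfold_locales
    show "pr j \<in> carrier ?E" for j using cproj_simps(1)[OF sub[of j]] by (simp add: pr_def ell2_operators_simps)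
    show "adj ?E (pr j) = pr j" for j unfolding pr_def by (rule cproj_simps(2)[OF sub])
    show "pr j \<otimes>\<^bsub>?E\<^esub> pr j = pr j" for j unfolding pr_def using cproj_simps(3)[OF sub sub, of j j] by simp
    have z: "pmap_op P {} (\<lambda>y. y) = \<zero>\<^bsub>?E\<^esub>" by (simp add: pmap_op_def ell2_operators_simps)
    show "pr i \<otimes>\<^bsub>?E\<^esub> pr j = \<zero>\<^bsub>?E\<^esub>" if "i \<noteq> j" for i j
    proof -
      have e: "{x \<in> P. \<mu> x = i} \<inter> {x \<in> P. \<mu> x = j} = {}" using that by auto
      show ?thesis unfolding pr_def cproj_simps(3)[OF sub sub] e by (rule z)
    qed
    show "pr j = \<zero>\<^bsub>?E\<^esub>" if "j \<notin> Q" for j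
    proof -
      have e: "{x \<in> P. \<mu> x = j} = {}" using \<mu>Q that by auto
      show ?thesis unfolding pr_def e by (rule z)
    qed
    show "\<pi> (?W p) \<otimes>\<^bsub>?E\<^esub> pr j = pr (\<mu> p \<otimes>\<^bsub>K\<^esub> j) \<otimes>\<^bsub>?E\<^esub> \<pi> (?W p)" if "p \<in> P" "j \<in> carrier K" for p j
      unfolding \<pi>T[OF that(1)] pr_def by (rule toeplitz_level_proj[OF q \<mu> K that])
    show "cnorm ?A d \<le> opnorm P (\<pi> d \<otimes>\<^bsub>?E\<^esub> pr \<one>\<^bsub>K\<^esub>)"
      if "d \<in> lspan ?A (R.monoms ({n \<in> P. \<mu> n = \<one>\<^bsub>K\<^esub>} \<times> {n \<in> P. \<mu> n = \<one>\<^bsub>K\<^esub>}))" for d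
      using kernel_rep_isometric[OF q qK ctrl assms(5) \<pi> \<pi>T, of d] that unfolding NP pr_def by simp
  qed (rule qK ctrl \<pi>)+
  \<comment> \<open>Both norms are continuous along a convergent sequence, as \<pi> is contractive,
    so the estimate on the span of monomials passes to limits.\<close>
  have bound: "cnorm ?A x \<le> cnorm ?E (\<pi> x)" if x: "x \<in> carrier ?A" for x
  proof -
    have "?W ` P \<subseteq> carrier (cstar_prod (covariant_reps G P) fst)"
      by (rule image_subsetI) (rule universal_rep_in)
    then have "x \<in> cstar_span ?A (?W ` P)"
      using cstar_span_generated[OF unital_cstar_algebra_covariant_reps] x by (simp add: universal_cstar_def)
    then obtain s where s: "A.conv s x" "\<And>n. s n \<in> lspan ?A (R.monoms (P \<times> P))" using R.span_dense by blast
    have "cnorm ?A (s n) \<le> cnorm ?E (\<pi> (s n))" for n by (rule C.span_isometric[OF assms(4) s(2)])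
    then show ?thesis
      using A.conv_norm[OF s(1)] E.conv_norm[OF star_hom_conv[OF A.unital_cstar_algebra_axioms E.unital_cstar_algebra_axioms \<pi> s(1)]]
      by (intro LIMSEQ_le) auto
  qed
  have "inj_on \<pi> (carrier ?A)"
  proof (rule inj_onI)
    fix x y assume xy: "x \<in> carrier ?A" "y \<in> carrier ?A" "\<pi> x = \<pi> y"
    have d: "x \<ominus>\<^bsub>?A\<^esub> y \<in> carrier ?A" using xy by simp
    have "\<pi> (x \<ominus>\<^bsub>?A\<^esub> y) = \<zero>\<^bsub>?E\<^esub>"
      using star_hom_minus[OF A.unital_cstar_algebra_axioms E.unital_cstar_algebra_axioms \<pi> xy(1,2)] xy star_homD(1)[OF \<pi> xy(2)]
      by simp
    then have "cnorm ?A (x \<ominus>\<^bsub>?A\<^esub> y) \<le> 0" using bound[OF d] by simp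
    then show "x = y" using A.cnorm_le_0[OF _ d] A.eq_if_minus_zero xy by blast
  qed
  then show ?thesis unfolding amenable_qlo_def using q \<pi>0 \<pi>T by blast
qed

end
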